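(* Let $G$ be a finite group and let $(\mathcal C,\pi)\ne(\{e\},1)$ be a conjugacy class $\mathcal C$ of $G$ with base point $r$, and an irreducible complex representation $\pi$ of the centraliser $C_G$ of $r$. For the bicovariant calculus $\Omega^1_{\mathcal C,\pi}$ on $D^\vee(G)$, we obtain a principal homogeneous bundle $\mathbb CG\hookrightarrow D^\vee(G)\twoheadrightarrow\mathbb C(G)$ with $$\Omega^1\cong\Omega^1_{\widetilde\pi},\qquad\Lambda^1\cong\delta_{\pi,1}\Lambda^1_{\mathcal C},$$ where $\Omega^1$ is the induced calculus on the base $\mathbb CG$, $\widetilde\pi$ is the $G$-representation obtained by restricting the action of $D(G)$ on $V_{\mathcal C,\pi}$, and $\Lambda^1$ is the space of left-invariant 1-forms of the calculus on the structure Hopf algebra $\mathbb C(G)$ of the bundle (so $\Lambda^1=0$ if $\pi\neq1$).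
   Context: $D^\vee(G)$ is the Hopf algebra on $\mathbb C(G)\otimes\mathbb CG$ with tensor product algebra and counit, $\Delta(\delta_g\otimes h)=\sum_f\delta_f\otimes f^{-1}ghg^{-1}f\otimes\delta_{f^{-1}g}\otimes h$, $S(\delta_g\otimes h)=\delta_{g^{-1}}\otimes gh^{-1}g^{-1}$. The surjection $p=\mathrm{id}\otimes\epsilon:D^\vee(G)\to\mathbb C(G)$ gives a right coaction $(\mathrm{id}\otimes p)\Delta$, whose invariant subalgebra is identified with $\mathbb CG$ by $g\mapsto\sum_{f\in G}\delta_f\otimes f^{-1}gf$. Fix $q:\mathcal C\to G$, $q_crq_c^{-1}=c$, $q_r=e$, and $\zeta_c(g)=q_{gcg^{-1}}^{-1}gq_c\in C_G$. $V_{\mathcal C,\pi}=\mathbb C\mathcal C\otimes V_\pi$ has basis $E_{ci}=c\otimes v_i$, dual basis $E^{ci}$, $G$-action $\widetilde\pi(h)E_{ci}=h\triangleright E_{ci}=\pi(\zeta_c(h))^j{}_iE_{(hch^{-1})j}$, and $h\triangleright E^{ci}=\pi(\zeta_c(h)^{-1})^i{}_jE^{(hch^{-1})j}$. $\Omega^1_{\mathcal C,\pi}=D^\vee(G)\otimes\mathrm{End}(V_{\mathcal C,\pi})$ is the bicovariant calculus with free left module structure, right module structure $(E_{ci}\otimes E^{dj})\cdot\delta_g=\delta_{gc^{-1}}\otimes(E_{ci}\otimes E^{dj})$, $(E_{ci}\otimes E^{dj})\cdot h=chc^{-1}\otimes(E_{ci}\otimes h^{-1}\triangleright E^{dj})$,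 and inner exterior derivative $dx=\theta x-x\theta$ with $\theta=\sum_{c,i}E_{ci}\otimes E^{ci}$. A (first order) calculus on an algebra $A$ is an $A$-bimodule $\Omega^1$ with a derivation $d:A\to\Omega^1$ such that $\Omega^1$ is spanned by $A\,dA$. For a Hopf algebra $H$ with bicovariant calculus $\Omega^1_H=H\otimes\Lambda^1$, $\Lambda^1$ denotes the left-invariant 1-forms and $\varpi:H^+\to\Lambda^1$, $\varpi(h)=(Sh_1)dh_2$ on $H^+=\ker\epsilon$, so $\Lambda^1\cong H^+/\ker\varpi$. A principal homogeneous bundle $A\hookrightarrow P\twoheadrightarrow H$ here means: a surjection of Hopf algebras $p:P\to H$, $A=P^H$ the invariants of the right coaction $(\mathrm{id}\otimes p)\Delta$, written $x\mapsto x^1\otimes x^2$, such that $P\otimes_AP\to P\otimes H$, $x\otimes y\mapsto xy^1\otimes y^2$, is bijective; $P$ has a bicovariant calculus $\Omega^1_P=P\otimes P^+/I$ ($I$ the kernel of its $\varpi$); $A$ has the restricted calculus $\Omega^1=A\,dA\subseteq\Omega^1_P$; $H$ has the bicovariant calculus with $\Lambda^1=H^+/p(I)$; and $0\to P\Omega^1P\to\Omega^1_P\xrightarrow{\mathrm{ver}}P\otimes\Lambda^1\to0$ is exact, with $\mathrm{ver}(x\,dy)=xy^1\otimes\varpi(y^2-\epsilon(y^2)1)$. For a representation $\rho:G\to\mathrm{End}(V)$, $\Omega^1_\rho=\mathbb CG\otimes\rho(\mathbb CG^+)$ is the calculus on $\mathbb CG$ with free left module structure, $x\cdot g=g\otimes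 x\rho(g)$ and $dg=g\otimes(\rho(g)-1)$. $\Lambda^1_{\mathcal C}$ has basis $\{e_c\}_{c\in\mathcal C}$ and defines the bicovariant calculus on $\mathbb C(G)$ with $e_c\delta_g=\delta_{gc^{-1}}e_c$, $d\delta_g=\sum_{c\in\mathcal C}(\delta_{gc^{-1}}-\delta_g)e_c$. $\delta_{\pi,1}$ is $1$ if $\pi$ is trivial and $0$ otherwise. *)

theory Defs
  imports Complex_Main "HOL-Algebra.Module" "HOL-Algebra.QuotRing"
begin

section \<open>Complex vector spaces with a basis\<close>

text \<open>
  A vector space with finite basis \<open>B\<close> is the space of functions supported on \<open>B\<close>; the
  tensor product of the spaces on \<open>B\<close> and \<open>C\<close> is the space on \<open>B \<times> C\<close>.
\<close>

definition complex_ring :: "complex ring" where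
  "complex_ring = \<lparr>carrier = UNIV, mult = (*), one = 1, zero = 0, add = (+)\<rparr>"

definition fspace :: "'b set \<Rightarrow> (complex, 'b \<Rightarrow> complex) module" where
  "fspace B = \<lparr>carrier = {f. \<forall>b. b \<notin> B \<longrightarrow> f b = 0}, mult = undefined, one = undefined,
     zero = (\<lambda>_. 0), add = (\<lambda>f g b. f b + g b), smult = (\<lambda>c f b. c * f b)\<rparr>"

definition bvec :: "'b \<Rightarrow> 'b \<Rightarrow> complex" where
  "bvec b = (\<lambda>x. if x = b then 1 else 0)"

text \<open>Linear extension of a map given on the basis \<open>B\<close>.\<close>

definition lext :: "'b set \<Rightarrow> ('b \<Rightarrow> 'c \<Rightarrow> complex) \<Rightarrow> ('b \<Rightarrow> complex) \<Rightarrow> 'c \<Rightarrow> complex" where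
  "lext B f x = (\<lambda>y. \<Sum>b\<in>B. x b * f b y)"

definition tprod :: "('b \<Rightarrow> complex) \<Rightarrow> ('c \<Rightarrow> complex) \<Rightarrow> 'b \<times> 'c \<Rightarrow> complex" where
  "tprod x y = (\<lambda>(b, c). x b * y c)"

definition tmap :: "'b set \<Rightarrow> 'c set \<Rightarrow> (('b \<Rightarrow> complex) \<Rightarrow> 'd \<Rightarrow> complex)
    \<Rightarrow> (('c \<Rightarrow> complex) \<Rightarrow> 'e \<Rightarrow> complex) \<Rightarrow> ('b \<times> 'c \<Rightarrow> complex) \<Rightarrow> 'd \<times> 'e \<Rightarrow> complex" where
  "tmap B C f g = lext (B \<times> C) (\<lambda>(b, c). tprod (f (bvec b)) (g (bvec c)))"

text \<open>For \<open>X \<subseteq> carrier M\<close>, the linear span of \<open>X\<close>.\<close>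

definition lin_span :: "(complex, 'm, 'z) module_scheme \<Rightarrow> 'm set \<Rightarrow> 'm set" where
  "lin_span M X = \<Inter>{N. submodule N complex_ring M \<and> X \<subseteq> N}"

text \<open>The tensor product of two subspaces, inside the tensor product of the ambient spaces.\<close>

definition tens :: "('b \<Rightarrow> complex) set \<Rightarrow> ('c \<Rightarrow> complex) set \<Rightarrow> ('b \<times> 'c \<Rightarrow> complex) set" where
  "tens U W = lin_span (fspace UNIV) {tprod x y | x y. x \<in> U \<and> y \<in> W}"

definition lin_map ::
  "(complex, 'm, 'y) module_scheme \<Rightarrow> (complex, 'n, 'z) module_scheme \<Rightarrow> ('m \<Rightarrow> 'n) \<Rightarrow> bool" where
  "lin_map M N f \<longleftrightarrow> f \<in> carrier M \<rightarrow> carrier N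
     \<and> (\<forall>x\<in>carrier M. \<forall>y\<in>carrier M. f (x \<oplus>\<^bsub>M\<^esub> y) = f x \<oplus>\<^bsub>N\<^esub> f y)
     \<and> (\<forall>c. \<forall>x\<in>carrier M. f (c \<odot>\<^bsub>M\<^esub> x) = c \<odot>\<^bsub>N\<^esub> f x)"

definition lin_iso ::
  "(complex, 'm, 'y) module_scheme \<Rightarrow> (complex, 'n, 'z) module_scheme \<Rightarrow> ('m \<Rightarrow> 'n) \<Rightarrow> bool" where
  "lin_iso M N f \<longleftrightarrow> lin_map M N f \<and> bij_betw f (carrier M) (carrier N)"

text \<open>The quotient of a module by a submodule, in the style of \<^const>\<open>FactRing\<close>.\<close>

definition quot_module :: "('s, 'm, 'z) module_scheme \<Rightarrow> 'm set \<Rightarrow> ('s, 'm set) module" where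
  "quot_module M N = \<lparr>carrier = a_rcosets\<^bsub>M\<^esub> N, mult = undefined, one = undefined,
     zero = N, add = set_add M, smult = (\<lambda>c X. \<Union>x\<in>X. N +>\<^bsub>M\<^esub> (c \<odot>\<^bsub>M\<^esub> x))\<rparr>"


section \<open>Algebras and Hopf algebras\<close>

text \<open>Algebras and Hopf algebras are given by their values on a basis.\<close>

record 'b alg_data =
  basis :: "'b set"
  bmult :: "'b \<Rightarrow> 'b \<Rightarrow> 'b \<Rightarrow> complex"
  bunit :: "'b \<Rightarrow> complex"

record 'b hopf_data = "'b alg_data" +
  bcomult :: "'b \<Rightarrow> 'b \<times> 'b \<Rightarrow> complex"
  bcounit :: "'b \<Rightarrow> complex"
  bantipode :: "'b \<Rightarrow> 'b \<Rightarrow> complex"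

definition alg :: "('b, 'z) alg_data_scheme \<Rightarrow> (complex, 'b \<Rightarrow> complex) module" where
  "alg A = (fspace (basis A))
     \<lparr>mult := (\<lambda>x y. lext (basis A) (\<lambda>b. lext (basis A) (bmult A b) y) x), one := bunit A\<rparr>"

definition tensor_alg ::
  "('b, 'y) alg_data_scheme \<Rightarrow> ('c, 'z) alg_data_scheme \<Rightarrow> ('b \<times> 'c) alg_data" where
  "tensor_alg A B = \<lparr>basis = basis A \<times> basis B,
     bmult = (\<lambda>(a, b) (a', b'). tprod (bmult A a a') (bmult B b b')),
     bunit = tprod (bunit A) (bunit B)\<rparr>"

definition comult :: "('b, 'z) hopf_data_scheme \<Rightarrow> ('b \<Rightarrow> complex) \<Rightarrow> 'b \<times> 'b \<Rightarrow> complex" where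
  "comult H = lext (basis H) (bcomult H)"

definition counit :: "('b, 'z) hopf_data_scheme \<Rightarrow> ('b \<Rightarrow> complex) \<Rightarrow> complex" where
  "counit H x = (\<Sum>b\<in>basis H. x b * bcounit H b)"

definition antipode :: "('b, 'z) hopf_data_scheme \<Rightarrow> ('b \<Rightarrow> complex) \<Rightarrow> 'b \<Rightarrow> complex" where
  "antipode H = lext (basis H) (bantipode H)"

text \<open>The kernel of the counit, \<open>H\<^sup>+\<close>.\<close>

definition augm :: "('b, 'z) hopf_data_scheme \<Rightarrow> ('b \<Rightarrow> complex) set" where
  "augm H = {x \<in> carrier (alg H). counit H x = 0}"

definition complex_algebra :: "(complex, 'a, 'z) module_scheme \<Rightarrow> bool" where
  "complex_algebra A \<longleftrightarrow> module complex_ring A \<and> ring A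
     \<and> (\<forall>c. \<forall>x\<in>carrier A. \<forall>y\<in>carrier A.
          (c \<odot>\<^bsub>A\<^esub> x) \<otimes>\<^bsub>A\<^esub> y = c \<odot>\<^bsub>A\<^esub> (x \<otimes>\<^bsub>A\<^esub> y) \<and> x \<otimes>\<^bsub>A\<^esub> (c \<odot>\<^bsub>A\<^esub> y) = c \<odot>\<^bsub>A\<^esub> (x \<otimes>\<^bsub>A\<^esub> y))"

definition algebra_iso ::
  "(complex, 'a, 'y) module_scheme \<Rightarrow> (complex, 'b, 'z) module_scheme \<Rightarrow> ('a \<Rightarrow> 'b) \<Rightarrow> bool" where
  "algebra_iso A B f \<longleftrightarrow> f \<in> ring_iso A B \<and> lin_map A B f"

definition hopf_algebra :: "('b, 'z) hopf_data_scheme \<Rightarrow> bool" where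
  "hopf_algebra H \<longleftrightarrow> (let B = basis H; V = carrier (alg H); T = alg (tensor_alg H H) in
     finite B
     \<and> (\<forall>b\<in>B. bcomult H b \<in> carrier T \<and> bantipode H b \<in> V)
     \<and> complex_algebra (alg H)
     \<and> (\<forall>x\<in>V. \<forall>a b c. tmap B B (comult H) (\<lambda>y. y) (comult H x) ((a, b), c)
                     = tmap B B (\<lambda>y. y) (comult H) (comult H x) (a, (b, c)))
     \<and> (\<forall>x\<in>V. \<forall>b. (\<Sum>a\<in>B. bcounit H a * comult H x (a, b)) = x b
                \<and> (\<Sum>a\<in>B. comult H x (b, a) * bcounit H a) = x b)
     \<and> (\<forall>x\<in>V. \<forall>y\<in>V. comult H (x \<otimes>\<^bsub>alg H\<^esub> y) = comult H x \<otimes>\<^bsub>T\<^esub> comult H y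
                    \<and> counit H (x \<otimes>\<^bsub>alg H\<^esub> y) = counit H x * counit H y)
     \<and> comult H \<one>\<^bsub>alg H\<^esub> = \<one>\<^bsub>T\<^esub> \<and> counit H \<one>\<^bsub>alg H\<^esub> = 1
     \<and> (\<forall>x\<in>V. lext (B \<times> B) (\<lambda>(a, b). bantipode H a \<otimes>\<^bsub>alg H\<^esub> bvec b) (comult H x)
                 = counit H x \<odot>\<^bsub>alg H\<^esub> \<one>\<^bsub>alg H\<^esub>
             \<and> lext (B \<times> B) (\<lambda>(a, b). bvec a \<otimes>\<^bsub>alg H\<^esub> bantipode H b) (comult H x)
                 = counit H x \<odot>\<^bsub>alg H\<^esub> \<one>\<^bsub>alg H\<^esub>))"

definition hopf_surjection :: "('p, 'y) hopf_data_scheme \<Rightarrow> ('h, 'z) hopf_data_scheme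
    \<Rightarrow> (('p \<Rightarrow> complex) \<Rightarrow> 'h \<Rightarrow> complex) \<Rightarrow> bool" where
  "hopf_surjection P H p \<longleftrightarrow>
     p \<in> ring_hom (alg P) (alg H) \<and> lin_map (alg P) (alg H) p
     \<and> p ` carrier (alg P) = carrier (alg H)
     \<and> (\<forall>x\<in>carrier (alg P). comult H (p x) = tmap (basis P) (basis P) p p (comult P x)
          \<and> counit H (p x) = counit P x \<and> antipode H (p x) = p (antipode P x))"


section \<open>First order differential calculi\<close>

text \<open>The module of 1-forms, with the left and right actions of the algebra and the derivation.\<close>

record ('a, 'm) calculus = "(complex, 'm) module" +
  lact :: "'a \<Rightarrow> 'm \<Rightarrow> 'm"
  ract :: "'m \<Rightarrow> 'a \<Rightarrow> 'm"
  diff :: "'a \<Rightarrow> 'm"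

definition fo_calculus ::
  "(complex, 'a, 'y) module_scheme \<Rightarrow> ('a, 'm, 'z) calculus_scheme \<Rightarrow> bool" where
  "fo_calculus A \<Omega> \<longleftrightarrow>
     module complex_ring \<Omega>
     \<and> (\<forall>a\<in>carrier A. lin_map \<Omega> \<Omega> (lact \<Omega> a) \<and> lin_map \<Omega> \<Omega> (\<lambda>w. ract \<Omega> w a))
     \<and> (\<forall>w\<in>carrier \<Omega>. lin_map A \<Omega> (\<lambda>a. lact \<Omega> a w) \<and> lin_map A \<Omega> (ract \<Omega> w)
          \<and> lact \<Omega> \<one>\<^bsub>A\<^esub> w = w \<and> ract \<Omega> w \<one>\<^bsub>A\<^esub> = w)
     \<and> (\<forall>a\<in>carrier A. \<forall>b\<in>carrier A. \<forall>w\<in>carrier \<Omega>.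
          lact \<Omega> (a \<otimes>\<^bsub>A\<^esub> b) w = lact \<Omega> a (lact \<Omega> b w)
          \<and> ract \<Omega> w (a \<otimes>\<^bsub>A\<^esub> b) = ract \<Omega> (ract \<Omega> w a) b
          \<and> ract \<Omega> (lact \<Omega> a w) b = lact \<Omega> a (ract \<Omega> w b))
     \<and> lin_map A \<Omega> (diff \<Omega>)
     \<and> (\<forall>a\<in>carrier A. \<forall>b\<in>carrier A.
          diff \<Omega> (a \<otimes>\<^bsub>A\<^esub> b) = ract \<Omega> (diff \<Omega> a) b \<oplus>\<^bsub>\<Omega>\<^esub> lact \<Omega> a (diff \<Omega> b))
     \<and> carrier \<Omega> = lin_span \<Omega> {lact \<Omega> a (diff \<Omega> b) | a b. a \<in> carrier A \<and> b \<in> carrier A}"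

text \<open>Isomorphism of calculi over an isomorphism \<open>f\<close> of algebras.\<close>

definition calculus_iso :: "(complex, 'a, 'y) module_scheme \<Rightarrow> ('a, 'm, 'z) calculus_scheme
    \<Rightarrow> (complex, 'b, 'u) module_scheme \<Rightarrow> ('b, 'n, 'v) calculus_scheme
    \<Rightarrow> ('a \<Rightarrow> 'b) \<Rightarrow> ('m \<Rightarrow> 'n) \<Rightarrow> bool" where
  "calculus_iso A \<Omega> B \<Xi> f \<phi> \<longleftrightarrow>
     algebra_iso A B f \<and> lin_iso \<Omega> \<Xi> \<phi>
     \<and> (\<forall>a\<in>carrier A. \<forall>w\<in>carrier \<Omega>.
          \<phi> (lact \<Omega> a w) = lact \<Xi> (f a) (\<phi> w) \<and> \<phi> (ract \<Omega> w a) = ract \<Xi> (\<phi> w) (f a))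
     \<and> (\<forall>a\<in>carrier A. \<phi> (diff \<Omega> a) = diff \<Xi> (f a))"

text \<open>
  The map \<open>H \<otimes> H \<rightarrow> \<Omega>\<close>, \<open>x \<otimes> y \<mapsto> x dy\<close>, and the left and right codiagonal coactions
  \<open>x \<otimes> y \<mapsto> x\<^sub>1y\<^sub>1 \<otimes> (x\<^sub>2 \<otimes> y\<^sub>2)\<close> and \<open>x \<otimes> y \<mapsto> (x\<^sub>1 \<otimes> y\<^sub>1) \<otimes> x\<^sub>2y\<^sub>2\<close> on \<open>H \<otimes> H\<close>.
  A calculus is bicovariant if \<open>x dy \<mapsto> x\<^sub>1y\<^sub>1 \<otimes> x\<^sub>2 dy\<^sub>2\<close> and \<open>x dy \<mapsto> x\<^sub>1 dy\<^sub>1 \<otimes> x\<^sub>2y\<^sub>2\<close>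
  are well defined (Woronowicz); an element of \<open>H \<otimes> \<Omega>\<close> is zero if all its coefficients
  with respect to the basis of \<open>H\<close> are.
\<close>

definition form_of ::
  "('b, 'y) hopf_data_scheme \<Rightarrow> ('b \<Rightarrow> complex, 'm, 'z) calculus_scheme \<Rightarrow> ('b \<times> 'b \<Rightarrow> complex) \<Rightarrow> 'm" where
  "form_of H \<Omega> t = (\<Oplus>\<^bsub>\<Omega>\<^esub>u\<in>basis H \<times> basis H.
     t u \<odot>\<^bsub>\<Omega>\<^esub> lact \<Omega> (bvec (fst u)) (diff \<Omega> (bvec (snd u))))"

definition codiag_left ::
  "('b, 'z) hopf_data_scheme \<Rightarrow> ('b \<times> 'b \<Rightarrow> complex) \<Rightarrow> 'b \<times> ('b \<times> 'b) \<Rightarrow> complex" where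
  "codiag_left H = lext (basis H \<times> basis H) (\<lambda>(x, y) (b, (c, d)).
     \<Sum>b1\<in>basis H. \<Sum>b2\<in>basis H. bcomult H x (b1, c) * bcomult H y (b2, d) * bmult H b1 b2 b)"

definition codiag_right ::
  "('b, 'z) hopf_data_scheme \<Rightarrow> ('b \<times> 'b \<Rightarrow> complex) \<Rightarrow> ('b \<times> 'b) \<times> 'b \<Rightarrow> complex" where
  "codiag_right H = lext (basis H \<times> basis H) (\<lambda>(x, y) ((c, d), b).
     \<Sum>b1\<in>basis H. \<Sum>b2\<in>basis H. bcomult H x (c, b1) * bcomult H y (d, b2) * bmult H b1 b2 b)"

definition bicovariant_calculus ::
  "('b, 'y) hopf_data_scheme \<Rightarrow> ('b \<Rightarrow> complex, 'm, 'z) calculus_scheme \<Rightarrow> bool" where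
  "bicovariant_calculus H \<Omega> \<longleftrightarrow> fo_calculus (alg H) \<Omega>
     \<and> (\<forall>t\<in>carrier (fspace (basis H \<times> basis H)). form_of H \<Omega> t = \<zero>\<^bsub>\<Omega>\<^esub> \<longrightarrow>
          (\<forall>b\<in>basis H. form_of H \<Omega> (\<lambda>u. codiag_left H t (b, u)) = \<zero>\<^bsub>\<Omega>\<^esub>
                     \<and> form_of H \<Omega> (\<lambda>u. codiag_right H t (u, b)) = \<zero>\<^bsub>\<Omega>\<^esub>))"

text \<open>The map \<open>\<varpi>(h) = S(h\<^sub>1) dh\<^sub>2\<close> and its kernel in \<open>H\<^sup>+\<close>.\<close>

definition mc_form ::
  "('b, 'y) hopf_data_scheme \<Rightarrow> ('b \<Rightarrow> complex, 'm, 'z) calculus_scheme \<Rightarrow> ('b \<Rightarrow> complex) \<Rightarrow> 'm" where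
  "mc_form H \<Omega> h = (\<Oplus>\<^bsub>\<Omega>\<^esub>u\<in>basis H \<times> basis H.
     comult H h u \<odot>\<^bsub>\<Omega>\<^esub> lact \<Omega> (antipode H (bvec (fst u))) (diff \<Omega> (bvec (snd u))))"

definition mc_kernel ::
  "('b, 'y) hopf_data_scheme \<Rightarrow> ('b \<Rightarrow> complex, 'm, 'z) calculus_scheme \<Rightarrow> ('b \<Rightarrow> complex) set" where
  "mc_kernel H \<Omega> = {h \<in> augm H. mc_form H \<Omega> h = \<zero>\<^bsub>\<Omega>\<^esub>}"

text \<open>
  The space \<open>\<Lambda>\<^sup>1 = H\<^sup>+/R\<close> and the calculus \<open>H \<otimes> H\<^sup>+/R\<close>, the latter as the quotient of
  \<open>H \<otimes> H\<^sup>+\<close> by \<open>H \<otimes> R\<close>, with \<open>k(h \<otimes> [x]) = kh \<otimes> [x]\<close>, \<open>(h \<otimes> [x])k = hk\<^sub>1 \<otimes> [xk\<^sub>2]\<close>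
  and \<open>dh = h\<^sub>1 \<otimes> [h\<^sub>2 - \<epsilon>(h\<^sub>2)1]\<close>.
\<close>

definition inv_forms ::
  "('b, 'z) hopf_data_scheme \<Rightarrow> ('b \<Rightarrow> complex) set \<Rightarrow> (complex, ('b \<Rightarrow> complex) set) module" where
  "inv_forms H R = quot_module ((fspace (basis H))\<lparr>carrier := augm H\<rparr>) R"

definition tens_inv_forms :: "('p, 'y) alg_data_scheme \<Rightarrow> ('h, 'z) hopf_data_scheme
    \<Rightarrow> ('h \<Rightarrow> complex) set \<Rightarrow> (complex, ('p \<times> 'h \<Rightarrow> complex) set) module" where
  "tens_inv_forms P H R = quot_module
     ((fspace (basis P \<times> basis H))\<lparr>carrier := tens (carrier (alg P)) (augm H)\<rparr>)
     (tens (carrier (alg P)) R)"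

definition tens_class :: "('p, 'y) alg_data_scheme \<Rightarrow> ('h, 'z) hopf_data_scheme
    \<Rightarrow> ('h \<Rightarrow> complex) set \<Rightarrow> ('p \<times> 'h \<Rightarrow> complex) \<Rightarrow> ('p \<times> 'h \<Rightarrow> complex) set" where
  "tens_class P H R t = tens (carrier (alg P)) R +>\<^bsub>fspace (basis P \<times> basis H)\<^esub> t"

definition quot_calculus :: "('b, 'z) hopf_data_scheme \<Rightarrow> ('b \<Rightarrow> complex) set
    \<Rightarrow> ('b \<Rightarrow> complex, ('b \<times> 'b \<Rightarrow> complex) set) calculus" where
  "quot_calculus H R = (let T = alg (tensor_alg H H) in
     module.extend (tens_inv_forms H H R) (calculus.fields
       (\<lambda>h X. \<Union>t\<in>X. tens_class H H R (tprod h \<one>\<^bsub>alg H\<^esub> \<otimes>\<^bsub>T\<^esub> t))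
       (\<lambda>X h. \<Union>t\<in>X. tens_class H H R (t \<otimes>\<^bsub>T\<^esub> comult H h))
       (\<lambda>h. tens_class H H R (\<lambda>u. comult H h u - tprod h \<one>\<^bsub>alg H\<^esub> u))))"


section \<open>Principal homogeneous bundles\<close>

text \<open>The right coaction \<open>(id \<otimes> p)\<Delta>\<close> and its invariants.\<close>

definition coact :: "('p, 'y) hopf_data_scheme \<Rightarrow> (('p \<Rightarrow> complex) \<Rightarrow> 'h \<Rightarrow> complex)
    \<Rightarrow> ('p \<Rightarrow> complex) \<Rightarrow> 'p \<times> 'h \<Rightarrow> complex" where
  "coact P p x = tmap (basis P) (basis P) (\<lambda>y. y) p (comult P x)"

definition coinv :: "('p, 'y) hopf_data_scheme \<Rightarrow> ('h, 'z) hopf_data_scheme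
    \<Rightarrow> (('p \<Rightarrow> complex) \<Rightarrow> 'h \<Rightarrow> complex) \<Rightarrow> ('p \<Rightarrow> complex) set" where
  "coinv P H p = {x \<in> carrier (alg P). coact P p x = tprod x \<one>\<^bsub>alg H\<^esub>}"

definition base_algebra :: "('p, 'y) hopf_data_scheme \<Rightarrow> ('h, 'z) hopf_data_scheme
    \<Rightarrow> (('p \<Rightarrow> complex) \<Rightarrow> 'h \<Rightarrow> complex) \<Rightarrow> (complex, 'p \<Rightarrow> complex) module" where
  "base_algebra P H p = (alg P)\<lparr>carrier := coinv P H p\<rparr>"

text \<open>The kernel of \<open>P \<otimes> P \<rightarrow> P \<otimes>\<^sub>A P\<close>.\<close>

definition balancing :: "('p, 'y) hopf_data_scheme \<Rightarrow> ('h, 'z) hopf_data_scheme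
    \<Rightarrow> (('p \<Rightarrow> complex) \<Rightarrow> 'h \<Rightarrow> complex) \<Rightarrow> ('p \<times> 'p \<Rightarrow> complex) set" where
  "balancing P H p = lin_span (fspace (basis P \<times> basis P))
     {(\<lambda>u. tprod (x \<otimes>\<^bsub>alg P\<^esub> a) y u - tprod x (a \<otimes>\<^bsub>alg P\<^esub> y) u) | x a y.
        x \<in> carrier (alg P) \<and> a \<in> coinv P H p \<and> y \<in> carrier (alg P)}"

text \<open>\<open>x \<otimes> y \<mapsto> xy\<^sup>1 \<otimes> y\<^sup>2\<close> on \<open>P \<otimes> P\<close>.\<close>

definition can_map :: "('p, 'y) hopf_data_scheme \<Rightarrow> ('h, 'z) hopf_data_scheme
    \<Rightarrow> (('p \<Rightarrow> complex) \<Rightarrow> 'h \<Rightarrow> complex) \<Rightarrow> ('p \<times> 'p \<Rightarrow> complex) \<Rightarrow> 'p \<times> 'h \<Rightarrow> complex" where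
  "can_map P H p = lext (basis P \<times> basis P)
     (\<lambda>(x, y). tprod (bvec x) \<one>\<^bsub>alg H\<^esub> \<otimes>\<^bsub>alg (tensor_alg P H)\<^esub> coact P p (bvec y))"

definition hopf_galois :: "('p, 'y) hopf_data_scheme \<Rightarrow> ('h, 'z) hopf_data_scheme
    \<Rightarrow> (('p \<Rightarrow> complex) \<Rightarrow> 'h \<Rightarrow> complex) \<Rightarrow> bool" where
  "hopf_galois P H p \<longleftrightarrow> (\<exists>F.
     (\<forall>t\<in>carrier (fspace (basis P \<times> basis P)).
        F (balancing P H p +>\<^bsub>fspace (basis P \<times> basis P)\<^esub> t) = can_map P H p t)
     \<and> bij_betw F (carrier (quot_module (fspace (basis P \<times> basis P)) (balancing P H p)))
                  (carrier (fspace (basis P \<times> basis H))))"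

text \<open>The restricted calculus \<open>A dA\<close> on the base.\<close>

definition base_calculus :: "('p, 'y) hopf_data_scheme \<Rightarrow> ('h, 'z) hopf_data_scheme
    \<Rightarrow> (('p \<Rightarrow> complex) \<Rightarrow> 'h \<Rightarrow> complex) \<Rightarrow> ('p \<Rightarrow> complex, 'm) calculus
    \<Rightarrow> ('p \<Rightarrow> complex, 'm) calculus" where
  "base_calculus P H p \<Omega> = \<Omega>\<lparr>carrier :=
     lin_span \<Omega> {lact \<Omega> a (diff \<Omega> b) | a b. a \<in> coinv P H p \<and> b \<in> coinv P H p}\<rparr>"

definition horizontal_forms :: "('p, 'y) hopf_data_scheme \<Rightarrow> ('h, 'z) hopf_data_scheme
    \<Rightarrow> (('p \<Rightarrow> complex) \<Rightarrow> 'h \<Rightarrow> complex) \<Rightarrow> ('p \<Rightarrow> complex, 'm) calculus \<Rightarrow> 'm set" where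
  "horizontal_forms P H p \<Omega> = lin_span \<Omega> {ract \<Omega> (lact \<Omega> x w) y | x w y.
     x \<in> carrier (alg P) \<and> w \<in> carrier (base_calculus P H p \<Omega>) \<and> y \<in> carrier (alg P)}"

text \<open>The ideal \<open>p(I)\<close> and the calculus it defines on the structure Hopf algebra.\<close>

definition fibre_ideal :: "('p, 'y) hopf_data_scheme \<Rightarrow> (('p \<Rightarrow> complex) \<Rightarrow> 'h \<Rightarrow> complex)
    \<Rightarrow> ('p \<Rightarrow> complex, 'm) calculus \<Rightarrow> ('h \<Rightarrow> complex) set" where
  "fibre_ideal P p \<Omega> = p ` mc_kernel P \<Omega>"

definition fibre_calculus :: "('p, 'y) hopf_data_scheme \<Rightarrow> ('h, 'z) hopf_data_scheme
    \<Rightarrow> (('p \<Rightarrow> complex) \<Rightarrow> 'h \<Rightarrow> complex) \<Rightarrow> ('p \<Rightarrow> complex, 'm) calculus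
    \<Rightarrow> ('h \<Rightarrow> complex, ('h \<times> 'h \<Rightarrow> complex) set) calculus" where
  "fibre_calculus P H p \<Omega> = quot_calculus H (fibre_ideal P p \<Omega>)"

text \<open>
  In the last clause, the representative of \<open>ver(x dy) = xy\<^sup>1 \<otimes> \<varpi>(y\<^sup>2 - \<epsilon>(y\<^sup>2)1)\<close> in
  \<open>P \<otimes> H\<^sup>+\<close> is \<open>(x \<otimes> 1)(y\<^sup>1 \<otimes> y\<^sup>2 - y \<otimes> 1)\<close>, since \<open>y\<^sup>1\<epsilon>(y\<^sup>2) = y\<close>.
\<close>

definition principal_homogeneous_bundle ::
  "('p, 'y) hopf_data_scheme \<Rightarrow> ('h, 'z) hopf_data_scheme
    \<Rightarrow> (('p \<Rightarrow> complex) \<Rightarrow> 'h \<Rightarrow> complex) \<Rightarrow> ('p \<Rightarrow> complex, 'm) calculus \<Rightarrow> bool" where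
  "principal_homogeneous_bundle P H p \<Omega> \<longleftrightarrow>
     hopf_algebra P \<and> hopf_algebra H \<and> hopf_surjection P H p \<and> hopf_galois P H p
     \<and> bicovariant_calculus P \<Omega>
     \<and> fo_calculus (base_algebra P H p) (base_calculus P H p \<Omega>)
     \<and> bicovariant_calculus H (fibre_calculus P H p \<Omega>)
     \<and> (let R = fibre_ideal P p \<Omega>; Q = tens_inv_forms P H R in
          \<exists>ver. lin_map \<Omega> Q ver
            \<and> (\<forall>x\<in>carrier (alg P). \<forall>y\<in>carrier (alg P).
                 ver (lact \<Omega> x (diff \<Omega> y)) = tens_class P H R
                   (tprod x \<one>\<^bsub>alg H\<^esub> \<otimes>\<^bsub>alg (tensor_alg P H)\<^esub>
                      (\<lambda>u. coact P p y u - tprod y \<one>\<^bsub>alg H\<^esub> u)))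
            \<and> ver ` carrier \<Omega> = carrier Q
            \<and> {w \<in> carrier \<Omega>. ver w = \<zero>\<^bsub>Q\<^esub>} = horizontal_forms P H p \<Omega>)"


section \<open>The Hopf algebras of a finite group\<close>

definition gconj :: "('g, 'z) monoid_scheme \<Rightarrow> 'g \<Rightarrow> 'g \<Rightarrow> 'g" where
  "gconj G g h = g \<otimes>\<^bsub>G\<^esub> h \<otimes>\<^bsub>G\<^esub> inv\<^bsub>G\<^esub> g"

definition conj_class :: "('g, 'z) monoid_scheme \<Rightarrow> 'g \<Rightarrow> 'g set" where
  "conj_class G r = (\<lambda>g. gconj G g r) ` carrier G"

definition centralizer :: "('g, 'z) monoid_scheme \<Rightarrow> 'g \<Rightarrow> ('g, 'z) monoid_scheme" where
  "centralizer G r = G\<lparr>carrier := {g \<in> carrier G. g \<otimes>\<^bsub>G\<^esub> r = r \<otimes>\<^bsub>G\<^esub> g}\<rparr>"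

definition group_hopf :: "('g, 'z) monoid_scheme \<Rightarrow> 'g hopf_data" where
  "group_hopf G = \<lparr>basis = carrier G,
     bmult = (\<lambda>g h. bvec (g \<otimes>\<^bsub>G\<^esub> h)), bunit = bvec \<one>\<^bsub>G\<^esub>,
     bcomult = (\<lambda>g. bvec (g, g)), bcounit = (\<lambda>g. 1), bantipode = (\<lambda>g. bvec (inv\<^bsub>G\<^esub> g))\<rparr>"

definition fun_hopf :: "('g, 'z) monoid_scheme \<Rightarrow> 'g hopf_data" where
  "fun_hopf G = \<lparr>basis = carrier G,
     bmult = (\<lambda>g h. if g = h then bvec g else (\<lambda>_. 0)),
     bunit = (\<lambda>g. if g \<in> carrier G then 1 else 0),
     bcomult = (\<lambda>g z. \<Sum>f\<in>carrier G. tprod (bvec f) (bvec (inv\<^bsub>G\<^esub> f \<otimes>\<^bsub>G\<^esub> g)) z),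
     bcounit = (\<lambda>g. if g = \<one>\<^bsub>G\<^esub> then 1 else 0), bantipode = (\<lambda>g. bvec (inv\<^bsub>G\<^esub> g))\<rparr>"

text \<open>\<open>D\<^sup>\<or>(G)\<close>, where \<open>(g, h)\<close> stands for \<open>\<delta>\<^sub>g \<otimes> h\<close>.\<close>

definition dvee :: "('g, 'z) monoid_scheme \<Rightarrow> ('g \<times> 'g) hopf_data" where
  "dvee G = \<lparr>basis = basis (tensor_alg (fun_hopf G) (group_hopf G)),
     bmult = bmult (tensor_alg (fun_hopf G) (group_hopf G)),
     bunit = bunit (tensor_alg (fun_hopf G) (group_hopf G)),
     bcomult = (\<lambda>(g, h) z. \<Sum>f\<in>carrier G.
        tprod (bvec (f, gconj G (inv\<^bsub>G\<^esub> f) (gconj G g h))) (bvec (inv\<^bsub>G\<^esub> f \<otimes>\<^bsub>G\<^esub> g, h)) z),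
     bcounit = (\<lambda>(g, h). bcounit (fun_hopf G) g * bcounit (group_hopf G) h),
     bantipode = (\<lambda>(g, h). bvec (inv\<^bsub>G\<^esub> g, gconj G g (inv\<^bsub>G\<^esub> h)))\<rparr>"

text \<open>\<open>p = id \<otimes> \<epsilon> : D\<^sup>\<or>(G) \<rightarrow> \<complex>(G)\<close>, and the inclusion \<open>g \<mapsto> \<Sum>\<^sub>f \<delta>\<^sub>f \<otimes> f\<^sup>-\<^sup>1gf\<close> of \<open>\<complex>G\<close>.\<close>

definition dvee_proj :: "('g, 'z) monoid_scheme \<Rightarrow> ('g \<times> 'g \<Rightarrow> complex) \<Rightarrow> 'g \<Rightarrow> complex" where
  "dvee_proj G x = (\<lambda>g. \<Sum>h\<in>carrier G. x (g, h) * bcounit (group_hopf G) h)"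

definition dvee_incl :: "('g, 'z) monoid_scheme \<Rightarrow> ('g \<Rightarrow> complex) \<Rightarrow> 'g \<times> 'g \<Rightarrow> complex" where
  "dvee_incl G = lext (carrier G)
     (\<lambda>g z. \<Sum>f\<in>carrier G. bvec (f, gconj G (inv\<^bsub>G\<^esub> f) g) z)"


section \<open>Representations and the calculi they define\<close>

text \<open>
  A representation on the space with basis \<open>K\<close> is given by matrices, \<open>\<rho> g k l\<close> being the
  entry in row \<open>k\<close> and column \<open>l\<close>, i.e. \<open>g \<triangleright> e\<^sub>l = \<Sum>\<^sub>k \<rho> g k l e\<^sub>k\<close>.
\<close>

definition group_rep ::
  "('g, 'z) monoid_scheme \<Rightarrow> 'k set \<Rightarrow> ('g \<Rightarrow> 'k \<Rightarrow> 'k \<Rightarrow> complex) \<Rightarrow> bool" where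
  "group_rep G K \<rho> \<longleftrightarrow> finite K
     \<and> (\<forall>k\<in>K. \<forall>l\<in>K. \<rho> \<one>\<^bsub>G\<^esub> k l = (if k = l then 1 else 0))
     \<and> (\<forall>g\<in>carrier G. \<forall>h\<in>carrier G. \<forall>k\<in>K. \<forall>l\<in>K.
          \<rho> (g \<otimes>\<^bsub>G\<^esub> h) k l = (\<Sum>m\<in>K. \<rho> g k m * \<rho> h m l))"

definition mat_act :: "'k set \<Rightarrow> ('k \<Rightarrow> 'k \<Rightarrow> complex) \<Rightarrow> ('k \<Rightarrow> complex) \<Rightarrow> 'k \<Rightarrow> complex" where
  "mat_act K m v = (\<lambda>k. if k \<in> K then \<Sum>l\<in>K. m k l * v l else 0)"

definition irreducible_rep ::
  "('g, 'z) monoid_scheme \<Rightarrow> 'k set \<Rightarrow> ('g \<Rightarrow> 'k \<Rightarrow> 'k \<Rightarrow> complex) \<Rightarrow> bool" where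
  "irreducible_rep G K \<rho> \<longleftrightarrow> group_rep G K \<rho> \<and> K \<noteq> {}
     \<and> (\<forall>N. submodule N complex_ring (fspace K)
            \<and> (\<forall>g\<in>carrier G. \<forall>v\<in>N. mat_act K (\<rho> g) v \<in> N)
          \<longrightarrow> N = {\<lambda>_. 0} \<or> N = carrier (fspace K))"

definition trivial_rep ::
  "('g, 'z) monoid_scheme \<Rightarrow> 'k set \<Rightarrow> ('g \<Rightarrow> 'k \<Rightarrow> 'k \<Rightarrow> complex) \<Rightarrow> bool" where
  "trivial_rep G K \<rho> \<longleftrightarrow> card K = 1
     \<and> (\<forall>g\<in>carrier G. \<forall>k\<in>K. \<forall>l\<in>K. \<rho> g k l = (if k = l then 1 else 0))"

text \<open>
  Free left modules \<open>A \<otimes> \<Lambda>\<close> with \<open>\<Lambda>\<close> having basis \<open>L\<close>; the right action is determined by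
  \<open>s l a \<in> A \<otimes> \<Lambda>\<close>, the product \<open>(1 \<otimes> l) \<cdot> a\<close> for basis elements \<open>l\<close> and \<open>a\<close>.
\<close>

definition free_lact :: "('b, 'z) alg_data_scheme \<Rightarrow> ('b \<Rightarrow> complex)
    \<Rightarrow> ('b \<times> 'l \<Rightarrow> complex) \<Rightarrow> 'b \<times> 'l \<Rightarrow> complex" where
  "free_lact A a w = (\<lambda>(b, l). (a \<otimes>\<^bsub>alg A\<^esub> (\<lambda>b'. w (b', l))) b)"

definition free_ract :: "('b, 'z) alg_data_scheme \<Rightarrow> 'l set
    \<Rightarrow> ('l \<Rightarrow> 'b \<Rightarrow> 'b \<times> 'l \<Rightarrow> complex)
    \<Rightarrow> ('b \<times> 'l \<Rightarrow> complex) \<Rightarrow> ('b \<Rightarrow> complex) \<Rightarrow> 'b \<times> 'l \<Rightarrow> complex" where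
  "free_ract A L s w a = lext (basis A \<times> L)
     (\<lambda>(b, l). free_lact A (bvec b) (lext (basis A) (s l) a)) w"

definition free_calculus :: "('b, 'z) alg_data_scheme \<Rightarrow> 'l set
    \<Rightarrow> ('l \<Rightarrow> 'b \<Rightarrow> 'b \<times> 'l \<Rightarrow> complex) \<Rightarrow> (('b \<Rightarrow> complex) \<Rightarrow> 'b \<times> 'l \<Rightarrow> complex)
    \<Rightarrow> ('b \<Rightarrow> complex, 'b \<times> 'l \<Rightarrow> complex) calculus" where
  "free_calculus A L s \<delta> = module.extend (fspace (basis A \<times> L))
     (calculus.fields (free_lact A) (free_ract A L s) \<delta>)"

text \<open>
  \<open>\<Omega>\<^sup>1\<^sub>\<rho> = \<complex>G \<otimes> \<rho>(\<complex>G\<^sup>+)\<close>; endomorphisms are written in the basis of matrix units, \<open>(k, l)\<close>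
  being the one in row \<open>k\<close> and column \<open>l\<close>.
\<close>

definition kmat :: "'k set \<Rightarrow> ('k \<Rightarrow> 'k \<Rightarrow> complex) \<Rightarrow> 'k \<times> 'k \<Rightarrow> complex" where
  "kmat K m = (\<lambda>(k, l). if k \<in> K \<and> l \<in> K then m k l else 0)"

definition rep_calculus ::
  "('g, 'z) monoid_scheme \<Rightarrow> 'k set \<Rightarrow> ('g \<Rightarrow> 'k \<Rightarrow> 'k \<Rightarrow> complex)
    \<Rightarrow> ('g \<Rightarrow> complex, 'g \<times> ('k \<times> 'k) \<Rightarrow> complex) calculus" where
  "rep_calculus G K \<rho> = (free_calculus (group_hopf G) (K \<times> K)
     (\<lambda>(k, l) g. tprod (bvec g) (kmat K (\<lambda>m n. if m = k then \<rho> g l n else 0)))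
     (lext (carrier G) (\<lambda>g. tprod (bvec g) (kmat K (\<lambda>k l. \<rho> g k l - (if k = l then 1 else 0))))))
     \<lparr>carrier := tens (carrier (alg (group_hopf G)))
        (lext (carrier G) (\<lambda>g. kmat K (\<rho> g)) ` augm (group_hopf G))\<rparr>"

text \<open>The calculus on \<open>\<complex>(G)\<close> with left-invariant forms \<open>e\<^sub>c\<close>, \<open>c \<in> S\<close>.\<close>

definition class_calculus ::
  "('g, 'z) monoid_scheme \<Rightarrow> 'g set \<Rightarrow> ('g \<Rightarrow> complex, 'g \<times> 'g \<Rightarrow> complex) calculus" where
  "class_calculus G S = free_calculus (fun_hopf G) S
     (\<lambda>c g. tprod (bvec (g \<otimes>\<^bsub>G\<^esub> inv\<^bsub>G\<^esub> c)) (bvec c))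
     (lext (carrier G) (\<lambda>g z. \<Sum>c\<in>S. tprod (bvec (g \<otimes>\<^bsub>G\<^esub> inv\<^bsub>G\<^esub> c)) (bvec c) z - tprod (bvec g) (bvec c) z))"


section \<open>The calculus on \<open>D\<^sup>\<or>(G)\<close>\<close>

text \<open>
  \<open>J\<close> indexes the basis of \<open>V\<^sub>\<pi>\<close>, so that \<open>E\<^sub>c\<^sub>i\<close> and \<open>E\<^sup>c\<^sup>i\<close> are both indexed by
  \<open>(c, i) \<in> C \<times> J\<close>, and \<open>((c, i), (d, j))\<close> stands for \<open>E\<^sub>c\<^sub>i \<otimes> E\<^sup>d\<^sup>j\<close>. The entry
  \<open>\<pi> g j i\<close> is \<open>\<pi>(g)\<^sup>j\<^sub>i\<close>.
\<close>

definition zeta :: "('g, 'z) monoid_scheme \<Rightarrow> ('g \<Rightarrow> 'g) \<Rightarrow> 'g \<Rightarrow> 'g \<Rightarrow> 'g" where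
  "zeta G q c g = inv\<^bsub>G\<^esub> (q (gconj G g c)) \<otimes>\<^bsub>G\<^esub> g \<otimes>\<^bsub>G\<^esub> q c"

definition pi_tilde :: "('g, 'z) monoid_scheme \<Rightarrow> ('g \<Rightarrow> 'g) \<Rightarrow> ('g \<Rightarrow> 'i \<Rightarrow> 'i \<Rightarrow> complex)
    \<Rightarrow> 'g \<Rightarrow> 'g \<times> 'i \<Rightarrow> 'g \<times> 'i \<Rightarrow> complex" where
  "pi_tilde G q \<pi> h = (\<lambda>(d, j) (c, i). if d = gconj G h c then \<pi> (zeta G q c h) j i else 0)"

text \<open>\<open>h \<triangleright> E\<^sup>c\<^sup>i\<close>\<close>

definition dual_act :: "('g, 'z) monoid_scheme \<Rightarrow> ('g \<Rightarrow> 'g) \<Rightarrow> 'i set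
    \<Rightarrow> ('g \<Rightarrow> 'i \<Rightarrow> 'i \<Rightarrow> complex) \<Rightarrow> 'g \<Rightarrow> 'g \<times> 'i \<Rightarrow> 'g \<times> 'i \<Rightarrow> complex" where
  "dual_act G q J \<pi> h = (\<lambda>(c, i) (d, j).
     if d = gconj G h c \<and> j \<in> J then \<pi> (inv\<^bsub>G\<^esub> (zeta G q c h)) i j else 0)"

definition dvee_right :: "('g, 'z) monoid_scheme \<Rightarrow> ('g \<Rightarrow> 'g) \<Rightarrow> 'i set
    \<Rightarrow> ('g \<Rightarrow> 'i \<Rightarrow> 'i \<Rightarrow> complex) \<Rightarrow> ('g \<times> 'i) \<times> ('g \<times> 'i) \<Rightarrow> 'g \<times> 'g
    \<Rightarrow> ('g \<times> 'g) \<times> (('g \<times> 'i) \<times> ('g \<times> 'i)) \<Rightarrow> complex" where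
  "dvee_right G q J \<pi> = (\<lambda>((c, i), (d, j)) (g, h).
     tprod (bvec (g \<otimes>\<^bsub>G\<^esub> inv\<^bsub>G\<^esub> c, gconj G c h))
           (tprod (bvec (c, i)) (dual_act G q J \<pi> (inv\<^bsub>G\<^esub> h) (d, j))))"

definition dvee_theta :: "('g, 'z) monoid_scheme \<Rightarrow> 'g set \<Rightarrow> 'i set
    \<Rightarrow> ('g \<times> 'g) \<times> (('g \<times> 'i) \<times> ('g \<times> 'i)) \<Rightarrow> complex" where
  "dvee_theta G C J = tprod \<one>\<^bsub>alg (dvee G)\<^esub> (\<lambda>z. \<Sum>k\<in>C \<times> J. tprod (bvec k) (bvec k) z)"

definition dvee_calculus :: "('g, 'z) monoid_scheme \<Rightarrow> 'g set \<Rightarrow> ('g \<Rightarrow> 'g) \<Rightarrow> 'i set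
    \<Rightarrow> ('g \<Rightarrow> 'i \<Rightarrow> 'i \<Rightarrow> complex)
    \<Rightarrow> ('g \<times> 'g \<Rightarrow> complex, ('g \<times> 'g) \<times> (('g \<times> 'i) \<times> ('g \<times> 'i)) \<Rightarrow> complex) calculus" where
  "dvee_calculus G C q J \<pi> =
     (let L = (C \<times> J) \<times> (C \<times> J); s = dvee_right G q J \<pi>; \<theta> = dvee_theta G C J in
      free_calculus (dvee G) L s
        (\<lambda>x z. free_ract (dvee G) L s \<theta> x z - free_lact (dvee G) x \<theta> z))"

end

theory Submission
  imports Defs "Jordan_Normal_Form.Char_Poly"
begin

text \<open>
  In coordinates everything is explicit: with \<open>u = c\<^sup>-\<^sup>1hc\<close> and \<open>\<rho>\<close> the representation on \<open>V\<close>, the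
  coefficient of \<open>dy\<close> at \<open>(f, h)\<close> and \<open>E\<^sub>c\<^sub>i \<otimes> E\<^sup>d\<^sup>j\<close> is \<open>y(fc, u) \<rho>(u)\<^sub>c\<^sub>i\<^sub>,\<^sub>d\<^sub>j\<close>, minus \<open>y(f, h)\<close> if
  \<open>(c, i) = (d, j)\<close>. By Schur orthogonality for \<open>\<pi>\<close>, the rows over a single \<open>c\<close> of the matrices
  \<open>\<rho>(u)\<close> span all such row blocks, even by combinations with coefficient sum 0 unless \<open>\<pi>\<close> is
  trivial; if \<open>\<pi>\<close> is trivial, the row sums of \<open>\<rho>(u)\<close> are 1 and \<open>1 \<notin> C\<close>. Hence every form is a
  combination of forms \<open>x dy\<close>. The ideal \<open>I\<close> is the annihilator of \<open>V\<close> in \<open>P\<^sup>+\<close>, so \<open>p(I)\<close>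
  consists of the functions vanishing at 1 and, if \<open>\<pi>\<close> is trivial, on \<open>C\<close>. The map \<open>ver\<close> is zero
  unless \<open>\<pi>\<close> is trivial, when it takes row sums; its kernel is spanned by row blocks of the
  matrices \<open>\<rho>(u) - 1\<close>, and these give horizontal forms.
\<close>

section \<open>Spaces of functions\<close>

text \<open>The excluded pair matters because the counit of an element of P is the sum of its slice
  over 1, while a matrix unit in the rows over c is realised by an element living on the slice over
  c. Its counit is 0 for free when c is not 1; over c = 1 it is 0 only because the coefficients sum
  to 0, which fails exactly for trivial \<open>\<pi>\<close>. The algebra coordinate f and the block
  c of a row interact, since right multiplication evaluates at fc. The right coaction moves f to fs
  and must at the same time conjugate the matrices by rho(s), whereas the left coaction only shifts
  f. On the base, with g = fhf^-1, the matrix rho(c^-1hc) - 1 is rho(g) - 1 conjugated by rho(fc),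
  so the isomorphism conjugates each block of rows by its own group element. It stays injective
  because rho(c) preserves the block over c. Quotients are treated uniformly: each denominator is
  shown to be the kernel of an explicit map (the canonical map, or restriction of functions to a
  subset of G), and cosets are replaced by its values.\<close>

definition lin_closed :: "('b \<Rightarrow> complex) set \<Rightarrow> bool" where
  "lin_closed V \<longleftrightarrow> (\<lambda>_. 0) \<in> V \<and> (\<forall>x\<in>V. \<forall>y\<in>V. (\<lambda>b. x b + y b) \<in> V)
     \<and> (\<forall>c. \<forall>x\<in>V. (\<lambda>b. c * x b) \<in> V)"

text \<open>Covers \<open>fspace\<close>, \<open>alg\<close>, the free calculi and all of these with
  a smaller carrier, so that spans, submodules and linear maps are treated once. The operations are
  prescribed on all functions, hence shrinking the carrier does not change them. The quotient
  modules, whose elements are cosets, fall outside it.\<close>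

definition fun_module :: "(complex, 'b \<Rightarrow> complex, 'z) module_scheme \<Rightarrow> bool" where
  "fun_module M \<longleftrightarrow> lin_closed (carrier M) \<and> \<zero>\<^bsub>M\<^esub> = (\<lambda>_. 0)
     \<and> (\<forall>x y. x \<oplus>\<^bsub>M\<^esub> y = (\<lambda>b. x b + y b)) \<and> (\<forall>c x. c \<odot>\<^bsub>M\<^esub> x = (\<lambda>b. c * x b))"

lemma lin_closedI:
  assumes "(\<lambda>_. 0) \<in> V" "\<And>x y. x \<in> V \<Longrightarrow> y \<in> V \<Longrightarrow> (\<lambda>b. x b + y b) \<in> V"
    and "\<And>c x. x \<in> V \<Longrightarrow> (\<lambda>b. c * x b) \<in> V"
  shows "lin_closed V"
  using assms by (simp add: lin_closed_def)

lemma lin_closedD: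
  assumes "lin_closed V"
  shows "(\<lambda>_. 0) \<in> V" "x \<in> V \<Longrightarrow> y \<in> V \<Longrightarrow> (\<lambda>b. x b + y b) \<in> V"
    "x \<in> V \<Longrightarrow> (\<lambda>b. c * x b) \<in> V"
  using assms by (simp_all add: lin_closed_def)

lemma lin_closed_minus:
  assumes "lin_closed V" "x \<in> V"
  shows "(\<lambda>b. - x b) \<in> V"
  using lin_closedD(3)[OF assms, of "-1"] by simp

lemma lin_closed_diff:
  assumes "lin_closed V" "x \<in> V" "y \<in> V"
  shows "(\<lambda>b. x b - y b) \<in> V"
  using lin_closedD(2)[OF assms(1,2) lin_closed_minus[OF assms(1,3)]] by simp

lemma lin_closed_sum:
  assumes "lin_closed V" "\<And>i. i \<in> I \<Longrightarrow> f i \<in> V"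
  shows "(\<lambda>b. \<Sum>i\<in>I. f i b) \<in> V"
  using assms(2)
proof (induction I rule: infinite_finite_induct)
  case (insert i I)
  then show ?case
    using lin_closedD(2)[OF assms(1), of "f i" "\<lambda>b. \<Sum>i\<in>I. f i b"] by simp
qed (simp_all add: lin_closedD(1)[OF assms(1)])

lemma lin_closed_lin_comb:
  assumes "lin_closed V" "\<And>i. i \<in> I \<Longrightarrow> f i \<in> V"
  shows "(\<lambda>b. \<Sum>i\<in>I. c i * f i b) \<in> V"
  using lin_closed_sum[OF assms(1), of I "\<lambda>i b. c i * f i b"] lin_closedD(3)[OF assms(1)] assms(2)
  by blast

lemma carrier_fspace: "x \<in> carrier (fspace B) \<longleftrightarrow> (\<forall>b. b \<notin> B \<longrightarrow> x b = 0)"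
  by (simp add: fspace_def)

lemma fspaceD: "x \<in> carrier (fspace B) \<Longrightarrow> b \<notin> B \<Longrightarrow> x b = 0"
  by (simp add: carrier_fspace)

lemma fspace_eqI:
  assumes "x \<in> carrier (fspace B)" "y \<in> carrier (fspace B)" "\<And>b. b \<in> B \<Longrightarrow> x b = y b"
  shows "x = y"
proof
  fix b show "x b = y b"
    using assms by (cases "b \<in> B") (auto simp: carrier_fspace)
qed

lemma lin_closed_fspace [simp]: "lin_closed (carrier (fspace B))"
  by (auto simp: lin_closed_def carrier_fspace)

lemma fun_module_fspace [simp]: "fun_module (fspace B)"
  unfolding fun_module_def using lin_closed_fspace[of B] by (simp add: fspace_def)

lemma fun_module_ops:
  assumes "fun_module M"
  shows "\<zero>\<^bsub>M\<^esub> = (\<lambda>_. 0)" "x \<oplus>\<^bsub>M\<^esub> y = (\<lambda>b. x b + y b)" "c \<odot>\<^bsub>M\<^esub> x = (\<lambda>b. c * x b)"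
    "lin_closed (carrier M)"
  using assms by (simp_all add: fun_module_def)

lemma fun_module_carrier_update:
  assumes "fun_module M" "lin_closed V"
  shows "fun_module (M\<lparr>carrier := V\<rparr>)"
  using assms by (simp add: fun_module_def)

lemma complex_ring_simps [simp]:
  "carrier complex_ring = UNIV" "x \<oplus>\<^bsub>complex_ring\<^esub> y = x + y" "x \<otimes>\<^bsub>complex_ring\<^esub> y = x * y"
  "\<zero>\<^bsub>complex_ring\<^esub> = 0" "\<one>\<^bsub>complex_ring\<^esub> = 1"
  by (simp_all add: complex_ring_def)

lemma cring_complex_ring: "cring complex_ring"
  by (intro cringI abelian_groupI comm_monoidI)
    (auto simp: algebra_simps intro: exI[of _ "- x" for x])

lemma abelian_group_fun_module:
  assumes "fun_module M"
  shows "abelian_group M"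
proof (rule abelian_groupI)
  fix x assume x: "x \<in> carrier M"
  show "\<exists>y\<in>carrier M. y \<oplus>\<^bsub>M\<^esub> x = \<zero>\<^bsub>M\<^esub>"
    using lin_closed_minus[OF fun_module_ops(4)[OF assms] x]
    by (intro bexI[of _ "\<lambda>b. - x b"]) (auto simp: fun_module_ops[OF assms])
qed (auto simp: fun_module_ops[OF assms] lin_closedD[OF fun_module_ops(4)[OF assms]] algebra_simps)

lemma module_fun_module:
  assumes "fun_module M"
  shows "module complex_ring M"
  by (intro moduleI cring_complex_ring abelian_group_fun_module assms)
    (auto simp: fun_module_ops[OF assms] lin_closedD[OF fun_module_ops(4)[OF assms]] algebra_simps)

lemma finsum_fun_module:
  assumes "fun_module M" "\<And>i. i \<in> I \<Longrightarrow> f i \<in> carrier M"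
  shows "(\<Oplus>\<^bsub>M\<^esub>i\<in>I. f i) = (\<lambda>b. \<Sum>i\<in>I. f i b)"
proof -
  interpret abelian_group M by (rule abelian_group_fun_module[OF assms(1)])
  show ?thesis
    using assms(2)
    by (induction I rule: infinite_finite_induct)
      (auto simp: finsum_insert Pi_def fun_module_ops[OF assms(1)] finsum_infinite)
qed

text \<open>Additive inverses are multiples by -1 and zero is the multiple by 0 of any element, so a
  submodule is a nonempty subset closed under sums and scalars.\<close>

lemma submodule_iff:
  assumes "fun_module M"
  shows "submodule N complex_ring M \<longleftrightarrow> N \<subseteq> carrier M \<and> lin_closed N"
proof -
  interpret module complex_ring M by (rule module_fun_module[OF assms])
  have inv: "\<ominus>\<^bsub>M\<^esub> x = (\<lambda>b. - x b)" if "x \<in> carrier M" for x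
    using lin_closed_minus[OF fun_module_ops(4)[OF assms] that] that
    by (intro minus_equality) (auto simp: fun_module_ops[OF assms])
  show ?thesis
  proof
    assume N: "submodule N complex_ring M"
    then obtain x where x: "x \<in> N" "x \<in> carrier M"
      using submoduleE(1,2)[OF N] by blast
    have "0 \<odot>\<^bsub>M\<^esub> x \<in> N"
      using submoduleE(4)[OF N, of 0 x] x by simp
    then show "N \<subseteq> carrier M \<and> lin_closed N"
      using submoduleE(1,4,5)[OF N]
      by (auto intro!: lin_closedI simp: fun_module_ops[OF assms])
  next
    assume "N \<subseteq> carrier M \<and> lin_closed N"
    then show "submodule N complex_ring M"
      using lin_closed_minus[of N]
      by (intro submoduleI) (auto simp: inv fun_module_ops[OF assms] lin_closedD subset_iff)
  qed
qed

section \<open>Linear spans and linear maps\<close>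

definition fspan :: "('b \<Rightarrow> complex) set \<Rightarrow> ('b \<Rightarrow> complex) set" where
  "fspan X = \<Inter>{N. lin_closed N \<and> X \<subseteq> N}"

lemma lin_closed_fspan [simp]: "lin_closed (fspan X)"
  by (auto simp: fspan_def lin_closed_def)

lemma fspan_superset: "X \<subseteq> fspan X"
  by (auto simp: fspan_def)

lemma fspan_base: "x \<in> X \<Longrightarrow> x \<in> fspan X"
  using fspan_superset by blast

lemma fspan_minimal: "lin_closed N \<Longrightarrow> X \<subseteq> N \<Longrightarrow> fspan X \<subseteq> N"
  by (auto simp: fspan_def)

text \<open>\<open>fspan\<close> forgets the ambient module, so that spans taken in different
  modules can be compared. It intersects over a larger family of sets, but \<open>fspan X\<close> is
  itself a submodule once \<open>X\<close> lies in the carrier, so both intersections agree.\<close>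

lemma lin_span_eq_fspan:
  assumes "fun_module M" "X \<subseteq> carrier M"
  shows "lin_span M X = fspan X"
proof
  show "lin_span M X \<subseteq> fspan X"
    using fspan_minimal[OF fun_module_ops(4)[OF assms(1)] assms(2)] fspan_superset
    unfolding lin_span_def submodule_iff[OF assms(1)] by (intro Inter_lower) auto
qed (auto simp: lin_span_def fspan_def submodule_iff[OF assms(1)])

text \<open>Linearity is asked only on \<open>V\<close>, since the structure maps of an abstract
  calculus are known to be linear only on its carrier.\<close>

definition flinear :: "('b \<Rightarrow> complex) set \<Rightarrow> (('b \<Rightarrow> complex) \<Rightarrow> 'c \<Rightarrow> complex) \<Rightarrow> bool" where
  "flinear V f \<longleftrightarrow> (\<forall>x\<in>V. \<forall>y\<in>V. f (\<lambda>b. x b + y b) = (\<lambda>c. f x c + f y c))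
     \<and> (\<forall>k. \<forall>x\<in>V. f (\<lambda>b. k * x b) = (\<lambda>c. k * f x c))"

lemma flinearI:
  assumes "\<And>x y. x \<in> V \<Longrightarrow> y \<in> V \<Longrightarrow> f (\<lambda>b. x b + y b) = (\<lambda>c. f x c + f y c)"
    and "\<And>k x. x \<in> V \<Longrightarrow> f (\<lambda>b. k * x b) = (\<lambda>c. k * f x c)"
  shows "flinear V f"
  using assms by (simp add: flinear_def)

lemma flinearD:
  assumes "flinear V f"
  shows "x \<in> V \<Longrightarrow> y \<in> V \<Longrightarrow> f (\<lambda>b. x b + y b) = (\<lambda>c. f x c + f y c)"
    and "x \<in> V \<Longrightarrow> f (\<lambda>b. k * x b) = (\<lambda>c. k * f x c)"
  using assms by (simp_all add: flinear_def)

lemma flinear_zero: "flinear V f \<Longrightarrow> lin_closed V \<Longrightarrow> f (\<lambda>_. 0) = (\<lambda>_. 0)"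
  using flinearD(2)[of V f "\<lambda>_. 0" 0] lin_closedD(1)[of V] by simp

lemma flinear_diff:
  assumes "flinear V f" "lin_closed V" "x \<in> V" "y \<in> V"
  shows "f (\<lambda>b. x b - y b) = (\<lambda>c. f x c - f y c)"
  using flinearD(1)[OF assms(1,3) lin_closed_minus[OF assms(2,4)]] flinearD(2)[OF assms(1,4), of "-1"]
  by simp

lemma flinear_subset: "flinear V f \<Longrightarrow> W \<subseteq> V \<Longrightarrow> flinear W f"
  unfolding flinear_def by blast

lemma flinear_lin_comb:
  assumes "flinear V f" "lin_closed V" "\<And>i. i \<in> I \<Longrightarrow> x i \<in> V"
  shows "f (\<lambda>b. \<Sum>i\<in>I. k i * x i b) = (\<lambda>c. \<Sum>i\<in>I. k i * f (x i) c)"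
  using assms(3)
proof (induction I rule: infinite_finite_induct)
  case (insert i I)
  have "(\<lambda>b. \<Sum>i\<in>I. k i * x i b) \<in> V"
    using insert.prems by (intro lin_closed_lin_comb[OF assms(2)]) auto
  then show ?case
    using insert flinearD[OF assms(1)] lin_closedD(3)[OF assms(2)] by simp
qed (simp_all add: flinear_zero[OF assms(1,2)])

lemma lin_closed_kernel:
  assumes "lin_closed V" "flinear V f" "lin_closed W"
  shows "lin_closed {x \<in> V. f x \<in> W}"
  using assms flinear_zero[OF assms(2,1)]
  by (auto simp: lin_closed_def flinear_def)

lemma lin_closed_image:
  assumes "lin_closed V" "flinear V f"
  shows "lin_closed (f ` V)"
proof (rule lin_closedI)
  show "(\<lambda>_. 0) \<in> f ` V"
    using flinear_zero[OF assms(2,1)] lin_closedD(1)[OF assms(1)] by (metis imageI)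
next
  fix x y assume "x \<in> f ` V" "y \<in> f ` V"
  then obtain a b where "a \<in> V" "b \<in> V" "x = f a" "y = f b" by blast
  then show "(\<lambda>c. x c + y c) \<in> f ` V"
    using flinearD(1)[OF assms(2), of a b] lin_closedD(2)[OF assms(1), of a b]
    by (intro image_eqI[of _ _ "\<lambda>z. a z + b z"]) simp_all
next
  fix k x assume "x \<in> f ` V"
  then obtain a where "a \<in> V" "x = f a" by blast
  then show "(\<lambda>c. k * x c) \<in> f ` V"
    using flinearD(2)[OF assms(2), of a k] lin_closedD(3)[OF assms(1), of a k]
    by (intro image_eqI[of _ _ "\<lambda>z. k * a z"]) simp_all
qed

lemma fspan_image:
  assumes "lin_closed V" "flinear V f" "X \<subseteq> V"
  shows "f ` fspan X = fspan (f ` X)"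
proof
  have span: "fspan X \<subseteq> V"
    by (rule fspan_minimal[OF assms(1,3)])
  show "f ` fspan X \<subseteq> fspan (f ` X)"
    using fspan_minimal[OF lin_closed_kernel[OF assms(1,2) lin_closed_fspan], of X "f ` X"]
      fspan_superset assms(3) by fastforce
  show "fspan (f ` X) \<subseteq> f ` fspan X"
    using lin_closed_image[OF lin_closed_fspan flinear_subset[OF assms(2) span]]
    by (intro fspan_minimal) (auto intro: fspan_base)
qed

lemma lin_map_fun_module:
  assumes "fun_module M" "fun_module N"
  shows "lin_map M N f \<longleftrightarrow> f \<in> carrier M \<rightarrow> carrier N \<and> flinear (carrier M) f"
  by (auto simp: lin_map_def flinear_def fun_module_ops[OF assms(1)] fun_module_ops[OF assms(2)])

section \<open>Linear extension, bases and tensor products\<close>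

lemma flinear_lext [simp]: "flinear V (lext B f)"
  by (rule flinearI) (simp_all add: lext_def distrib_right sum.distrib sum_distrib_left mult.assoc)

lemma bvec_in_fspace [simp]: "bvec b \<in> carrier (fspace B) \<longleftrightarrow> b \<in> B"
  by (auto simp: carrier_fspace bvec_def)

lemma lext_bvec: "finite B \<Longrightarrow> b \<in> B \<Longrightarrow> lext B f (bvec b) = f b"
  by (rule ext) (simp add: lext_def bvec_def if_distrib[of "\<lambda>x. x * _"] cong: if_cong)

lemma lext_in:
  assumes "lin_closed V" "\<And>b. b \<in> B \<Longrightarrow> f b \<in> V"
  shows "lext B f x \<in> V"
  unfolding lext_def by (rule lin_closed_lin_comb[OF assms])

lemma fspace_expand:
  assumes "finite B" "x \<in> carrier (fspace B)"
  shows "x = (\<lambda>y. \<Sum>b\<in>B. x b * bvec b y)"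
  using assms by (auto simp: bvec_def carrier_fspace fun_eq_iff if_distrib[of "\<lambda>x. _ * x"] cong: if_cong)

lemma fspan_bvec:
  assumes "finite B"
  shows "fspan (bvec ` B) = carrier (fspace B)"
proof
  show "carrier (fspace B) \<subseteq> fspan (bvec ` B)"
  proof
    fix x assume "x \<in> carrier (fspace B)"
    then show "x \<in> fspan (bvec ` B)"
      using lin_closed_lin_comb[OF lin_closed_fspan, of B bvec "bvec ` B" x] fspan_base[of _ "bvec ` B"]
        fspace_expand[OF assms] by fastforce
  qed
  show "fspan (bvec ` B) \<subseteq> carrier (fspace B)"
    by (rule fspan_minimal) auto
qed

lemma tprod_in_fspace:
  "x \<in> carrier (fspace B) \<Longrightarrow> y \<in> carrier (fspace C) \<Longrightarrow> tprod x y \<in> carrier (fspace (B \<times> C))"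
  by (auto simp: carrier_fspace tprod_def)

lemma tprod_bvec: "tprod (bvec b) (bvec c) = bvec (b, c)"
  by (auto simp: tprod_def bvec_def fun_eq_iff)

text \<open>Slicing t along the first factor, as the sum over b of \<open>bvec b\<close> tensor t(b,
  _), shows that membership in a tensor product with a full coordinate space is a condition on each
  slice separately. This replaces spans of pure tensors by pointwise conditions.\<close>

lemma tens_fspace_eq:
  assumes "finite B" "lin_closed U"
  shows "tens (carrier (fspace B)) U
    = {t. \<forall>b. (\<lambda>c. t (b, c)) \<in> (if b \<in> B then U else {\<lambda>_. 0})}" (is "?L = ?R")
proof -
  let ?X = "{tprod x y | x y. x \<in> carrier (fspace B) \<and> y \<in> U}"
  have L: "?L = fspan ?X"
    unfolding tens_def by (rule lin_span_eq_fspan) (auto simp: carrier_fspace)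
  have "lin_closed ?R"
    using lin_closedD[OF assms(2)] by (auto intro!: lin_closedI split: if_splits simp: fun_eq_iff)
  moreover have "?X \<subseteq> ?R"
    using lin_closedD[OF assms(2)] by (auto simp: tprod_def carrier_fspace)
  ultimately have "?L \<subseteq> ?R"
    unfolding L by (rule fspan_minimal)
  moreover have "?R \<subseteq> ?L"
  proof
    fix t assume t: "t \<in> ?R"
    have "t = (\<lambda>z. \<Sum>b\<in>B. tprod (bvec b) (\<lambda>c. t (b, c)) z)"
    proof
      fix z :: "'a \<times> 'b"
      obtain b c where z: "z = (b, c)" by (cases z)
      have "t (b, c) = 0" if "b \<notin> B"
        using t that by (auto dest!: spec[of _ b] simp: fun_eq_iff)
      then show "t z = (\<Sum>b\<in>B. tprod (bvec b) (\<lambda>c. t (b, c)) z)"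
        using assms(1) by (auto simp: z tprod_def bvec_def if_distrib[of "\<lambda>x. x * _"] cong: if_cong)
    qed
    also have "\<dots> \<in> fspan ?X"
    proof (rule lin_closed_sum[OF lin_closed_fspan])
      fix b assume "b \<in> B"
      with t have "(\<lambda>c. t (b, c)) \<in> U"
        by (auto dest!: spec[of _ b])
      with \<open>b \<in> B\<close> show "tprod (bvec b) (\<lambda>c. t (b, c)) \<in> fspan ?X"
        by (intro fspan_base CollectI exI conjI refl) auto
    qed
    finally show "t \<in> ?L" unfolding L .
  qed
  ultimately show ?thesis by blast
qed

section \<open>Schur orthogonality\<close>

text \<open>An enumeration of \<open>J\<close> turns \<open>M\<close> into a square matrix of
  positive size. Its characteristic polynomial has positive degree and hence a complex root.\<close>

lemma ex_eigenvector:
  fixes M :: "'i \<Rightarrow> 'i \<Rightarrow> complex"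
  assumes "finite J" "J \<noteq> {}"
  shows "\<exists>k v. v \<in> carrier (fspace J) \<and> v \<noteq> (\<lambda>_. 0) \<and> (\<forall>i\<in>J. (\<Sum>j\<in>J. M i j * v j) = k * v i)"
proof -
  let ?n = "card J"
  obtain e where e: "bij_betw e {0..<?n} J"
    using ex_bij_betw_nat_finite[OF assms(1)] by blast
  define A where "A = Matrix.mat ?n ?n (\<lambda>(a, b). M (e a) (e b))"
  have A: "A \<in> carrier_mat ?n ?n"
    by (simp add: A_def)
  have "?n \<noteq> 0"
    using assms by simp
  then have "\<not> constant (poly (char_poly A))"
    using degree_monic_char_poly[OF A] by (simp add: constant_degree)
  then obtain k where "poly (char_poly A) k = 0"
    using fundamental_theorem_of_algebra by blast
  then obtain v where v: "v \<in> carrier_vec ?n" "v \<noteq> 0\<^sub>v ?n" "A *\<^sub>v v = k \<cdot>\<^sub>v v"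
    using eigenvalue_root_char_poly[OF A, of k] A by (auto simp: eigenvalue_def eigenvector_def)
  \<comment> \<open>The inverse of the enumeration carries the eigenvector back to a function on
    \<open>J\<close>.\<close>
  define d where "d = the_inv_into {0..<?n} e"
  have ed: "e (d j) = j" "d j < ?n" if "j \<in> J" for j
    using that e f_the_inv_into_f_bij_betw[OF e] bij_betwE[OF bij_betw_the_inv_into[OF e]]
    by (auto simp: d_def)
  have de: "d (e a) = a" if "a < ?n" for a
    using that e by (simp add: d_def the_inv_into_f_f bij_betw_def)
  define w where "w = (\<lambda>j. if j \<in> J then v $ d j else 0)"
  have "w \<noteq> (\<lambda>_. 0)"
  proof
    assume w: "w = (\<lambda>_. 0)"
    have "v $ a = 0" if "a < ?n" for a
    proof -
      have "e a \<in> J"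
        using that bij_betwE[OF e] by simp
      then show ?thesis
        using fun_cong[OF w, of "e a"] de[OF that] by (simp add: w_def)
    qed
    then have "v = 0\<^sub>v ?n"
      using v(1) by (intro eq_vecI) auto
    with v(2) show False by simp
  qed
  moreover have "(\<Sum>j\<in>J. M i j * w j) = k * w i" if i: "i \<in> J" for i
  proof -
    have "(\<Sum>j\<in>J. M i j * w j) = (\<Sum>b\<in>{0..<?n}. M i (e b) * w (e b))"
      by (rule sum.reindex_bij_betw[OF e, symmetric])
    also have "\<dots> = (\<Sum>b\<in>{0..<?n}. A $$ (d i, b) * v $ b)"
      using bij_betwE[OF e] by (intro sum.cong) (auto simp: A_def w_def ed[OF i] de)
    also have "\<dots> = (A *\<^sub>v v) $ d i"
      using v(1) A ed(2)[OF i] by (simp add: scalar_prod_def)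
    also have "\<dots> = k * w i"
      using v(1) ed(2)[OF i] i by (simp add: v(3) w_def)
    finally show ?thesis .
  qed
  ultimately show ?thesis
    by (intro exI[of _ k] exI[of _ w]) (auto simp: w_def carrier_fspace)
qed

lemma irreducible_rep_invariant:
  assumes "irreducible_rep G K \<rho>" "lin_closed N" "N \<subseteq> carrier (fspace K)"
    and "\<And>g v. g \<in> carrier G \<Longrightarrow> v \<in> N \<Longrightarrow> mat_act K (\<rho> g) v \<in> N"
    and "x \<in> N" "x \<noteq> (\<lambda>_. 0)"
  shows "N = carrier (fspace K)"
  using assms(2-) assms(1) unfolding irreducible_rep_def submodule_iff[OF fun_module_fspace] by blast

lemma mat_act_in [simp]: "mat_act K m v \<in> carrier (fspace K)"
  by (simp add: mat_act_def carrier_fspace)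

lemma mat_act_linear:
  "mat_act K m (\<lambda>_. 0) = (\<lambda>_. 0)"
  "mat_act K m (\<lambda>b. x b + y b) = (\<lambda>b. mat_act K m x b + mat_act K m y b)"
  "mat_act K m (\<lambda>b. c * x b) = (\<lambda>b. c * mat_act K m x b)"
  by (auto simp: mat_act_def distrib_left sum.distrib sum_distrib_left mult.left_commute)

text \<open>An eigenspace of \<open>T\<close> is nonzero and, since \<open>T\<close> commutes with
  the representation, invariant. Irreducibility makes it the whole space, and evaluation on basis
  vectors shows that \<open>T\<close> is scalar.\<close>

lemma schur:
  assumes irr: "irreducible_rep G K \<rho>"
    and comm: "\<And>g k l. g \<in> carrier G \<Longrightarrow> k \<in> K \<Longrightarrow> l \<in> K
      \<Longrightarrow> (\<Sum>m\<in>K. \<rho> g k m * T m l) = (\<Sum>m\<in>K. T k m * \<rho> g m l)"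
  shows "\<exists>c. \<forall>k\<in>K. \<forall>l\<in>K. T k l = (if k = l then c else 0)"
proof -
  have K: "finite K" "K \<noteq> {}"
    using irr by (auto simp: irreducible_rep_def group_rep_def)
  obtain c v where v: "v \<in> carrier (fspace K)" "v \<noteq> (\<lambda>_. 0)" "\<forall>i\<in>K. (\<Sum>j\<in>K. T i j * v j) = c * v i"
    using ex_eigenvector[OF K, of T] by blast
  define N where "N = {v \<in> carrier (fspace K). \<forall>i\<in>K. (\<Sum>j\<in>K. T i j * v j) = c * v i}"
  have N: "N = carrier (fspace K)"
  proof (rule irreducible_rep_invariant[OF irr _ _ _ _ v(2)])
    show "lin_closed N"
      by (rule lin_closedI)
        (auto simp: N_def lin_closedD[OF lin_closed_fspace] algebra_simps sum.distrib simp flip: sum_distrib_left)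
    fix g v assume g: "g \<in> carrier G" and "v \<in> N"
    then have Tv: "(\<Sum>j\<in>K. T i j * v j) = c * v i" if "i \<in> K" for i
      using that by (simp add: N_def)
    have "(\<Sum>j\<in>K. T i j * mat_act K (\<rho> g) v j) = c * mat_act K (\<rho> g) v i" if i: "i \<in> K" for i
    proof -
      have "(\<Sum>j\<in>K. T i j * mat_act K (\<rho> g) v j) = (\<Sum>j\<in>K. \<Sum>l\<in>K. T i j * \<rho> g j l * v l)"
        by (simp add: mat_act_def sum_distrib_left mult.assoc)
      also have "\<dots> = (\<Sum>l\<in>K. (\<Sum>j\<in>K. T i j * \<rho> g j l) * v l)"
        by (subst sum.swap) (simp add: sum_distrib_right)
      also have "\<dots> = (\<Sum>l\<in>K. (\<Sum>j\<in>K. \<rho> g i j * T j l) * v l)"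
        using comm[OF g i] by simp
      also have "\<dots> = (\<Sum>j\<in>K. \<rho> g i j * (\<Sum>l\<in>K. T j l * v l))"
        by (simp add: sum_distrib_left sum_distrib_right mult.assoc) (rule sum.swap)
      also have "\<dots> = (\<Sum>j\<in>K. \<rho> g i j * (c * v j))"
        using Tv by simp
      also have "\<dots> = c * mat_act K (\<rho> g) v i"
        using i by (simp add: mat_act_def sum_distrib_left algebra_simps)
      finally show ?thesis .
    qed
    then show "mat_act K (\<rho> g) v \<in> N" by (simp add: N_def)
  qed (use v in \<open>auto simp: N_def\<close>)
  have "T k l = (if k = l then c else 0)" if "k \<in> K" "l \<in> K" for k l
  proof -
    have "bvec l \<in> N"
      using N that by simp
    then show ?thesis
      using that K(1)
      by (auto simp: N_def bvec_def if_distrib[of "\<lambda>x. _ * x"] dest!: bspec[of _ _ k] cong: if_cong)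
  qed
  then show ?thesis by blast
qed

text \<open>Averaging a matrix unit over the group gives an operator commuting with
  \<open>\<rho>\<close>, which is scalar by \<open>schur\<close>; the scalar is found from the
  trace.\<close>

lemma schur_orthogonality:
  assumes G: "group G" "finite (carrier G)" and irr: "irreducible_rep G K \<rho>"
    and K: "a \<in> K" "b \<in> K" "i \<in> K" "j \<in> K"
  shows "(\<Sum>g\<in>carrier G. \<rho> g a b * \<rho> (inv\<^bsub>G\<^esub> g) j i)
    = (if a = i \<and> b = j then of_nat (card (carrier G)) / of_nat (card K) else 0)"
proof -
  interpret group G by (rule G(1))
  have fin: "finite K" "K \<noteq> {}"
    and one: "\<And>k l. k \<in> K \<Longrightarrow> l \<in> K \<Longrightarrow> \<rho> \<one>\<^bsub>G\<^esub> k l = (if k = l then 1 else 0)"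
    and mul: "\<And>g h k l. g \<in> carrier G \<Longrightarrow> h \<in> carrier G \<Longrightarrow> k \<in> K \<Longrightarrow> l \<in> K
      \<Longrightarrow> \<rho> (g \<otimes>\<^bsub>G\<^esub> h) k l = (\<Sum>m\<in>K. \<rho> g k m * \<rho> h m l)"
    using irr by (auto simp: irreducible_rep_def group_rep_def)
  \<comment> \<open>The matrix of the sum over g of rho(g) E rho(g)^-1, where E is the matrix unit
    in row b and column j.\<close>
  define T where "T = (\<lambda>k l. \<Sum>g\<in>carrier G. \<rho> g k b * \<rho> (inv\<^bsub>G\<^esub> g) j l)"
  have "\<exists>c. \<forall>k\<in>K. \<forall>l\<in>K. T k l = (if k = l then c else 0)"
  proof (rule schur[OF irr])
    fix h k l assume h: "h \<in> carrier G" and kl: "k \<in> K" "l \<in> K"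
    have "(\<Sum>m\<in>K. \<rho> h k m * T m l)
        = (\<Sum>g\<in>carrier G. (\<Sum>m\<in>K. \<rho> h k m * \<rho> g m b) * \<rho> (inv\<^bsub>G\<^esub> g) j l)"
      unfolding T_def by (simp add: sum_distrib_left sum_distrib_right mult.assoc) (rule sum.swap)
    \<comment> \<open>Writing g as h^-1(hg) inside the inverse makes the summand a function of hg
      alone, so that the summation variable can be translated.\<close>
    also have "\<dots> = (\<Sum>g\<in>carrier G. \<rho> (h \<otimes>\<^bsub>G\<^esub> g) k b * \<rho> (inv\<^bsub>G\<^esub> (inv\<^bsub>G\<^esub> h \<otimes>\<^bsub>G\<^esub> (h \<otimes>\<^bsub>G\<^esub> g))) j l)"
      using h kl K by (intro sum.cong) (auto simp: mul simp flip: m_assoc)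
    also have "\<dots> = (\<Sum>g\<in>carrier G. \<rho> g k b * \<rho> (inv\<^bsub>G\<^esub> (inv\<^bsub>G\<^esub> h \<otimes>\<^bsub>G\<^esub> g)) j l)"
      using h by (intro sum.reindex_bij_witness[of _ "\<lambda>g. inv\<^bsub>G\<^esub> h \<otimes>\<^bsub>G\<^esub> g" "\<lambda>g. h \<otimes>\<^bsub>G\<^esub> g"])
        (auto simp flip: m_assoc)
    also have "\<dots> = (\<Sum>g\<in>carrier G. \<rho> g k b * (\<Sum>m\<in>K. \<rho> (inv\<^bsub>G\<^esub> g) j m * \<rho> h m l))"
      using h kl K by (intro sum.cong) (auto simp: inv_mult_group mul)
    also have "\<dots> = (\<Sum>m\<in>K. T k m * \<rho> h m l)"
      unfolding T_def by (simp add: sum_distrib_left sum_distrib_right mult.assoc) (rule sum.swap)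
    finally show "(\<Sum>m\<in>K. \<rho> h k m * T m l) = (\<Sum>m\<in>K. T k m * \<rho> h m l)" .
  qed
  then obtain c where c: "\<And>k l. k \<in> K \<Longrightarrow> l \<in> K \<Longrightarrow> T k l = (if k = l then c else 0)"
    by blast
  \<comment> \<open>The trace of \<open>T\<close>: each group element contributes the (j, b) entry
    of rho(g^-1 g), the identity matrix.\<close>
  have "of_nat (card K) * c = (\<Sum>k\<in>K. T k k)"
    using c by simp
  also have "\<dots> = (\<Sum>g\<in>carrier G. \<Sum>k\<in>K. \<rho> (inv\<^bsub>G\<^esub> g) j k * \<rho> g k b)"
    unfolding T_def by (subst sum.swap) (simp add: mult.commute)
  also have "\<dots> = (\<Sum>g\<in>carrier G. \<rho> (inv\<^bsub>G\<^esub> g \<otimes>\<^bsub>G\<^esub> g) j b)"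
    by (intro sum.cong) (use K mul[symmetric] in simp_all)
  also have "\<dots> = (if b = j then of_nat (card (carrier G)) else 0)"
    using K by (simp add: one)
  finally have "of_nat (card K) * c = (if b = j then of_nat (card (carrier G)) else 0)" .
  moreover have "(of_nat (card K) :: complex) \<noteq> 0"
    using fin by simp
  ultimately have "c = (if b = j then of_nat (card (carrier G)) / of_nat (card K) else 0)"
    by (auto simp: field_simps)
  with c[OF K(1,3)] show ?thesis
    by (simp add: T_def)
qed

text \<open>A nonzero column of the summed matrices would be an invariant vector. By irreducibility
  every vector would then be invariant, so every line would be a subrepresentation; the dimension
  would be 1 and the representation trivial.\<close>

lemma sum_nontrivial_irreducible_rep:
  assumes G: "group G" "finite (carrier G)" and irr: "irreducible_rep G K \<rho>"
    and nontriv: "\<not> trivial_rep G K \<rho>" and K: "k \<in> K" "l \<in> K"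
  shows "(\<Sum>g\<in>carrier G. \<rho> g k l) = 0"
proof (rule ccontr)
  interpret group G by (rule G(1))
  have fin: "finite K"
    and mul: "\<And>g h k l. g \<in> carrier G \<Longrightarrow> h \<in> carrier G \<Longrightarrow> k \<in> K \<Longrightarrow> l \<in> K
      \<Longrightarrow> \<rho> (g \<otimes>\<^bsub>G\<^esub> h) k l = (\<Sum>m\<in>K. \<rho> g k m * \<rho> h m l)"
    using irr by (auto simp: irreducible_rep_def group_rep_def)
  define v where "v = (\<lambda>m. if m \<in> K then \<Sum>g\<in>carrier G. \<rho> g m l else 0)"
  define N where "N = {x \<in> carrier (fspace K). \<forall>g\<in>carrier G. mat_act K (\<rho> g) x = x}"
  assume "(\<Sum>g\<in>carrier G. \<rho> g k l) \<noteq> 0"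
  then have "v k \<noteq> 0" using K by (simp add: v_def)
  then have v0: "v \<noteq> (\<lambda>_. 0)" by auto
  have "mat_act K (\<rho> h) v = v" if h: "h \<in> carrier G" for h
  proof
    fix m
    have "(\<Sum>n\<in>K. \<rho> h m n * v n) = v m" if m: "m \<in> K"
    proof -
      have "(\<Sum>n\<in>K. \<rho> h m n * v n) = (\<Sum>g\<in>carrier G. \<Sum>n\<in>K. \<rho> h m n * \<rho> g n l)"
        by (simp add: v_def sum_distrib_left) (rule sum.swap)
      also have "\<dots> = (\<Sum>g\<in>carrier G. \<rho> (h \<otimes>\<^bsub>G\<^esub> g) m l)"
        using h m K by (intro sum.cong) (auto simp: mul)
      also have "\<dots> = (\<Sum>g\<in>carrier G. \<rho> g m l)"
        using h by (intro sum.reindex_bij_witness[of _ "\<lambda>g. inv\<^bsub>G\<^esub> h \<otimes>\<^bsub>G\<^esub> g" "\<lambda>g. h \<otimes>\<^bsub>G\<^esub> g"])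
          (auto simp flip: m_assoc)
      finally show ?thesis using m by (simp add: v_def)
    qed
    then show "mat_act K (\<rho> h) v m = v m"
      by (simp add: mat_act_def v_def)
  qed
  then have vN: "v \<in> N"
    by (auto simp: N_def v_def carrier_fspace)
  have N: "N = carrier (fspace K)"
  proof (rule irreducible_rep_invariant[OF irr _ _ _ vN v0])
    show "lin_closed N"
      by (rule lin_closedI) (auto simp: N_def mat_act_linear lin_closedD[OF lin_closed_fspace])
  qed (auto simp: N_def)
  then have id: "\<rho> g m n = (if m = n then 1 else 0)" if "g \<in> carrier G" "m \<in> K" "n \<in> K" for g m n
  proof -
    have "mat_act K (\<rho> g) (bvec n) m = bvec n m"
    proof -
      have "bvec n \<in> N"
        using N that by simp
      then show ?thesis
        using that by (simp add: N_def)
    qed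
    then show ?thesis
      using that fin by (simp add: mat_act_def bvec_def if_distrib[of "\<lambda>x. _ * x"] cong: if_cong)
  qed
  have "carrier (fspace {k}) = carrier (fspace K)"
  proof (rule irreducible_rep_invariant[OF irr, of _ "bvec k"])
    fix g x assume "g \<in> carrier G" "x \<in> carrier (fspace {k})"
    then have "mat_act K (\<rho> g) x = x"
      using fin K by (auto simp: mat_act_def carrier_fspace fun_eq_iff id if_distrib[of "\<lambda>x. x * _"] cong: if_cong)
    with \<open>x \<in> _\<close> show "mat_act K (\<rho> g) x \<in> carrier (fspace {k})" by simp
  qed (use K in \<open>auto simp: carrier_fspace bvec_def fun_eq_iff\<close>)
  then have "K = {k}"
    using K(1) bvec_in_fspace by (metis singletonD singletonI subset_antisym subsetI)
  then have "card K = 1" by (metis is_singletonI is_singleton_altdef)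
  with id nontriv show False by (simp add: trivial_rep_def)
qed

section \<open>Quotients of function spaces\<close>

lemma coset_fun_module:
  assumes "\<And>x y. x \<oplus>\<^bsub>M\<^esub> y = (\<lambda>b. x b + y b)"
  shows "N +>\<^bsub>M\<^esub> x = {\<lambda>b. n b + x b | n. n \<in> N}"
  by (auto simp: a_r_coset_def' assms)

text \<open>The denominator is given as the kernel of an explicit linear map f. Cosets are then the
  fibres of f, and computations in the quotient become computations with values of f. Instances are
  the balanced tensor square of P, the left-invariant forms on the fibre, and the tensor products of
  the latter with P and H.\<close>

locale linear_quotient =
  fixes M :: "(complex, 'b \<Rightarrow> complex) module" and N :: "('b \<Rightarrow> complex) set"
    and f :: "('b \<Rightarrow> complex) \<Rightarrow> 'c \<Rightarrow> complex"
  assumes fun_module: "fun_module M" and flinear: "flinear (carrier M) f"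
    and kernel: "N = {x \<in> carrier M. f x = (\<lambda>_. 0)}"
begin

abbreviation "cls x \<equiv> N +>\<^bsub>M\<^esub> x"

text \<open>The map induced by f. The choice of a representative is harmless on the coset of a
  carrier element, because f is constant there by \<open>coset_eq\<close>.\<close>

definition lift :: "('b \<Rightarrow> complex) set \<Rightarrow> 'c \<Rightarrow> complex" where
  "lift X = f (SOME x. x \<in> X)"

lemma lin_closed_carrier: "lin_closed (carrier M)"
  by (rule fun_module_ops(4)[OF fun_module])

lemma coset_eq:
  assumes "x \<in> carrier M"
  shows "cls x = {y \<in> carrier M. f y = f x}"
proof (rule equalityI; rule subsetI)
  fix y assume "y \<in> cls x"
  then show "y \<in> {y \<in> carrier M. f y = f x}"
    using assms flinearD(1)[OF flinear] lin_closedD(2)[OF lin_closed_carrier]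
    by (auto simp: coset_fun_module[OF fun_module_ops(2)[OF fun_module]] kernel)
next
  fix y assume y: "y \<in> {y \<in> carrier M. f y = f x}"
  then have "(\<lambda>b. y b - x b) \<in> N"
    using assms lin_closed_diff[OF lin_closed_carrier] flinear_diff[OF flinear lin_closed_carrier]
    by (simp add: kernel)
  then show "y \<in> cls x"
    unfolding coset_fun_module[OF fun_module_ops(2)[OF fun_module]]
    by (intro CollectI exI[of _ "\<lambda>b. y b - x b"] conjI) auto
qed

lemma coset_eq_iff:
  assumes "x \<in> carrier M" "y \<in> carrier M"
  shows "cls x = cls y \<longleftrightarrow> f x = f y"
  using assms by (auto simp: coset_eq)

lemma carrier_quot: "carrier (quot_module M N) = cls ` carrier M"
  by (auto simp: quot_module_def A_RCOSETS_def')

lemma zero_quot: "\<zero>\<^bsub>quot_module M N\<^esub> = cls (\<lambda>_. 0)"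
  using coset_eq[OF lin_closedD(1)[OF lin_closed_carrier]] flinear_zero[OF flinear lin_closed_carrier]
  by (simp add: quot_module_def kernel)

lemma add_quot:
  assumes "x \<in> carrier M" "y \<in> carrier M"
  shows "cls x \<oplus>\<^bsub>quot_module M N\<^esub> cls y = cls (\<lambda>b. x b + y b)"
proof -
  have xy: "(\<lambda>b. x b + y b) \<in> carrier M"
    by (rule lin_closedD(2)[OF lin_closed_carrier assms])
  have "cls x \<oplus>\<^bsub>quot_module M N\<^esub> cls y = {\<lambda>b. u b + v b | u v. u \<in> cls x \<and> v \<in> cls y}"
    by (auto simp: quot_module_def set_add_def set_mult_def fun_module_ops(2)[OF fun_module])
  also have "\<dots> = cls (\<lambda>b. x b + y b)"
    unfolding coset_eq[OF assms(1)] coset_eq[OF assms(2)] coset_eq[OF xy]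
  proof (rule equalityI; rule subsetI)
    fix z assume z: "z \<in> {z \<in> carrier M. f z = f (\<lambda>b. x b + y b)}"
    have "(\<lambda>b. z b - y b) \<in> carrier M" "f (\<lambda>b. z b - y b) = f x"
      using z assms lin_closed_diff[OF lin_closed_carrier]
      by (auto simp: flinear_diff[OF flinear lin_closed_carrier] flinearD(1)[OF flinear])
    then show "z \<in> {\<lambda>b. u b + v b |u v. u \<in> {y \<in> carrier M. f y = f x} \<and> v \<in> {z \<in> carrier M. f z = f y}}"
      using assms(2) by (intro CollectI exI[of _ "\<lambda>b. z b - y b"] exI[of _ y] conjI) auto
  next
    fix z assume "z \<in> {\<lambda>b. u b + v b |u v. u \<in> {y \<in> carrier M. f y = f x} \<and> v \<in> {z \<in> carrier M. f z = f y}}"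
    then obtain u v where "z = (\<lambda>b. u b + v b)" "u \<in> carrier M" "f u = f x" "v \<in> carrier M" "f v = f y"
      by blast
    then show "z \<in> {z \<in> carrier M. f z = f (\<lambda>b. x b + y b)}"
      using assms by (simp add: flinearD(1)[OF flinear] lin_closedD(2)[OF lin_closed_carrier])
  qed
  finally show ?thesis .
qed

text \<open>Scalar multiplication and the module actions on quotients are defined as unions over
  representatives. On a coset the family is nonempty and constant, so the union collapses to a
  single value.\<close>

lemma Union_coset:
  assumes "x \<in> carrier M" "\<And>y. y \<in> carrier M \<Longrightarrow> f y = f x \<Longrightarrow> F y = F x"
  shows "(\<Union>y\<in>cls x. F y) = F x"
proof (rule SUP_eq_const)
  show "cls x \<noteq> {}"
    using assms(1) coset_eq[OF assms(1)] by blast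
  fix y assume "y \<in> cls x"
  then show "F y = F x"
    by (intro assms(2)) (simp_all add: coset_eq[OF assms(1)])
qed

lemma smult_quot:
  assumes "x \<in> carrier M"
  shows "c \<odot>\<^bsub>quot_module M N\<^esub> cls x = cls (\<lambda>b. c * x b)"
proof -
  have "c \<odot>\<^bsub>quot_module M N\<^esub> cls x = (\<Union>y\<in>cls x. cls (\<lambda>b. c * y b))"
    by (simp add: quot_module_def fun_module_ops(3)[OF fun_module])
  also have "\<dots> = cls (\<lambda>b. c * x b)"
    using assms lin_closedD(3)[OF lin_closed_carrier]
    by (intro Union_coset) (simp_all add: coset_eq_iff flinearD(2)[OF flinear])
  finally show ?thesis .
qed

lemma lift_cls:
  assumes "x \<in> carrier M"
  shows "lift (cls x) = f x"
proof -
  have "(SOME y. y \<in> cls x) \<in> cls x"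
    by (rule someI[of _ x]) (simp add: coset_eq assms)
  then show ?thesis
    by (simp add: lift_def coset_eq assms)
qed

lemma bij_lift: "bij_betw lift (carrier (quot_module M N)) (f ` carrier M)"
  unfolding bij_betw_def carrier_quot
  by (auto simp: inj_on_def lift_cls coset_eq_iff image_image)

text \<open>First isomorphism theorem, with the operations of the coset module evaluated on
  representatives.\<close>

lemma lin_iso_lift:
  assumes "fun_module K" "f ` carrier M = carrier K"
  shows "lin_iso (quot_module M N) K lift"
proof -
  have "lin_map (quot_module M N) K lift"
    unfolding lin_map_def
  proof (intro conjI ballI allI)
    show "lift \<in> carrier (quot_module M N) \<rightarrow> carrier K"
      using bij_lift assms(2) by (auto simp: bij_betw_def)
    fix X Y c assume "X \<in> carrier (quot_module M N)" "Y \<in> carrier (quot_module M N)"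
    then obtain x y where "x \<in> carrier M" "X = cls x" "y \<in> carrier M" "Y = cls y"
      by (auto simp: carrier_quot)
    then show "lift (X \<oplus>\<^bsub>quot_module M N\<^esub> Y) = lift X \<oplus>\<^bsub>K\<^esub> lift Y"
      by (simp add: add_quot lift_cls lin_closedD[OF lin_closed_carrier] flinearD(1)[OF flinear]
          fun_module_ops(2)[OF assms(1)])
  next
    fix X c assume "X \<in> carrier (quot_module M N)"
    then obtain x where "x \<in> carrier M" "X = cls x"
      by (auto simp: carrier_quot)
    then show "lift (c \<odot>\<^bsub>quot_module M N\<^esub> X) = c \<odot>\<^bsub>K\<^esub> lift X"
      by (simp add: smult_quot lift_cls lin_closedD[OF lin_closed_carrier] flinearD(2)[OF flinear]
          fun_module_ops(3)[OF assms(1)])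
  qed
  with bij_lift assms(2) show ?thesis
    by (simp add: lin_iso_def)
qed

lemma quot_closed:
  assumes "X \<in> carrier (quot_module M N)" "Y \<in> carrier (quot_module M N)"
  shows "X \<oplus>\<^bsub>quot_module M N\<^esub> Y \<in> carrier (quot_module M N)"
    "c \<odot>\<^bsub>quot_module M N\<^esub> X \<in> carrier (quot_module M N)"
    "\<zero>\<^bsub>quot_module M N\<^esub> \<in> carrier (quot_module M N)"
proof -
  obtain x y where "x \<in> carrier M" "X = cls x" "y \<in> carrier M" "Y = cls y"
    using assms by (auto simp: carrier_quot)
  then show "X \<oplus>\<^bsub>quot_module M N\<^esub> Y \<in> carrier (quot_module M N)"
    "c \<odot>\<^bsub>quot_module M N\<^esub> X \<in> carrier (quot_module M N)"
    "\<zero>\<^bsub>quot_module M N\<^esub> \<in> carrier (quot_module M N)"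
    using lin_closedD[OF lin_closed_carrier]
    by (auto simp: add_quot smult_quot zero_quot carrier_quot)
qed

text \<open>Produces linear maps into a quotient from linear maps g on representatives; the vertical
  map arises in this way.\<close>

lemma lin_map_cls:
  assumes "fun_module L" "flinear (carrier L) g" "g ` carrier L \<subseteq> carrier M"
  shows "lin_map L (quot_module M N) (\<lambda>w. cls (g w))"
  using assms(3) flinearD[OF assms(2)]
  by (auto simp: lin_map_def carrier_quot add_quot smult_quot image_subset_iff fun_module_ops[OF assms(1)])

end

section \<open>Algebras given by structure constants\<close>

lemma alg_ops:
  "carrier (alg A) = carrier (fspace (basis A))" "\<one>\<^bsub>alg A\<^esub> = bunit A"
  "x \<oplus>\<^bsub>alg A\<^esub> y = (\<lambda>b. x b + y b)" "\<zero>\<^bsub>alg A\<^esub> = (\<lambda>_. 0)" "c \<odot>\<^bsub>alg A\<^esub> x = (\<lambda>b. c * x b)"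
  by (simp_all add: alg_def fspace_def)

lemma alg_mult:
  "x \<otimes>\<^bsub>alg A\<^esub> y = (\<lambda>z. \<Sum>a\<in>basis A. \<Sum>b\<in>basis A. x a * y b * bmult A a b z)"
  by (simp add: alg_def lext_def sum_distrib_left mult.assoc)

lemma fun_module_alg [simp]: "fun_module (alg A)"
  using lin_closed_fspace[of "basis A"] by (simp add: fun_module_def alg_ops)

lemma alg_mult_linear:
  "(\<lambda>b. x b + x' b) \<otimes>\<^bsub>alg A\<^esub> y = (\<lambda>z. (x \<otimes>\<^bsub>alg A\<^esub> y) z + (x' \<otimes>\<^bsub>alg A\<^esub> y) z)"
  "x \<otimes>\<^bsub>alg A\<^esub> (\<lambda>b. y b + y' b) = (\<lambda>z. (x \<otimes>\<^bsub>alg A\<^esub> y) z + (x \<otimes>\<^bsub>alg A\<^esub> y') z)"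
  "(\<lambda>b. c * x b) \<otimes>\<^bsub>alg A\<^esub> y = (\<lambda>z. c * (x \<otimes>\<^bsub>alg A\<^esub> y) z)"
  "x \<otimes>\<^bsub>alg A\<^esub> (\<lambda>b. c * y b) = (\<lambda>z. c * (x \<otimes>\<^bsub>alg A\<^esub> y) z)"
  by (simp_all add: alg_mult ring_distribs sum.distrib sum_distrib_left ac_simps)

text \<open>Bilinearity of the product is automatic for structure constants, which leaves closure,
  associativity and the unit laws.\<close>

lemma complex_algebra_alg:
  assumes "\<And>x y. x \<in> carrier (alg A) \<Longrightarrow> y \<in> carrier (alg A) \<Longrightarrow> x \<otimes>\<^bsub>alg A\<^esub> y \<in> carrier (alg A)"
    and "\<And>x y z. x \<in> carrier (alg A) \<Longrightarrow> y \<in> carrier (alg A) \<Longrightarrow> z \<in> carrier (alg A)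
      \<Longrightarrow> (x \<otimes>\<^bsub>alg A\<^esub> y) \<otimes>\<^bsub>alg A\<^esub> z = x \<otimes>\<^bsub>alg A\<^esub> (y \<otimes>\<^bsub>alg A\<^esub> z)"
    and "\<one>\<^bsub>alg A\<^esub> \<in> carrier (alg A)"
    and "\<And>x. x \<in> carrier (alg A) \<Longrightarrow> \<one>\<^bsub>alg A\<^esub> \<otimes>\<^bsub>alg A\<^esub> x = x"
    and "\<And>x. x \<in> carrier (alg A) \<Longrightarrow> x \<otimes>\<^bsub>alg A\<^esub> \<one>\<^bsub>alg A\<^esub> = x"
  shows "complex_algebra (alg A)"
proof -
  have "ring (alg A)"
    using assms
    by (intro ringI abelian_group_fun_module monoidI) (auto simp: alg_ops(3) alg_mult_linear)
  then show ?thesis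
    by (simp add: complex_algebra_def module_fun_module alg_mult_linear alg_ops(5))
qed

section \<open>Free bimodules and transport of calculi\<close>

text \<open>First isomorphism theorem for the canonical map on the unbalanced tensor square, so that
  the Galois condition becomes a statement on kernel and image without cosets.\<close>

lemma hopf_galoisI:
  assumes "balancing P H p = {t \<in> carrier (fspace (basis P \<times> basis P)). can_map P H p t = (\<lambda>_. 0)}"
    and "can_map P H p ` carrier (fspace (basis P \<times> basis P)) = carrier (fspace (basis P \<times> basis H))"
  shows "hopf_galois P H p"
proof -
  interpret linear_quotient "fspace (basis P \<times> basis P)" "balancing P H p" "can_map P H p"
    using assms(1) by unfold_locales (simp_all add: can_map_def)
  show ?thesis
    unfolding hopf_galois_def using bij_lift assms(2) lift_cls by (metis (no_types, lifting))
qed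

section \<open>Free left modules with a twisted right action\<close>

lemma free_calculus_simps [simp]:
  "carrier (free_calculus A L s \<delta>) = carrier (fspace (basis A \<times> L))"
  "lact (free_calculus A L s \<delta>) = free_lact A" "ract (free_calculus A L s \<delta>) = free_ract A L s"
  "diff (free_calculus A L s \<delta>) = \<delta>"
  by (simp_all add: free_calculus_def module.extend_def calculus.fields_def)

lemma fun_module_free_calculus [simp]: "fun_module (free_calculus A L s \<delta>)"
proof -
  have "fun_module (free_calculus A L s \<delta>) \<longleftrightarrow> lin_closed (carrier (fspace (basis A \<times> L)))"
    unfolding fun_module_def free_calculus_simps
    by (simp add: free_calculus_def module.extend_def calculus.fields_def fspace_def)
  then show ?thesis by simp
qed

lemma free_lact_linear:
  "free_lact A (\<lambda>b. x b + y b) w = (\<lambda>z. free_lact A x w z + free_lact A y w z)"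
  "free_lact A (\<lambda>b. c * x b) w = (\<lambda>z. c * free_lact A x w z)"
  "free_lact A x (\<lambda>b. v b + w b) = (\<lambda>z. free_lact A x v z + free_lact A x w z)"
  "free_lact A x (\<lambda>b. c * w b) = (\<lambda>z. c * free_lact A x w z)"
  by (simp_all add: free_lact_def alg_mult_linear fun_eq_iff)

lemma lext_linear:
  "lext B f (\<lambda>b. x b + y b) = (\<lambda>z. lext B f x z + lext B f y z)"
  "lext B f (\<lambda>b. c * x b) = (\<lambda>z. c * lext B f x z)"
  by (simp_all add: lext_def ring_distribs sum.distrib sum_distrib_left ac_simps)

lemma free_ract_linear:
  "free_ract A L s (\<lambda>b. v b + w b) x = (\<lambda>z. free_ract A L s v x z + free_ract A L s w x z)"
  "free_ract A L s (\<lambda>b. c * w b) x = (\<lambda>z. c * free_ract A L s w x z)"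
  "free_ract A L s w (\<lambda>b. x b + y b) = (\<lambda>z. free_ract A L s w x z + free_ract A L s w y z)"
  "free_ract A L s w (\<lambda>b. c * x b) = (\<lambda>z. c * free_ract A L s w x z)"
  unfolding free_ract_def lext_linear free_lact_linear
  by (simp_all add: lext_def case_prod_unfold ring_distribs sum.distrib sum_distrib_left ac_simps)

lemma free_lact_bvec:
  assumes "finite (basis A)" "a \<in> basis A"
  shows "free_lact A (bvec a) w (z, l) = (\<Sum>b\<in>basis A. w (b, l) * bmult A a b z)"
proof -
  have "free_lact A (bvec a) w (z, l)
    = (\<Sum>a'\<in>basis A. bvec a a' * (\<Sum>b\<in>basis A. w (b, l) * bmult A a' b z))"
    by (simp add: free_lact_def alg_mult sum_distrib_left mult.assoc)
  then show ?thesis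
    using assms by (simp add: bvec_def if_distrib[of "\<lambda>x. x * _"] cong: if_cong)
qed

text \<open>Right multiplication by x is multiplication of the row of slices of w by a matrix over
  A, whose (l, l') entry is the l' component of (1 tensor l) x. In this form it commutes with left
  multiplication by associativity of A.\<close>

lemma free_ract_eq:
  assumes "finite (basis A)" "finite L"
  shows "free_ract A L s w x (z, l')
    = (\<Sum>l\<in>L. ((\<lambda>b. w (b, l)) \<otimes>\<^bsub>alg A\<^esub> (\<lambda>b. lext (basis A) (s l) x (b, l'))) z)"
proof -
  have "free_ract A L s w x (z, l')
    = (\<Sum>a\<in>basis A. \<Sum>l\<in>L. w (a, l) * (\<Sum>b\<in>basis A. lext (basis A) (s l) x (b, l') * bmult A a b z))"
    unfolding free_ract_def lext_def[of "basis A \<times> L"] sum.cartesian_product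
    by (intro sum.cong refl) (auto simp: free_lact_bvec[OF assms(1)])
  also have "\<dots> = (\<Sum>l\<in>L. ((\<lambda>b. w (b, l)) \<otimes>\<^bsub>alg A\<^esub> (\<lambda>b. lext (basis A) (s l) x (b, l'))) z)"
    by (subst sum.swap) (simp add: alg_mult sum_distrib_left mult.assoc)
  finally show ?thesis .
qed

lemma alg_mult_sum:
  "(\<lambda>b. \<Sum>i\<in>I. f i b) \<otimes>\<^bsub>alg A\<^esub> y = (\<lambda>z. \<Sum>i\<in>I. (f i \<otimes>\<^bsub>alg A\<^esub> y) z)"
  "x \<otimes>\<^bsub>alg A\<^esub> (\<lambda>b. \<Sum>i\<in>I. f i b) = (\<lambda>z. \<Sum>i\<in>I. (x \<otimes>\<^bsub>alg A\<^esub> f i) z)"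
proof -
  have zero: "(\<lambda>_. 0) \<otimes>\<^bsub>alg A\<^esub> y = (\<lambda>_. 0)" "x \<otimes>\<^bsub>alg A\<^esub> (\<lambda>_. 0) = (\<lambda>_. 0)"
    by (simp_all add: alg_mult)
  show "(\<lambda>b. \<Sum>i\<in>I. f i b) \<otimes>\<^bsub>alg A\<^esub> y = (\<lambda>z. \<Sum>i\<in>I. (f i \<otimes>\<^bsub>alg A\<^esub> y) z)"
    by (induction I rule: infinite_finite_induct) (simp_all add: zero alg_mult_linear)
  show "x \<otimes>\<^bsub>alg A\<^esub> (\<lambda>b. \<Sum>i\<in>I. f i b) = (\<lambda>z. \<Sum>i\<in>I. (x \<otimes>\<^bsub>alg A\<^esub> f i) z)"
    by (induction I rule: infinite_finite_induct) (simp_all add: zero alg_mult_linear)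
qed

lemma complex_algebraD:
  assumes "complex_algebra A"
  shows "ring A" "x \<in> carrier A \<Longrightarrow> y \<in> carrier A \<Longrightarrow> x \<otimes>\<^bsub>A\<^esub> y \<in> carrier A" "\<one>\<^bsub>A\<^esub> \<in> carrier A"
    "x \<in> carrier A \<Longrightarrow> y \<in> carrier A \<Longrightarrow> z \<in> carrier A \<Longrightarrow> (x \<otimes>\<^bsub>A\<^esub> y) \<otimes>\<^bsub>A\<^esub> z = x \<otimes>\<^bsub>A\<^esub> (y \<otimes>\<^bsub>A\<^esub> z)"
    "x \<in> carrier A \<Longrightarrow> \<one>\<^bsub>A\<^esub> \<otimes>\<^bsub>A\<^esub> x = x" "x \<in> carrier A \<Longrightarrow> x \<otimes>\<^bsub>A\<^esub> \<one>\<^bsub>A\<^esub> = x"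
proof -
  interpret ring A using assms by (simp add: complex_algebra_def)
  show "ring A" "x \<in> carrier A \<Longrightarrow> y \<in> carrier A \<Longrightarrow> x \<otimes>\<^bsub>A\<^esub> y \<in> carrier A" "\<one>\<^bsub>A\<^esub> \<in> carrier A"
    "x \<in> carrier A \<Longrightarrow> y \<in> carrier A \<Longrightarrow> z \<in> carrier A \<Longrightarrow> (x \<otimes>\<^bsub>A\<^esub> y) \<otimes>\<^bsub>A\<^esub> z = x \<otimes>\<^bsub>A\<^esub> (y \<otimes>\<^bsub>A\<^esub> z)"
    "x \<in> carrier A \<Longrightarrow> \<one>\<^bsub>A\<^esub> \<otimes>\<^bsub>A\<^esub> x = x" "x \<in> carrier A \<Longrightarrow> x \<otimes>\<^bsub>A\<^esub> \<one>\<^bsub>A\<^esub> = x"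
    by (simp_all add: ring_axioms m_assoc)
qed

lemma slice_in_fspace: "w \<in> carrier (fspace (B \<times> L)) \<Longrightarrow> (\<lambda>b. w (b, l)) \<in> carrier (fspace B)"
  by (simp add: carrier_fspace)

text \<open>Only closure and the unit and product laws of the right action depend on the twist
  \<open>s\<close>. The compatibility of the two actions is a consequence,
  \<open>lact_ract\<close>.\<close>

locale free_bimodule =
  fixes A :: "('b, 'y) alg_data_scheme" and L :: "'l set" and s :: "'l \<Rightarrow> 'b \<Rightarrow> 'b \<times> 'l \<Rightarrow> complex"
  assumes alg: "complex_algebra (alg A)" and fin: "finite (basis A)" "finite L"
    and s_closed: "\<And>l b. l \<in> L \<Longrightarrow> b \<in> basis A \<Longrightarrow> s l b \<in> carrier (fspace (basis A \<times> L))"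
    and ract_one: "\<And>w. w \<in> carrier (fspace (basis A \<times> L)) \<Longrightarrow> free_ract A L s w \<one>\<^bsub>alg A\<^esub> = w"
    and ract_mult: "\<And>w x y. w \<in> carrier (fspace (basis A \<times> L)) \<Longrightarrow> x \<in> carrier (alg A)
      \<Longrightarrow> y \<in> carrier (alg A)
      \<Longrightarrow> free_ract A L s w (x \<otimes>\<^bsub>alg A\<^esub> y) = free_ract A L s (free_ract A L s w x) y"
begin

abbreviation "\<Omega>\<^sub>0 \<equiv> carrier (fspace (basis A \<times> L))"

lemma lact_closed:
  assumes "x \<in> carrier (alg A)" "w \<in> \<Omega>\<^sub>0"
  shows "free_lact A x w \<in> \<Omega>\<^sub>0"
proof -
  have "(x \<otimes>\<^bsub>alg A\<^esub> (\<lambda>b. w (b, l))) \<in> carrier (fspace (basis A))" for l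
    using complex_algebraD(2)[OF alg, of x "\<lambda>b. w (b, l)"] assms slice_in_fspace[of w]
    by (simp add: alg_ops)
  moreover have "(x \<otimes>\<^bsub>alg A\<^esub> (\<lambda>b. w (b, l))) z = 0" if "l \<notin> L" for l z
    using that assms(2) by (simp add: alg_mult carrier_fspace)
  ultimately show ?thesis
    by (auto simp: free_lact_def carrier_fspace)
qed

lemma ract_closed:
  assumes "x \<in> carrier (alg A)" "w \<in> \<Omega>\<^sub>0"
  shows "free_ract A L s w x \<in> \<Omega>\<^sub>0"
  unfolding free_ract_def using complex_algebraD(3)[OF alg]
  by (intro lext_in lin_closed_fspace)
    (auto intro!: lact_closed lext_in s_closed simp: alg_ops)

lemma lact_one: "w \<in> \<Omega>\<^sub>0 \<Longrightarrow> free_lact A \<one>\<^bsub>alg A\<^esub> w = w"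
  using complex_algebraD(5)[OF alg] slice_in_fspace[of w]
  by (auto simp: free_lact_def alg_ops fun_eq_iff)

lemma lact_mult:
  assumes "w \<in> \<Omega>\<^sub>0" "x \<in> carrier (alg A)" "y \<in> carrier (alg A)"
  shows "free_lact A (x \<otimes>\<^bsub>alg A\<^esub> y) w = free_lact A x (free_lact A y w)"
  using complex_algebraD(4)[OF alg] slice_in_fspace[OF assms(1)] assms(2,3)
  by (auto simp: free_lact_def alg_ops fun_eq_iff)

lemma lact_ract:
  assumes "w \<in> \<Omega>\<^sub>0" "x \<in> carrier (alg A)" "y \<in> carrier (alg A)"
  shows "free_ract A L s (free_lact A x w) y = free_lact A x (free_ract A L s w y)"
proof
  fix z :: "'b \<times> 'l"
  obtain b l' where z: "z = (b, l')" by (cases z)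
  have r: "(\<lambda>b. lext (basis A) (s l) y (b, l')) \<in> carrier (alg A)" if "l \<in> L" for l
    unfolding alg_ops(1) by (intro slice_in_fspace[of _ _ L] lext_in lin_closed_fspace s_closed that)
  have w: "(\<lambda>b. w (b, l)) \<in> carrier (alg A)" for l
    using slice_in_fspace[OF assms(1)] by (simp add: alg_ops)
  have "free_ract A L s (free_lact A x w) y z
      = (\<Sum>l\<in>L. ((x \<otimes>\<^bsub>alg A\<^esub> (\<lambda>b. w (b, l))) \<otimes>\<^bsub>alg A\<^esub> (\<lambda>b. lext (basis A) (s l) y (b, l'))) b)"
    by (simp add: z free_ract_eq[OF fin] free_lact_def)
  also have "\<dots> = (\<Sum>l\<in>L. (x \<otimes>\<^bsub>alg A\<^esub> ((\<lambda>b. w (b, l)) \<otimes>\<^bsub>alg A\<^esub> (\<lambda>b. lext (basis A) (s l) y (b, l')))) b)"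
    using complex_algebraD(4)[OF alg assms(2) w r] by simp
  also have "\<dots> = free_lact A x (free_ract A L s w y) z"
    by (simp add: z free_lact_def free_ract_eq[OF fin] alg_mult_sum)
  finally show "free_ract A L s (free_lact A x w) y z = free_lact A x (free_ract A L s w y) z" .
qed

text \<open>For an inner derivation the Leibniz rule is the telescoping identity theta xy - xy theta
  = (theta x - x theta) y + x (theta y - y theta). What has to be supplied is the spanning
  condition, and there it is enough to reach the basis forms.\<close>

lemma fo_calculus_inner:
  assumes \<theta>: "\<theta> \<in> \<Omega>\<^sub>0"
    and diff: "\<And>x. x \<in> carrier (alg A) \<Longrightarrow> \<delta> x = (\<lambda>z. free_ract A L s \<theta> x z - free_lact A x \<theta> z)"
    and span: "\<And>b l. b \<in> basis A \<Longrightarrow> l \<in> L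
      \<Longrightarrow> bvec (b, l) \<in> fspan {free_lact A x (\<delta> y) | x y. x \<in> carrier (alg A) \<and> y \<in> carrier (alg A)}"
  shows "fo_calculus (alg A) (free_calculus A L s \<delta>)"
proof -
  let ?X = "{free_lact A x (\<delta> y) | x y. x \<in> carrier (alg A) \<and> y \<in> carrier (alg A)}"
  have closed: "\<delta> x \<in> \<Omega>\<^sub>0" if "x \<in> carrier (alg A)" for x
    using that \<theta> by (simp add: diff lin_closed_diff lact_closed ract_closed)
  have "?X \<subseteq> \<Omega>\<^sub>0"
    using closed lact_closed by blast
  moreover have "\<Omega>\<^sub>0 \<subseteq> fspan ?X"
    unfolding fspan_bvec[symmetric, OF finite_cartesian_product[OF fin]]
    by (rule fspan_minimal) (auto intro!: span)
  ultimately have "lin_span (free_calculus A L s \<delta>) ?X = \<Omega>\<^sub>0"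
    using fspan_minimal[of \<Omega>\<^sub>0 ?X] by (subst lin_span_eq_fspan) auto
  moreover have "\<delta> (\<lambda>b. x b + y b) = (\<lambda>z. \<delta> x z + \<delta> y z)" "\<delta> (\<lambda>b. c * x b) = (\<lambda>z. c * \<delta> x z)"
    if "x \<in> carrier (alg A)" "y \<in> carrier (alg A)" for x y c
    using that
    by (simp_all add: diff alg_ops(1) lin_closedD[OF lin_closed_fspace] free_ract_linear free_lact_linear
        fun_eq_iff algebra_simps)
  moreover have "\<delta> (x \<otimes>\<^bsub>alg A\<^esub> y) = (\<lambda>z. free_ract A L s (\<delta> x) y z + free_lact A x (\<delta> y) z)"
    if x: "x \<in> carrier (alg A)" and y: "y \<in> carrier (alg A)" for x y
  proof -
    have "free_ract A L s (\<delta> x) y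
        = (\<lambda>z. free_ract A L s (free_ract A L s \<theta> x) y z - free_ract A L s (free_lact A x \<theta>) y z)"
      unfolding diff[OF x]
      by (rule flinear_diff[OF _ lin_closed_fspace])
        (use x y \<theta> ract_closed lact_closed in \<open>auto simp: flinear_def free_ract_linear\<close>)
    moreover have "free_lact A x (\<delta> y)
        = (\<lambda>z. free_lact A x (free_ract A L s \<theta> y) z - free_lact A x (free_lact A y \<theta>) z)"
      unfolding diff[OF y]
      by (rule flinear_diff[OF _ lin_closed_fspace])
        (use x y \<theta> ract_closed lact_closed in \<open>auto simp: flinear_def free_lact_linear\<close>)
    ultimately show ?thesis
      using x y \<theta> complex_algebraD(2)[OF alg x y]
      by (simp add: diff ract_mult lact_mult lact_ract)
  qed
  ultimately show ?thesis
    unfolding fo_calculus_def lin_map_fun_module[OF fun_module_free_calculus fun_module_free_calculus]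
      lin_map_fun_module[OF fun_module_alg fun_module_free_calculus]
    using closed
    by (simp add: module_fun_module flinear_def free_lact_linear free_ract_linear lact_closed ract_closed
      lact_one ract_one lact_mult ract_mult lact_ract fun_module_ops(2)[OF fun_module_free_calculus])
qed

end

section \<open>Restriction and transport of calculi\<close>

lemma fo_calculusD:
  assumes calc: "fo_calculus (alg P) \<Omega>" and \<Omega>: "fun_module \<Omega>"
  shows "\<And>a. a \<in> carrier (alg P) \<Longrightarrow> flinear (carrier \<Omega>) (lact \<Omega> a)"
    "\<And>a. a \<in> carrier (alg P) \<Longrightarrow> flinear (carrier \<Omega>) (\<lambda>w. ract \<Omega> w a)"
    "\<And>w. w \<in> carrier \<Omega> \<Longrightarrow> flinear (carrier (alg P)) (\<lambda>a. lact \<Omega> a w)"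
    "\<And>w. w \<in> carrier \<Omega> \<Longrightarrow> flinear (carrier (alg P)) (ract \<Omega> w)"
    "flinear (carrier (alg P)) (diff \<Omega>)"
    "\<And>a w. a \<in> carrier (alg P) \<Longrightarrow> w \<in> carrier \<Omega> \<Longrightarrow> lact \<Omega> a w \<in> carrier \<Omega>"
    "\<And>a w. a \<in> carrier (alg P) \<Longrightarrow> w \<in> carrier \<Omega> \<Longrightarrow> ract \<Omega> w a \<in> carrier \<Omega>"
    "\<And>a. a \<in> carrier (alg P) \<Longrightarrow> diff \<Omega> a \<in> carrier \<Omega>"
    "\<And>w. w \<in> carrier \<Omega> \<Longrightarrow> lact \<Omega> \<one>\<^bsub>alg P\<^esub> w = w"
    "\<And>w. w \<in> carrier \<Omega> \<Longrightarrow> ract \<Omega> w \<one>\<^bsub>alg P\<^esub> = w"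
    "\<And>a b w. a \<in> carrier (alg P) \<Longrightarrow> b \<in> carrier (alg P) \<Longrightarrow> w \<in> carrier \<Omega>
      \<Longrightarrow> lact \<Omega> (a \<otimes>\<^bsub>alg P\<^esub> b) w = lact \<Omega> a (lact \<Omega> b w)"
    "\<And>a b w. a \<in> carrier (alg P) \<Longrightarrow> b \<in> carrier (alg P) \<Longrightarrow> w \<in> carrier \<Omega>
      \<Longrightarrow> ract \<Omega> w (a \<otimes>\<^bsub>alg P\<^esub> b) = ract \<Omega> (ract \<Omega> w a) b"
    "\<And>a b w. a \<in> carrier (alg P) \<Longrightarrow> b \<in> carrier (alg P) \<Longrightarrow> w \<in> carrier \<Omega>
      \<Longrightarrow> ract \<Omega> (lact \<Omega> a w) b = lact \<Omega> a (ract \<Omega> w b)"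
    "\<And>a b. a \<in> carrier (alg P) \<Longrightarrow> b \<in> carrier (alg P)
      \<Longrightarrow> diff \<Omega> (a \<otimes>\<^bsub>alg P\<^esub> b) = (\<lambda>z. ract \<Omega> (diff \<Omega> a) b z + lact \<Omega> a (diff \<Omega> b) z)"
  using calc unfolding fo_calculus_def lin_map_fun_module[OF \<Omega> \<Omega>] lin_map_fun_module[OF fun_module_alg \<Omega>]
    fun_module_ops(2)[OF \<Omega>] Pi_iff
  by blast+

text \<open>The point that is not formal is the stability of A dA under right multiplication. It
  comes from the Leibniz rule in the form (db) a = d(ba) - b da.\<close>

lemma fo_calculus_restrict:
  assumes calc: "fo_calculus (alg P) \<Omega>" and \<Omega>: "fun_module \<Omega>" and A: "A \<subseteq> carrier (alg P)" "lin_closed A"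
    and one: "\<one>\<^bsub>alg P\<^esub> \<in> A" and mult: "\<And>x y. x \<in> A \<Longrightarrow> y \<in> A \<Longrightarrow> x \<otimes>\<^bsub>alg P\<^esub> y \<in> A"
  shows "fo_calculus ((alg P)\<lparr>carrier := A\<rparr>)
    (\<Omega>\<lparr>carrier := lin_span \<Omega> {lact \<Omega> a (diff \<Omega> b) | a b. a \<in> A \<and> b \<in> A}\<rparr>)"
proof -
  let ?X = "{lact \<Omega> a (diff \<Omega> b) | a b. a \<in> A \<and> b \<in> A}"
  note c = fo_calculusD[OF calc \<Omega>]
  note A' = subsetD[OF A(1)]
  note lin = fun_module_ops(4)[OF \<Omega>]
  have X: "?X \<subseteq> carrier \<Omega>"
    using c(6,8) A' by blast
  note span = lin_span_eq_fspan[OF \<Omega> X]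
  have sub: "fspan ?X \<subseteq> carrier \<Omega>"
    by (rule fspan_minimal[OF lin X])
  have lact: "lact \<Omega> a w \<in> fspan ?X" if a: "a \<in> A" and "w \<in> fspan ?X" for a w
  proof -
    have "fspan ?X \<subseteq> {w \<in> carrier \<Omega>. lact \<Omega> a w \<in> fspan ?X}"
    proof (rule fspan_minimal[OF lin_closed_kernel[OF lin c(1)[OF A'[OF a]] lin_closed_fspan]])
      have "lact \<Omega> a (lact \<Omega> b (diff \<Omega> b')) \<in> fspan ?X" if "b \<in> A" "b' \<in> A" for b b'
        using that a A' mult[OF a, of b] c(8)
        by (intro fspan_base CollectI exI[of _ "a \<otimes>\<^bsub>alg P\<^esub> b"] exI[of _ b'] conjI) (simp_all add: c(11))
      then show "?X \<subseteq> {w \<in> carrier \<Omega>. lact \<Omega> a w \<in> fspan ?X}"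
        using X by blast
    qed
    with that show ?thesis by blast
  qed
  have ract: "ract \<Omega> w a \<in> fspan ?X" if a: "a \<in> A" and "w \<in> fspan ?X" for a w
  proof -
    have "fspan ?X \<subseteq> {w \<in> carrier \<Omega>. ract \<Omega> w a \<in> fspan ?X}"
    proof (rule fspan_minimal[OF lin_closed_kernel[OF lin c(2)[OF A'[OF a]] lin_closed_fspan]])
      have "ract \<Omega> (lact \<Omega> b (diff \<Omega> b')) a \<in> fspan ?X" if b: "b \<in> A" and b': "b' \<in> A" for b b'
      proof -
        note [simp] = A'[OF a] A'[OF b] A'[OF b']
        have "ract \<Omega> (diff \<Omega> b') a = (\<lambda>z. diff \<Omega> (b' \<otimes>\<^bsub>alg P\<^esub> a) z - lact \<Omega> b' (diff \<Omega> a) z)"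
          by (simp add: c(14))
        then have "ract \<Omega> (lact \<Omega> b (diff \<Omega> b')) a
            = lact \<Omega> b (\<lambda>z. diff \<Omega> (b' \<otimes>\<^bsub>alg P\<^esub> a) z - lact \<Omega> b' (diff \<Omega> a) z)"
          by (simp add: c(8,13))
        also have "\<dots> = (\<lambda>z. lact \<Omega> b (diff \<Omega> (b' \<otimes>\<^bsub>alg P\<^esub> a)) z - lact \<Omega> b (lact \<Omega> b' (diff \<Omega> a)) z)"
          by (rule flinear_diff[OF c(1) lin]) (simp_all add: c(6,8) A'[OF mult[OF b' a]])
        also have "\<dots> \<in> fspan ?X"
        proof (rule lin_closed_diff[OF lin_closed_fspan])
          show "lact \<Omega> b (diff \<Omega> (b' \<otimes>\<^bsub>alg P\<^esub> a)) \<in> fspan ?X"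
            by (intro fspan_base) (use b mult[OF b' a] in blast)
          show "lact \<Omega> b (lact \<Omega> b' (diff \<Omega> a)) \<in> fspan ?X"
            by (intro lact b fspan_base) (use b' a in blast)
        qed
        finally show ?thesis .
      qed
      then show "?X \<subseteq> {w \<in> carrier \<Omega>. ract \<Omega> w a \<in> fspan ?X}"
        using X by blast
    qed
    with that show ?thesis by blast
  qed
  \<comment> \<open>The unit lies in A, so da = 1 da is one of the generators.\<close>
  have diff: "diff \<Omega> a \<in> fspan ?X" if "a \<in> A" for a
    using that one c(8,9) A' by (intro fspan_base) force
  have M: "fun_module (\<Omega>\<lparr>carrier := fspan ?X\<rparr>)" "fun_module ((alg P)\<lparr>carrier := A\<rparr>)"
    by (simp_all add: fun_module_carrier_update \<Omega> A(2))
  have "lin_span (\<Omega>\<lparr>carrier := fspan ?X\<rparr>) ?X = fspan ?X"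
    by (rule lin_span_eq_fspan[OF M(1)]) (simp add: fspan_superset)
  moreover have fl: "flinear (fspan ?X) f" if "flinear (carrier \<Omega>) f" for f
    :: "('b \<Rightarrow> complex) \<Rightarrow> 'b \<Rightarrow> complex"
    using flinear_subset[OF that sub] .
  moreover have flA: "flinear A f" if "flinear (carrier (alg P)) f" for f :: "('a \<Rightarrow> complex) \<Rightarrow> 'b \<Rightarrow> complex"
    using flinear_subset[OF that A(1)] .
  moreover note subsetD[OF sub]
  ultimately show ?thesis
    unfolding span fo_calculus_def lin_map_fun_module[OF M(1) M(1)] lin_map_fun_module[OF M(2) M(1)]
      fun_module_ops(2)[OF M(1)]
    using A' by (simp add: module_fun_module[OF M(1)] c lact ract diff)
qed

text \<open>\<open>\<Omega>\<close> may consist of cosets. Its module and calculus axioms are not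
  assumed: given closure of the carrier and compatibility of the bijection \<open>\<Psi>\<close>
  with all operations, each axiom is an equation that can be checked after applying
  \<open>\<Psi>\<close>, in a calculus of functions.\<close>

locale calculus_transport =
  fixes A :: "('b, 'y) alg_data_scheme" and \<Omega> :: "('b \<Rightarrow> complex, 'm, 'v) calculus_scheme"
    and \<Xi> :: "('b \<Rightarrow> complex, 'c \<Rightarrow> complex, 'w) calculus_scheme" and \<Psi> :: "'m \<Rightarrow> 'c \<Rightarrow> complex"
  assumes alg: "complex_algebra (alg A)" and calc: "fo_calculus (alg A) \<Xi>" and \<Xi>: "fun_module \<Xi>"
    and iso: "lin_iso \<Omega> \<Xi> \<Psi>"
    and closed: "\<And>u v. u \<in> carrier \<Omega> \<Longrightarrow> v \<in> carrier \<Omega> \<Longrightarrow> u \<oplus>\<^bsub>\<Omega>\<^esub> v \<in> carrier \<Omega>"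
      "\<And>c u. u \<in> carrier \<Omega> \<Longrightarrow> c \<odot>\<^bsub>\<Omega>\<^esub> u \<in> carrier \<Omega>" "\<zero>\<^bsub>\<Omega>\<^esub> \<in> carrier \<Omega>"
    and zero: "\<Psi> \<zero>\<^bsub>\<Omega>\<^esub> = (\<lambda>_. 0)"
    and lact: "\<And>a u. a \<in> carrier (alg A) \<Longrightarrow> u \<in> carrier \<Omega> \<Longrightarrow> lact \<Omega> a u \<in> carrier \<Omega>"
      "\<And>a u. a \<in> carrier (alg A) \<Longrightarrow> u \<in> carrier \<Omega> \<Longrightarrow> \<Psi> (lact \<Omega> a u) = lact \<Xi> a (\<Psi> u)"
    and ract: "\<And>a u. a \<in> carrier (alg A) \<Longrightarrow> u \<in> carrier \<Omega> \<Longrightarrow> ract \<Omega> u a \<in> carrier \<Omega>"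
      "\<And>a u. a \<in> carrier (alg A) \<Longrightarrow> u \<in> carrier \<Omega> \<Longrightarrow> \<Psi> (ract \<Omega> u a) = ract \<Xi> (\<Psi> u) a"
    and diff: "\<And>a. a \<in> carrier (alg A) \<Longrightarrow> diff \<Omega> a \<in> carrier \<Omega>"
      "\<And>a. a \<in> carrier (alg A) \<Longrightarrow> \<Psi> (diff \<Omega> a) = diff \<Xi> a"
begin

lemma bij: "bij_betw \<Psi> (carrier \<Omega>) (carrier \<Xi>)"
  using iso by (simp add: lin_iso_def)

lemma inj: "u \<in> carrier \<Omega> \<Longrightarrow> v \<in> carrier \<Omega> \<Longrightarrow> \<Psi> u = \<Psi> v \<Longrightarrow> u = v"
  using bij by (auto simp: bij_betw_def inj_on_def)

lemma into: "u \<in> carrier \<Omega> \<Longrightarrow> \<Psi> u \<in> carrier \<Xi>"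
  using bij by (auto simp: bij_betw_def)

lemma hom:
  "u \<in> carrier \<Omega> \<Longrightarrow> v \<in> carrier \<Omega> \<Longrightarrow> \<Psi> (u \<oplus>\<^bsub>\<Omega>\<^esub> v) = (\<lambda>z. \<Psi> u z + \<Psi> v z)"
  "u \<in> carrier \<Omega> \<Longrightarrow> \<Psi> (c \<odot>\<^bsub>\<Omega>\<^esub> u) = (\<lambda>z. c * \<Psi> u z)"
  using iso by (simp_all add: lin_iso_def lin_map_def fun_module_ops[OF \<Xi>])

lemma alg_closed:
  "x \<in> carrier (alg A) \<Longrightarrow> y \<in> carrier (alg A) \<Longrightarrow> (\<lambda>b. x b + y b) \<in> carrier (alg A)"
  "x \<in> carrier (alg A) \<Longrightarrow> (\<lambda>b. c * x b) \<in> carrier (alg A)"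
  by (simp_all add: alg_ops lin_closedD[OF lin_closed_fspace])

lemma abelian_group: "abelian_group \<Omega>"
proof (rule abelian_groupI)
  fix x assume "x \<in> carrier \<Omega>"
  then show "\<exists>y\<in>carrier \<Omega>. y \<oplus>\<^bsub>\<Omega>\<^esub> x = \<zero>\<^bsub>\<Omega>\<^esub>"
    by (intro bexI[of _ "- 1 \<odot>\<^bsub>\<Omega>\<^esub> x"] inj) (simp_all add: closed hom zero)
qed (auto intro!: inj simp: closed hom zero add.assoc add.commute)

lemma module: "module complex_ring \<Omega>"
  by (intro moduleI cring_complex_ring abelian_group)
    (auto intro!: inj simp: closed hom algebra_simps)

lemma finsum_hom:
  assumes "\<And>i. i \<in> I \<Longrightarrow> f i \<in> carrier \<Omega>"
  shows "\<Psi> (\<Oplus>\<^bsub>\<Omega>\<^esub>i\<in>I. f i) = (\<lambda>z. \<Sum>i\<in>I. \<Psi> (f i) z)"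
proof -
  interpret abelian_group \<Omega> by (rule abelian_group)
  show ?thesis
    using assms
    by (induction I rule: infinite_finite_induct)
      (auto simp: finsum_infinite zero hom finsum_insert Pi_def intro!: finsum_closed)
qed

text \<open>Needed for the spanning condition: it quantifies over submodules of
  \<open>\<Omega>\<close>, whereas spans are accessible on the side of functions.\<close>

lemma lin_closed_image_submodule:
  assumes "submodule N complex_ring \<Omega>"
  shows "lin_closed (\<Psi> ` N)"
proof -
  interpret module complex_ring \<Omega> by (rule module)
  note N = submoduleE[OF assms]
  have \<zero>: "\<zero>\<^bsub>\<Omega>\<^esub> \<in> N"
  proof -
    obtain u where u: "u \<in> N" "u \<in> carrier \<Omega>"
      using N(1,2) by blast
    have "0 \<odot>\<^bsub>\<Omega>\<^esub> u = \<zero>\<^bsub>\<Omega>\<^esub>"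
      using u by (intro inj) (simp_all add: closed hom zero)
    then show ?thesis
      using N(4)[of 0 u] u by simp
  qed
  show ?thesis
  proof (rule lin_closedI)
    show "(\<lambda>_. 0) \<in> \<Psi> ` N"
      using \<zero> zero by (metis imageI)
  next
    fix x y assume "x \<in> \<Psi> ` N" "y \<in> \<Psi> ` N"
    then obtain u v where "u \<in> N" "v \<in> N" "x = \<Psi> u" "y = \<Psi> v" by blast
    then show "(\<lambda>b. x b + y b) \<in> \<Psi> ` N"
      using N(1) by (intro image_eqI[of _ _ "u \<oplus>\<^bsub>\<Omega>\<^esub> v"] N(5)) (auto simp: hom subset_iff)
  next
    fix c x assume "x \<in> \<Psi> ` N"
    then obtain u where "u \<in> N" "x = \<Psi> u" by blast
    then show "(\<lambda>b. c * x b) \<in> \<Psi> ` N"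
      using N(1) by (intro image_eqI[of _ _ "c \<odot>\<^bsub>\<Omega>\<^esub> u"] N(4)) (auto simp: hom subset_iff)
  qed
qed

lemma fo_calculus: "fo_calculus (alg A) \<Omega>"
proof -
  note c = fo_calculusD[OF calc \<Xi>]
  note simps = flinearD[OF c(1)] flinearD[OF c(2)] flinearD[OF c(3)] flinearD[OF c(4)] flinearD[OF c(5)]
    c(9-14) into alg_ops(3,5) alg_closed lact ract diff closed hom complex_algebraD(2,3)[OF alg]
  let ?X = "{lact \<Omega> a (diff \<Omega> b) | a b. a \<in> carrier (alg A) \<and> b \<in> carrier (alg A)}"
  let ?Y = "{lact \<Xi> a (diff \<Xi> b) | a b. a \<in> carrier (alg A) \<and> b \<in> carrier (alg A)}"
  have X: "?X \<subseteq> carrier \<Omega>"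
    using lact(1) diff(1) by blast
  have "?Y \<subseteq> carrier \<Xi>"
    using c(6,8) by blast
  then have Y: "carrier \<Xi> = fspan ?Y"
    using calc by (simp add: fo_calculus_def lin_span_eq_fspan[OF \<Xi>])
  \<comment> \<open>If a submodule contains all a db, its image contains the generators of
    \<open>\<Xi>\<close>, hence all of \<open>\<Xi>\<close>; injectivity of \<open>\<Psi>\<close>
    carries this back.\<close>
  have "carrier \<Omega> \<subseteq> N" if N: "submodule N complex_ring \<Omega>" "?X \<subseteq> N" for N
  proof
    fix u assume u: "u \<in> carrier \<Omega>"
    have "lact \<Xi> a (diff \<Xi> b) \<in> \<Psi> ` N" if "a \<in> carrier (alg A)" "b \<in> carrier (alg A)" for a b
      using that N(2) diff lact(2)[of a "diff \<Omega> b"] by (intro image_eqI[of _ _ "lact \<Omega> a (diff \<Omega> b)"]) auto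
    then have "carrier \<Xi> \<subseteq> \<Psi> ` N"
      unfolding Y by (intro fspan_minimal lin_closed_image_submodule N(1)) blast
    then obtain v where "v \<in> N" "\<Psi> u = \<Psi> v"
      using into[OF u] by blast
    moreover have "N \<subseteq> carrier \<Omega>"
      using module.submoduleE(1)[OF module N(1)] .
    ultimately show "u \<in> N"
      using inj u by blast
  qed
  then have span: "carrier \<Omega> = lin_span \<Omega> ?X"
    unfolding lin_span_def using module.carrier_is_submodule[OF module] X by blast
  show ?thesis
    unfolding fo_calculus_def lin_map_def
    by (intro conjI ballI allI Pi_I module span; (simp add: simps; fail | (rule inj; simp add: simps; fail)))
qed

lemma calculus_iso: "calculus_iso (alg A) \<Omega> (alg A) \<Xi> (\<lambda>x. x) \<Psi>"
  using iso by (auto simp: calculus_iso_def algebra_iso_def ring_iso_def Ring.ring_hom_def lin_map_def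
      lact ract diff bij_betw_def)

end

text \<open>The codiagonal coactions live on the tensor square of H and do not involve the calculus.
  Hence only the vanishing of \<open>form_of\<close> has to be compared, and \<open>\<Psi>\<close>
  carries one form to the other.\<close>

lemma bicovariant_calculus_transport:
  assumes "calculus_transport H \<Omega> \<Xi> \<Psi>" "bicovariant_calculus H \<Xi>"
  shows "bicovariant_calculus H \<Omega>"
proof -
  interpret calculus_transport H \<Omega> \<Xi> \<Psi> by (rule assms(1))
  note c = fo_calculusD[OF calc \<Xi>]
  have form: "form_of H \<Omega> t = \<zero>\<^bsub>\<Omega>\<^esub> \<longleftrightarrow> form_of H \<Xi> t = \<zero>\<^bsub>\<Xi>\<^esub>" for t
  proof -
    have b: "bvec (fst u) \<in> carrier (alg H)" "bvec (snd u) \<in> carrier (alg H)" if "u \<in> basis H \<times> basis H" for u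
      using that by (auto simp: alg_ops)
    have "\<Psi> (form_of H \<Omega> t) = (\<lambda>z. \<Sum>u\<in>basis H \<times> basis H.
        \<Psi> (t u \<odot>\<^bsub>\<Omega>\<^esub> lact \<Omega> (bvec (fst u)) (diff \<Omega> (bvec (snd u)))) z)"
      unfolding form_of_def by (intro finsum_hom closed(2) lact(1) diff(1) b)
    also have "\<dots> = (\<lambda>z. \<Sum>u\<in>basis H \<times> basis H.
        (t u \<odot>\<^bsub>\<Xi>\<^esub> lact \<Xi> (bvec (fst u)) (diff \<Xi> (bvec (snd u)))) z)"
      by (intro ext sum.cong refl) (simp add: lact diff hom b fun_module_ops[OF \<Xi>])
    also have "\<dots> = form_of H \<Xi> t"
      unfolding form_of_def using b
      by (intro finsum_fun_module[OF \<Xi>, symmetric])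
        (simp add: c(6,8) lin_closedD[OF fun_module_ops(4)[OF \<Xi>]] fun_module_ops(3)[OF \<Xi>])
    finally have "\<Psi> (form_of H \<Omega> t) = form_of H \<Xi> t" .
    moreover have "form_of H \<Omega> t \<in> carrier \<Omega>"
      unfolding form_of_def using b
      by (intro abelian_monoid.finsum_closed abelian_group.axioms(1) abelian_group)
        (auto simp: lact diff closed)
    ultimately show ?thesis
      using inj[of "form_of H \<Omega> t" "\<zero>\<^bsub>\<Omega>\<^esub>"] zero by (auto simp: closed fun_module_ops[OF \<Xi>])
  qed
  show ?thesis
    using assms(2) fo_calculus by (simp add: bicovariant_calculus_def form)
qed

section \<open>The Hopf algebras of a finite group\<close>

text \<open>Linear maps are determined on the basis, so a tensor product of maps acts on one
  variable at a time. Coassociativity and the compatibility of coproducts with maps thereby become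
  substitutions in explicit functions.\<close>

lemma tmap_eq:
  assumes B: "finite B" and C: "finite C" and X: "X \<in> carrier (fspace (B \<times> C))"
    and f: "flinear (carrier (fspace B)) f" and g: "flinear (carrier (fspace C)) g"
  shows "tmap B C f g X (z, w) = f (\<lambda>b. g (\<lambda>c. X (b, c)) w) z"
proof -
  have g0: "g (\<lambda>c. X (b, c)) w = (\<Sum>c\<in>C. X (b, c) * g (bvec c) w)" for b
  proof -
    have "(\<lambda>c. X (b, c)) \<in> carrier (fspace C)"
      using X by (simp add: carrier_fspace)
    from fspace_expand[OF C this]
    have "g (\<lambda>c. X (b, c)) w = g (\<lambda>c'. \<Sum>c\<in>C. X (b, c) * bvec c c') w"
      by simp
    also have "\<dots> = (\<Sum>c\<in>C. X (b, c) * g (bvec c) w)"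
      by (subst flinear_lin_comb[OF g lin_closed_fspace]) auto
    finally show ?thesis .
  qed
  define y where "y = (\<lambda>b. g (\<lambda>c. X (b, c)) w)"
  have y: "y \<in> carrier (fspace B)"
    using X by (simp add: y_def g0 carrier_fspace)
  have "f y z = f (\<lambda>b'. \<Sum>b\<in>B. y b * bvec b b') z"
    using fspace_expand[OF B y] by simp
  also have "\<dots> = (\<Sum>b\<in>B. y b * f (bvec b) z)"
    by (subst flinear_lin_comb[OF f lin_closed_fspace]) auto
  also have "\<dots> = tmap B C f g X (z, w)"
    by (simp add: y_def g0 tmap_def lext_def tprod_def case_prod_unfold sum_distrib_left sum_distrib_right
        ac_simps sum.cartesian_product)
  finally show ?thesis
    by (simp add: y_def)
qed

lemma sum_delta_eq:
  fixes f :: "'a \<Rightarrow> 'b::comm_monoid_add"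
  assumes "finite A" "a \<in> A" "\<And>x. x \<in> A \<Longrightarrow> P x \<longleftrightarrow> x = a"
  shows "(\<Sum>x\<in>A. if P x then f x else 0) = f a"
proof -
  have "(\<Sum>x\<in>A. if P x then f x else 0) = (\<Sum>x\<in>A. if x = a then f x else 0)"
    using assms(3) by (intro sum.cong) auto
  then show ?thesis
    using assms(1,2) by simp
qed

lemma tensor_alg_simps [simp]:
  "basis (tensor_alg A B) = basis A \<times> basis B" "bunit (tensor_alg A B) = tprod (bunit A) (bunit B)"
  "bmult (tensor_alg A B) u v z = bmult A (fst u) (fst v) (fst z) * bmult B (snd u) (snd v) (snd z)"
  by (auto simp: tensor_alg_def tprod_def case_prod_unfold)

lemma tensor_alg_mult:
  "(X \<otimes>\<^bsub>alg (tensor_alg A B)\<^esub> Y) (z, z') = (\<Sum>u\<in>basis A. \<Sum>v\<in>basis A.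
     (\<Sum>u'\<in>basis B. \<Sum>v'\<in>basis B. X (u, u') * Y (v, v') * bmult B u' v' z') * bmult A u v z)"
proof -
  have "(X \<otimes>\<^bsub>alg (tensor_alg A B)\<^esub> Y) (z, z') = (\<Sum>u\<in>basis A. \<Sum>u'\<in>basis B. \<Sum>v\<in>basis A. \<Sum>v'\<in>basis B.
     X (u, u') * Y (v, v') * (bmult A u v z * bmult B u' v' z'))"
    by (simp add: alg_mult sum.cartesian_product')
  also have "\<dots> = (\<Sum>u\<in>basis A. \<Sum>v\<in>basis A. \<Sum>u'\<in>basis B. \<Sum>v'\<in>basis B.
     X (u, u') * Y (v, v') * (bmult A u v z * bmult B u' v' z'))"
    by (intro sum.cong refl sum.swap)
  finally show ?thesis
    by (simp add: sum_distrib_left ac_simps)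
qed

locale finite_group = group +
  assumes finite_carrier [simp]: "finite (carrier G)"
begin

lemma cancel [simp]:
  assumes "x \<in> carrier G" "y \<in> carrier G"
  shows "x \<otimes> (inv x \<otimes> y) = y" "inv x \<otimes> (x \<otimes> y) = y"
  using assms by (simp_all flip: m_assoc)

lemmas word_simps = m_assoc inv_mult_group

lemma eq_mult_iff:
  assumes "x \<in> carrier G" "y \<in> carrier G" "z \<in> carrier G"
  shows "z = x \<otimes> y \<longleftrightarrow> y = inv x \<otimes> z" "z = x \<otimes> y \<longleftrightarrow> x = z \<otimes> inv y"
  using assms by (auto simp: word_simps)

lemma inv_mult_eq_one_iff:
  assumes "x \<in> carrier G" "y \<in> carrier G"
  shows "inv x \<otimes> y = \<one> \<longleftrightarrow> x = y"
  using assms by (metis cancel(1) l_inv r_one)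

lemma sum_mult_left:
  assumes "x \<in> carrier G"
  shows "(\<Sum>k\<in>carrier G. f (x \<otimes> k)) = (\<Sum>k\<in>carrier G. f k)"
  using assms by (intro sum.reindex_bij_witness[of _ "\<lambda>k. inv x \<otimes> k" "\<lambda>k. x \<otimes> k"]) auto

lemma sum_inv: "(\<Sum>k\<in>carrier G. f (inv k)) = (\<Sum>k\<in>carrier G. f k)"
  by (intro sum.reindex_bij_witness[of _ "\<lambda>k. inv k" "\<lambda>k. inv k"]) auto

lemma gconj_closed [simp]: "x \<in> carrier G \<Longrightarrow> y \<in> carrier G \<Longrightarrow> gconj G x y \<in> carrier G"
  by (simp add: gconj_def)

lemma gconj_inv [simp]:
  assumes "x \<in> carrier G" "y \<in> carrier G"
  shows "gconj G (inv x) (gconj G x y) = y" "gconj G x (gconj G (inv x) y) = y"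
  using assms by (simp_all add: gconj_def word_simps)

lemma gconj_eq_iff:
  assumes "x \<in> carrier G" "y \<in> carrier G" "z \<in> carrier G"
  shows "z = gconj G x y \<longleftrightarrow> y = gconj G (inv x) z"
  using assms by auto

lemma sum_gconj:
  assumes "x \<in> carrier G"
  shows "(\<Sum>k\<in>carrier G. f (gconj G x k)) = (\<Sum>k\<in>carrier G. f k)"
  using assms by (intro sum.reindex_bij_witness[of _ "gconj G (inv x)" "gconj G x"]) auto

section \<open>Explicit structure maps of the two Hopf algebras\<close>

abbreviation "P \<equiv> dvee G"
abbreviation "H \<equiv> fun_hopf G"
abbreviation "p \<equiv> dvee_proj G"

lemma hopf_simps [simp]:
  "basis (fun_hopf G) = carrier G" "basis (group_hopf G) = carrier G" "basis (dvee G) = carrier G \<times> carrier G"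
  "bunit (fun_hopf G) = (\<lambda>g. if g \<in> carrier G then 1 else 0)" "bunit (group_hopf G) = bvec \<one>"
  "bunit (dvee G) = (\<lambda>(g, h). if g \<in> carrier G \<and> h = \<one> then 1 else 0)"
  "bcounit (fun_hopf G) g = (if g = \<one> then 1 else 0)" "bcounit (group_hopf G) g = 1"
  "bcounit (dvee G) u = (if fst u = \<one> then 1 else 0)"
  "bantipode (fun_hopf G) g = bvec (inv g)"
  "bantipode (dvee G) u = bvec (inv (fst u), gconj G (fst u) (inv (snd u)))"
  by (auto simp: fun_hopf_def group_hopf_def dvee_def tensor_alg_def tprod_def bvec_def case_prod_unfold
      fun_eq_iff)

lemma finite_basis_dvee: "finite (basis P)"
  by simp

text \<open>The product is pointwise in the first coordinate and convolution in the second. The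
  weight \<open>F\<close> is left arbitrary because the same double sum occurs in products on tensor
  algebras and in the codiagonal coactions.\<close>

lemma dvee_bmult_sum:
  "(\<Sum>u\<in>basis P. \<Sum>v\<in>basis P. F u v * bmult P u v z)
    = (if z \<in> carrier G \<times> carrier G then \<Sum>k\<in>carrier G. F (fst z, k) (fst z, inv k \<otimes> snd z) else 0)"
proof -
  obtain g h where z: "z = (g, h)" by (cases z)
  have bm: "bmult P (a, k) (b, l) (g, h) = (if b = a \<and> g = a \<and> h = k \<otimes> l then 1 else 0)" for a b k l
    by (auto simp: dvee_def tensor_alg_def tprod_def bvec_def fun_hopf_def group_hopf_def)
  have "(\<Sum>u\<in>basis P. \<Sum>v\<in>basis P. F u v * bmult P u v z)
      = (\<Sum>a\<in>carrier G. \<Sum>k\<in>carrier G. \<Sum>b\<in>carrier G. \<Sum>l\<in>carrier G.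
          F (a, k) (b, l) * (if b = a \<and> g = a \<and> h = k \<otimes> l then 1 else 0))"
    by (simp add: z bm sum.cartesian_product')
  also have "\<dots> = (\<Sum>a\<in>carrier G. if g = a then (\<Sum>k\<in>carrier G. \<Sum>l\<in>carrier G.
          if h = k \<otimes> l then F (a, k) (a, l) else 0) else 0)"
  proof (rule sum.cong[OF refl])
    fix a assume a: "a \<in> carrier G"
    have "(\<Sum>k\<in>carrier G. \<Sum>b\<in>carrier G. \<Sum>l\<in>carrier G.
          F (a, k) (b, l) * (if b = a \<and> g = a \<and> h = k \<otimes> l then 1 else 0))
        = (\<Sum>k\<in>carrier G. \<Sum>b\<in>carrier G. if b = a then if g = a then
            (\<Sum>l\<in>carrier G. if h = k \<otimes> l then F (a, k) (a, l) else 0) else 0 else 0)"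
      by (intro sum.cong refl) (auto intro!: sum.cong sum.neutral)
    also have "\<dots> = (if g = a then (\<Sum>k\<in>carrier G. \<Sum>l\<in>carrier G.
          if h = k \<otimes> l then F (a, k) (a, l) else 0) else 0)"
      using a by (cases "g = a") simp_all
    finally show "(\<Sum>k\<in>carrier G. \<Sum>b\<in>carrier G. \<Sum>l\<in>carrier G.
          F (a, k) (b, l) * (if b = a \<and> g = a \<and> h = k \<otimes> l then 1 else 0)) = \<dots>" .
  qed
  also have "\<dots> = (if g \<in> carrier G then (\<Sum>k\<in>carrier G. \<Sum>l\<in>carrier G.
          if h = k \<otimes> l then F (g, k) (g, l) else 0) else 0)"
    by (rule sum.delta'[OF finite_carrier])
  also have "\<dots> = (if g \<in> carrier G \<and> h \<in> carrier G then \<Sum>k\<in>carrier G. F (g, k) (g, inv k \<otimes> h) else 0)"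
  proof (cases "h \<in> carrier G")
    case True
    have "(\<Sum>l\<in>carrier G. if h = k \<otimes> l then F (g, k) (g, l) else 0) = F (g, k) (g, inv k \<otimes> h)"
      if "k \<in> carrier G" for k
      using that True by (intro sum_delta_eq eq_mult_iff(1)) auto
    then have "(\<Sum>k\<in>carrier G. \<Sum>l\<in>carrier G. if h = k \<otimes> l then F (g, k) (g, l) else 0)
        = (\<Sum>k\<in>carrier G. F (g, k) (g, inv k \<otimes> h))"
      by (rule sum.cong[OF refl])
    then show ?thesis
      using True by (simp only: simp_thms)
  next
    case False
    then have "(\<Sum>k\<in>carrier G. \<Sum>l\<in>carrier G. if h = k \<otimes> l then F (g, k) (g, l) else 0) = 0"
      by (intro sum.neutral ballI) auto
    then show ?thesis
      using False by (simp only: simp_thms if_False if_cancel)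
  qed
  finally show ?thesis
    by (simp add: z)
qed

lemma fun_bmult_sum:
  "(\<Sum>u\<in>basis H. \<Sum>v\<in>basis H. F u v * bmult H u v z) = (if z \<in> carrier G then F z z else 0)"
proof -
  have "F u v * bmult H u v z = (if u = v then if z = u then F u v else 0 else 0)" for u v
    by (simp add: fun_hopf_def bvec_def)
  then show ?thesis by simp
qed

lemma group_bmult_sum:
  "(\<Sum>u\<in>carrier G. \<Sum>v\<in>carrier G. F u v * bmult (group_hopf G) u v z)
    = (if z \<in> carrier G then \<Sum>k\<in>carrier G. F k (inv k \<otimes> z) else 0)"
proof (cases "z \<in> carrier G")
  case True
  have "(\<Sum>v\<in>carrier G. F u v * bmult (group_hopf G) u v z) = F u (inv u \<otimes> z)" if "u \<in> carrier G" for u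
  proof -
    have "(\<Sum>v\<in>carrier G. F u v * bmult (group_hopf G) u v z)
        = (\<Sum>v\<in>carrier G. if z = u \<otimes> v then F u v else 0)"
      by (intro sum.cong) (auto simp: group_hopf_def bvec_def)
    also have "\<dots> = F u (inv u \<otimes> z)"
      using that True by (intro sum_delta_eq eq_mult_iff(1)) auto
    finally show ?thesis .
  qed
  with True show ?thesis by (simp cong: sum.cong)
next
  case False
  then have "bmult (group_hopf G) u v z = 0" if "u \<in> carrier G" "v \<in> carrier G" for u v
    using that by (auto simp: group_hopf_def bvec_def)
  with False show ?thesis by (simp cong: sum.cong)
qed

lemma dvee_mult:
  "x \<otimes>\<^bsub>alg P\<^esub> y = (\<lambda>(g, h). if g \<in> carrier G \<and> h \<in> carrier G
     then \<Sum>k\<in>carrier G. x (g, k) * y (g, inv k \<otimes> h) else 0)"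
  by (auto simp: alg_mult dvee_bmult_sum fun_eq_iff simp del: hopf_simps(3))

lemma fun_mult: "x \<otimes>\<^bsub>alg H\<^esub> y = (\<lambda>g. if g \<in> carrier G then x g * y g else 0)"
  by (simp add: alg_mult fun_bmult_sum del: hopf_simps(1))

lemma group_mult:
  "x \<otimes>\<^bsub>alg (group_hopf G)\<^esub> y
    = (\<lambda>g. if g \<in> carrier G then \<Sum>k\<in>carrier G. x k * y (inv k \<otimes> g) else 0)"
  by (simp add: alg_mult group_bmult_sum)

lemma dvee_dvee_mult:
  "(X \<otimes>\<^bsub>alg (tensor_alg P P)\<^esub> Y) (z, z')
    = (if z \<in> carrier G \<times> carrier G \<and> z' \<in> carrier G \<times> carrier G
       then \<Sum>k\<in>carrier G. \<Sum>l\<in>carrier G. X ((fst z, k), (fst z', l))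
         * Y ((fst z, inv k \<otimes> snd z), (fst z', inv l \<otimes> snd z')) else 0)"
  by (simp add: tensor_alg_mult dvee_bmult_sum del: hopf_simps(3))

lemma dvee_fun_mult:
  "(X \<otimes>\<^bsub>alg (tensor_alg P H)\<^esub> Y) (z, s)
    = (if z \<in> carrier G \<times> carrier G \<and> s \<in> carrier G
       then \<Sum>k\<in>carrier G. X ((fst z, k), s) * Y ((fst z, inv k \<otimes> snd z), s) else 0)"
  by (simp add: tensor_alg_mult dvee_bmult_sum fun_bmult_sum del: hopf_simps(1,3))

lemma fun_fun_mult:
  "(X \<otimes>\<^bsub>alg (tensor_alg H H)\<^esub> Y) (z, s)
    = (if z \<in> carrier G \<and> s \<in> carrier G then X (z, s) * Y (z, s) else 0)"
  by (simp add: tensor_alg_mult fun_bmult_sum del: hopf_simps(1))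

text \<open>With a = f and b = f^-1 g the defining sum runs over the factorisations g = ab, and the
  twist f^-1 ghg^-1 f is conjugation of h by b. The later formulas use a, b and v as free
  parameters.\<close>

lemma bcomult_dvee:
  assumes "g \<in> carrier G" "h \<in> carrier G"
  shows "bcomult P (g, h) ((a, u), (b, v)) = (if a \<in> carrier G \<and> b \<in> carrier G \<and> v \<in> carrier G
    \<and> g = a \<otimes> b \<and> h = v \<and> u = gconj G b v then 1 else 0)"
proof -
  have bc: "bcomult P (g, h) z
      = (\<Sum>f\<in>carrier G. tprod (bvec (f, gconj G (inv f) (gconj G g h))) (bvec (inv f \<otimes> g, h)) z)" for z
    by (simp add: dvee_def)
  have "bcomult P (g, h) ((a, u), (b, v))
      = (\<Sum>f\<in>carrier G. if f = a then if u = gconj G (inv a) (gconj G g h) \<and> b = inv a \<otimes> g \<and> v = h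
          then 1 else 0 else 0)"
    unfolding bc by (intro sum.cong refl) (auto simp: tprod_def bvec_def)
  also have "\<dots> = (if a \<in> carrier G \<and> u = gconj G (inv a) (gconj G g h) \<and> b = inv a \<otimes> g \<and> v = h then 1 else 0)"
    by simp
  also have "\<dots> = (if a \<in> carrier G \<and> b \<in> carrier G \<and> v \<in> carrier G
    \<and> g = a \<otimes> b \<and> h = v \<and> u = gconj G b v then 1 else 0)"
    using assms by (auto simp: gconj_def word_simps)
  finally show ?thesis .
qed

lemma dvee_comult:
  "comult P x = (\<lambda>((a, u), (b, v)). if a \<in> carrier G \<and> b \<in> carrier G \<and> v \<in> carrier G \<and> u = gconj G b v
    then x (a \<otimes> b, v) else 0)"
proof -
  have "comult P x ((a, u), (b, v)) = (if a \<in> carrier G \<and> b \<in> carrier G \<and> v \<in> carrier G \<and> u = gconj G b v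
    then x (a \<otimes> b, v) else 0)" for a u b v
  proof -
    have "comult P x ((a, u), (b, v)) = (\<Sum>z\<in>carrier G \<times> carrier G. if z = (a \<otimes> b, v)
        then if a \<in> carrier G \<and> b \<in> carrier G \<and> v \<in> carrier G \<and> u = gconj G b v then x z else 0 else 0)"
      unfolding comult_def lext_def hopf_simps by (intro sum.cong refl) (auto simp: bcomult_dvee split: if_splits)
    then show ?thesis by simp
  qed
  then show ?thesis by (simp add: fun_eq_iff)
qed

lemma fun_comult:
  "comult H x = (\<lambda>(a, b). if a \<in> carrier G \<and> b \<in> carrier G then x (a \<otimes> b) else 0)"
proof -
  have "comult H x (a, b) = (if a \<in> carrier G \<and> b \<in> carrier G then x (a \<otimes> b) else 0)" for a b
  proof -
    have bc: "bcomult H g z = (\<Sum>f\<in>carrier G. tprod (bvec f) (bvec (inv f \<otimes> g)) z)" for g z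
      by (simp add: fun_hopf_def)
    have "bcomult H g (a, b) = (if g = a \<otimes> b \<and> a \<in> carrier G \<and> b \<in> carrier G then 1 else 0)"
      if "g \<in> carrier G" for g
    proof -
      have "bcomult H g (a, b) = (\<Sum>f\<in>carrier G. if f = a then if b = inv a \<otimes> g then 1 else 0 else 0)"
        unfolding bc by (intro sum.cong refl) (auto simp: tprod_def bvec_def)
      then show ?thesis using that by auto
    qed
    then have "comult H x (a, b) = (\<Sum>g\<in>carrier G. if g = a \<otimes> b then
        if a \<in> carrier G \<and> b \<in> carrier G then x g else 0 else 0)"
      unfolding comult_def lext_def hopf_simps by (intro sum.cong refl) auto
    then show ?thesis by simp
  qed
  then show ?thesis by (simp add: fun_eq_iff)
qed

lemma sum_comult:
  "(\<Sum>w\<in>basis P \<times> basis P. comult P x w * F w)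
    = (\<Sum>a\<in>carrier G. \<Sum>b\<in>carrier G. \<Sum>v\<in>carrier G. x (a \<otimes> b, v) * F ((a, gconj G b v), (b, v)))"
proof -
  have "(\<Sum>w\<in>basis P \<times> basis P. comult P x w * F w)
      = (\<Sum>a\<in>carrier G. \<Sum>u\<in>carrier G. \<Sum>b\<in>carrier G. \<Sum>v\<in>carrier G.
          if u = gconj G b v then x (a \<otimes> b, v) * F ((a, u), (b, v)) else 0)"
    unfolding hopf_simps sum.cartesian_product' dvee_comult by (intro sum.cong refl) auto
  also have "\<dots> = (\<Sum>a\<in>carrier G. \<Sum>b\<in>carrier G. \<Sum>u\<in>carrier G. \<Sum>v\<in>carrier G.
          if u = gconj G b v then x (a \<otimes> b, v) * F ((a, u), (b, v)) else 0)"
    by (rule sum.cong[OF refl sum.swap])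
  also have "\<dots> = (\<Sum>a\<in>carrier G. \<Sum>b\<in>carrier G. \<Sum>v\<in>carrier G. \<Sum>u\<in>carrier G.
          if u = gconj G b v then x (a \<otimes> b, v) * F ((a, u), (b, v)) else 0)"
    by (rule sum.cong[OF refl], rule sum.cong[OF refl], rule sum.swap)
  also have "\<dots> = (\<Sum>a\<in>carrier G. \<Sum>b\<in>carrier G. \<Sum>v\<in>carrier G. x (a \<otimes> b, v) * F ((a, gconj G b v), (b, v)))"
    by (intro sum.cong refl) simp
  finally show ?thesis .
qed

lemma dvee_counit: "counit P x = (\<Sum>h\<in>carrier G. x (\<one>, h))"
proof -
  have "counit P x = (\<Sum>g\<in>carrier G. \<Sum>h\<in>carrier G. if g = \<one> then x (g, h) else 0)"
    unfolding counit_def hopf_simps sum.cartesian_product' by (intro sum.cong refl) auto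
  also have "\<dots> = (\<Sum>h\<in>carrier G. x (\<one>, h))"
    by (subst sum.swap) simp
  finally show ?thesis .
qed

lemma fun_counit: "counit H x = x \<one>"
proof -
  have "counit H x = (\<Sum>g\<in>carrier G. if g = \<one> then x g else 0)"
    unfolding counit_def hopf_simps by (intro sum.cong refl) auto
  then show ?thesis by simp
qed

text \<open>The permutation of basis vectors that defines the antipode is an involution, so the same
  expression describes its effect on coefficients.\<close>

lemma dvee_antipode:
  "antipode P x = (\<lambda>(g, h). if g \<in> carrier G \<and> h \<in> carrier G then x (inv g, gconj G g (inv h)) else 0)"
proof -
  have "antipode P x (g, h) = (if g \<in> carrier G \<and> h \<in> carrier G then x (inv g, gconj G g (inv h)) else 0)" for g h
  proof -
    have eq: "(g, h) = (inv a, gconj G a (inv u)) \<longleftrightarrow>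
        (a, u) = (inv g, gconj G g (inv h)) \<and> g \<in> carrier G \<and> h \<in> carrier G"
      if "a \<in> carrier G" "u \<in> carrier G" for a u
      using that by (auto simp: gconj_def word_simps)
    have b: "bvec (inv (fst w), gconj G (fst w) (inv (snd w))) (g, h)
        = (if w = (inv g, gconj G g (inv h)) \<and> g \<in> carrier G \<and> h \<in> carrier G then 1 else 0 :: complex)"
      if "w \<in> carrier G \<times> carrier G" for w
      unfolding bvec_def using eq[of "fst w" "snd w"] that by (simp only: prod.collapse mem_Times_iff)
    have "antipode P x (g, h) = (\<Sum>w\<in>carrier G \<times> carrier G. if w = (inv g, gconj G g (inv h))
        then if g \<in> carrier G \<and> h \<in> carrier G then x w else 0 else 0)"
      unfolding antipode_def lext_def hopf_simps by (intro sum.cong refl) (simp add: b)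
    then show ?thesis by simp
  qed
  then show ?thesis by (simp add: fun_eq_iff)
qed

lemma fun_antipode: "antipode H x = (\<lambda>g. if g \<in> carrier G then x (inv g) else 0)"
proof
  fix g
  have "antipode H x g = (\<Sum>a\<in>carrier G. if a = inv g then if g \<in> carrier G then x a else 0 else 0)"
    unfolding antipode_def lext_def hopf_simps by (intro sum.cong refl) (auto simp: bvec_def)
  then show "antipode H x g = (if g \<in> carrier G then x (inv g) else 0)" by simp
qed

text \<open>Over each g the slice is a copy of the group algebra, so the axioms reduce to those of
  convolution; associativity is the invariance of summation under left translation.\<close>

lemma complex_algebra_dvee: "complex_algebra (alg P)"
proof (rule complex_algebra_alg)
  fix x y z assume "x \<in> carrier (alg P)" "y \<in> carrier (alg P)" "z \<in> carrier (alg P)"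
  have "(\<Sum>k\<in>carrier G. (\<Sum>l\<in>carrier G. x (g, l) * y (g, inv l \<otimes> k)) * z (g, inv k \<otimes> h))
      = (\<Sum>l\<in>carrier G. x (g, l) * (\<Sum>k\<in>carrier G. y (g, k) * z (g, inv k \<otimes> (inv l \<otimes> h))))"
    if "h \<in> carrier G" for g h
  proof -
    have "(\<Sum>k\<in>carrier G. (\<Sum>l\<in>carrier G. x (g, l) * y (g, inv l \<otimes> k)) * z (g, inv k \<otimes> h))
        = (\<Sum>l\<in>carrier G. x (g, l) * (\<Sum>k\<in>carrier G. y (g, inv l \<otimes> k) * z (g, inv k \<otimes> h)))"
      by (simp add: sum_distrib_left sum_distrib_right mult.assoc) (rule sum.swap)
    also have "\<dots> = (\<Sum>l\<in>carrier G. x (g, l) * (\<Sum>k\<in>carrier G. y (g, k) * z (g, inv k \<otimes> (inv l \<otimes> h))))"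
    proof (rule sum.cong[OF refl])
      fix l assume l: "l \<in> carrier G"
      then show "x (g, l) * (\<Sum>k\<in>carrier G. y (g, inv l \<otimes> k) * z (g, inv k \<otimes> h))
          = x (g, l) * (\<Sum>k\<in>carrier G. y (g, k) * z (g, inv k \<otimes> (inv l \<otimes> h)))"
        using that by (subst sum_mult_left[symmetric, OF l]) (simp add: word_simps)
    qed
    finally show ?thesis .
  qed
  then show "(x \<otimes>\<^bsub>alg P\<^esub> y) \<otimes>\<^bsub>alg P\<^esub> z = x \<otimes>\<^bsub>alg P\<^esub> (y \<otimes>\<^bsub>alg P\<^esub> z)"
    by (auto simp: dvee_mult fun_eq_iff)
next
  fix x assume x: "x \<in> carrier (alg P)"
  have "(\<Sum>k\<in>carrier G. (if k = \<one> then 1 else 0) * x (g, inv k \<otimes> h)) = x (g, h)"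
    "(\<Sum>k\<in>carrier G. x (g, k) * (if inv k \<otimes> h = \<one> then 1 else 0)) = x (g, h)"
    if "h \<in> carrier G" for g h
  proof -
    show "(\<Sum>k\<in>carrier G. (if k = \<one> then 1 else 0) * x (g, inv k \<otimes> h)) = x (g, h)"
      using that by (simp add: if_distrib[of "\<lambda>x. x * _"] cong: if_cong)
    show "(\<Sum>k\<in>carrier G. x (g, k) * (if inv k \<otimes> h = \<one> then 1 else 0)) = x (g, h)"
      unfolding if_distrib[of "\<lambda>y. x _ * y"] mult_1_right mult_zero_right
      using that by (intro sum_delta_eq) (auto simp: inv_mult_eq_one_iff)
  qed
  note unit = this
  have "(\<one>\<^bsub>alg P\<^esub> \<otimes>\<^bsub>alg P\<^esub> x) (g, h) = x (g, h) \<and> (x \<otimes>\<^bsub>alg P\<^esub> \<one>\<^bsub>alg P\<^esub>) (g, h) = x (g, h)" for g h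
  proof (cases "g \<in> carrier G \<and> h \<in> carrier G")
    case True
    have "(\<one>\<^bsub>alg P\<^esub> \<otimes>\<^bsub>alg P\<^esub> x) (g, h) = (\<Sum>k\<in>carrier G. (if k = \<one> then 1 else 0) * x (g, inv k \<otimes> h))"
      unfolding dvee_mult using True by (simp add: alg_ops(2))
    moreover have "(x \<otimes>\<^bsub>alg P\<^esub> \<one>\<^bsub>alg P\<^esub>) (g, h) = (\<Sum>k\<in>carrier G. x (g, k) * (if inv k \<otimes> h = \<one> then 1 else 0))"
      unfolding dvee_mult using True by (simp add: alg_ops(2))
    ultimately show ?thesis
      by (simp only: unit[OF conjunct2[OF True]] simp_thms)
  next
    case False
    then have "x (g, h) = 0"
      using x by (auto simp: alg_ops(1) carrier_fspace)
    with False show ?thesis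
      by (auto simp: dvee_mult)
  qed
  then show "\<one>\<^bsub>alg P\<^esub> \<otimes>\<^bsub>alg P\<^esub> x = x" "x \<otimes>\<^bsub>alg P\<^esub> \<one>\<^bsub>alg P\<^esub> = x"
    by auto
qed (auto simp: dvee_mult alg_ops carrier_fspace)

lemma complex_algebra_fun: "complex_algebra (alg H)"
  by (rule complex_algebra_alg) (auto simp: fun_mult alg_ops carrier_fspace fun_eq_iff)

lemma comult_in: "comult P x \<in> carrier (fspace (basis P \<times> basis P))"
  "comult H y \<in> carrier (fspace (basis H \<times> basis H))"
  by (auto simp: dvee_comult fun_comult carrier_fspace)

lemma flinear_comult [simp]: "flinear V (comult A)"
  by (simp add: comult_def)

lemma flinear_id [simp]: "flinear V (\<lambda>y. y)"
  by (simp add: flinear_def)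

lemma dvee_proj_eq: "p x = (\<lambda>g. \<Sum>h\<in>carrier G. x (g, h))"
  by (simp add: dvee_proj_def)

lemma flinear_proj [simp]: "flinear V p"
  by (simp add: flinear_def dvee_proj_eq sum.distrib sum_distrib_left)

end

context finite_group
begin

section \<open>The Hopf algebra axioms\<close>

lemma tmap_dvee:
  assumes "flinear (carrier (fspace (basis P))) f" "flinear (carrier (fspace (basis P))) g"
  shows "tmap (basis P) (basis P) f g (comult P x) (z, w) = f (\<lambda>b. g (\<lambda>c. comult P x (b, c)) w) z"
  by (rule tmap_eq) (simp_all add: assms comult_in del: hopf_simps, simp_all)

lemma tmap_fun:
  assumes "flinear (carrier (fspace (basis H))) f" "flinear (carrier (fspace (basis H))) g"
  shows "tmap (basis H) (basis H) f g (comult H x) (z, w) = f (\<lambda>b. g (\<lambda>c. comult H x (b, c)) w) z"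
  by (rule tmap_eq) (simp_all add: assms comult_in del: hopf_simps, simp_all)

lemma sum_comult_fun:
  "(\<Sum>w\<in>basis H \<times> basis H. comult H x w * F w) = (\<Sum>a\<in>carrier G. \<Sum>b\<in>carrier G. x (a \<otimes> b) * F (a, b))"
  unfolding hopf_simps sum.cartesian_product' fun_comult by (intro sum.cong refl) auto

lemma gconj_gconj: "a \<in> carrier G \<Longrightarrow> b \<in> carrier G \<Longrightarrow> h \<in> carrier G
    \<Longrightarrow> gconj G a (gconj G b h) = gconj G (a \<otimes> b) h"
  by (simp add: gconj_def word_simps)

lemma gconj_one [simp]: "h \<in> carrier G \<Longrightarrow> gconj G \<one> h = h" "a \<in> carrier G \<Longrightarrow> gconj G a \<one> = \<one>"
  by (simp_all add: gconj_def)

lemma gconj_mult: "a \<in> carrier G \<Longrightarrow> h \<in> carrier G \<Longrightarrow> k \<in> carrier G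
    \<Longrightarrow> gconj G a (h \<otimes> k) = gconj G a h \<otimes> gconj G a k"
  by (simp add: gconj_def word_simps)

lemma inv_gconj: "a \<in> carrier G \<Longrightarrow> h \<in> carrier G \<Longrightarrow> inv (gconj G a h) = gconj G a (inv h)"
  by (simp add: gconj_def word_simps)

text \<open>The twist condition u = bvb^-1 is multiplicative because conjugation is a homomorphism.
  In the product of two coproducts one convolution variable is therefore determined by the other,
  and a single convolution remains.\<close>

lemma comult_mult_dvee: "comult P (x \<otimes>\<^bsub>alg P\<^esub> y) = comult P x \<otimes>\<^bsub>alg (tensor_alg P P)\<^esub> comult P y"
proof -
  have "comult P (x \<otimes>\<^bsub>alg P\<^esub> y) ((a, u), (b, v))
      = (comult P x \<otimes>\<^bsub>alg (tensor_alg P P)\<^esub> comult P y) ((a, u), (b, v))" for a u b v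
  proof (cases "a \<in> carrier G \<and> b \<in> carrier G \<and> u \<in> carrier G \<and> v \<in> carrier G")
    case True
    then have a: "a \<in> carrier G" and b: "b \<in> carrier G" and u: "u \<in> carrier G" and v: "v \<in> carrier G"
      by auto
    have "(comult P x \<otimes>\<^bsub>alg (tensor_alg P P)\<^esub> comult P y) ((a, u), (b, v))
        = (\<Sum>k\<in>carrier G. \<Sum>l\<in>carrier G. comult P x ((a, k), b, l) * comult P y ((a, inv k \<otimes> u), b, inv l \<otimes> v))"
      using True by (simp add: dvee_dvee_mult)
    also have "\<dots> = (\<Sum>k\<in>carrier G. \<Sum>l\<in>carrier G. if k = gconj G b l then
        if u = gconj G b v then x (a \<otimes> b, l) * y (a \<otimes> b, inv l \<otimes> v) else 0 else 0)"
    proof (intro sum.cong refl)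
      fix k l assume k: "k \<in> carrier G" and l: "l \<in> carrier G"
      have "inv k \<otimes> u = gconj G b (inv l \<otimes> v) \<longleftrightarrow> u = gconj G b v" if "k = gconj G b l"
        using a b u v k l that by (simp add: inv_gconj gconj_mult)
      with k l a b v show "comult P x ((a, k), b, l) * comult P y ((a, inv k \<otimes> u), b, inv l \<otimes> v)
        = (if k = gconj G b l then
        if u = gconj G b v then x (a \<otimes> b, l) * y (a \<otimes> b, inv l \<otimes> v) else 0 else 0)"
        by (simp add: dvee_comult)
    qed
    also have "\<dots> = (\<Sum>l\<in>carrier G. if u = gconj G b v then x (a \<otimes> b, l) * y (a \<otimes> b, inv l \<otimes> v) else 0)"
      by (subst sum.swap) (use b in \<open>simp cong: sum.cong\<close>)
    also have "\<dots> = comult P (x \<otimes>\<^bsub>alg P\<^esub> y) ((a, u), (b, v))"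
      using a b v by (simp add: dvee_comult dvee_mult)
    finally show ?thesis ..
  next
    case False
    then show ?thesis
      by (auto simp: dvee_comult dvee_dvee_mult dvee_mult)
  qed
  then show ?thesis by (simp add: fun_eq_iff)
qed

lemma counit_mult_dvee: "counit P (x \<otimes>\<^bsub>alg P\<^esub> y) = counit P x * counit P y"
proof -
  have "counit P (x \<otimes>\<^bsub>alg P\<^esub> y) = (\<Sum>k\<in>carrier G. \<Sum>h\<in>carrier G. x (\<one>, k) * y (\<one>, inv k \<otimes> h))"
    by (simp add: dvee_counit dvee_mult) (rule sum.swap)
  also have "\<dots> = (\<Sum>k\<in>carrier G. \<Sum>h\<in>carrier G. x (\<one>, k) * y (\<one>, h))"
  proof (rule sum.cong[OF refl])
    fix k assume "k \<in> carrier G"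
    then show "(\<Sum>h\<in>carrier G. x (\<one>, k) * y (\<one>, inv k \<otimes> h)) = (\<Sum>h\<in>carrier G. x (\<one>, k) * y (\<one>, h))"
      using sum_mult_left[of "inv k" "\<lambda>h. x (\<one>, k) * y (\<one>, h)"] by simp
  qed
  finally show ?thesis
    by (simp add: dvee_counit sum_distrib_left sum_distrib_right)
       (rule sum.swap)
qed

text \<open>Products are pointwise in the first coordinate, so in both identities only the terms
  with b = a^-1 survive. There the twists cancel and the group parts multiply to 1, which leaves the
  sum of x(1, v) over v, the counit.\<close>

lemma antipode_dvee:
  "lext (basis P \<times> basis P) (\<lambda>(a, b). bantipode P a \<otimes>\<^bsub>alg P\<^esub> bvec b) (comult P x)
    = (\<lambda>z. counit P x * \<one>\<^bsub>alg P\<^esub> z)"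
  "lext (basis P \<times> basis P) (\<lambda>(a, b). bvec a \<otimes>\<^bsub>alg P\<^esub> bantipode P b) (comult P x)
    = (\<lambda>z. counit P x * \<one>\<^bsub>alg P\<^esub> z)"
proof -
  have mult: "(bvec (a, u) \<otimes>\<^bsub>alg P\<^esub> bvec (b, v)) (g, h)
      = (if g = a \<and> g = b \<and> h = u \<otimes> v then 1 else 0)"
    if "a \<in> carrier G" "u \<in> carrier G" "b \<in> carrier G" "v \<in> carrier G" for a u b v g h
  proof -
    have "(\<Sum>k\<in>carrier G. bvec (a, u) (g, k) * bvec (b, v) (g, inv k \<otimes> h))
        = (\<Sum>k\<in>carrier G. if k = u then if g = a \<and> g = b \<and> inv u \<otimes> h = v then 1 else 0 else 0 :: complex)"
      by (intro sum.cong refl) (auto simp: bvec_def)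
    also have "\<dots> = (if g = a \<and> g = b \<and> inv u \<otimes> h = v then 1 else 0)"
      using that by simp
    finally show ?thesis
      using that by (auto simp: dvee_mult)
  qed
  have "lext (basis P \<times> basis P) (\<lambda>(a, b). bantipode P a \<otimes>\<^bsub>alg P\<^esub> bvec b) (comult P x) (g, h)
      = counit P x * \<one>\<^bsub>alg P\<^esub> (g, h)" for g h
  proof -
    have "lext (basis P \<times> basis P) (\<lambda>(a, b). bantipode P a \<otimes>\<^bsub>alg P\<^esub> bvec b) (comult P x) (g, h)
        = (\<Sum>a\<in>carrier G. \<Sum>b\<in>carrier G. \<Sum>v\<in>carrier G. x (a \<otimes> b, v) *
            (bantipode P (a, gconj G b v) \<otimes>\<^bsub>alg P\<^esub> bvec (b, v)) (g, h))"
      unfolding lext_def sum_comult by simp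
    also have "\<dots> = (\<Sum>a\<in>carrier G. \<Sum>b\<in>carrier G. \<Sum>v\<in>carrier G. if b = inv a then
        if a = inv g then if g \<in> carrier G \<and> h = \<one> then x (\<one>, v) else 0 else 0 else 0)"
    proof (intro sum.cong refl)
      fix a b v assume abv: "a \<in> carrier G" "b \<in> carrier G" "v \<in> carrier G"
      have lhs: "(bantipode P (a, gconj G b v) \<otimes>\<^bsub>alg P\<^esub> bvec (b, v)) (g, h) = (if (g = inv a \<and> g = b) \<and> h = gconj G a (inv (gconj G b v)) \<otimes> v then 1 else 0)"
        using abv by (simp add: mult)
      show "x (a \<otimes> b, v) * (bantipode P (a, gconj G b v) \<otimes>\<^bsub>alg P\<^esub> bvec (b, v)) (g, h)
          = (if b = inv a then if a = inv g then if g \<in> carrier G \<and> h = \<one> then x (\<one>, v) else 0 else 0 else 0)"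
      proof (cases "g \<in> carrier G \<and> a = inv g \<and> b = g")
        case True
        with abv show ?thesis
          unfolding lhs by (simp add: inv_gconj)
      next
        case False
        then have n: "\<not> (g = inv a \<and> g = b)"
          using abv by auto
        have "(if b = inv a then if a = inv g then if g \<in> carrier G \<and> h = \<one> then x (\<one>, v) else 0 else 0 else 0) = 0"
          using False by auto
        then show ?thesis
          unfolding lhs by (simp only: n simp_thms if_False mult_zero_right)
      qed
    qed
    also have "\<dots> = (\<Sum>a\<in>carrier G. \<Sum>v\<in>carrier G. if a = inv g then if g \<in> carrier G \<and> h = \<one> then x (\<one>, v) else 0 else 0)"
      by (rule sum.cong[OF refl], subst sum.swap) (simp cong: sum.cong)
    also have "\<dots> = (\<Sum>v\<in>carrier G. if g \<in> carrier G \<and> h = \<one> then x (\<one>, v) else 0)"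
      by (subst sum.swap) (cases "g \<in> carrier G"; simp cong: if_cong)
    also have "\<dots> = counit P x * \<one>\<^bsub>alg P\<^esub> (g, h)"
      by (auto simp: dvee_counit alg_ops intro!: sum.neutral)
    finally show ?thesis .
  qed
  then show "lext (basis P \<times> basis P) (\<lambda>(a, b). bantipode P a \<otimes>\<^bsub>alg P\<^esub> bvec b) (comult P x)
    = (\<lambda>z. counit P x * \<one>\<^bsub>alg P\<^esub> z)"
    by (simp add: fun_eq_iff)
  have "lext (basis P \<times> basis P) (\<lambda>(a, b). bvec a \<otimes>\<^bsub>alg P\<^esub> bantipode P b) (comult P x) (g, h)
      = counit P x * \<one>\<^bsub>alg P\<^esub> (g, h)" for g h
  proof -
    have "lext (basis P \<times> basis P) (\<lambda>(a, b). bvec a \<otimes>\<^bsub>alg P\<^esub> bantipode P b) (comult P x) (g, h)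
        = (\<Sum>a\<in>carrier G. \<Sum>b\<in>carrier G. \<Sum>v\<in>carrier G. x (a \<otimes> b, v) *
            (bvec (a, gconj G b v) \<otimes>\<^bsub>alg P\<^esub> bantipode P (b, v)) (g, h))"
      unfolding lext_def sum_comult by simp
    also have "\<dots> = (\<Sum>a\<in>carrier G. \<Sum>b\<in>carrier G. \<Sum>v\<in>carrier G. if b = inv a then
        if a = g then if g \<in> carrier G \<and> h = \<one> then x (\<one>, v) else 0 else 0 else 0)"
    proof (intro sum.cong refl)
      fix a b v assume abv: "a \<in> carrier G" "b \<in> carrier G" "v \<in> carrier G"
      have lhs: "(bvec (a, gconj G b v) \<otimes>\<^bsub>alg P\<^esub> bantipode P (b, v)) (g, h) = (if (g = a \<and> g = inv b) \<and> h = gconj G b v \<otimes> gconj G b (inv v) then 1 else 0)"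
        using abv by (simp add: mult)
      show "x (a \<otimes> b, v) * (bvec (a, gconj G b v) \<otimes>\<^bsub>alg P\<^esub> bantipode P (b, v)) (g, h)
          = (if b = inv a then if a = g then if g \<in> carrier G \<and> h = \<one> then x (\<one>, v) else 0 else 0 else 0)"
      proof (cases "g \<in> carrier G \<and> a = g \<and> b = inv g")
        case True
        with abv show ?thesis
          unfolding lhs by (simp flip: gconj_mult)
      next
        case False
        then have n: "\<not> (g = a \<and> g = inv b)"
          using abv by auto
        have "(if b = inv a then if a = g then if g \<in> carrier G \<and> h = \<one> then x (\<one>, v) else 0 else 0 else 0) = 0"
          using False by auto
        then show ?thesis
          unfolding lhs by (simp only: n simp_thms if_False mult_zero_right)
      qed
    qed
    also have "\<dots> = (\<Sum>a\<in>carrier G. \<Sum>v\<in>carrier G. if a = g then if g \<in> carrier G \<and> h = \<one> then x (\<one>, v) else 0 else 0)"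
      by (rule sum.cong[OF refl], subst sum.swap) (simp cong: sum.cong)
    also have "\<dots> = (\<Sum>v\<in>carrier G. if g \<in> carrier G \<and> h = \<one> then x (\<one>, v) else 0)"
      by (subst sum.swap) (cases "g \<in> carrier G"; simp cong: if_cong)
    also have "\<dots> = counit P x * \<one>\<^bsub>alg P\<^esub> (g, h)"
      by (auto simp: dvee_counit alg_ops intro!: sum.neutral)
    finally show ?thesis .
  qed
  then show "lext (basis P \<times> basis P) (\<lambda>(a, b). bvec a \<otimes>\<^bsub>alg P\<^esub> bantipode P b) (comult P x)
    = (\<lambda>z. counit P x * \<one>\<^bsub>alg P\<^esub> z)"
    by (simp add: fun_eq_iff)
qed

lemma bcomult_in:
  "b \<in> basis P \<Longrightarrow> bcomult P b \<in> carrier (fspace (basis P \<times> basis P))"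
  "g \<in> basis H \<Longrightarrow> bcomult H g \<in> carrier (fspace (basis H \<times> basis H))"
proof -
  show "bcomult P b \<in> carrier (fspace (basis P \<times> basis P))" if "b \<in> basis P"
    using comult_in(1)[of "bvec b"] that lext_bvec[of "basis P" b "bcomult P"] by (simp add: comult_def)
  show "bcomult H g \<in> carrier (fspace (basis H \<times> basis H))" if "g \<in> basis H"
    using comult_in(2)[of "bvec g"] that lext_bvec[of "basis H" g "bcomult H"] by (simp add: comult_def)
qed

lemma hopf_algebra_dvee: "hopf_algebra P"
proof -
  have coassoc: "tmap (basis P) (basis P) (comult P) (\<lambda>y. y) (comult P x) ((a, b), c)
      = tmap (basis P) (basis P) (\<lambda>y. y) (comult P) (comult P x) (a, (b, c))" for x a b c
    unfolding tmap_dvee[OF flinear_comult flinear_id] tmap_dvee[OF flinear_id flinear_comult]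
    by (cases a; cases b; cases c) (auto simp: dvee_comult m_assoc gconj_gconj)
  have counit: "(\<Sum>a\<in>basis P. bcounit P a * comult P x (a, b)) = x b"
    "(\<Sum>a\<in>basis P. comult P x (b, a) * bcounit P a) = x b"
    if x: "x \<in> carrier (alg P)" for x b
  proof -
    obtain g h where b: "b = (g, h)" by (cases b)
    have z: "x (g, h) = 0" if "\<not> (g \<in> carrier G \<and> h \<in> carrier G)"
      using x that by (auto simp: alg_ops carrier_fspace)
    have "(\<Sum>a\<in>basis P. bcounit P a * comult P x (a, b)) = counit P (\<lambda>a. comult P x (a, b))"
      by (simp add: counit_def mult.commute)
    also have "\<dots> = (\<Sum>u\<in>carrier G. if u = gconj G g h then if g \<in> carrier G \<and> h \<in> carrier G then x b else 0 else 0)"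
      unfolding dvee_counit by (intro sum.cong refl) (auto simp: b dvee_comult)
    also have "\<dots> = x b"
      using z by (auto simp: b)
    finally show "(\<Sum>a\<in>basis P. bcounit P a * comult P x (a, b)) = x b" .
    have "(\<Sum>a\<in>basis P. comult P x (b, a) * bcounit P a) = counit P (\<lambda>a. comult P x (b, a))"
      by (simp add: counit_def)
    also have "\<dots> = (\<Sum>v\<in>carrier G. if v = h then x b else 0)"
      using z unfolding dvee_counit by (intro sum.cong refl) (auto simp: b dvee_comult)
    also have "\<dots> = x b"
      using z by (auto simp: b)
    finally show "(\<Sum>a\<in>basis P. comult P x (b, a) * bcounit P a) = x b" .
  qed
  have one: "comult P \<one>\<^bsub>alg P\<^esub> = \<one>\<^bsub>alg (tensor_alg P P)\<^esub>"
  proof -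
    have "comult P \<one>\<^bsub>alg P\<^esub> ((a, u), (b, v)) = \<one>\<^bsub>alg (tensor_alg P P)\<^esub> ((a, u), (b, v))" for a u b v
      by (auto simp: dvee_comult alg_ops tprod_def)
    then show ?thesis by (simp add: fun_eq_iff)
  qed
  show ?thesis
    unfolding hopf_algebra_def Let_def
  proof (intro conjI ballI allI)
    show "finite (basis P)" by simp
    show "complex_algebra (alg P)" by (rule complex_algebra_dvee)
    fix b assume "b \<in> basis P"
    then show "bcomult P b \<in> carrier (alg (tensor_alg P P))" "bantipode P b \<in> carrier (alg P)"
      using bcomult_in(1)[of b] by (auto simp: alg_ops)
  qed (simp_all only: coassoc counit comult_mult_dvee counit_mult_dvee one antipode_dvee alg_ops(5),
      simp add: dvee_counit alg_ops)
qed

lemma hopf_algebra_fun: "hopf_algebra H"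
proof -
  have coassoc: "tmap (basis H) (basis H) (comult H) (\<lambda>y. y) (comult H x) ((a, b), c)
      = tmap (basis H) (basis H) (\<lambda>y. y) (comult H) (comult H x) (a, (b, c))" for x a b c
    unfolding tmap_fun[OF flinear_comult flinear_id] tmap_fun[OF flinear_id flinear_comult]
    by (auto simp: fun_comult m_assoc)
  have counit: "(\<Sum>a\<in>basis H. bcounit H a * comult H x (a, b)) = x b"
    "(\<Sum>a\<in>basis H. comult H x (b, a) * bcounit H a) = x b"
    if x: "x \<in> carrier (alg H)" for x b
  proof -
    have "x b = 0" if "b \<notin> carrier G"
      using x that by (simp add: alg_ops carrier_fspace)
    then have "counit H (\<lambda>a. comult H x (a, b)) = x b" "counit H (\<lambda>a. comult H x (b, a)) = x b"
      unfolding fun_counit by (auto simp: fun_comult)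
    then show "(\<Sum>a\<in>basis H. bcounit H a * comult H x (a, b)) = x b"
      "(\<Sum>a\<in>basis H. comult H x (b, a) * bcounit H a) = x b"
      by (simp_all add: counit_def mult.commute)
  qed
  have mult: "comult H (x \<otimes>\<^bsub>alg H\<^esub> y) = comult H x \<otimes>\<^bsub>alg (tensor_alg H H)\<^esub> comult H y" for x y
  proof -
    have "comult H (x \<otimes>\<^bsub>alg H\<^esub> y) (a, b) = (comult H x \<otimes>\<^bsub>alg (tensor_alg H H)\<^esub> comult H y) (a, b)" for a b
      by (simp add: fun_comult fun_mult fun_fun_mult)
    then show ?thesis by (simp add: fun_eq_iff)
  qed
  have one: "comult H \<one>\<^bsub>alg H\<^esub> = \<one>\<^bsub>alg (tensor_alg H H)\<^esub>"
    by (auto simp: fun_comult alg_ops tprod_def fun_eq_iff)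
  have bv: "(bvec a \<otimes>\<^bsub>alg H\<^esub> bvec b) z = (if a = b then if z = a then 1 else 0 else 0)" if "a \<in> carrier G" for a b z
    using that by (auto simp: fun_mult bvec_def)
  have antipode: "lext (basis H \<times> basis H) (\<lambda>(a, b). bantipode H a \<otimes>\<^bsub>alg H\<^esub> bvec b) (comult H x)
      = (\<lambda>z. counit H x * \<one>\<^bsub>alg H\<^esub> z)"
    "lext (basis H \<times> basis H) (\<lambda>(a, b). bvec a \<otimes>\<^bsub>alg H\<^esub> bantipode H b) (comult H x)
      = (\<lambda>z. counit H x * \<one>\<^bsub>alg H\<^esub> z)" for x
  proof -
    have "lext (basis H \<times> basis H) (\<lambda>(a, b). bantipode H a \<otimes>\<^bsub>alg H\<^esub> bvec b) (comult H x) z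
        = (\<Sum>a\<in>carrier G. \<Sum>b\<in>carrier G. x (a \<otimes> b) * (bvec (inv a) \<otimes>\<^bsub>alg H\<^esub> bvec b) z)" for z
      unfolding lext_def sum_comult_fun by simp
    also have "\<dots> z = (\<Sum>a\<in>carrier G. \<Sum>b\<in>carrier G. if b = inv a then
        if a = inv z then if z \<in> carrier G then x \<one> else 0 else 0 else 0)" for z
      by (intro sum.cong refl) (auto simp: bv)
    also have "\<dots> z = counit H x * \<one>\<^bsub>alg H\<^esub> z" for z
      by (cases "z \<in> carrier G") (simp_all add: fun_counit alg_ops cong: sum.cong)
    finally show "lext (basis H \<times> basis H) (\<lambda>(a, b). bantipode H a \<otimes>\<^bsub>alg H\<^esub> bvec b) (comult H x)
      = (\<lambda>z. counit H x * \<one>\<^bsub>alg H\<^esub> z)" by (rule ext)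
    have "lext (basis H \<times> basis H) (\<lambda>(a, b). bvec a \<otimes>\<^bsub>alg H\<^esub> bantipode H b) (comult H x) z
        = (\<Sum>a\<in>carrier G. \<Sum>b\<in>carrier G. x (a \<otimes> b) * (bvec a \<otimes>\<^bsub>alg H\<^esub> bvec (inv b)) z)" for z
      unfolding lext_def sum_comult_fun by simp
    also have "\<dots> z = (\<Sum>a\<in>carrier G. \<Sum>b\<in>carrier G. if b = inv a then
        if a = z then x \<one> else 0 else 0)" for z
      by (intro sum.cong refl) (auto simp: bv)
    also have "\<dots> z = counit H x * \<one>\<^bsub>alg H\<^esub> z" for z
      by (cases "z \<in> carrier G") (simp_all add: fun_counit alg_ops cong: sum.cong)
    finally show "lext (basis H \<times> basis H) (\<lambda>(a, b). bvec a \<otimes>\<^bsub>alg H\<^esub> bantipode H b) (comult H x)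
      = (\<lambda>z. counit H x * \<one>\<^bsub>alg H\<^esub> z)" by (rule ext)
  qed
  show ?thesis
    unfolding hopf_algebra_def Let_def
  proof (intro conjI ballI allI)
    show "finite (basis H)" by simp
    show "complex_algebra (alg H)" by (rule complex_algebra_fun)
    fix b assume "b \<in> basis H"
    then show "bcomult H b \<in> carrier (alg (tensor_alg H H))" "bantipode H b \<in> carrier (alg H)"
      using bcomult_in(2)[of b] by (auto simp: alg_ops)
  qed (simp_all only: coassoc counit mult one antipode alg_ops(5),
      simp_all add: fun_counit fun_mult alg_ops)
qed

text \<open>Summation over the group coordinate turns convolution into a product. In the coproduct
  every v has exactly one partner u, so summing over both group coordinates leaves the coproduct of
  functions on G.\<close>

lemma hopf_surjection_proj: "hopf_surjection P H p"
proof -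
  have lin: "lin_map (alg P) (alg H) p"
    unfolding lin_map_fun_module[OF fun_module_alg fun_module_alg]
    by (auto simp: alg_ops carrier_fspace dvee_proj_eq)
  have mult: "p (x \<otimes>\<^bsub>alg P\<^esub> y) g = (p x \<otimes>\<^bsub>alg H\<^esub> p y) g" for x y g
  proof (cases "g \<in> carrier G")
    case True
    have "p (x \<otimes>\<^bsub>alg P\<^esub> y) g = (\<Sum>k\<in>carrier G. \<Sum>h\<in>carrier G. x (g, k) * y (g, inv k \<otimes> h))"
      using True by (simp add: dvee_proj_eq dvee_mult) (rule sum.swap)
    also have "\<dots> = (\<Sum>k\<in>carrier G. x (g, k) * (\<Sum>h\<in>carrier G. y (g, h)))"
      unfolding sum_distrib_left[symmetric]
      by (intro sum.cong refl arg_cong2[of _ _ _ _ "(*)"] sum_mult_left[of "inv _" "\<lambda>h. y (g, h)"]) simp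
    finally show ?thesis
      using True by (simp add: fun_mult dvee_proj_eq sum_distrib_right)
  qed (simp add: dvee_proj_eq dvee_mult fun_mult)
  have "p \<in> Ring.ring_hom (alg P) (alg H)"
    using lin mult
    by (intro ring_hom_memI) (auto simp: lin_map_def fun_eq_iff alg_ops dvee_proj_eq)
  moreover have "p ` carrier (alg P) = carrier (alg H)"
  proof
    show "carrier (alg H) \<subseteq> p ` carrier (alg P)"
    proof
      fix y assume "y \<in> carrier (alg H)"
      then show "y \<in> p ` carrier (alg P)"
        \<comment> \<open>The preimage of y is y tensor the unit of the group algebra.\<close>
        by (intro image_eqI[of _ _ "\<lambda>(g, h). if h = \<one> then y g else 0"])
          (auto simp: alg_ops carrier_fspace dvee_proj_eq fun_eq_iff)
    qed
  qed (use lin in \<open>auto simp: lin_map_def\<close>)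
  moreover have "comult H (p x) = tmap (basis P) (basis P) p p (comult P x)" for x
  proof -
    have "comult H (p x) (a, b) = tmap (basis P) (basis P) p p (comult P x) (a, b)" for a b
    proof (cases "a \<in> carrier G \<and> b \<in> carrier G")
      case True
      have "tmap (basis P) (basis P) p p (comult P x) (a, b)
          = (\<Sum>u\<in>carrier G. \<Sum>v\<in>carrier G. if u = gconj G b v then x (a \<otimes> b, v) else 0)"
        using True unfolding tmap_dvee[OF flinear_proj flinear_proj]
        by (simp add: dvee_proj_eq dvee_comult cong: sum.cong)
      also have "\<dots> = comult H (p x) (a, b)"
        using True by (subst sum.swap) (simp add: fun_comult dvee_proj_eq cong: sum.cong)
      finally show ?thesis ..
    next
      case False
      then show ?thesis
        unfolding tmap_dvee[OF flinear_proj flinear_proj] by (auto simp: dvee_proj_eq dvee_comult fun_comult)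
    qed
    then show ?thesis by (simp add: fun_eq_iff)
  qed
  moreover have "antipode H (p x) g = p (antipode P x) g" for x g
  proof (cases "g \<in> carrier G")
    case True
    then have "(\<Sum>h\<in>carrier G. x (inv g, gconj G g (inv h))) = (\<Sum>h\<in>carrier G. x (inv g, h))"
      using sum_gconj[OF True, of "\<lambda>h. x (inv g, h)"] sum_inv[of "\<lambda>h. x (inv g, gconj G g h)"] by simp
    with True show ?thesis
      by (simp add: fun_antipode dvee_antipode dvee_proj_eq)
  qed (simp add: fun_antipode dvee_antipode dvee_proj_eq)
  ultimately show ?thesis
    using lin by (auto simp: hopf_surjection_def fun_counit dvee_counit dvee_proj_eq)
qed

text \<open>The projection sums over the group part v of the second leg, and the twist condition
  leaves the single term v = s^-1 ks.\<close>

lemma dvee_coact: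
  "coact P p x = (\<lambda>((f, k), s). if f \<in> carrier G \<and> k \<in> carrier G \<and> s \<in> carrier G
     then x (f \<otimes> s, gconj G (inv s) k) else 0)"
proof -
  have "coact P p x ((f, k), s) = (if f \<in> carrier G \<and> k \<in> carrier G \<and> s \<in> carrier G
     then x (f \<otimes> s, gconj G (inv s) k) else 0)" for f k s
  proof -
    have "coact P p x ((f, k), s) = (\<Sum>v\<in>carrier G. comult P x ((f, k), s, v))"
      unfolding coact_def tmap_dvee[OF flinear_id flinear_proj] by (simp add: dvee_proj_eq)
    also have "\<dots> = (\<Sum>v\<in>carrier G. if v = gconj G (inv s) k then
        if f \<in> carrier G \<and> k \<in> carrier G \<and> s \<in> carrier G then x (f \<otimes> s, v) else 0 else 0)"
      by (intro sum.cong refl) (auto simp: dvee_comult)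
    finally show ?thesis by simp
  qed
  then show ?thesis by (simp add: fun_eq_iff)
qed

lemma can_map_dvee:
  "can_map P H p t = (\<lambda>((g, h), s). if g \<in> carrier G \<and> h \<in> carrier G \<and> s \<in> carrier G
     then \<Sum>k\<in>carrier G. t ((g, k), (g \<otimes> s, gconj G (inv s) (inv k \<otimes> h))) else 0)"
proof -
  have "can_map P H p t ((g, h), s) = (if g \<in> carrier G \<and> h \<in> carrier G \<and> s \<in> carrier G
     then \<Sum>k\<in>carrier G. t ((g, k), (g \<otimes> s, gconj G (inv s) (inv k \<otimes> h))) else 0)" for g h s
  proof (cases "g \<in> carrier G \<and> h \<in> carrier G \<and> s \<in> carrier G")
    case True
    let ?y = "\<lambda>k. (g \<otimes> s, gconj G (inv s) (inv k \<otimes> h))"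
    have "can_map P H p t ((g, h), s) = (\<Sum>x\<in>basis P. \<Sum>y\<in>basis P. t (x, y) *
        (\<Sum>k\<in>carrier G. bvec x (g, k) * bvec y (?y k)))"
      using True unfolding can_map_def lext_def sum.cartesian_product'
      by (simp add: dvee_fun_mult dvee_coact tprod_def alg_ops cong: sum.cong del: hopf_simps(3))
    also have "\<dots> = (\<Sum>k\<in>carrier G. \<Sum>x\<in>basis P. \<Sum>y\<in>basis P. if x = (g, k) then if y = ?y k then t (x, y) else 0 else 0)"
    proof -
      have "(\<Sum>x\<in>basis P. \<Sum>y\<in>basis P. t (x, y) * (\<Sum>k\<in>carrier G. bvec x (g, k) * bvec y (?y k)))
          = (\<Sum>x\<in>basis P. \<Sum>y\<in>basis P. \<Sum>k\<in>carrier G. if x = (g, k) then if y = ?y k then t (x, y) else 0 else 0)"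
        unfolding sum_distrib_left by (intro sum.cong refl) (auto simp: bvec_def)
      also have "\<dots> = (\<Sum>x\<in>basis P. \<Sum>k\<in>carrier G. \<Sum>y\<in>basis P. if x = (g, k) then if y = ?y k then t (x, y) else 0 else 0)"
        by (rule sum.cong[OF refl], rule sum.swap)
      finally show ?thesis
        by (simp only: sum.swap[of _ "basis P" "carrier G"])
    qed
    also have "\<dots> = (\<Sum>k\<in>carrier G. t ((g, k), ?y k))"
    proof (rule sum.cong[OF refl])
      fix k assume k: "k \<in> carrier G"
      then have "?y k \<in> basis P" "(g, k) \<in> basis P"
        using True by auto
      moreover from this have row: "(\<Sum>y\<in>basis P. if x = (g, k) then if y = ?y k then t (x, y) else 0 else 0)
          = (if x = (g, k) then t (x, ?y k) else 0)" for x
        by (cases "x = (g, k)") (simp_all add: finite_basis_dvee del: hopf_simps(3))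
      ultimately show "(\<Sum>x\<in>basis P. \<Sum>y\<in>basis P. if x = (g, k) then if y = ?y k then t (x, y) else 0 else 0) = t ((g, k), ?y k)"
        by (simp add: row finite_basis_dvee del: hopf_simps(3))
    qed
    finally show ?thesis
      using True by simp
  next
    case False
    then show ?thesis
      unfolding can_map_def lext_def by (intro trans[OF sum.neutral]) (auto simp: dvee_fun_mult)
  qed
  then show ?thesis by (simp add: fun_eq_iff)
qed

end

section \<open>Coinvariants and the canonical map\<close>

context finite_group
begin

section \<open>The coinvariants as a copy of the group algebra\<close>

abbreviation "CG \<equiv> alg (group_hopf G)"
abbreviation "A \<equiv> coinv P H p"

lemma gconj_cancel:
  assumes "a \<in> carrier G" "h \<in> carrier G" "k \<in> carrier G"
  shows "gconj G a h = gconj G a k \<longleftrightarrow> h = k"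
  using assms gconj_inv(1)[of a h] gconj_inv(1)[of a k] by metis

lemma dvee_incl_eq:
  "dvee_incl G y = (\<lambda>(f, k). if f \<in> carrier G \<and> k \<in> carrier G then y (gconj G f k) else 0)"
proof -
  have "dvee_incl G y (f, k) = (if f \<in> carrier G \<and> k \<in> carrier G then y (gconj G f k) else 0)" for f k
  proof -
    have b: "(\<Sum>f'\<in>carrier G. bvec (f', gconj G (inv f') g) (f, k))
        = (if g = gconj G f k then if f \<in> carrier G \<and> k \<in> carrier G then 1 else 0 else 0 :: complex)"
      if "g \<in> carrier G" for g
    proof -
      have "(\<Sum>f'\<in>carrier G. bvec (f', gconj G (inv f') g) (f, k))
        = (\<Sum>f'\<in>carrier G. if f' = f then if k = gconj G (inv f) g then 1 else 0 else 0 :: complex)"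
        by (intro sum.cong refl) (auto simp: bvec_def)
      also have "\<dots> = (if g = gconj G f k then if f \<in> carrier G \<and> k \<in> carrier G then 1 else 0 else 0)"
        using that by auto
      finally show ?thesis .
    qed
    have "dvee_incl G y (f, k) = (\<Sum>g\<in>carrier G. if g = gconj G f k then
        if f \<in> carrier G \<and> k \<in> carrier G then y g else 0 else 0)"
      unfolding dvee_incl_def lext_def by (intro sum.cong refl) (simp add: b)
    then show ?thesis by simp
  qed
  then show ?thesis by (simp add: fun_eq_iff)
qed

lemma flinear_incl: "flinear V (dvee_incl G)"
  by (simp add: dvee_incl_def)

lemma incl_closed: "dvee_incl G y \<in> carrier (alg P)"
  by (auto simp: dvee_incl_eq alg_ops carrier_fspace)

lemma coinv_iff:
  "x \<in> A \<longleftrightarrow> x \<in> carrier (alg P) \<and> (\<forall>f\<in>carrier G. \<forall>k\<in>carrier G. \<forall>s\<in>carrier G.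
     x (f \<otimes> s, gconj G (inv s) k) = x (f, k))"
proof -
  have "coact P p x = tprod x \<one>\<^bsub>alg H\<^esub> \<longleftrightarrow> (\<forall>f\<in>carrier G. \<forall>k\<in>carrier G. \<forall>s\<in>carrier G.
     x (f \<otimes> s, gconj G (inv s) k) = x (f, k))" if "x \<in> carrier (alg P)"
    using that by (auto simp: dvee_coact tprod_def fun_eq_iff alg_ops carrier_fspace)
  then show ?thesis
    by (auto simp: coinv_def)
qed

lemma incl_in_coinv: "dvee_incl G y \<in> A"
  using incl_closed by (auto simp: coinv_iff dvee_incl_eq gconj_gconj m_assoc)

text \<open>Invariance at the base point 1, translated by f, gives x(f, k) = x(1, fkf^-1). A
  coinvariant is thus determined by its values over the identity, and these are arbitrary.\<close>

lemma coinv_eq: "A = dvee_incl G ` carrier CG"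
proof
  show "A \<subseteq> dvee_incl G ` carrier CG"
  proof
    fix x assume x: "x \<in> A"
    then have "x \<in> carrier (alg P)"
      by (simp add: coinv_def)
    then have xc: "x (f, k) = 0" if "\<not> (f \<in> carrier G \<and> k \<in> carrier G)" for f k
      using that by (auto simp: alg_ops carrier_fspace)
    have "x = dvee_incl G (\<lambda>k. x (\<one>, k))"
    proof -
      have "x (f, k) = dvee_incl G (\<lambda>k. x (\<one>, k)) (f, k)" for f k
      proof (cases "f \<in> carrier G \<and> k \<in> carrier G")
        case True
        have inv: "\<forall>f\<in>carrier G. \<forall>k\<in>carrier G. \<forall>s\<in>carrier G. x (f \<otimes> s, gconj G (inv s) k) = x (f, k)"
          using x by (simp add: coinv_iff)
        show ?thesis
          using bspec[OF bspec[OF bspec[OF inv, of \<one>], of "gconj G f k"], of f] True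
          by (simp add: dvee_incl_eq)
      qed (use xc in \<open>auto simp: dvee_incl_eq\<close>)
      from this[of "fst z" "snd z" for z] show ?thesis
        unfolding prod.collapse by (rule ext)
    qed
    moreover have "(\<lambda>k. x (\<one>, k)) \<in> carrier CG"
      using xc by (auto simp: alg_ops carrier_fspace)
    ultimately show "x \<in> dvee_incl G ` carrier CG" by blast
  qed
qed (auto intro: incl_in_coinv)

lemma inj_incl: "inj_on (dvee_incl G) (carrier CG)"
proof (rule inj_onI)
  fix x y assume xy: "x \<in> carrier CG" "y \<in> carrier CG" and eq: "dvee_incl G x = dvee_incl G y"
  have "x k = y k" for k
    using fun_cong[OF eq, of "(\<one>, k)"] xy
    by (cases "k \<in> carrier G") (auto simp: dvee_incl_eq alg_ops carrier_fspace)
  then show "x = y" by (rule ext)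
qed

text \<open>Over each f the inclusion is composition with conjugation by f, an automorphism, and
  this preserves convolution.\<close>

lemma incl_mult: "dvee_incl G (x \<otimes>\<^bsub>CG\<^esub> y) = dvee_incl G x \<otimes>\<^bsub>alg P\<^esub> dvee_incl G y"
proof -
  have "dvee_incl G (x \<otimes>\<^bsub>CG\<^esub> y) (f, k) = (dvee_incl G x \<otimes>\<^bsub>alg P\<^esub> dvee_incl G y) (f, k)" for f k
  proof (cases "f \<in> carrier G \<and> k \<in> carrier G")
    case True
    then have f: "f \<in> carrier G" and k: "k \<in> carrier G" by auto
    have "dvee_incl G (x \<otimes>\<^bsub>CG\<^esub> y) (f, k) = (\<Sum>l\<in>carrier G. x l * y (inv l \<otimes> gconj G f k))"
      using True by (simp add: dvee_incl_eq group_mult)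
    also have "\<dots> = (\<Sum>l\<in>carrier G. x (gconj G f l) * y (inv (gconj G f l) \<otimes> gconj G f k))"
      by (rule sum_gconj[OF f, symmetric])
    also have "\<dots> = (dvee_incl G x \<otimes>\<^bsub>alg P\<^esub> dvee_incl G y) (f, k)"
      using True by (simp add: dvee_mult dvee_incl_eq gconj_mult inv_gconj cong: sum.cong)
    finally show ?thesis .
  qed (auto simp: dvee_incl_eq dvee_mult)
  then show ?thesis by (simp add: fun_eq_iff)
qed

lemma incl_one: "dvee_incl G \<one>\<^bsub>CG\<^esub> = \<one>\<^bsub>alg P\<^esub>"
proof -
  have "gconj G f k = \<one> \<longleftrightarrow> k = \<one>" if "f \<in> carrier G" "k \<in> carrier G" for f k
    using gconj_eq_iff[of f k \<one>] that by auto
  then show ?thesis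
    by (auto simp: dvee_incl_eq alg_ops bvec_def fun_eq_iff)
qed

lemma lin_closed_coinv: "lin_closed A"
  unfolding coinv_eq by (intro lin_closed_image flinear_incl) (simp add: alg_ops)

lemma one_in_coinv: "\<one>\<^bsub>alg P\<^esub> \<in> A"
  using incl_in_coinv[of "\<one>\<^bsub>CG\<^esub>"] by (simp add: incl_one)

lemma group_mult_closed: "x \<otimes>\<^bsub>CG\<^esub> y \<in> carrier CG"
  by (simp add: group_mult alg_ops carrier_fspace)

lemma mult_in_coinv: "x \<in> A \<Longrightarrow> y \<in> A \<Longrightarrow> x \<otimes>\<^bsub>alg P\<^esub> y \<in> A"
  unfolding coinv_eq by (auto simp: incl_mult[symmetric] group_mult_closed)

lemma coinv_subset: "A \<subseteq> carrier (alg P)"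
  by (auto simp: coinv_def)

lemma fun_module_base_algebra: "fun_module (base_algebra P H p)"
  unfolding base_algebra_def by (intro fun_module_carrier_update fun_module_alg lin_closed_coinv)

lemma algebra_iso_incl: "algebra_iso CG (base_algebra P H p) (dvee_incl G)"
proof -
  have lin: "lin_map CG (base_algebra P H p) (dvee_incl G)"
    unfolding lin_map_fun_module[OF fun_module_alg fun_module_base_algebra]
    using incl_in_coinv by (simp add: flinear_incl base_algebra_def)
  have "dvee_incl G \<in> Ring.ring_hom CG (base_algebra P H p)"
    using lin by (intro ring_hom_memI) (auto simp: lin_map_def base_algebra_def incl_mult incl_one)
  moreover have "bij_betw (dvee_incl G) (carrier CG) (carrier (base_algebra P H p))"
    using inj_incl by (simp add: bij_betw_def base_algebra_def coinv_eq)
  ultimately show ?thesis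
    using lin by (simp add: algebra_iso_def ring_iso_def)
qed

text \<open>Modulo \<open>balancing\<close>, every basis vector \<open>(a, u) \<otimes> (g, h)\<close> is equivalent to one with \<open>h = \<one>\<close>,
  because \<open>(g, h)\<close> is the product of the coinvariant \<open>ghg\<^sup>-\<^sup>1\<close> and \<open>(g, \<one>)\<close>.\<close>

definition normal_form :: "('a \<times> 'a) \<times> ('a \<times> 'a) \<Rightarrow> ('a \<times> 'a) \<times> ('a \<times> 'a)" where
  "normal_form = (\<lambda>((a, u), (g, h)). ((a, u \<otimes> gconj G (inv a) (gconj G g h)), (g, \<one>)))"

lemma balancing_subset: "balancing P H p \<subseteq> carrier (fspace (basis P \<times> basis P))"
  and balancing_eq: "balancing P H p = fspan
     {(\<lambda>u. tprod (x \<otimes>\<^bsub>alg P\<^esub> a) y u - tprod x (a \<otimes>\<^bsub>alg P\<^esub> y) u) | x a y.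
        x \<in> carrier (alg P) \<and> a \<in> A \<and> y \<in> carrier (alg P)}" (is "_ = fspan ?X")
proof -
  have "?X \<subseteq> carrier (fspace (basis P \<times> basis P))"
  proof clarify
    fix x a y assume "x \<in> carrier (alg P)" "a \<in> A" "y \<in> carrier (alg P)"
    then show "(\<lambda>u. tprod (x \<otimes>\<^bsub>alg P\<^esub> a) y u - tprod x (a \<otimes>\<^bsub>alg P\<^esub> y) u) \<in> carrier (fspace (basis P \<times> basis P))"
      using complex_algebraD(2)[OF complex_algebra_dvee] coinv_subset unfolding alg_ops(1)
      by (intro lin_closed_diff lin_closed_fspace tprod_in_fspace) auto
  qed
  then show "balancing P H p = fspan ?X" "balancing P H p \<subseteq> carrier (fspace (basis P \<times> basis P))"
    unfolding balancing_def by (simp_all add: lin_span_eq_fspan fspan_minimal del: hopf_simps)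
qed

lemma lin_closed_balancing: "lin_closed (balancing P H p)"
  by (simp add: balancing_eq)

lemma bvec_normal_form:
  assumes "z \<in> basis P \<times> basis P"
  shows "(\<lambda>u. bvec z u - bvec (normal_form z) u) \<in> balancing P H p"
proof -
  obtain a u g h where z: "z = ((a, u), (g, h))" "a \<in> carrier G" "u \<in> carrier G" "g \<in> carrier G" "h \<in> carrier G"
    using assms by auto
  \<comment> \<open>This coinvariant has group part h over g and a^-1 ghg^-1 a over a. Moving it
    across the tensor sign removes h on the right and produces the extra factor of
    \<open>normal_form\<close> on the left.\<close>
  let ?c = "dvee_incl G (bvec (gconj G g h))"
  have eq: "gconj G g h = gconj G f k \<longleftrightarrow> k = gconj G (inv f) (gconj G g h)"
    if "f \<in> carrier G" "k \<in> carrier G" for f k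
    using z that by auto
  have "bvec (a, u) \<otimes>\<^bsub>alg P\<^esub> ?c = bvec (a, u \<otimes> gconj G (inv a) (gconj G g h))"
  proof -
    have "(bvec (a, u) \<otimes>\<^bsub>alg P\<^esub> ?c) (f, k) = bvec (a, u \<otimes> gconj G (inv a) (gconj G g h)) (f, k)" for f k
    proof (cases "f \<in> carrier G \<and> k \<in> carrier G")
      case True
      have mult: "(bvec (a, u) \<otimes>\<^bsub>alg P\<^esub> ?c) (f, k)
          = (\<Sum>l\<in>carrier G. bvec (a, u) (f, l) * ?c (f, inv l \<otimes> k))"
        using True by (simp add: dvee_mult)
      have "(bvec (a, u) \<otimes>\<^bsub>alg P\<^esub> ?c) (f, k) = (\<Sum>l\<in>carrier G. if l = u then
          if f = a \<and> gconj G f (inv u \<otimes> k) = gconj G g h then 1 else 0 else 0)"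
        unfolding mult unfolding dvee_incl_eq by (intro sum.cong refl) (use True z in \<open>auto simp: bvec_def\<close>)
      also have "\<dots> = (if f = a \<and> gconj G f (inv u \<otimes> k) = gconj G g h then 1 else 0)"
        using z by simp
      also have "\<dots> = bvec (a, u \<otimes> gconj G (inv a) (gconj G g h)) (f, k)"
      proof -
        have "gconj G a (inv u \<otimes> k) = gconj G g h \<longleftrightarrow> k = u \<otimes> gconj G (inv a) (gconj G g h)"
          using gconj_eq_iff[of a "inv u \<otimes> k" "gconj G g h"]
            eq_mult_iff(1)[of u "gconj G (inv a) (gconj G g h)" k] True z(2-5)
          by (metis gconj_closed inv_closed m_closed)
        then show ?thesis by (auto simp: bvec_def)
      qed
      finally show ?thesis .
    qed (use z in \<open>auto simp: dvee_mult bvec_def\<close>)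
    then show ?thesis by (simp add: fun_eq_iff)
  qed
  moreover have "?c \<otimes>\<^bsub>alg P\<^esub> bvec (g, \<one>) = bvec (g, h)"
  proof -
    have "(?c \<otimes>\<^bsub>alg P\<^esub> bvec (g, \<one>)) (f, k) = bvec (g, h) (f, k)" for f k
    proof (cases "f \<in> carrier G \<and> k \<in> carrier G")
      case True
      have mult: "(?c \<otimes>\<^bsub>alg P\<^esub> bvec (g, \<one>)) (f, k)
          = (\<Sum>l\<in>carrier G. ?c (f, l) * bvec (g, \<one>) (f, inv l \<otimes> k))"
        using True by (simp add: dvee_mult)
      have "(?c \<otimes>\<^bsub>alg P\<^esub> bvec (g, \<one>)) (f, k) = (\<Sum>l\<in>carrier G. if l = k then
          if f = g \<and> gconj G f k = gconj G g h then 1 else 0 else 0)"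
        unfolding mult unfolding dvee_incl_eq
        by (intro sum.cong refl) (use True z in \<open>auto simp: bvec_def inv_mult_eq_one_iff\<close>)
      also have "\<dots> = (if f = g \<and> gconj G f k = gconj G g h then 1 else 0)"
        using True by simp
      also have "\<dots> = bvec (g, h) (f, k)"
        using True z by (auto simp: bvec_def gconj_cancel)
      finally show ?thesis .
    qed (use z in \<open>auto simp: dvee_mult bvec_def\<close>)
    then show ?thesis by (simp add: fun_eq_iff)
  qed
  ultimately have "(\<lambda>w. bvec (normal_form z) w - bvec z w)
      = (\<lambda>w. tprod (bvec (a, u) \<otimes>\<^bsub>alg P\<^esub> ?c) (bvec (g, \<one>)) w - tprod (bvec (a, u)) (?c \<otimes>\<^bsub>alg P\<^esub> bvec (g, \<one>)) w)"
    by (simp add: z(1) normal_form_def tprod_bvec)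
  also have "\<dots> \<in> balancing P H p"
    unfolding balancing_eq using z
    by (intro fspan_base CollectI exI conjI refl) (auto simp: alg_ops incl_in_coinv)
  finally have "(\<lambda>w. bvec (normal_form z) w - bvec z w) \<in> balancing P H p" .
  then show ?thesis
    using lin_closed_minus[OF lin_closed_balancing] by fastforce
qed

text \<open>One inclusion says that the canonical map is balanced. For the other, the canonical map
  separates normal forms: the sum of the coefficients of t over all basis vectors with normal form
  ((a, v), (g, 1)) is the value of the canonical map at ((a, v), a^-1 g). If all these values
  vanish, t is a combination of differences between basis vectors and their normal forms.\<close>

lemma can_map_kernel:
  "balancing P H p = {t \<in> carrier (fspace (basis P \<times> basis P)). can_map P H p t = (\<lambda>_. 0)}"
proof
  let ?N = "{t \<in> carrier (fspace (basis P \<times> basis P)). can_map P H p t = (\<lambda>_. 0)}"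
  have "lin_closed {t \<in> carrier (fspace (basis P \<times> basis P)). can_map P H p t \<in> {\<lambda>_. 0}}"
  proof (rule lin_closed_kernel[OF lin_closed_fspace])
    show "lin_closed {\<lambda>_. 0}"
      by (simp add: lin_closed_def)
  qed (simp add: can_map_def)
  then have N: "lin_closed ?N" by simp
  show "balancing P H p \<subseteq> ?N"
  proof (subst balancing_eq, rule fspan_minimal[OF N], clarify, intro conjI)
    fix x a y assume x: "x \<in> carrier (alg P)" and a: "a \<in> A" and y: "y \<in> carrier (alg P)"
    let ?t = "\<lambda>u. tprod (x \<otimes>\<^bsub>alg P\<^esub> a) y u - tprod x (a \<otimes>\<^bsub>alg P\<^esub> y) u"
    show "?t \<in> carrier (fspace (basis P \<times> basis P))"
      using x a y balancing_subset unfolding balancing_eq by (blast intro: fspan_base)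
    have "(\<Sum>k\<in>carrier G. ?t ((g, k), (g \<otimes> s, gconj G (inv s) (inv k \<otimes> h)))) = 0"
      if g: "g \<in> carrier G" and h: "h \<in> carrier G" and s: "s \<in> carrier G" for g h s
    proof -
      have "(\<Sum>k\<in>carrier G. tprod (x \<otimes>\<^bsub>alg P\<^esub> a) y ((g, k), (g \<otimes> s, gconj G (inv s) (inv k \<otimes> h))))
          = (\<Sum>l\<in>carrier G. \<Sum>k\<in>carrier G. x (g, l) * a (g, inv l \<otimes> k) * y (g \<otimes> s, gconj G (inv s) (inv k \<otimes> h)))"
        using that by (simp add: tprod_def dvee_mult sum_distrib_right cong: sum.cong) (rule sum.swap)
      also have "\<dots> = (\<Sum>l\<in>carrier G. \<Sum>k\<in>carrier G. x (g, l) * a (g, k) * y (g \<otimes> s, gconj G (inv s) (inv k \<otimes> (inv l \<otimes> h))))"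
      proof (rule sum.cong[OF refl])
        fix l assume l: "l \<in> carrier G"
        show "(\<Sum>k\<in>carrier G. x (g, l) * a (g, inv l \<otimes> k) * y (g \<otimes> s, gconj G (inv s) (inv k \<otimes> h)))
          = (\<Sum>k\<in>carrier G. x (g, l) * a (g, k) * y (g \<otimes> s, gconj G (inv s) (inv k \<otimes> (inv l \<otimes> h))))"
          using l h by (subst sum_mult_left[symmetric, OF l]) (simp add: word_simps cong: sum.cong)
      qed
      \<comment> \<open>Coinvariance moves the argument of a from g to gs, where y is evaluated.
        Conjugating the summation variable by s then exhibits the product ay at gs.\<close>
      also have "\<dots> = (\<Sum>l\<in>carrier G. \<Sum>k\<in>carrier G. x (g, l) * a (g \<otimes> s, gconj G (inv s) k)
          * y (g \<otimes> s, gconj G (inv s) (inv k \<otimes> (inv l \<otimes> h))))"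
        using a g s by (simp add: coinv_iff cong: sum.cong)
      also have "\<dots> = (\<Sum>l\<in>carrier G. \<Sum>k\<in>carrier G. x (g, l) * a (g \<otimes> s, k)
          * y (g \<otimes> s, inv k \<otimes> gconj G (inv s) (inv l \<otimes> h)))"
      proof (rule sum.cong[OF refl])
        fix l assume l: "l \<in> carrier G"
        have "(\<Sum>k\<in>carrier G. x (g, l) * a (g \<otimes> s, k) * y (g \<otimes> s, inv k \<otimes> gconj G (inv s) (inv l \<otimes> h)))
           = (\<Sum>k\<in>carrier G. x (g, l) * a (g \<otimes> s, gconj G (inv s) k)
              * y (g \<otimes> s, inv (gconj G (inv s) k) \<otimes> gconj G (inv s) (inv l \<otimes> h)))"
          by (rule sum_gconj[symmetric]) (simp add: s)
        also have "\<dots> = (\<Sum>k\<in>carrier G. x (g, l) * a (g \<otimes> s, gconj G (inv s) k)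
          * y (g \<otimes> s, gconj G (inv s) (inv k \<otimes> (inv l \<otimes> h))))"
          using l h s by (intro sum.cong refl) (simp add: inv_gconj gconj_mult)
        finally show "(\<Sum>k\<in>carrier G. x (g, l) * a (g \<otimes> s, gconj G (inv s) k)
          * y (g \<otimes> s, gconj G (inv s) (inv k \<otimes> (inv l \<otimes> h))))
          = (\<Sum>k\<in>carrier G. x (g, l) * a (g \<otimes> s, k) * y (g \<otimes> s, inv k \<otimes> gconj G (inv s) (inv l \<otimes> h)))" ..
      qed
      also have "\<dots> = (\<Sum>k\<in>carrier G. tprod x (a \<otimes>\<^bsub>alg P\<^esub> y) ((g, k), (g \<otimes> s, gconj G (inv s) (inv k \<otimes> h))))"
        using that by (simp add: tprod_def dvee_mult sum_distrib_left mult.assoc cong: sum.cong)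
      finally show ?thesis
        by (simp add: sum_subtractf)
    qed
    then show "can_map P H p ?t = (\<lambda>_. 0)"
      by (auto simp: can_map_dvee fun_eq_iff)
  qed
next
  show "{t \<in> carrier (fspace (basis P \<times> basis P)). can_map P H p t = (\<lambda>_. 0)} \<subseteq> balancing P H p"
  proof clarify
    fix t assume t: "t \<in> carrier (fspace (basis P \<times> basis P))" and ker: "can_map P H p t = (\<lambda>_. 0)"
    have nf: "(\<Sum>z\<in>basis P \<times> basis P. t z * bvec (normal_form z) ((a, v), (g, w))) = 0" for a v g w
    proof (cases "a \<in> carrier G \<and> v \<in> carrier G \<and> g \<in> carrier G \<and> w = \<one>")
      case True
      then have avg: "a \<in> carrier G" "v \<in> carrier G" "g \<in> carrier G" "w = \<one>" by auto
      have "(\<Sum>z\<in>basis P \<times> basis P. t z * bvec (normal_form z) ((a, v), (g, w)))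
          = (\<Sum>a'\<in>carrier G. \<Sum>u\<in>carrier G. \<Sum>g'\<in>carrier G. \<Sum>h\<in>carrier G. if a' = a then if g' = g then
              if h = gconj G (inv g \<otimes> a) (inv u \<otimes> v) then t ((a', u), (g', h)) else 0 else 0 else 0)"
        unfolding hopf_simps sum.cartesian_product'
      proof (intro sum.cong refl)
        fix a' u g' h assume "a' \<in> carrier G" "u \<in> carrier G" "g' \<in> carrier G" "h \<in> carrier G"
        moreover have "v = u \<otimes> gconj G (inv a \<otimes> g) h \<longleftrightarrow> h = gconj G (inv g \<otimes> a) (inv u \<otimes> v)"
          if "u \<in> carrier G" "h \<in> carrier G"
        proof -
          have "v = u \<otimes> gconj G (inv a \<otimes> g) h \<longleftrightarrow> gconj G (inv a \<otimes> g) h = inv u \<otimes> v"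
            using that avg by (intro eq_mult_iff(1)) auto
          also have "\<dots> \<longleftrightarrow> h = gconj G (inv (inv a \<otimes> g)) (inv u \<otimes> v)"
            using gconj_eq_iff[of "inv a \<otimes> g" h "inv u \<otimes> v"] that avg(1-3)
            by (metis inv_closed m_closed)
          finally show ?thesis
            using avg by (simp add: inv_mult_group)
        qed
        ultimately show "t ((a', u), g', h) * bvec (normal_form ((a', u), g', h)) ((a, v), g, w)
          = (if a' = a then if g' = g then
              if h = gconj G (inv g \<otimes> a) (inv u \<otimes> v) then t ((a', u), (g', h)) else 0 else 0 else 0)"
          using avg by (auto simp: normal_form_def bvec_def gconj_gconj)
      qed
      also have "\<dots> = (\<Sum>a'\<in>carrier G. if a' = a then (\<Sum>u\<in>carrier G. \<Sum>g'\<in>carrier G. if g' = g then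
            (\<Sum>h\<in>carrier G. if h = gconj G (inv g \<otimes> a) (inv u \<otimes> v) then t ((a', u), (g', h)) else 0) else 0) else 0)"
        (is "sum ?L _ = sum ?R _")
      proof (rule sum.cong[OF refl])
        fix a'
        show "?L a' = ?R a'"
          by (cases "a' = a") (simp only: simp_thms if_True, intro sum.cong refl, simp, simp)
      qed
      also have "\<dots> = (\<Sum>u\<in>carrier G. t ((a, u), (g, gconj G (inv g \<otimes> a) (inv u \<otimes> v))))"
        using avg by (simp cong: sum.cong)
      also have "\<dots> = can_map P H p t ((a, v), inv a \<otimes> g)"
        using avg by (simp add: can_map_dvee inv_mult_group)
      finally show ?thesis
        by (simp add: ker)
    next
      case False
      then show ?thesis
        by (intro sum.neutral) (auto simp: normal_form_def bvec_def)
    qed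
    have "t = (\<lambda>w. \<Sum>z\<in>basis P \<times> basis P. t z * (bvec z w - bvec (normal_form z) w))"
    proof
      fix w
      have "(\<Sum>z\<in>basis P \<times> basis P. t z * bvec z w) = t w"
        by (rule fun_cong[OF fspace_expand[OF _ t], symmetric]) simp
      moreover have "(\<Sum>z\<in>basis P \<times> basis P. t z * bvec (normal_form z) w) = 0"
        using nf[of "fst (fst w)" "snd (fst w)" "fst (snd w)" "snd (snd w)"] by (simp only: prod.collapse)
      ultimately show "t w = (\<Sum>z\<in>basis P \<times> basis P. t z * (bvec z w - bvec (normal_form z) w))"
        by (simp add: right_diff_distrib sum_subtractf del: hopf_simps)
    qed
    also have "\<dots> \<in> balancing P H p"
      by (rule lin_closed_lin_comb[OF lin_closed_balancing bvec_normal_form])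
    finally show "t \<in> balancing P H p" .
  qed
qed

lemma hopf_galois_dvee: "hopf_galois P H p"
proof (rule hopf_galoisI[OF can_map_kernel])
  show "can_map P H p ` carrier (fspace (basis P \<times> basis P)) = carrier (fspace (basis P \<times> basis H))"
  proof
    show "can_map P H p ` carrier (fspace (basis P \<times> basis P)) \<subseteq> carrier (fspace (basis P \<times> basis H))"
      by (auto simp: can_map_dvee carrier_fspace)
    show "carrier (fspace (basis P \<times> basis H)) \<subseteq> can_map P H p ` carrier (fspace (basis P \<times> basis P))"
    proof
      fix y assume y: "y \<in> carrier (fspace (basis P \<times> basis H))"
      \<comment> \<open>The preimage is supported on normal forms: the second factor carries the
        group element 1, and its point g encodes the value a^-1 g of the last variable.\<close>
      define t where "t = (\<lambda>((a, v), (g, w)). if a \<in> carrier G \<and> g \<in> carrier G \<and> w = \<one> then y ((a, v), inv a \<otimes> g) else 0)"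
      have "can_map P H p t ((g, h), s) = y ((g, h), s)" for g h s
      proof (cases "g \<in> carrier G \<and> h \<in> carrier G \<and> s \<in> carrier G")
        case True
        have "gconj G (inv s) (inv k \<otimes> h) = \<one> \<longleftrightarrow> k = h" if "k \<in> carrier G" for k
          using gconj_eq_iff[of "inv s" "inv k \<otimes> h" \<one>] that True inv_mult_eq_one_iff[of k h] by auto
        then have "can_map P H p t ((g, h), s) = (\<Sum>k\<in>carrier G. if k = h then y ((g, k), s) else 0)"
          using True by (simp add: can_map_dvee t_def cong: sum.cong)
        also have "\<dots> = y ((g, h), s)"
          using True by simp
        finally show ?thesis .
      next
        case False
        then show ?thesis
          using y by (auto simp: can_map_dvee carrier_fspace)
      qed
      then have "y = can_map P H p t"
        by (auto simp: fun_eq_iff)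
      moreover have "t \<in> carrier (fspace (basis P \<times> basis P))"
        using y by (auto simp: t_def carrier_fspace)
      ultimately show "y \<in> can_map P H p ` carrier (fspace (basis P \<times> basis P))" by blast
    qed
  qed
qed

end

section \<open>The calculus on \<open>D\<^sup>\<or>(G)\<close>\<close>

text \<open>Turns formulas for products of two basis vectors into formulas for an arbitrary element
  t of a tensor product.\<close>

lemma sum_bvec_pair:
  assumes "finite B" "finite C" "\<And>k. k \<in> I \<Longrightarrow> a k \<in> B" "\<And>k. k \<in> I \<Longrightarrow> b k \<in> C"
  shows "(\<Sum>u\<in>B \<times> C. t u * (\<Sum>k\<in>I. \<phi> k * (bvec (fst u) (a k) * bvec (snd u) (b k))))
    = (\<Sum>k\<in>I. \<phi> k * t (a k, b k))"
proof -
  have "(\<Sum>u\<in>B \<times> C. t u * (\<Sum>k\<in>I. \<phi> k * (bvec (fst u) (a k) * bvec (snd u) (b k))))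
      = (\<Sum>u\<in>B \<times> C. \<Sum>k\<in>I. if u = (a k, b k) then \<phi> k * t u else 0)"
    unfolding sum_distrib_left by (intro sum.cong refl) (auto simp: bvec_def)
  also have "\<dots> = (\<Sum>k\<in>I. \<Sum>u\<in>B \<times> C. if u = (a k, b k) then \<phi> k * t u else 0)"
    by (rule sum.swap)
  also have "\<dots> = (\<Sum>k\<in>I. \<phi> k * t (a k, b k))"
    using assms by (intro sum.cong refl) simp
  finally show ?thesis .
qed

locale class_rep = finite_group +
  fixes r :: 'a and C :: "'a set" and q :: "'a \<Rightarrow> 'a" and J :: "'i set"
    and \<pi> :: "'a \<Rightarrow> 'i \<Rightarrow> 'i \<Rightarrow> complex"
  assumes r: "r \<in> carrier G" and C_def: "C = conj_class G r" and q_closed: "q \<in> C \<rightarrow> carrier G"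
    and q: "\<And>c. c \<in> C \<Longrightarrow> q c \<otimes> r \<otimes> inv (q c) = c"
    and irreducible: "irreducible_rep (centralizer G r) J \<pi>"
begin

section \<open>The centraliser and the induced representation\<close>

abbreviation "Z \<equiv> centralizer G r"
abbreviation "K \<equiv> C \<times> J"
abbreviation "\<rho> \<equiv> pi_tilde G q \<pi>"
abbreviation "kron \<equiv> (\<lambda>m n. if m = n then 1 else 0)"
abbreviation "\<Omega> \<equiv> dvee_calculus G C q J \<pi>"

lemma C_subset: "c \<in> C \<Longrightarrow> c \<in> carrier G"
  using r by (auto simp: C_def conj_class_def)

lemma finite_C [simp]: "finite C"
  by (simp add: C_def conj_class_def)

lemma finite_J [simp]: "finite J"
  using irreducible by (simp add: irreducible_rep_def group_rep_def)

lemma gconj_C: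
  assumes "c \<in> C" "g \<in> carrier G"
  shows "gconj G g c \<in> C"
proof -
  obtain h where "h \<in> carrier G" "c = gconj G h r"
    using assms(1) by (auto simp: C_def conj_class_def)
  then show ?thesis
    using assms r by (simp add: C_def conj_class_def gconj_gconj)
qed

lemma q_in: "c \<in> C \<Longrightarrow> q c \<in> carrier G"
  using q_closed by auto

lemma gconj_q: "c \<in> C \<Longrightarrow> gconj G (q c) r = c"
  using q by (simp add: gconj_def)

lemma centralizer_simps [simp]:
  "x \<otimes>\<^bsub>Z\<^esub> y = x \<otimes> y" "\<one>\<^bsub>Z\<^esub> = \<one>"
  by (simp_all add: centralizer_def)

lemma carrier_centralizer: "x \<in> carrier Z \<longleftrightarrow> x \<in> carrier G \<and> gconj G x r = r"
proof -
  have "x \<otimes> r = r \<otimes> x \<longleftrightarrow> gconj G x r = r" if "x \<in> carrier G"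
    using that r by (metis gconj_def inv_solve_right m_closed)
  then show ?thesis
    by (auto simp: centralizer_def)
qed

lemma subgroup_centralizer: "subgroup (carrier Z) G"
proof (rule subgroupI)
  fix x y assume "x \<in> carrier Z" "y \<in> carrier Z"
  then show "x \<otimes> y \<in> carrier Z"
    using r by (simp add: carrier_centralizer gconj_gconj[symmetric])
next
  fix x assume "x \<in> carrier Z"
  then show "inv x \<in> carrier Z"
    using r gconj_inv(1)[of x r] by (simp add: carrier_centralizer)
next
  have "\<one> \<in> carrier Z"
    using r by (simp add: carrier_centralizer)
  then show "carrier Z \<noteq> {}" by blast
qed (simp add: carrier_centralizer subset_iff)

lemma group_centralizer: "group Z"
  using subgroup.subgroup_is_group[OF subgroup_centralizer is_group] by (simp add: centralizer_def)

lemma inv_centralizer: "x \<in> carrier Z \<Longrightarrow> inv\<^bsub>Z\<^esub> x = inv x"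
  using m_inv_consistent[OF subgroup_centralizer] by (simp add: centralizer_def)

lemma finite_centralizer: "finite (carrier Z)"
  by (rule finite_subset[OF subgroup.subset[OF subgroup_centralizer]]) simp

lemma zeta_in:
  assumes "c \<in> C" "g \<in> carrier G"
  shows "zeta G q c g \<in> carrier Z"
proof -
  have "gconj G (inv (q (gconj G g c)) \<otimes> g \<otimes> q c) r
      = gconj G (inv (q (gconj G g c))) (gconj G g (gconj G (q c) r))"
    using assms r q_in gconj_C by (simp add: gconj_gconj m_assoc)
  also have "\<dots> = gconj G (inv (q (gconj G g c))) (gconj G (q (gconj G g c)) r)"
    using assms gconj_C by (simp add: gconj_q)
  also have "\<dots> = r"
    using assms r q_in gconj_C by simp
  finally show ?thesis
    using assms q_in gconj_C by (simp add: zeta_def carrier_centralizer)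
qed

text \<open>The inner factors \<open>q\<close> cancel, since g starts at the point that h reaches.
  This cocycle identity is what makes \<open>\<rho>\<close> multiplicative.\<close>

lemma zeta_mult:
  assumes "c \<in> C" "g \<in> carrier G" "h \<in> carrier G"
  shows "zeta G q c (g \<otimes> h) = zeta G q (gconj G h c) g \<otimes> zeta G q c h"
  using assms q_in gconj_C C_subset by (simp add: zeta_def gconj_gconj word_simps)

lemma zeta_one: "c \<in> C \<Longrightarrow> zeta G q c \<one> = \<one>"
  using q_in C_subset by (simp add: zeta_def)

lemma inv_zeta:
  assumes "c \<in> C" "g \<in> carrier G"
  shows "inv (zeta G q c g) = zeta G q (gconj G g c) (inv g)"
  using assms q_in gconj_C C_subset by (simp add: zeta_def word_simps)

lemma pi_one: "i \<in> J \<Longrightarrow> j \<in> J \<Longrightarrow> \<pi> \<one> i j = (if i = j then 1 else 0)"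
  using irreducible by (simp add: irreducible_rep_def group_rep_def)

lemma pi_mult: "g \<in> carrier Z \<Longrightarrow> h \<in> carrier Z \<Longrightarrow> i \<in> J \<Longrightarrow> j \<in> J
    \<Longrightarrow> \<pi> (g \<otimes> h) i j = (\<Sum>l\<in>J. \<pi> g i l * \<pi> h l j)"
  using irreducible by (simp add: irreducible_rep_def group_rep_def)

lemma rho_eq: "\<rho> g m n = (if fst m = gconj G g (fst n) then \<pi> (zeta G q (fst n) g) (snd m) (snd n) else 0)"
  by (simp add: pi_tilde_def case_prod_unfold)

lemma rho_one: "m \<in> K \<Longrightarrow> n \<in> K \<Longrightarrow> \<rho> \<one> m n = (if m = n then 1 else 0)"
  using C_subset by (auto simp: rho_eq zeta_one pi_one prod_eq_iff)

text \<open>\<open>\<rho>\<close> is the representation induced from the centraliser, with g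
  carrying the block over c to the block over gcg^-1. In the matrix product only the intermediate
  block over hdh^-1 contributes, and there the cocycle identity applies.\<close>

lemma rho_mult:
  assumes "g \<in> carrier G" "h \<in> carrier G" "m \<in> K" "n \<in> K"
  shows "\<rho> (g \<otimes> h) m n = (\<Sum>l\<in>K. \<rho> g m l * \<rho> h l n)"
proof -
  obtain c i d j where mn: "m = (c, i)" "n = (d, j)" "c \<in> C" "i \<in> J" "d \<in> C" "j \<in> J"
    using assms by auto
  let ?e = "gconj G h d"
  have "(\<Sum>l\<in>K. \<rho> g m l * \<rho> h l n) = (\<Sum>e\<in>C. if e = ?e then if c = gconj G g e then
      (\<Sum>l\<in>J. \<pi> (zeta G q e g) i l * \<pi> (zeta G q d h) l j) else 0 else 0)"
    unfolding sum.cartesian_product' by (intro sum.cong refl) (simp add: rho_eq mn)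
  also have "\<dots> = (if c = gconj G g ?e then (\<Sum>l\<in>J. \<pi> (zeta G q ?e g) i l * \<pi> (zeta G q d h) l j) else 0)"
    using assms mn gconj_C by simp
  also have "\<dots> = \<rho> (g \<otimes> h) m n"
    using assms mn C_subset gconj_C
    by (simp add: rho_eq gconj_gconj zeta_mult zeta_in flip: pi_mult)
  finally show ?thesis ..
qed

lemma rho_nonzero: "\<rho> g m n \<noteq> 0 \<Longrightarrow> fst m = gconj G g (fst n)"
  by (auto simp: rho_eq split: if_splits)

text \<open>The dual action of h^-1 on a dual basis vector gives its row in the matrix of h. Right
  multiplication of forms by h therefore multiplies endomorphisms by \<open>\<rho> h\<close> on the
  right.\<close>

lemma dual_act_eq:
  assumes "h \<in> carrier G" "m \<in> K"
  shows "dual_act G q J \<pi> (inv h) m n = (if n \<in> K then \<rho> h m n else 0)"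
proof -
  obtain c i d j where mn: "m = (c, i)" "n = (d, j)" "c \<in> C" "i \<in> J"
    using assms by (cases n) auto
  have "d = gconj G (inv h) c \<longleftrightarrow> d \<in> C \<and> c = gconj G h d"
    using assms mn C_subset gconj_C[of c "inv h"] by auto
  moreover have "inv (zeta G q c (inv h)) = zeta G q d h" if "d = gconj G (inv h) c"
    using assms mn that by (simp add: inv_zeta)
  ultimately show ?thesis
    by (auto simp: dual_act_def rho_eq mn)
qed

lemma dvee_right_eq:
  assumes "h \<in> carrier G" "n \<in> K"
  shows "dvee_right G q J \<pi> (m, n) (g, h) ((f, k), (m', n'))
    = (if f = g \<otimes> inv (fst m) \<and> k = gconj G (fst m) h \<and> m' = m \<and> n' \<in> K then \<rho> h n n' else 0)"
  using dual_act_eq[OF assms] by (cases m; cases n) (auto simp: dvee_right_def tprod_def bvec_def)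

section \<open>The two actions on forms in coordinates\<close>

lemma lact_eq:
  "free_lact P x w = (\<lambda>((f, h), l). if f \<in> carrier G \<and> h \<in> carrier G
     then \<Sum>k\<in>carrier G. x (f, k) * w ((f, inv k \<otimes> h), l) else 0)"
  by (auto simp: free_lact_def dvee_mult)

abbreviation "L \<equiv> K \<times> K"
abbreviation "sr \<equiv> dvee_right G q J \<pi>"

text \<open>Undoes the twist with which group elements pass through a matrix unit in a row over c:
  an h on the right of such a form appears as chc^-1 on the left.\<close>

definition \<gamma> :: "'a \<times> 'i \<Rightarrow> 'a \<Rightarrow> 'a" where
  "\<gamma> m h = gconj G (inv (fst m)) h"

lemma gamma_in [simp]: "m \<in> K \<Longrightarrow> h \<in> carrier G \<Longrightarrow> \<gamma> m h \<in> carrier G"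
  using C_subset by (auto simp: \<gamma>_def)

lemma gamma_mult: "m \<in> K \<Longrightarrow> h \<in> carrier G \<Longrightarrow> k \<in> carrier G \<Longrightarrow> \<gamma> m (h \<otimes> k) = \<gamma> m h \<otimes> \<gamma> m k"
  using C_subset by (auto simp: \<gamma>_def gconj_mult)

lemma gamma_inv: "m \<in> K \<Longrightarrow> h \<in> carrier G \<Longrightarrow> \<gamma> m (inv h) = inv (\<gamma> m h)"
  using C_subset by (auto simp: \<gamma>_def inv_gconj)

lemma gamma_one [simp]: "m \<in> K \<Longrightarrow> \<gamma> m \<one> = \<one>"
  using C_subset by (auto simp: \<gamma>_def)

lemma sum_gamma: "m \<in> K \<Longrightarrow> (\<Sum>k\<in>carrier G. F (\<gamma> m k)) = (\<Sum>k\<in>carrier G. F k)"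
  unfolding \<gamma>_def using C_subset by (intro sum_gconj) auto

lemma K_fst: "m \<in> K \<Longrightarrow> fst m \<in> carrier G"
  using C_subset by auto

text \<open>Once the target coordinates and k are fixed, the relations leave one contributing basis
  vector of the algebra: x is read off at fc and at the untwisted group element, whose matrix acts
  on the second index of the endomorphism.\<close>

lemma ract_in:
  assumes "f \<in> carrier G" "h \<in> carrier G" "m \<in> K" "n \<in> K"
  shows "free_ract P L sr w x ((f, h), (m, n)) = (\<Sum>k\<in>carrier G. \<Sum>l\<in>K.
     w ((f, k), (m, l)) * (x (f \<otimes> fst m, \<gamma> m (inv k \<otimes> h)) * \<rho> (\<gamma> m (inv k \<otimes> h)) l n))"
proof -
  have lext: "lext (basis P) (sr (m', l)) x ((f, k), (m, n))
      = (if m' = m then x (f \<otimes> fst m, \<gamma> m k) * \<rho> (\<gamma> m k) l n else 0)"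
    if "m' \<in> K" "l \<in> K" "k \<in> carrier G" for m' l k
  proof -
    have eq: "f = g \<otimes> inv (fst m) \<and> k = gconj G (fst m) h \<longleftrightarrow> (g, h) = (f \<otimes> fst m, \<gamma> m k)"
      if "g \<in> carrier G" "h \<in> carrier G" for g h
      using that assms K_fst[OF assms(3)] \<open>k \<in> carrier G\<close> by (auto simp: \<gamma>_def m_assoc)
    have "lext (basis P) (sr (m', l)) x ((f, k), (m, n))
        = (\<Sum>u\<in>carrier G \<times> carrier G. if u = (f \<otimes> fst m, \<gamma> m k) then if m' = m then x u * \<rho> (snd u) l n else 0 else 0)"
      unfolding lext_def hopf_simps
    proof (rule sum.cong[OF refl])
      fix u assume u: "u \<in> carrier G \<times> carrier G"
      have "sr (m', l) u ((f, k), (m, n)) = (if (f = fst u \<otimes> inv (fst m') \<and> k = gconj G (fst m') (snd u)) \<and> m' = m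
          then \<rho> (snd u) l n else 0)"
        using dvee_right_eq[of "snd u" l m' "fst u" f k m n] u that assms by (auto split: if_splits)
      also have "\<dots> = (if u = (f \<otimes> fst m, \<gamma> m k) \<and> m' = m then \<rho> (snd u) l n else 0)"
      proof (cases "m' = m")
        case True
        then show ?thesis
          using eq[of "fst u" "snd u"] u by (simp only: prod.collapse mem_Times_iff simp_thms)
      qed simp
      finally show "x u * sr (m', l) u ((f, k), (m, n))
          = (if u = (f \<otimes> fst m, \<gamma> m k) then if m' = m then x u * \<rho> (snd u) l n else 0 else 0)"
        by simp
    qed
    also have "\<dots> = (if m' = m then x (f \<otimes> fst m, \<gamma> m k) * \<rho> (\<gamma> m k) l n else 0)"
      using assms that K_fst[OF assms(3)] by simp
    finally show ?thesis .
  qed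
  have "free_ract P L sr w x ((f, h), (m, n))
      = (\<Sum>m'\<in>K. \<Sum>l\<in>K. \<Sum>k\<in>carrier G. w ((f, k), (m', l)) * lext (basis P) (sr (m', l)) x ((f, inv k \<otimes> h), (m, n)))"
    using assms by (subst free_ract_eq) (simp_all add: dvee_mult sum.cartesian_product'[of _ K K])
  also have "\<dots> = (\<Sum>m'\<in>K. if m' = m then (\<Sum>l\<in>K. \<Sum>k\<in>carrier G.
      w ((f, k), (m, l)) * (x (f \<otimes> fst m, \<gamma> m (inv k \<otimes> h)) * \<rho> (\<gamma> m (inv k \<otimes> h)) l n)) else 0)"
    (is "sum ?A _ = sum ?B _")
  proof (rule sum.cong[OF refl])
    fix m' assume m': "m' \<in> K"
    show "?A m' = ?B m'"
    proof (cases "m' = m")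
      case True
      have "?A m' = (\<Sum>l\<in>K. \<Sum>k\<in>carrier G.
          w ((f, k), (m, l)) * (x (f \<otimes> fst m, \<gamma> m (inv k \<otimes> h)) * \<rho> (\<gamma> m (inv k \<otimes> h)) l n))"
        by (rule sum.cong[OF refl], rule sum.cong[OF refl]) (use True m' assms lext in simp)
      then show ?thesis
        by (simp only: True simp_thms if_True)
    next
      case False
      then show ?thesis
        using m' assms lext by (simp only: if_False simp_thms) (intro sum.neutral ballI, simp)
    qed
  qed
  also have "\<dots> = (\<Sum>l\<in>K. \<Sum>k\<in>carrier G.
      w ((f, k), (m, l)) * (x (f \<otimes> fst m, \<gamma> m (inv k \<otimes> h)) * \<rho> (\<gamma> m (inv k \<otimes> h)) l n))"
    using assms by (subst sum.delta) auto
  finally show ?thesis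
    by (simp only: sum.swap[of _ K "carrier G"])
qed

lemma sr_closed:
  assumes "l \<in> L" "b \<in> basis P"
  shows "sr l b \<in> carrier (fspace (basis P \<times> L))"
proof -
  obtain m n g h where lb: "l = (m, n)" "m \<in> K" "n \<in> K" "b = (g, h)" "g \<in> carrier G" "h \<in> carrier G"
    using assms by auto
  have "sr l b ((f, k), (m', n')) = 0" if "((f, k), (m', n')) \<notin> basis P \<times> L" for f k m' n'
    unfolding lb dvee_right_eq[OF lb(6,3)] using that lb K_fst[OF lb(2)] by auto
  then show ?thesis
    by (auto simp: carrier_fspace)
qed

lemma ract_closed: "free_ract P L sr w x \<in> carrier (fspace (basis P \<times> L))"
  unfolding free_ract_def
proof (rule lext_in[OF lin_closed_fspace])
  fix u assume "u \<in> basis P \<times> L"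
  then obtain b l where u: "u = (b, l)" "b \<in> basis P" "l \<in> L" by blast
  have "lext (basis P) (sr l) x \<in> carrier (fspace (basis P \<times> L))"
    using u by (intro lext_in lin_closed_fspace sr_closed)
  then show "(case u of (b, l) \<Rightarrow> free_lact P (bvec b) (lext (basis P) (sr l) x)) \<in> carrier (fspace (basis P \<times> L))"
    unfolding u(1) by (auto simp: lact_eq carrier_fspace)
qed

lemma forms_eqI:
  assumes "v \<in> carrier (fspace (basis P \<times> L))" "w \<in> carrier (fspace (basis P \<times> L))"
    and "\<And>f h m n. f \<in> carrier G \<Longrightarrow> h \<in> carrier G \<Longrightarrow> m \<in> K \<Longrightarrow> n \<in> K \<Longrightarrow> v ((f, h), (m, n)) = w ((f, h), (m, n))"
  shows "v = w"
proof (rule fspace_eqI[OF assms(1,2)])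
  fix z assume "z \<in> basis P \<times> L"
  then show "v z = w z"
    using assms(3) by (cases z) auto
qed

text \<open>In the product law the group elements k'^-1 k and k^-1 h multiply to k'^-1 h. As
  \<open>\<gamma>\<close> and \<open>\<rho>\<close> are multiplicative, the matrix factors combine,
  and the remaining sum over k is the convolution product.\<close>

lemma free_bimodule: "free_bimodule P L sr"
proof
  show "complex_algebra (alg P)" by (rule complex_algebra_dvee)
  show "finite (basis P)" "finite L" by simp_all
  show "\<And>l b. l \<in> L \<Longrightarrow> b \<in> basis P \<Longrightarrow> sr l b \<in> carrier (fspace (basis P \<times> L))"
    by (rule sr_closed)
next
  fix w assume w: "w \<in> carrier (fspace (basis P \<times> L))"
  show "free_ract P L sr w \<one>\<^bsub>alg P\<^esub> = w"
  proof (rule forms_eqI[OF ract_closed w])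
    fix f h m n assume z: "f \<in> carrier G" "h \<in> carrier G" "m \<in> K" "n \<in> K"
    have "\<gamma> m (inv k \<otimes> h) = \<one> \<longleftrightarrow> k = h" if "k \<in> carrier G" for k
      using that z gconj_eq_iff[of "inv (fst m)" "inv k \<otimes> h" \<one>] inv_mult_eq_one_iff[of k h] K_fst[OF z(3)]
      by (auto simp: \<gamma>_def)
    then have "free_ract P L sr w \<one>\<^bsub>alg P\<^esub> ((f, h), (m, n))
        = (\<Sum>k\<in>carrier G. if k = h then \<Sum>l\<in>K. w ((f, k), (m, l)) * \<rho> \<one> l n else 0)"
      unfolding ract_in[OF z] using z K_fst[OF z(3)] by (intro sum.cong refl) (simp add: alg_ops)
    also have "\<dots> = (\<Sum>l\<in>K. if l = n then w ((f, h), (m, l)) else 0)"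
      using z by (simp add: rho_one if_distrib[of "\<lambda>x. _ * x"] cong: sum.cong if_cong)
    also have "\<dots> = w ((f, h), (m, n))"
      using z by (subst sum.delta) auto
    finally show "free_ract P L sr w \<one>\<^bsub>alg P\<^esub> ((f, h), (m, n)) = w ((f, h), (m, n))" .
  qed
next
  fix w x y assume w: "w \<in> carrier (fspace (basis P \<times> L))" "x \<in> carrier (alg P)" "y \<in> carrier (alg P)"
  show "free_ract P L sr w (x \<otimes>\<^bsub>alg P\<^esub> y) = free_ract P L sr (free_ract P L sr w x) y"
  proof (rule forms_eqI[OF ract_closed ract_closed])
    fix f h m n assume z: "f \<in> carrier G" "h \<in> carrier G" "m \<in> K" "n \<in> K"
    note m = K_fst[OF z(3)]
    let ?X = "\<lambda>k. x (f \<otimes> fst m, k)" and ?Y = "\<lambda>k. y (f \<otimes> fst m, k)"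
    have "free_ract P L sr (free_ract P L sr w x) y ((f, h), (m, n))
        = (\<Sum>k\<in>carrier G. \<Sum>l\<in>K. (\<Sum>k'\<in>carrier G. \<Sum>l'\<in>K.
             w ((f, k'), (m, l')) * (?X (\<gamma> m (inv k' \<otimes> k)) * \<rho> (\<gamma> m (inv k' \<otimes> k)) l' l))
           * (?Y (\<gamma> m (inv k \<otimes> h)) * \<rho> (\<gamma> m (inv k \<otimes> h)) l n))"
      unfolding ract_in[OF z] by (intro sum.cong refl) (simp only: ract_in[OF z(1) _ z(3)])
    also have "\<dots> = (\<Sum>k\<in>carrier G. \<Sum>k'\<in>carrier G. \<Sum>l'\<in>K. w ((f, k'), (m, l'))
        * (?X (\<gamma> m (inv k' \<otimes> k)) * ?Y (\<gamma> m (inv k \<otimes> h)) * \<rho> (\<gamma> m (inv k' \<otimes> h)) l' n))"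
    proof (rule sum.cong[OF refl])
      fix k assume k: "k \<in> carrier G"
      have "(\<Sum>l\<in>K. (\<Sum>k'\<in>carrier G. \<Sum>l'\<in>K.
             w ((f, k'), (m, l')) * (?X (\<gamma> m (inv k' \<otimes> k)) * \<rho> (\<gamma> m (inv k' \<otimes> k)) l' l))
           * (?Y (\<gamma> m (inv k \<otimes> h)) * \<rho> (\<gamma> m (inv k \<otimes> h)) l n))
         = (\<Sum>k'\<in>carrier G. \<Sum>l\<in>K. \<Sum>l'\<in>K. w ((f, k'), (m, l'))
            * (?X (\<gamma> m (inv k' \<otimes> k)) * ?Y (\<gamma> m (inv k \<otimes> h))
            * (\<rho> (\<gamma> m (inv k' \<otimes> k)) l' l * \<rho> (\<gamma> m (inv k \<otimes> h)) l n)))"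
        unfolding sum_distrib_right by (subst sum.swap) (simp only: ac_simps)
      also have "\<dots> = (\<Sum>k'\<in>carrier G. \<Sum>l'\<in>K. w ((f, k'), (m, l'))
        * (?X (\<gamma> m (inv k' \<otimes> k)) * ?Y (\<gamma> m (inv k \<otimes> h)) * \<rho> (\<gamma> m (inv k' \<otimes> h)) l' n))"
      proof (rule sum.cong[OF refl])
        fix k' assume k': "k' \<in> carrier G"
        have g: "\<gamma> m (inv k' \<otimes> h) = \<gamma> m (inv k' \<otimes> k) \<otimes> \<gamma> m (inv k \<otimes> h)"
          using k k' z by (simp add: word_simps flip: gamma_mult)
        have "(\<Sum>l\<in>K. \<rho> (\<gamma> m (inv k' \<otimes> k)) l' l * \<rho> (\<gamma> m (inv k \<otimes> h)) l n) = \<rho> (\<gamma> m (inv k' \<otimes> h)) l' n"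
          if "l' \<in> K" for l'
          unfolding g using k k' z that by (intro rho_mult[symmetric]) simp_all
        then show "(\<Sum>l\<in>K. \<Sum>l'\<in>K. w ((f, k'), (m, l'))
            * (?X (\<gamma> m (inv k' \<otimes> k)) * ?Y (\<gamma> m (inv k \<otimes> h))
            * (\<rho> (\<gamma> m (inv k' \<otimes> k)) l' l * \<rho> (\<gamma> m (inv k \<otimes> h)) l n)))
          = (\<Sum>l'\<in>K. w ((f, k'), (m, l'))
            * (?X (\<gamma> m (inv k' \<otimes> k)) * ?Y (\<gamma> m (inv k \<otimes> h)) * \<rho> (\<gamma> m (inv k' \<otimes> h)) l' n))"
          by (subst sum.swap) (intro sum.cong refl, simp add: sum_distrib_left[symmetric])
      qed
      finally show "(\<Sum>l\<in>K. (\<Sum>k'\<in>carrier G. \<Sum>l'\<in>K.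
             w ((f, k'), (m, l')) * (?X (\<gamma> m (inv k' \<otimes> k)) * \<rho> (\<gamma> m (inv k' \<otimes> k)) l' l))
           * (?Y (\<gamma> m (inv k \<otimes> h)) * \<rho> (\<gamma> m (inv k \<otimes> h)) l n))
         = (\<Sum>k'\<in>carrier G. \<Sum>l'\<in>K. w ((f, k'), (m, l'))
        * (?X (\<gamma> m (inv k' \<otimes> k)) * ?Y (\<gamma> m (inv k \<otimes> h)) * \<rho> (\<gamma> m (inv k' \<otimes> h)) l' n))" .
    qed
    also have "\<dots> = (\<Sum>k'\<in>carrier G. \<Sum>l'\<in>K. w ((f, k'), (m, l'))
        * ((\<Sum>k\<in>carrier G. ?X (\<gamma> m (inv k' \<otimes> k)) * ?Y (\<gamma> m (inv k \<otimes> h))) * \<rho> (\<gamma> m (inv k' \<otimes> h)) l' n))"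
      unfolding sum_distrib_left sum_distrib_right
      by (subst sum.swap) (rule sum.cong[OF refl], rule sum.swap)
    also have "\<dots> = free_ract P L sr w (x \<otimes>\<^bsub>alg P\<^esub> y) ((f, h), (m, n))"
      unfolding ract_in[OF z]
    proof (rule sum.cong[OF refl], rule sum.cong[OF refl])
      fix k' l' assume k': "k' \<in> carrier G"
      have "(\<Sum>k\<in>carrier G. ?X (\<gamma> m (inv k' \<otimes> k)) * ?Y (\<gamma> m (inv k \<otimes> h)))
          = (\<Sum>k\<in>carrier G. ?X (\<gamma> m (inv k' \<otimes> k)) * ?Y (inv (\<gamma> m (inv k' \<otimes> k)) \<otimes> \<gamma> m (inv k' \<otimes> h)))"
        using k' z by (intro sum.cong refl) (simp add: gamma_mult gamma_inv word_simps)
      also have "\<dots> = (\<Sum>k\<in>carrier G. ?X (\<gamma> m k) * ?Y (inv (\<gamma> m k) \<otimes> \<gamma> m (inv k' \<otimes> h)))"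
        by (rule sum_mult_left) (simp add: k')
      also have "\<dots> = (\<Sum>k\<in>carrier G. ?X k * ?Y (inv k \<otimes> \<gamma> m (inv k' \<otimes> h)))"
        by (rule sum_gamma[OF z(3)])
      also have "\<dots> = (x \<otimes>\<^bsub>alg P\<^esub> y) (f \<otimes> fst m, \<gamma> m (inv k' \<otimes> h))"
        using k' z m by (simp add: dvee_mult)
      finally show "w ((f, k'), (m, l')) * ((\<Sum>k\<in>carrier G. ?X (\<gamma> m (inv k' \<otimes> k)) * ?Y (\<gamma> m (inv k \<otimes> h)))
            * \<rho> (\<gamma> m (inv k' \<otimes> h)) l' n)
          = w ((f, k'), (m, l')) * ((x \<otimes>\<^bsub>alg P\<^esub> y) (f \<otimes> fst m, \<gamma> m (inv k' \<otimes> h)) * \<rho> (\<gamma> m (inv k' \<otimes> h)) l' n)"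
        by simp
    qed
    finally show "free_ract P L sr w (x \<otimes>\<^bsub>alg P\<^esub> y) ((f, h), (m, n)) = free_ract P L sr (free_ract P L sr w x) y ((f, h), (m, n))" ..
  qed
qed

end

context class_rep
begin

interpretation bim: free_bimodule P L sr
  by (rule free_bimodule)

abbreviation "\<theta> \<equiv> dvee_theta G C J"
abbreviation "\<delta> x \<equiv> (\<lambda>z. free_ract P L sr \<theta> x z - free_lact P x \<theta> z)"

lemma Omega_eq: "\<Omega> = free_calculus P L sr \<delta>"
  by (simp add: dvee_calculus_def Let_def)

lemma Omega_simps [simp]:
  "carrier \<Omega> = carrier (fspace (basis P \<times> L))" "lact \<Omega> = free_lact P" "ract \<Omega> = free_ract P L sr"
  "diff \<Omega> = \<delta>" "fun_module \<Omega>"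
  by (simp_all add: Omega_eq)

lemma theta_eq:
  "\<theta> = (\<lambda>((f, k), (m, n)). if f \<in> carrier G \<and> k = \<one> \<and> m \<in> K \<and> m = n then 1 else 0)"
proof -
  have "\<theta> ((f, k), (m, n)) = (if f \<in> carrier G \<and> k = \<one> \<and> m \<in> K \<and> m = n then 1 else 0)" for f k m n
  proof -
    have "(\<Sum>l\<in>K. tprod (bvec l) (bvec l) (m, n)) = (\<Sum>l\<in>K. if l = m then if m = n then 1 else 0 else 0 :: complex)"
      by (intro sum.cong refl) (auto simp: tprod_def bvec_def)
    also have "\<dots> = (if m \<in> K \<and> m = n then 1 else 0)"
      by (subst sum.delta) auto
    finally show ?thesis
      by (auto simp: dvee_theta_def tprod_def alg_ops)
  qed
  then show ?thesis by (simp add: fun_eq_iff)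
qed

lemma theta_closed: "\<theta> \<in> carrier (fspace (basis P \<times> L))"
  by (auto simp: theta_eq carrier_fspace)

lemma delta_closed: "x \<in> carrier (alg P) \<Longrightarrow> \<delta> x \<in> carrier (fspace (basis P \<times> L))"
  by (intro lin_closed_diff lin_closed_fspace ract_closed bim.lact_closed theta_closed)

text \<open>The form \<open>\<theta>\<close> is concentrated at the group element 1 and on the
  diagonal of the endomorphisms, so each of its two products with x has a single surviving
  term.\<close>

lemma delta_in:
  assumes "f \<in> carrier G" "h \<in> carrier G" "m \<in> K" "n \<in> K"
  shows "\<delta> x ((f, h), (m, n)) = x (f \<otimes> fst m, \<gamma> m h) * \<rho> (\<gamma> m h) m n - (if m = n then x (f, h) else 0)"
proof -
  have "free_ract P L sr \<theta> x ((f, h), (m, n)) = (\<Sum>k\<in>carrier G. \<Sum>l\<in>K. if k = \<one> then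
      if l = m then x (f \<otimes> fst m, \<gamma> m (inv k \<otimes> h)) * \<rho> (\<gamma> m (inv k \<otimes> h)) l n else 0 else 0)"
    unfolding ract_in[OF assms] by (intro sum.cong refl) (use assms in \<open>auto simp: theta_eq\<close>)
  also have "\<dots> = (\<Sum>k\<in>carrier G. if k = \<one> then
      (\<Sum>l\<in>K. if l = m then x (f \<otimes> fst m, \<gamma> m (inv k \<otimes> h)) * \<rho> (\<gamma> m (inv k \<otimes> h)) l n else 0) else 0)"
    by (intro sum.cong refl) simp
  also have "\<dots> = x (f \<otimes> fst m, \<gamma> m h) * \<rho> (\<gamma> m h) m n"
    using assms by (subst sum.delta, simp, subst sum.delta) auto
  moreover have "free_lact P x \<theta> ((f, h), (m, n)) = (\<Sum>k\<in>carrier G. if k = h then if m = n then x (f, k) else 0 else 0)"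
  proof -
    have "free_lact P x \<theta> ((f, h), (m, n)) = (\<Sum>k\<in>carrier G. x (f, k) * \<theta> ((f, inv k \<otimes> h), (m, n)))"
      using assms by (simp add: lact_eq)
    then show ?thesis
      using assms by (simp only:) (intro sum.cong refl, auto simp: theta_eq inv_mult_eq_one_iff)
  qed
  ultimately show ?thesis
    using assms by simp
qed

lemma lact_delta:
  assumes "f \<in> carrier G" "h \<in> carrier G" "m \<in> K" "n \<in> K"
  shows "free_lact P x (\<delta> y) ((f, h), (m, n))
    = (\<Sum>k\<in>carrier G. \<rho> (\<gamma> m (inv k \<otimes> h)) m n * (x (f, k) * y (f \<otimes> fst m, \<gamma> m (inv k \<otimes> h))))
      - (\<Sum>k\<in>carrier G. (if m = n then 1 else 0) * (x (f, k) * y (f, inv k \<otimes> h)))"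
proof -
  have "free_lact P x (\<delta> y) ((f, h), (m, n)) = (\<Sum>k\<in>carrier G. x (f, k) * \<delta> y ((f, inv k \<otimes> h), (m, n)))"
    using assms by (simp add: lact_eq)
  also have "\<dots> = (\<Sum>k\<in>carrier G. \<rho> (\<gamma> m (inv k \<otimes> h)) m n * (x (f, k) * y (f \<otimes> fst m, \<gamma> m (inv k \<otimes> h)))
      - (if m = n then 1 else 0) * (x (f, k) * y (f, inv k \<otimes> h)))"
    by (rule sum.cong[OF refl]) (subst delta_in, use assms in \<open>auto simp: algebra_simps\<close>)
  finally show ?thesis
    by (simp add: sum_subtractf)
qed

section \<open>Bicovariance of the calculus\<close>

lemma form_of_eq:
  "form_of P \<Omega> t = (\<lambda>z. \<Sum>u\<in>basis P \<times> basis P. t u * free_lact P (bvec (fst u)) (\<delta> (bvec (snd u))) z)"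
proof -
  have c: "free_lact P (bvec (fst u)) (\<delta> (bvec (snd u))) \<in> carrier (fspace (basis P \<times> L))"
    if "u \<in> basis P \<times> basis P" for u
    using that by (intro bim.lact_closed delta_closed) (auto simp: alg_ops)
  show ?thesis
    unfolding form_of_def
    by (subst finsum_fun_module) (auto simp: fun_module_ops(3) intro!: lin_closedD(3)[OF lin_closed_fspace]
        c[unfolded mem_Times_iff hopf_simps] c)
qed

lemma form_of_closed: "form_of P \<Omega> t \<in> carrier (fspace (basis P \<times> L))"
  unfolding form_of_eq
  by (intro lin_closed_lin_comb lin_closed_fspace bim.lact_closed delta_closed) (auto simp: alg_ops)

text \<open>The formula \<open>lact_delta\<close> is bilinear in x and y. Replacing x tensor y by t
  expresses the vanishing of a form as a system of linear equations on t.\<close>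

lemma form_of_in:
  assumes "f \<in> carrier G" "h \<in> carrier G" "m \<in> K" "n \<in> K"
  shows "form_of P \<Omega> t ((f, h), (m, n))
    = (\<Sum>k\<in>carrier G. \<rho> (\<gamma> m (inv k \<otimes> h)) m n * t ((f, k), (f \<otimes> fst m, \<gamma> m (inv k \<otimes> h))))
      - (\<Sum>k\<in>carrier G. (if m = n then 1 else 0) * t ((f, k), (f, inv k \<otimes> h)))"
  unfolding form_of_eq lact_delta[OF assms] right_diff_distrib sum_subtractf
  by (subst (1 2) sum_bvec_pair) (use assms K_fst[OF assms(3)] in auto)

lemma form_of_zero_iff:
  "form_of P \<Omega> t = (\<lambda>_. 0) \<longleftrightarrow> (\<forall>f\<in>carrier G. \<forall>h\<in>carrier G. \<forall>m\<in>K. \<forall>n\<in>K. form_of P \<Omega> t ((f, h), (m, n)) = 0)"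
proof
  assume *: "\<forall>f\<in>carrier G. \<forall>h\<in>carrier G. \<forall>m\<in>K. \<forall>n\<in>K. form_of P \<Omega> t ((f, h), (m, n)) = 0"
  show "form_of P \<Omega> t = (\<lambda>_. 0)"
    by (rule forms_eqI[OF form_of_closed]) (use * in \<open>auto simp: carrier_fspace\<close>)
qed simp

lemma bcomult_dvee_eq:
  assumes "x \<in> basis P" "a \<in> carrier G" "b \<in> carrier G" "v \<in> carrier G"
  shows "bcomult P x ((a, u), (b, v)) = (if u = gconj G b v then bvec x (a \<otimes> b, v) else 0)"
  using assms by (cases x) (auto simp: bcomult_dvee bvec_def)

text \<open>The second legs determine the group parts aua^-1 and ghg^-1 of the first legs; the
  coefficient survives exactly when w is their product.\<close>

lemma codiag_left_dvee:
  assumes "s \<in> carrier G" "w \<in> carrier G" "a \<in> carrier G" "u \<in> carrier G" "g \<in> carrier G" "h \<in> carrier G"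
  shows "codiag_left P t ((s, w), ((a, u), (g, h)))
    = (if w = gconj G a u \<otimes> gconj G g h then t ((s \<otimes> a, u), (s \<otimes> g, h)) else 0)"
proof -
  have "codiag_left P t ((s, w), ((a, u), (g, h))) = (\<Sum>z\<in>basis P \<times> basis P. t z *
      (\<Sum>b1\<in>basis P. \<Sum>b2\<in>basis P. bcomult P (fst z) (b1, (a, u)) * bcomult P (snd z) (b2, (g, h)) * bmult P b1 b2 (s, w)))"
    by (simp add: codiag_left_def lext_def case_prod_unfold)
  also have "\<dots> = (\<Sum>z\<in>basis P \<times> basis P. t z * (\<Sum>k\<in>carrier G.
      (if k = gconj G a u \<and> inv k \<otimes> w = gconj G g h then 1 else 0)
        * (bvec (fst z) (s \<otimes> a, u) * bvec (snd z) (s \<otimes> g, h))))"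
    unfolding dvee_bmult_sum using assms
    by (intro sum.cong refl arg_cong2[of _ _ _ _ "(*)"])
      (auto simp: bcomult_dvee_eq mem_Times_iff simp del: hopf_simps intro!: sum.cong)
  also have "\<dots> = (\<Sum>k\<in>carrier G. (if k = gconj G a u \<and> inv k \<otimes> w = gconj G g h then 1 else 0)
      * t ((s \<otimes> a, u), (s \<otimes> g, h)))"
    by (rule sum_bvec_pair) (use assms in auto)
  also have "\<dots> = (\<Sum>k\<in>carrier G. if k = gconj G a u then
      if w = gconj G a u \<otimes> gconj G g h then t ((s \<otimes> a, u), (s \<otimes> g, h)) else 0 else 0)"
  proof (rule sum.cong[OF refl])
    fix k assume "k \<in> carrier G"
    have "inv (gconj G a u) \<otimes> w = gconj G g h \<longleftrightarrow> w = gconj G a u \<otimes> gconj G g h"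
      using eq_mult_iff(1)[of "gconj G a u" "gconj G g h" w] assms by auto
    then show "(if k = gconj G a u \<and> inv k \<otimes> w = gconj G g h then 1 else 0) * t ((s \<otimes> a, u), (s \<otimes> g, h))
      = (if k = gconj G a u then
      if w = gconj G a u \<otimes> gconj G g h then t ((s \<otimes> a, u), (s \<otimes> g, h)) else 0 else 0)"
      by simp
  qed
  finally show ?thesis
    using assms by simp
qed

text \<open>Mirror image of the left case: the first legs determine the group parts s^-1 us and s^-1
  hs of the second legs, and w has to be their product.\<close>

lemma codiag_right_dvee:
  assumes "s \<in> carrier G" "w \<in> carrier G" "a \<in> carrier G" "u \<in> carrier G" "g \<in> carrier G" "h \<in> carrier G"
  shows "codiag_right P t (((a, u), (g, h)), (s, w))
    = (if w = gconj G (inv s) (u \<otimes> h)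
       then t ((a \<otimes> s, gconj G (inv s) u), (g \<otimes> s, gconj G (inv s) h)) else 0)"
proof -
  have "codiag_right P t (((a, u), (g, h)), (s, w)) = (\<Sum>z\<in>basis P \<times> basis P. t z *
      (\<Sum>b1\<in>basis P. \<Sum>b2\<in>basis P. bcomult P (fst z) ((a, u), b1) * bcomult P (snd z) ((g, h), b2) * bmult P b1 b2 (s, w)))"
    by (simp add: codiag_right_def lext_def case_prod_unfold)
  also have "\<dots> = (\<Sum>z\<in>basis P \<times> basis P. t z * (\<Sum>k\<in>carrier G.
      (if u = gconj G s k \<and> h = gconj G s (inv k \<otimes> w) then 1 else 0)
        * (bvec (fst z) (a \<otimes> s, k) * bvec (snd z) (g \<otimes> s, inv k \<otimes> w))))"
    unfolding dvee_bmult_sum using assms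
    by (intro sum.cong refl arg_cong2[of _ _ _ _ "(*)"])
      (auto simp: bcomult_dvee_eq mem_Times_iff simp del: hopf_simps intro!: sum.cong)
  also have "\<dots> = (\<Sum>k\<in>carrier G. (if u = gconj G s k \<and> h = gconj G s (inv k \<otimes> w) then 1 else 0)
      * t ((a \<otimes> s, k), (g \<otimes> s, inv k \<otimes> w)))"
    by (rule sum_bvec_pair) (use assms in auto)
  also have "\<dots> = (\<Sum>k\<in>carrier G. if k = gconj G (inv s) u then
      if w = gconj G (inv s) (u \<otimes> h) then t ((a \<otimes> s, k), (g \<otimes> s, gconj G (inv s) h)) else 0 else 0)"
  proof (rule sum.cong[OF refl])
    fix k assume k: "k \<in> carrier G"
    have 1: "u = gconj G s k \<longleftrightarrow> k = gconj G (inv s) u"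
      using gconj_eq_iff[of s k u] assms k by simp
    have 2: "h = gconj G s (inv k \<otimes> w) \<longleftrightarrow> inv k \<otimes> w = gconj G (inv s) h"
      using gconj_eq_iff[of s "inv k \<otimes> w" h] assms k by simp
    have 3: "inv k \<otimes> w = gconj G (inv s) h \<longleftrightarrow> w = k \<otimes> gconj G (inv s) h"
      using eq_mult_iff(1)[of k "gconj G (inv s) h" w] assms k by auto
    have 4: "w = k \<otimes> gconj G (inv s) h \<longleftrightarrow> w = gconj G (inv s) (u \<otimes> h)" if "k = gconj G (inv s) u"
      using assms that by (simp add: gconj_mult)
    show "(if u = gconj G s k \<and> h = gconj G s (inv k \<otimes> w) then 1 else 0) * t ((a \<otimes> s, k), (g \<otimes> s, inv k \<otimes> w))
      = (if k = gconj G (inv s) u then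
      if w = gconj G (inv s) (u \<otimes> h) then t ((a \<otimes> s, k), (g \<otimes> s, gconj G (inv s) h)) else 0 else 0)"
    proof (cases "k = gconj G (inv s) u \<and> w = gconj G (inv s) (u \<otimes> h)")
      case True
      then have "inv k \<otimes> w = gconj G (inv s) h"
        using 3 4 by blast
      with True 1 2 show ?thesis by (simp only: simp_thms if_True mult_1_left)
    next
      case False
      then have "\<not> (u = gconj G s k \<and> h = gconj G s (inv k \<otimes> w))"
        using 1 2 3 4 by blast
      with False show ?thesis by auto
    qed
  qed
  finally show ?thesis
    using assms by simp
qed

text \<open>In both sums that make up the form, the required w equals fhf^-1, independently of the
  summation variable k. The coaction then merely shifts f to sf, and vanishing is preserved.\<close>

lemma covariant_left:
  assumes zero: "form_of P \<Omega> t = (\<lambda>_. 0)" and sw: "s \<in> carrier G" "w \<in> carrier G"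
  shows "form_of P \<Omega> (\<lambda>u. codiag_left P t ((s, w), u)) = (\<lambda>_. 0)"
  unfolding form_of_zero_iff
proof (intro ballI)
  fix f h m n assume z: "f \<in> carrier G" "h \<in> carrier G" "m \<in> K" "n \<in> K"
  note m = K_fst[OF z(3)]
  have 1: "gconj G f k \<otimes> gconj G (f \<otimes> fst m) (\<gamma> m (inv k \<otimes> h)) = gconj G f h" if "k \<in> carrier G" for k
    using that z m by (simp add: \<gamma>_def gconj_gconj[symmetric] flip: gconj_mult)
  have 2: "gconj G f k \<otimes> gconj G f (inv k \<otimes> h) = gconj G f h" if "k \<in> carrier G" for k
    using that z by (simp flip: gconj_mult)
  have "form_of P \<Omega> (\<lambda>u. codiag_left P t ((s, w), u)) ((f, h), (m, n))
      = (if w = gconj G f h then form_of P \<Omega> t ((s \<otimes> f, h), (m, n)) else 0)"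
    using z sw m by (simp add: form_of_in codiag_left_dvee 1 2 m_assoc cong: sum.cong)
  then show "form_of P \<Omega> (\<lambda>u. codiag_left P t ((s, w), u)) ((f, h), (m, n)) = 0"
    by (simp add: zero)
qed

lemma sum_rho_one: "m \<in> K \<Longrightarrow> n \<in> K \<Longrightarrow> s \<in> carrier G
    \<Longrightarrow> (\<Sum>l\<in>K. \<rho> s m l * \<rho> (inv s) l n) = (if m = n then 1 else 0)"
  by (simp add: rho_one flip: rho_mult)

text \<open>The right coaction moves (f, h) to (fs, s^-1 hs) and also changes the basis of V. Up to
  a condition on w, its coefficient at (m, n) is an entry of the coefficient matrix at the moved
  point, conjugated by \<open>\<rho> s\<close>.\<close>

lemma covariant_right:
  assumes zero: "form_of P \<Omega> t = (\<lambda>_. 0)" and sw: "s \<in> carrier G" "w \<in> carrier G"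
  shows "form_of P \<Omega> (\<lambda>u. codiag_right P t (u, (s, w))) = (\<lambda>_. 0)"
  unfolding form_of_zero_iff
proof (intro ballI)
  fix f h m n assume z: "f \<in> carrier G" "h \<in> carrier G" "m \<in> K" "n \<in> K"
  note m = K_fst[OF z(3)] and n = K_fst[OF z(4)]
  let ?c = "gconj G (inv s)" and ?g = "\<lambda>k. \<gamma> m (inv k \<otimes> h)"
  let ?T = "\<lambda>k. t ((f \<otimes> s, ?c k), ((f \<otimes> fst m) \<otimes> s, ?c (?g k)))"
  let ?U = "\<lambda>k. t ((f \<otimes> s, ?c k), (f \<otimes> s, ?c (inv k \<otimes> h)))"
  \<comment> \<open>The (m, n) entry of rho(s) F rho(s)^-1, where F is the matrix of coefficients of
    the given form at (fs, s^-1 hs). It vanishes because F does.\<close>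
  define X where "X = (\<Sum>k\<in>carrier G. \<rho> (?g k) m n * ?T k) - (\<Sum>k\<in>carrier G. (if m = n then 1 else 0) * ?U k)"
  have "X = 0"
  proof -
    have F: "\<rho> s m m' * (form_of P \<Omega> t ((f \<otimes> s, ?c h), (m', n')) * \<rho> (inv s) n' n)
        = (\<Sum>k\<in>carrier G. ?T k * (\<rho> s m m' * \<rho> (?c (?g k)) m' n' * \<rho> (inv s) n' n))
          - (\<Sum>k\<in>carrier G. ?U k * (if m' = n' then \<rho> s m m' * \<rho> (inv s) n' n else 0))"
      if m'n': "m' \<in> K" "n' \<in> K" for m' n'
    proof (cases "\<rho> s m m' = 0")
      case False
      \<comment> \<open>A nonzero entry of rho(s) relates the blocks by c = sc's^-1, which gives
        fsc' = fcs and so makes the arguments of t agree.\<close>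
      then have c: "fst m = gconj G s (fst m')"
        by (rule rho_nonzero)
      note m' = K_fst[OF m'n'(1)]
      have 1: "f \<otimes> s \<otimes> fst m' = f \<otimes> fst m \<otimes> s"
        using z sw m' by (simp add: c gconj_def word_simps)
      have 2: "\<gamma> m' (?c (inv k \<otimes> h)) = ?c (?g k)" if "k \<in> carrier G" for k
        using that z sw m m' by (simp add: \<gamma>_def c gconj_def word_simps)
      have 3: "inv (?c k) \<otimes> ?c h = ?c (inv k \<otimes> h)" if "k \<in> carrier G" for k
        using that z sw by (simp add: inv_gconj gconj_mult)
      have "form_of P \<Omega> t ((f \<otimes> s, ?c h), (m', n'))
        = (\<Sum>k\<in>carrier G. \<rho> (\<gamma> m' (inv (?c k) \<otimes> ?c h)) m' n' * t ((f \<otimes> s, ?c k), (f \<otimes> s \<otimes> fst m', \<gamma> m' (inv (?c k) \<otimes> ?c h))))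
        - (\<Sum>k\<in>carrier G. (if m' = n' then 1 else 0) * t ((f \<otimes> s, ?c k), (f \<otimes> s, inv (?c k) \<otimes> ?c h)))"
        by (subst form_of_in)
          (use z sw m'n' sum_gconj[of "inv s" "\<lambda>k. \<rho> (\<gamma> m' (inv k \<otimes> ?c h)) m' n' * t ((f \<otimes> s, k), (f \<otimes> s \<otimes> fst m', \<gamma> m' (inv k \<otimes> ?c h)))"]
            sum_gconj[of "inv s" "\<lambda>k. (if m' = n' then 1 else 0) * t ((f \<otimes> s, k), (f \<otimes> s, inv k \<otimes> ?c h))"] in simp_all)
      also have "\<dots> = (\<Sum>k\<in>carrier G. \<rho> (?c (?g k)) m' n' * ?T k) - (\<Sum>k\<in>carrier G. (if m' = n' then 1 else 0) * ?U k)"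
        by (simp add: 1 2 3 cong: sum.cong)
      finally have F: "form_of P \<Omega> t ((f \<otimes> s, ?c h), (m', n'))
        = (\<Sum>k\<in>carrier G. \<rho> (?c (?g k)) m' n' * ?T k) - (\<Sum>k\<in>carrier G. (if m' = n' then 1 else 0) * ?U k)" .
      show ?thesis
        unfolding F left_diff_distrib right_diff_distrib sum_distrib_left sum_distrib_right
        by (intro arg_cong2[of _ _ _ _ "(-)"] sum.cong refl) auto
    qed auto
    have "0 = (\<Sum>m'\<in>K. \<Sum>n'\<in>K. \<rho> s m m' * (form_of P \<Omega> t ((f \<otimes> s, ?c h), (m', n')) * \<rho> (inv s) n' n))"
      by (simp add: zero)
    also have "\<dots> = (\<Sum>m'\<in>K. \<Sum>n'\<in>K. (\<Sum>k\<in>carrier G. ?T k * (\<rho> s m m' * \<rho> (?c (?g k)) m' n' * \<rho> (inv s) n' n))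
          - (\<Sum>k\<in>carrier G. ?U k * (if m' = n' then \<rho> s m m' * \<rho> (inv s) n' n else 0)))"
      by (rule sum.cong[OF refl], rule sum.cong[OF refl], rule F)
    also have "\<dots> = (\<Sum>m'\<in>K. \<Sum>n'\<in>K. \<Sum>k\<in>carrier G. ?T k * (\<rho> s m m' * \<rho> (?c (?g k)) m' n' * \<rho> (inv s) n' n))
          - (\<Sum>m'\<in>K. \<Sum>n'\<in>K. \<Sum>k\<in>carrier G. ?U k * (if m' = n' then \<rho> s m m' * \<rho> (inv s) n' n else 0))"
      by (simp only: sum_subtractf)
    also have "(\<Sum>m'\<in>K. \<Sum>n'\<in>K. \<Sum>k\<in>carrier G. ?T k * (\<rho> s m m' * \<rho> (?c (?g k)) m' n' * \<rho> (inv s) n' n))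
        = (\<Sum>k\<in>carrier G. \<rho> (?g k) m n * ?T k)"
    proof -
      have "(\<Sum>m'\<in>K. \<Sum>n'\<in>K. \<Sum>k\<in>carrier G. ?T k * (\<rho> s m m' * \<rho> (?c (?g k)) m' n' * \<rho> (inv s) n' n))
        = (\<Sum>m'\<in>K. \<Sum>k\<in>carrier G. \<Sum>n'\<in>K. ?T k * (\<rho> s m m' * \<rho> (?c (?g k)) m' n' * \<rho> (inv s) n' n))"
        by (rule sum.cong[OF refl], rule sum.swap)
      also have "\<dots> = (\<Sum>k\<in>carrier G. \<Sum>m'\<in>K. \<Sum>n'\<in>K. ?T k * (\<rho> s m m' * \<rho> (?c (?g k)) m' n' * \<rho> (inv s) n' n))"
        by (rule sum.swap)
      also have "\<dots> = (\<Sum>k\<in>carrier G. \<rho> (?g k) m n * ?T k)"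
      proof (rule sum.cong[OF refl])
        fix k assume k: "k \<in> carrier G"
        have "?g k = s \<otimes> (?c (?g k) \<otimes> inv s)"
          using k z sw gamma_in[OF z(3), of "inv k \<otimes> h"] by (simp add: gconj_def word_simps)
        then have "\<rho> (?g k) m n = \<rho> (s \<otimes> (?c (?g k) \<otimes> inv s)) m n"
          by (rule arg_cong[of _ _ "\<lambda>g. \<rho> g m n"])
        also have "\<dots> = (\<Sum>m'\<in>K. \<rho> s m m' * \<rho> (?c (?g k) \<otimes> inv s) m' n)"
          by (rule rho_mult) (use k z sw in auto)
        also have "\<dots> = (\<Sum>m'\<in>K. \<Sum>n'\<in>K. \<rho> s m m' * \<rho> (?c (?g k)) m' n' * \<rho> (inv s) n' n)"
        proof (rule sum.cong[OF refl])
          fix m' assume "m' \<in> K"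
          then have "\<rho> (?c (?g k) \<otimes> inv s) m' n = (\<Sum>n'\<in>K. \<rho> (?c (?g k)) m' n' * \<rho> (inv s) n' n)"
            by (intro rho_mult) (use k z sw in auto)
          then show "\<rho> s m m' * \<rho> (?c (?g k) \<otimes> inv s) m' n = (\<Sum>n'\<in>K. \<rho> s m m' * \<rho> (?c (?g k)) m' n' * \<rho> (inv s) n' n)"
            by (simp add: sum_distrib_left mult.assoc)
        qed
        finally show "(\<Sum>m'\<in>K. \<Sum>n'\<in>K. ?T k * (\<rho> s m m' * \<rho> (?c (?g k)) m' n' * \<rho> (inv s) n' n)) = \<rho> (?g k) m n * ?T k"
          by (simp add: sum_distrib_left mult.commute)
      qed
      finally show ?thesis .
    qed
    also have "(\<Sum>m'\<in>K. \<Sum>n'\<in>K. \<Sum>k\<in>carrier G. ?U k * (if m' = n' then \<rho> s m m' * \<rho> (inv s) n' n else 0))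
        = (\<Sum>k\<in>carrier G. (if m = n then 1 else 0) * ?U k)"
    proof -
      have "(\<Sum>m'\<in>K. \<Sum>n'\<in>K. \<Sum>k\<in>carrier G. ?U k * (if m' = n' then \<rho> s m m' * \<rho> (inv s) n' n else 0))
          = (\<Sum>m'\<in>K. \<Sum>n'\<in>K. if n' = m' then (\<Sum>k\<in>carrier G. ?U k) * (\<rho> s m m' * \<rho> (inv s) m' n) else 0)"
        by (rule sum.cong[OF refl], rule sum.cong[OF refl]) (simp add: sum_distrib_right)
      also have "\<dots> = (\<Sum>m'\<in>K. (\<Sum>k\<in>carrier G. ?U k) * (\<rho> s m m' * \<rho> (inv s) m' n))"
        by (rule sum.cong[OF refl]) (subst sum.delta, auto)
      also have "\<dots> = (\<Sum>k\<in>carrier G. ?U k) * (if m = n then 1 else 0)"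
        unfolding sum_distrib_left[symmetric] sum_rho_one[OF z(3,4) sw(1)] ..
      finally show ?thesis
        by (simp add: sum_distrib_left mult.commute)
    qed
    finally show ?thesis
      by (simp add: X_def)
  qed
  \<comment> \<open>Let c and d be the blocks of m and n. A nonzero entry of
    \<open>\<rho> (?g k)\<close> at (m, n) forces c to be the conjugate of d by \<open>?g k\<close>,
    whence k times \<open>?g k\<close> is hcd^-1 for every k. The condition on w is thus the same in
    all terms of both sums.\<close>
  let ?w = "?c (h \<otimes> (fst m \<otimes> inv (fst n)))"
  have 1: "\<rho> (?g k) m n * codiag_right P t (((f, k), (f \<otimes> fst m, ?g k)), (s, w))
      = (if w = ?w then \<rho> (?g k) m n * ?T k else 0)" if k: "k \<in> carrier G" for k
  proof (cases "\<rho> (?g k) m n = 0")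
    case False
    then have "fst m = gconj G (?g k) (fst n)"
      by (rule rho_nonzero)
    then have "fst m \<otimes> ?g k = ?g k \<otimes> fst n"
      using gamma_in[OF z(3), of "inv k \<otimes> h"] k z n by (simp add: gconj_def word_simps)
    moreover have "fst m \<otimes> ?g k = inv k \<otimes> (h \<otimes> fst m)"
      using k z m by (simp add: \<gamma>_def gconj_def word_simps)
    ultimately have "?g k \<otimes> fst n = inv k \<otimes> (h \<otimes> fst m)"
      by simp
    then have "?g k = inv k \<otimes> (h \<otimes> fst m) \<otimes> inv (fst n)"
      using gamma_in[OF z(3), of "inv k \<otimes> h"] k z m n by (simp add: inv_solve_right)
    then have "k \<otimes> ?g k = h \<otimes> (fst m \<otimes> inv (fst n))"
      using k z m n by (simp add: m_assoc)
    then show ?thesis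
      using k z sw m gamma_in[OF z(3), of "inv k \<otimes> h"] by (simp add: codiag_right_dvee)
  qed simp
  have 2: "(if m = n then 1 else 0) * codiag_right P t (((f, k), (f, inv k \<otimes> h)), (s, w))
      = (if w = ?w then (if m = n then 1 else 0) * ?U k else 0)" if k: "k \<in> carrier G" for k
    using k z sw m by (auto simp: codiag_right_dvee)
  have "form_of P \<Omega> (\<lambda>u. codiag_right P t (u, (s, w))) ((f, h), (m, n)) = (if w = ?w then X else 0)"
    unfolding form_of_in[OF z] X_def using 1 2 by (simp cong: sum.cong)
  then show "form_of P \<Omega> (\<lambda>u. codiag_right P t (u, (s, w))) ((f, h), (m, n)) = 0"
    by (simp add: \<open>X = 0\<close>)
qed

end

section \<open>The ideals of the calculi\<close>

locale nontrivial_class_rep = class_rep G r C q J \<pi>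
  for G :: "('a, 'b) monoid_scheme" (structure) and r C q and J :: "'i set" and \<pi> +
  assumes nontrivial: "\<not> (C = {\<one>} \<and> trivial_rep Z J \<pi>)"
begin

section \<open>Matrix units from the rows over one point\<close>

interpretation bim: free_bimodule P L sr
  by (rule free_bimodule)

text \<open>Index set of the left-invariant forms on the fibre. Being empty for nontrivial
  \<open>\<pi>\<close>, it encodes the factor delta in the theorem.\<close>

definition S :: "'a set" where
  "S = (if trivial_rep Z J \<pi> then C else {})"

lemma S_subset: "c \<in> S \<Longrightarrow> c \<in> C"
  by (simp add: S_def split: if_splits)

lemma finite_S [simp]: "finite S"
  by (simp add: S_def)

lemma S_carrier: "c \<in> S \<Longrightarrow> c \<in> carrier G"
  using S_subset C_subset by blast

text \<open>A conjugacy class containing 1 is {1}, and with trivial \<open>\<pi>\<close> this is the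
  excluded pair.\<close>

lemma one_notin_S: "\<one> \<notin> S"
proof
  assume "\<one> \<in> S"
  then have triv: "trivial_rep Z J \<pi>" and "\<one> \<in> C"
    by (simp_all add: S_def split: if_splits)
  then obtain g where g: "g \<in> carrier G" "gconj G g r = \<one>"
    by (auto simp: C_def conj_class_def)
  then have "r = \<one>"
    using gconj_inv(1)[of g r] r by simp
  then have "C = {\<one>}"
    using one_closed by (auto simp: C_def conj_class_def image_iff intro!: bexI[of _ \<one>])
  with triv nontrivial show False by blast
qed

lemma J_singleton:
  assumes "c \<in> S" "i \<in> J"
  shows "J = {i}"
proof -
  have "card J = 1"
    using assms by (simp add: S_def trivial_rep_def split: if_splits)
  then show ?thesis
    using assms(2) by (auto simp: card_1_singleton_iff)
qed

text \<open>For trivial \<open>\<pi>\<close> the matrices are the permutation matrices of the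
  conjugation action on \<open>C\<close>.\<close>

lemma row_sum_rho:
  assumes "c \<in> S" "i \<in> J" "u \<in> carrier G"
  shows "(\<Sum>n\<in>K. \<rho> u (c, i) n) = 1"
proof -
  have c: "c \<in> C" "c \<in> carrier G"
    using assms S_subset S_carrier by auto
  have J: "J = {i}"
    using J_singleton assms by blast
  have triv: "trivial_rep Z J \<pi>"
    using assms by (simp add: S_def split: if_splits)
  have "(\<Sum>n\<in>K. \<rho> u (c, i) n) = (\<Sum>d\<in>C. \<Sum>j\<in>J. \<rho> u (c, i) (d, j))"
    by (simp add: sum.cartesian_product')
  also have "\<dots> = (\<Sum>d\<in>C. if d = gconj G (inv u) c then 1 else 0)"
  proof (rule sum.cong[OF refl])
    fix d assume d: "d \<in> C"
    have "\<pi> (zeta G q d u) i i = 1"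
      using triv assms(2) zeta_in[OF d assms(3)] by (simp add: trivial_rep_def)
    moreover have "c = gconj G u d \<longleftrightarrow> d = gconj G (inv u) c"
      using gconj_eq_iff[of u d c] assms d c C_subset by auto
    ultimately show "(\<Sum>j\<in>J. \<rho> u (c, i) (d, j)) = (if d = gconj G (inv u) c then 1 else 0)"
      by (subst J) (auto simp: rho_eq)
  qed
  also have "\<dots> = 1"
    using gconj_C[OF c(1), of "inv u"] assms by simp
  finally show ?thesis .
qed

text \<open>Schur orthogonality makes \<open>\<rho>\<close>, restricted to the rows over one \<open>c\<close>, span all matrices; the sum of the
  coefficients vanishes unless \<open>\<pi>\<close> is trivial.\<close>

lemma matrix_unit_rho:
  assumes c: "c \<in> C" and d: "d \<in> C" and i: "i \<in> J" and j: "j \<in> J"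
  obtains a :: "'a \<Rightarrow> complex" where
    "\<And>i' n. i' \<in> J \<Longrightarrow> n \<in> K \<Longrightarrow> (\<Sum>u\<in>carrier G. a u * \<rho> u (c, i') n) = (if i' = i \<and> n = (d, j) then 1 else 0)"
    "(\<Sum>u\<in>carrier G. a u) = (if c \<in> S then 1 else 0)"
proof -
  let ?k = "of_nat (card J) / of_nat (card (carrier Z)) :: complex"
  let ?g = "\<lambda>k. q c \<otimes> k \<otimes> inv (q d)"
  \<comment> \<open>The coefficients dual to the entries of \<open>\<pi>\<close> in Schur
    orthogonality, placed on the group elements that conjugate d to c. These form the set of all
    \<open>q c\<close> k \<open>q d\<close>^-1, and \<open>zeta\<close> recovers k from such an
    element.\<close>
  define a where "a = (\<lambda>u. \<Sum>k\<in>carrier Z. if u = ?g k then ?k * \<pi> (inv k) j i else 0)"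
  have Z: "k \<in> carrier G" "gconj G k r = r" if "k \<in> carrier Z" for k
    using that by (simp_all add: carrier_centralizer)
  note qc = q_in[OF c] and qd = q_in[OF d]
  interpret Z: group Z by (rule group_centralizer)
  have card: "(of_nat (card (carrier Z)) :: complex) \<noteq> 0" "(of_nat (card J) :: complex) \<noteq> 0"
    using finite_centralizer Z.one_closed i by auto
  have sum_a: "(\<Sum>u\<in>carrier G. a u * F u) = (\<Sum>k\<in>carrier Z. ?k * \<pi> (inv k) j i * F (?g k))" for F
  proof -
    have "(\<Sum>u\<in>carrier G. a u * F u)
        = (\<Sum>u\<in>carrier G. \<Sum>k\<in>carrier Z. if u = ?g k then ?k * \<pi> (inv k) j i * F u else 0)"
      unfolding a_def sum_distrib_right by (intro sum.cong refl) simp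
    also have "\<dots> = (\<Sum>k\<in>carrier Z. \<Sum>u\<in>carrier G. if u = ?g k then ?k * \<pi> (inv k) j i * F u else 0)"
      by (rule sum.swap)
    also have "\<dots> = (\<Sum>k\<in>carrier Z. ?k * \<pi> (inv k) j i * F (?g k))"
      using Z(1) qc qd by (intro sum.cong refl) simp
    finally show ?thesis .
  qed
  \<comment> \<open>Conjugation by \<open>q d\<close>^-1 takes d to r, k fixes r, and
    \<open>q c\<close> takes r to c.\<close>
  have conj: "gconj G (?g k) d = c" if "k \<in> carrier Z" for k
  proof -
    have "gconj G (?g k) d = gconj G (?g k) (gconj G (q d) r)"
      by (simp only: gconj_q[OF d])
    also have "\<dots> = gconj G (q c \<otimes> k) r"
      using Z(1)[OF that] qc qd r by (simp add: gconj_gconj m_assoc)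
    also have "\<dots> = gconj G (q c) (gconj G k r)"
      by (rule gconj_gconj[symmetric]) (use Z(1)[OF that] qc r in auto)
    finally show ?thesis
      by (simp add: Z(2)[OF that] gconj_q[OF c])
  qed
  have "(\<Sum>u\<in>carrier G. a u * \<rho> u (c, i') n) = (if i' = i \<and> n = (d, j) then 1 else 0)"
    if i': "i' \<in> J" and n: "n \<in> K" for i' n
  proof -
    obtain d' j' where n': "n = (d', j')" "d' \<in> C" "j' \<in> J"
      using n by auto
    have \<rho>: "\<rho> (?g k) (c, i') n = (if d' = d then \<pi> k i' j' else 0)" if k: "k \<in> carrier Z" for k
    proof -
      have "c = gconj G (?g k) d' \<longleftrightarrow> d' = d"
        using conj[OF k] gconj_cancel[of "?g k" d d'] Z(1)[OF k] qc qd C_subset d n' by auto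
      moreover have "zeta G q d (?g k) = k"
        using conj[OF k] Z(1)[OF k] qc qd by (simp add: zeta_def m_assoc)
      ultimately show ?thesis
        by (auto simp: rho_eq n')
    qed
    have "(\<Sum>u\<in>carrier G. a u * \<rho> u (c, i') n)
        = (if d' = d then ?k * (\<Sum>k\<in>carrier Z. \<pi> k i' j' * \<pi> (inv\<^bsub>Z\<^esub> k) j i) else 0)"
      unfolding sum_a by (simp add: \<rho> inv_centralizer sum_distrib_left ac_simps cong: sum.cong)
    also have "(\<Sum>k\<in>carrier Z. \<pi> k i' j' * \<pi> (inv\<^bsub>Z\<^esub> k) j i)
        = (if i' = i \<and> j' = j then of_nat (card (carrier Z)) / of_nat (card J) else 0)"
      by (rule schur_orthogonality[OF group_centralizer finite_centralizer irreducible i' n'(3) i j])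
    finally show ?thesis
      using card by (auto simp: n')
  qed
  moreover have "(\<Sum>u\<in>carrier G. a u) = (if c \<in> S then 1 else 0)"
  proof -
    have "(\<Sum>u\<in>carrier G. a u) = ?k * (\<Sum>k\<in>carrier Z. \<pi> (inv\<^bsub>Z\<^esub> k) j i)"
      using sum_a[of "\<lambda>_. 1"] by (simp add: inv_centralizer sum_distrib_left cong: sum.cong)
    also have "(\<Sum>k\<in>carrier Z. \<pi> (inv\<^bsub>Z\<^esub> k) j i) = (\<Sum>k\<in>carrier Z. \<pi> k j i)"
      by (intro sum.reindex_bij_witness[of _ "\<lambda>k. inv\<^bsub>Z\<^esub> k" "\<lambda>k. inv\<^bsub>Z\<^esub> k"]) auto
    \<comment> \<open>For trivial \<open>\<pi>\<close> the sum counts the centraliser and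
      \<open>J\<close> has one element, so the normalised sum is 1. Otherwise the sum over the
      centraliser vanishes.\<close>
    also have "?k * \<dots> = (if c \<in> S then 1 else 0)"
    proof (cases "trivial_rep Z J \<pi>")
      case True
      then have "c \<in> S"
        using c by (simp add: S_def)
      then have "J = {i}"
        using J_singleton i by blast
      moreover have "\<pi> k i i = 1" if "k \<in> carrier Z" for k
        using True that i by (simp add: trivial_rep_def)
      ultimately show ?thesis
        using \<open>c \<in> S\<close> j card by simp
    next
      case False
      then show ?thesis
        using sum_nontrivial_irreducible_rep[OF group_centralizer finite_centralizer irreducible False j i]
        by (simp add: S_def)
    qed
    finally show ?thesis .
  qed
  ultimately show ?thesis
    using that by blast
qed

section \<open>The form varpi and the annihilator of V\<close>

definition act :: "('a \<times> 'a \<Rightarrow> complex) \<Rightarrow> 'a \<times> 'i \<Rightarrow> 'a \<times> 'i \<Rightarrow> complex" where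
  "act x m n = (\<Sum>v\<in>carrier G. x (fst m, v) * \<rho> v m n)"

lemma antipode_closed: "antipode P x \<in> carrier (alg P)"
  by (auto simp: dvee_antipode alg_ops carrier_fspace)

lemma bvec_closed: "b \<in> basis P \<Longrightarrow> bvec b \<in> carrier (alg P)"
  by (simp add: alg_ops)

lemma mc_form_eq:
  "mc_form P \<Omega> x = (\<lambda>z. \<Sum>w\<in>basis P \<times> basis P. comult P x w
     * free_lact P (antipode P (bvec (fst w))) (\<delta> (bvec (snd w))) z)"
  and mc_form_closed: "mc_form P \<Omega> x \<in> carrier (fspace (basis P \<times> L))"
proof -
  have c: "free_lact P (antipode P (bvec (fst w))) (\<delta> (bvec (snd w))) \<in> carrier (fspace (basis P \<times> L))"
    if "w \<in> basis P \<times> basis P" for w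
    using that by (intro bim.lact_closed delta_closed antipode_closed bvec_closed) (simp add: mem_Times_iff)
  show "mc_form P \<Omega> x = (\<lambda>z. \<Sum>w\<in>basis P \<times> basis P. comult P x w
     * free_lact P (antipode P (bvec (fst w))) (\<delta> (bvec (snd w))) z)"
    unfolding mc_form_def
    by (subst finsum_fun_module) (auto simp: fun_module_ops(3) intro!: lin_closedD(3)[OF lin_closed_fspace]
        c[unfolded mem_Times_iff hopf_simps] c)
  then show "mc_form P \<Omega> x \<in> carrier (fspace (basis P \<times> L))"
    using c by (simp only:) (intro lin_closed_lin_comb lin_closed_fspace c)
qed

text \<open>Left invariance is visible in the coefficients: they do not depend on f and live at the
  group element 1. The matrix found there is the operator by which x acts on V, where (g, h) acts as
  rho(h) followed by projection to the block over g, minus the counit of x.\<close>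

lemma mc_form_in:
  assumes z: "f \<in> carrier G" "h \<in> carrier G" "m \<in> K" "n \<in> K"
  shows "mc_form P \<Omega> x ((f, h), (m, n)) = (if h = \<one> then act x m n - (if m = n then counit P x else 0) else 0)"
proof -
  note m = K_fst[OF z(3)]
  \<comment> \<open>The antipode moves the first leg to a^-1, so a = f^-1. In the differential of
    the second leg, b = fc contributes \<open>\<rho> v\<close>, where x is then evaluated at ab = c,
    and b = f contributes the identity, where x is evaluated at 1. In both cases the twists cancel
    and force h = 1.\<close>
  have summand: "free_lact P (antipode P (bvec (a, gconj G b v))) (\<delta> (bvec (b, v))) ((f, h), (m, n))
      = (if a = inv f then (if b = f \<otimes> fst m then if h = \<one> then \<rho> v m n else 0 else 0)
          - (if b = f then if h = \<one> \<and> m = n then 1 else 0 else 0) else 0)"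
    if abv: "a \<in> carrier G" "b \<in> carrier G" "v \<in> carrier G" for a b v
  proof -
    let ?t = "gconj G a (inv (gconj G b v))"
    have "antipode P (bvec (a, gconj G b v)) = bvec (inv a, ?t)"
      unfolding antipode_def using abv by (subst lext_bvec) auto
    then have "free_lact P (antipode P (bvec (a, gconj G b v))) (\<delta> (bvec (b, v))) ((f, h), (m, n))
        = (\<Sum>k\<in>carrier G. bvec (inv a, ?t) (f, k) * \<delta> (bvec (b, v)) ((f, inv k \<otimes> h), (m, n)))"
      using z by (simp add: lact_eq[of "bvec _"])
    also have "\<dots> = (\<Sum>k\<in>carrier G. if k = ?t then if f = inv a then \<delta> (bvec (b, v)) ((f, inv k \<otimes> h), (m, n)) else 0 else 0)"
      by (intro sum.cong refl) (simp only: bvec_def prod.inject, simp)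
    also have "\<dots> = (if f = inv a then \<delta> (bvec (b, v)) ((f, inv ?t \<otimes> h), (m, n)) else 0)"
      using abv by simp
    also have "\<dots> = (if a = inv f then (if b = f \<otimes> fst m then if h = \<one> then \<rho> v m n else 0 else 0)
          - (if b = f then if h = \<one> \<and> m = n then 1 else 0 else 0) else 0)"
    proof (cases "f = inv a")
      case True
      then have a: "a = inv f" using abv by simp
      have t: "inv ?t = gconj G (inv f) (gconj G b v)"
        using abv z by (simp add: inv_gconj a)
      have 1: "v = \<gamma> m (inv ?t \<otimes> h) \<longleftrightarrow> h = \<one>" if "b = f \<otimes> fst m"
      proof -
        have it: "inv ?t = gconj G (fst m) v"
          unfolding t using that abv z m by (simp add: gconj_gconj[symmetric])
        have "\<gamma> m (inv ?t \<otimes> h) = v \<otimes> \<gamma> m h"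
          unfolding it using abv z m by (simp add: \<gamma>_def gconj_mult)
        moreover have "v = v \<otimes> \<gamma> m h \<longleftrightarrow> \<gamma> m h = \<one>"
          using abv z eq_mult_iff(1)[of v "\<gamma> m h" v] by simp
        moreover have "\<gamma> m h = \<one> \<longleftrightarrow> h = \<one>"
          unfolding \<gamma>_def using z m gconj_cancel[of "inv (fst m)" h \<one>] by simp
        ultimately show ?thesis by metis
      qed
      have 2: "v = inv ?t \<otimes> h \<longleftrightarrow> h = \<one>" if "b = f"
      proof -
        have "inv ?t = v"
          unfolding t using that abv z by simp
        then show ?thesis
          using abv z eq_mult_iff(1)[of v h v] by auto
      qed
      have "\<delta> (bvec (b, v)) ((f, inv ?t \<otimes> h), (m, n))
          = bvec (b, v) (f \<otimes> fst m, \<gamma> m (inv ?t \<otimes> h)) * \<rho> (\<gamma> m (inv ?t \<otimes> h)) m n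
            - (if m = n then bvec (b, v) (f, inv ?t \<otimes> h) else 0)"
        using z abv by (intro delta_in) auto
      also have "\<dots> = (if b = f \<otimes> fst m then if h = \<one> then \<rho> v m n else 0 else 0)
          - (if b = f then if h = \<one> \<and> m = n then 1 else 0 else 0)"
      proof (rule arg_cong2[of _ _ _ _ "(-)"])
        show "bvec (b, v) (f \<otimes> fst m, \<gamma> m (inv ?t \<otimes> h)) * \<rho> (\<gamma> m (inv ?t \<otimes> h)) m n
          = (if b = f \<otimes> fst m then if h = \<one> then \<rho> v m n else 0 else 0)"
        proof (cases "b = f \<otimes> fst m \<and> h = \<one>")
          case True
          then have "v = \<gamma> m (inv ?t \<otimes> h)"
            using 1 by blast
          with True show ?thesis
            by (simp only: bvec_def simp_thms if_True mult_1_left)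
        next
          case False
          then have "(f \<otimes> fst m, \<gamma> m (inv ?t \<otimes> h)) \<noteq> (b, v)"
            using 1 by (metis prod.inject)
          then have "bvec (b, v) (f \<otimes> fst m, \<gamma> m (inv ?t \<otimes> h)) = (0 :: complex)"
            by (simp only: bvec_def if_False)
          moreover have "(if b = f \<otimes> fst m then if h = \<one> then \<rho> v m n else 0 else 0) = 0"
            using False by auto
          ultimately show ?thesis
            by (simp only: mult_zero_left)
        qed
        show "(if m = n then bvec (b, v) (f, inv ?t \<otimes> h) else 0)
          = (if b = f then if h = \<one> \<and> m = n then 1 else 0 else 0)"
        proof (cases "b = f \<and> h = \<one>")
          case True
          then have "v = inv ?t \<otimes> h"
            using 2 by blast
          with True show ?thesis
            by (simp only: bvec_def simp_thms if_True)
        next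
          case False
          then have "(f, inv ?t \<otimes> h) \<noteq> (b, v)"
            using 2 by (metis prod.inject)
          then have "bvec (b, v) (f, inv ?t \<otimes> h) = (0 :: complex)"
            by (simp only: bvec_def if_False)
          moreover have "(if b = f then if h = \<one> \<and> m = n then 1 else 0 else 0) = (0 :: complex)"
            using False by auto
          ultimately show ?thesis
            by (simp only: if_cancel)
        qed
      qed
      finally show ?thesis
        by (simp only: if_P[OF True] if_P[OF a])
    next
      case False
      then have "a \<noteq> inv f" using z by auto
      with False show ?thesis by simp
    qed
    finally show ?thesis .
  qed
  have "mc_form P \<Omega> x ((f, h), (m, n)) = (\<Sum>a\<in>carrier G. \<Sum>b\<in>carrier G. \<Sum>v\<in>carrier G. x (a \<otimes> b, v) *
      free_lact P (antipode P (bvec (a, gconj G b v))) (\<delta> (bvec (b, v))) ((f, h), (m, n)))"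
    unfolding mc_form_eq sum_comult by simp
  also have "\<dots> = (\<Sum>a\<in>carrier G. \<Sum>b\<in>carrier G. \<Sum>v\<in>carrier G. if a = inv f then
      (if b = f \<otimes> fst m then if h = \<one> then x (a \<otimes> b, v) * \<rho> v m n else 0 else 0)
      - (if b = f then if h = \<one> \<and> m = n then x (a \<otimes> b, v) else 0 else 0) else 0)"
    by (intro sum.cong refl) (simp add: summand right_diff_distrib)
  also have "\<dots> = (\<Sum>a\<in>carrier G. if a = inv f then (\<Sum>b\<in>carrier G.
      (if b = f \<otimes> fst m then (\<Sum>v\<in>carrier G. if h = \<one> then x (a \<otimes> b, v) * \<rho> v m n else 0) else 0)
      - (if b = f then (\<Sum>v\<in>carrier G. if h = \<one> \<and> m = n then x (a \<otimes> b, v) else 0) else 0)) else 0)"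
    (is "sum ?A _ = sum ?B _")
  proof (rule sum.cong[OF refl])
    fix a
    have "(\<Sum>v\<in>carrier G.
        (if b = f \<otimes> fst m then if h = \<one> then x (a \<otimes> b, v) * \<rho> v m n else 0 else 0)
        - (if b = f then if h = \<one> \<and> m = n then x (a \<otimes> b, v) else 0 else 0))
      = (if b = f \<otimes> fst m then (\<Sum>v\<in>carrier G. if h = \<one> then x (a \<otimes> b, v) * \<rho> v m n else 0) else 0)
        - (if b = f then (\<Sum>v\<in>carrier G. if h = \<one> \<and> m = n then x (a \<otimes> b, v) else 0) else 0)" for b
      by (cases "b = f \<otimes> fst m"; cases "b = f") (simp_all only: sum_subtractf if_True if_False sum.neutral_const simp_thms)
    then show "?A a = ?B a"
      by (cases "a = inv f") (simp_all only: simp_thms if_True if_False sum.neutral_const)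
  qed
  also have "\<dots> = (\<Sum>v\<in>carrier G. if h = \<one> then x (fst m, v) * \<rho> v m n else 0)
      - (\<Sum>v\<in>carrier G. if h = \<one> \<and> m = n then x (\<one>, v) else 0)"
    using z m by (simp add: sum_subtractf cong: if_cong)
  also have "\<dots> = (if h = \<one> then act x m n - (if m = n then counit P x else 0) else 0)"
    by (auto simp: act_def dvee_counit)
  finally show ?thesis .
qed

text \<open>On the augmentation ideal the counit term of \<open>mc_form_in\<close> drops out, so the
  kernel consists of the elements acting as zero on V.\<close>

lemma mc_kernel_eq: "mc_kernel P \<Omega> = {x \<in> augm P. \<forall>m\<in>K. \<forall>n\<in>K. act x m n = 0}"
proof -
  have "mc_form P \<Omega> x = (\<lambda>_. 0) \<longleftrightarrow> (\<forall>m\<in>K. \<forall>n\<in>K. act x m n = 0)" if x: "counit P x = 0" for x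
  proof
    assume zero: "mc_form P \<Omega> x = (\<lambda>_. 0)"
    have "act x m n = 0" if "m \<in> K" "n \<in> K" for m n
      using mc_form_in[of \<one> \<one> m n x] that by (simp add: zero x)
    then show "\<forall>m\<in>K. \<forall>n\<in>K. act x m n = 0" by blast
  next
    assume *: "\<forall>m\<in>K. \<forall>n\<in>K. act x m n = 0"
    show "mc_form P \<Omega> x = (\<lambda>_. 0)"
      by (rule forms_eqI[OF mc_form_closed]) (use * in \<open>auto simp: carrier_fspace mc_form_in x\<close>)
  qed
  then show ?thesis
    by (auto simp: mc_kernel_def augm_def fun_module_ops(1))
qed

text \<open>The coefficients of \<open>matrix_unit_rho\<close> are placed on the slice over c. The
  counit sees only the slice over 1, so it vanishes when c is not 1; when c = 1, then c is not in
  \<open>S\<close> and the coefficients sum to 0.\<close>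

lemma matrix_unit_act:
  assumes "m \<in> K" "n \<in> K"
  obtains x where "x \<in> augm P"
    "\<And>m' n'. m' \<in> K \<Longrightarrow> n' \<in> K \<Longrightarrow> act x m' n' = (if m' = m \<and> n' = n then 1 else 0)"
proof -
  obtain c i d j where mn: "m = (c, i)" "n = (d, j)" "c \<in> C" "i \<in> J" "d \<in> C" "j \<in> J"
    using assms by auto
  obtain a where a: "\<And>i' n. i' \<in> J \<Longrightarrow> n \<in> K \<Longrightarrow> (\<Sum>u\<in>carrier G. a u * \<rho> u (c, i') n) = (if i' = i \<and> n = (d, j) then 1 else 0)"
    "(\<Sum>u\<in>carrier G. a u) = (if c \<in> S then 1 else 0 :: complex)"
    using matrix_unit_rho[OF mn(3,5,4,6)] by blast
  define x where "x = (\<lambda>(g, u). if g = c \<and> u \<in> carrier G then a u else 0)"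
  have "counit P x = (if \<one> = c then \<Sum>u\<in>carrier G. a u else 0)"
    by (auto simp: dvee_counit x_def cong: sum.cong)
  also have "\<dots> = 0"
    using a(2) one_notin_S by auto
  finally have "x \<in> augm P"
    using C_subset[OF mn(3)] by (auto simp: augm_def alg_ops carrier_fspace x_def)
  moreover have "act x m' n' = (if m' = m \<and> n' = n then 1 else 0)" if K: "m' \<in> K" "n' \<in> K" for m' n'
  proof -
    obtain c' i' where m': "m' = (c', i')" "i' \<in> J"
      using K(1) by blast
    show ?thesis
      using a(1)[OF m'(2) K(2)] by (cases "c' = c") (auto simp: act_def x_def m' mn cong: sum.cong)
  qed
  ultimately show ?thesis
    using that by blast
qed

text \<open>By \<open>matrix_unit_act\<close> every matrix unit is a left-invariant form varpi(x)
  with x in the augmentation ideal, and multiplying it on the left by a basis element of P gives an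
  arbitrary basis form.\<close>

lemma fo_calculus_dvee: "fo_calculus (alg P) \<Omega>"
  unfolding Omega_eq
proof (rule bim.fo_calculus_inner[OF theta_closed refl])
  fix b l assume b: "b \<in> basis P" and "l \<in> L"
  then obtain m n where l: "l = (m, n)" "m \<in> K" "n \<in> K" by blast
  let ?X = "{free_lact P x (\<delta> y) | x y. x \<in> carrier (alg P) \<and> y \<in> carrier (alg P)}"
  obtain x where x: "x \<in> augm P"
    "\<And>m' n'. m' \<in> K \<Longrightarrow> n' \<in> K \<Longrightarrow> act x m' n' = (if m' = m \<and> n' = n then 1 else 0)"
    using matrix_unit_act[OF l(2,3)] by blast
  obtain g k where gk: "b = (g, k)" "g \<in> carrier G" "k \<in> carrier G"
    using b by auto
  have bP: "bvec b \<in> carrier (alg P)"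
    using b by (simp add: alg_ops)
  have anti: "antipode P (bvec w) \<in> carrier (alg P)" for w
    by (auto simp: dvee_antipode alg_ops carrier_fspace)
  \<comment> \<open>varpi(x) is a combination of forms S(y) dz, and the factor \<open>bvec b\<close>
    is absorbed into S(y). Hence the multiple by \<open>bvec b\<close> lies in the span of the forms
    x dy.\<close>
  have "mc_form P \<Omega> x \<in> {w \<in> carrier (fspace (basis P \<times> L)). free_lact P (bvec b) w \<in> fspan ?X}"
    unfolding mc_form_eq
  proof (rule lin_closed_lin_comb)
    show "lin_closed {w \<in> carrier (fspace (basis P \<times> L)). free_lact P (bvec b) w \<in> fspan ?X}"
      by (rule lin_closed_kernel) (simp_all add: flinear_def free_lact_linear)
    fix w assume w: "w \<in> basis P \<times> basis P"
    then have w': "bvec (snd w) \<in> carrier (alg P)"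
      by (auto simp: alg_ops)
    have "free_lact P (bvec b) (free_lact P (antipode P (bvec (fst w))) (\<delta> (bvec (snd w))))
        = free_lact P (bvec b \<otimes>\<^bsub>alg P\<^esub> antipode P (bvec (fst w))) (\<delta> (bvec (snd w)))"
      by (rule bim.lact_mult[OF delta_closed[OF w'] bP anti, symmetric])
    also have "\<dots> \<in> fspan ?X"
      using complex_algebraD(2)[OF complex_algebra_dvee bP anti] w' by (intro fspan_base) blast
    finally show "free_lact P (antipode P (bvec (fst w))) (\<delta> (bvec (snd w)))
        \<in> {w \<in> carrier (fspace (basis P \<times> L)). free_lact P (bvec b) w \<in> fspan ?X}"
      using bim.lact_closed[OF anti delta_closed[OF w']] by blast
  qed
  moreover have "free_lact P (bvec b) (mc_form P \<Omega> x) = bvec (b, l)"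
  proof (rule forms_eqI)
    show "free_lact P (bvec b) (mc_form P \<Omega> x) \<in> carrier (fspace (basis P \<times> L))"
      by (rule bim.lact_closed[OF bP mc_form_closed])
    show "bvec (b, l) \<in> carrier (fspace (basis P \<times> L))"
      using b \<open>l \<in> L\<close> by simp
    fix f h m' n' assume z: "f \<in> carrier G" "h \<in> carrier G" "m' \<in> K" "n' \<in> K"
    have x0: "counit P x = 0"
      using x(1) by (simp add: augm_def)
    have "free_lact P (bvec b) (mc_form P \<Omega> x) ((f, h), (m', n'))
        = (\<Sum>k'\<in>carrier G. bvec b (f, k') * mc_form P \<Omega> x ((f, inv k' \<otimes> h), (m', n')))"
      using z by (simp add: lact_eq)
    also have "\<dots> = (\<Sum>k'\<in>carrier G. if k' = k then if f = g \<and> k' = h \<and> m' = m \<and> n' = n then 1 else 0 else 0)"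
      by (intro sum.cong refl) (use z in \<open>auto simp: bvec_def gk mc_form_in x(2) x0 inv_mult_eq_one_iff\<close>)
    also have "\<dots> = bvec (b, l) ((f, h), (m', n'))"
      using gk z by (auto simp: bvec_def l)
    finally show "free_lact P (bvec b) (mc_form P \<Omega> x) ((f, h), (m', n')) = bvec (b, l) ((f, h), (m', n'))" .
  qed
  ultimately show "bvec (b, l) \<in> fspan ?X"
    by simp
qed

lemma bicovariant_dvee: "bicovariant_calculus P \<Omega>"
  unfolding bicovariant_calculus_def
  using fo_calculus_dvee covariant_left covariant_right by (auto simp: fun_module_ops(1))

section \<open>The ideal of the calculus on the fibre\<close>

abbreviation "R \<equiv> fibre_ideal P p \<Omega>"

lemma augm_fun: "augm H = {x \<in> carrier (fspace (carrier G)). x \<one> = 0}"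
  by (simp add: augm_def alg_ops fun_counit)

text \<open>If x annihilates V and c is in \<open>S\<close>, adding up a row of the zero matrix over
  c with row sums 1 gives p(x)(c) = 0. Conversely, f is lifted slice by slice: f(g) times the group
  unit, corrected by a combination that acts in the same way on the rows over g but has coefficient
  sum 0.\<close>

lemma fibre_ideal_eq: "R = {f \<in> carrier (fspace (carrier G)). f \<one> = 0 \<and> (\<forall>c\<in>S. f c = 0)}"
proof
  show "R \<subseteq> {f \<in> carrier (fspace (carrier G)). f \<one> = 0 \<and> (\<forall>c\<in>S. f c = 0)}"
  proof
    fix f assume "f \<in> R"
    then obtain x where x: "x \<in> augm P" "\<And>m n. m \<in> K \<Longrightarrow> n \<in> K \<Longrightarrow> act x m n = 0" "f = p x"
      by (auto simp: fibre_ideal_def mc_kernel_eq)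
    have "f c = 0" if c: "c \<in> S" for c
    proof -
      obtain i where i: "i \<in> J"
        using irreducible by (auto simp: irreducible_rep_def)
      have "0 = (\<Sum>n\<in>K. act x (c, i) n)"
        using x(2) S_subset[OF c] i by simp
      also have "\<dots> = (\<Sum>v\<in>carrier G. x (c, v) * (\<Sum>n\<in>K. \<rho> v (c, i) n))"
        unfolding act_def sum_distrib_left by (subst sum.swap) simp
      also have "\<dots> = f c"
        using c i by (simp add: x(3) row_sum_rho dvee_proj_eq cong: sum.cong)
      finally show ?thesis by simp
    qed
    moreover have "f \<in> carrier (fspace (carrier G))" "f \<one> = 0"
      using x(1) by (auto simp: x(3) augm_def dvee_counit dvee_proj_eq alg_ops carrier_fspace)
    ultimately show "f \<in> {f \<in> carrier (fspace (carrier G)). f \<one> = 0 \<and> (\<forall>c\<in>S. f c = 0)}"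
      by blast
  qed
  show "{f \<in> carrier (fspace (carrier G)). f \<one> = 0 \<and> (\<forall>c\<in>S. f c = 0)} \<subseteq> R"
  proof clarify
    fix f assume f: "f \<in> carrier (fspace (carrier G))" "f \<one> = 0" "\<forall>c\<in>S. f c = 0"
    \<comment> \<open>Outside \<open>S\<close> the identity on the rows over c is a combination of
      the \<open>\<rho> u\<close> with coefficient sum 0, the sum over \<open>J\<close> of the
      combinations for the diagonal matrix units.\<close>
    have "\<exists>a. \<forall>i'\<in>J. \<forall>n\<in>K. (\<Sum>u\<in>carrier G. a u * \<rho> u (c, i') n) = (if (c, i') = n then 1 else 0)
        \<and> (\<Sum>u\<in>carrier G. a u) = (0 :: complex)" if c: "c \<in> C - S" for c
    proof -
      have "\<exists>a. (\<forall>i'\<in>J. \<forall>n\<in>K. (\<Sum>u\<in>carrier G. a u * \<rho> u (c, i') n) = (if i' = i \<and> n = (c, i) then 1 else 0))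
          \<and> (\<Sum>u\<in>carrier G. a u) = (0 :: complex)" if i: "i \<in> J" for i
      proof -
        have cC: "c \<in> C" "c \<notin> S"
          using c by auto
        obtain a where "\<And>i' n. i' \<in> J \<Longrightarrow> n \<in> K
            \<Longrightarrow> (\<Sum>u\<in>carrier G. a u * \<rho> u (c, i') n) = (if i' = i \<and> n = (c, i) then 1 else 0)"
          "(\<Sum>u\<in>carrier G. a u) = (if c \<in> S then 1 else 0 :: complex)"
          by (rule matrix_unit_rho[OF cC(1) cC(1) i i]) blast
        then show ?thesis
          using cC(2) by (intro exI[of _ a]) simp
      qed
      then have "\<forall>i\<in>J. \<exists>a. (\<forall>i'\<in>J. \<forall>n\<in>K. (\<Sum>u\<in>carrier G. a u * \<rho> u (c, i') n)
            = (if i' = i \<and> n = (c, i) then 1 else 0)) \<and> (\<Sum>u\<in>carrier G. a u) = (0 :: complex)"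
        by blast
      from bchoice[OF this] obtain a where a: "\<And>i i' n. i \<in> J \<Longrightarrow> i' \<in> J \<Longrightarrow> n \<in> K
          \<Longrightarrow> (\<Sum>u\<in>carrier G. a i u * \<rho> u (c, i') n) = (if i' = i \<and> n = (c, i) then 1 else 0)"
        "\<And>i. i \<in> J \<Longrightarrow> (\<Sum>u\<in>carrier G. a i u) = (0 :: complex)"
        by blast
      have "(\<Sum>u\<in>carrier G. (\<Sum>i\<in>J. a i u) * \<rho> u (c, i') n) = (if (c, i') = n then 1 else 0)"
        if "i' \<in> J" "n \<in> K" for i' n
      proof -
        have "(\<Sum>u\<in>carrier G. (\<Sum>i\<in>J. a i u) * \<rho> u (c, i') n) = (\<Sum>i\<in>J. \<Sum>u\<in>carrier G. a i u * \<rho> u (c, i') n)"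
          unfolding sum_distrib_right by (rule sum.swap)
        also have "\<dots> = (\<Sum>i\<in>J. if i = i' then if (c, i') = n then 1 else 0 else 0)"
          using a(1) that by (intro sum.cong refl) auto
        finally show ?thesis using that by simp
      qed
      moreover have "(\<Sum>u\<in>carrier G. \<Sum>i\<in>J. a i u) = 0"
        using a(2) by (subst sum.swap) simp
      ultimately show ?thesis
        by (intro exI[of _ "\<lambda>u. \<Sum>i\<in>J. a i u"]) auto
    qed
    then have "\<forall>c\<in>C - S. \<exists>a. \<forall>i'\<in>J. \<forall>n\<in>K. (\<Sum>u\<in>carrier G. a u * \<rho> u (c, i') n) = (if (c, i') = n then 1 else 0)
        \<and> (\<Sum>u\<in>carrier G. a u) = (0 :: complex)"
      by blast
    from bchoice[OF this] obtain a where a: "\<And>c i' n. c \<in> C - S \<Longrightarrow> i' \<in> J \<Longrightarrow> n \<in> K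
        \<Longrightarrow> (\<Sum>u\<in>carrier G. a c u * \<rho> u (c, i') n) = (if (c, i') = n then 1 else 0)"
      "\<And>c i' n. c \<in> C - S \<Longrightarrow> i' \<in> J \<Longrightarrow> n \<in> K \<Longrightarrow> (\<Sum>u\<in>carrier G. a c u) = (0 :: complex)"
      by blast
    \<comment> \<open>The slice over g has total f(g), so p(x) = f, and for g in
      \<open>C - S\<close> it acts as f(g) times identity minus identity. On \<open>S\<close> the
      factor f(g) is 0, and over points outside \<open>C\<close> there are no rows.\<close>
    define x where "x = (\<lambda>(g, u). if g \<in> carrier G \<and> u \<in> carrier G
        then f g * ((if u = \<one> then 1 else 0) - (if g \<in> C - S then a g u else 0)) else 0)"
    have px: "(\<Sum>u\<in>carrier G. x (g, u)) = f g" if g: "g \<in> carrier G" for g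
    proof -
      have "(\<Sum>u\<in>carrier G. if g \<in> C - S then a g u else 0) = 0"
      proof (cases "g \<in> C - S")
        case True
        moreover obtain i where "i \<in> J"
          using irreducible by (auto simp: irreducible_rep_def)
        ultimately show ?thesis
          using a(2)[of g i "(g, i)"] by simp
      qed (auto intro!: sum.neutral)
      then show ?thesis
        using g by (simp add: x_def sum_distrib_left[symmetric] sum_subtractf cong: sum.cong)
    qed
    have "x \<in> augm P"
      using px[of \<one>] f(2) by (auto simp: augm_def dvee_counit alg_ops carrier_fspace x_def)
    moreover have "act x m n = 0" if mn: "m \<in> K" "n \<in> K" for m n
    proof (cases "fst m \<in> S")
      case True
      then show ?thesis
        using f(3) by (auto simp: act_def x_def intro!: sum.neutral)
    next
      case False
      then have m: "fst m \<in> C - S" "snd m \<in> J" "fst m \<in> carrier G"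
        using mn C_subset by auto
      have "act x m n = f (fst m) * ((\<Sum>u\<in>carrier G. (if u = \<one> then 1 else 0) * \<rho> u m n)
          - (\<Sum>u\<in>carrier G. a (fst m) u * \<rho> u m n))"
        using m by (simp add: act_def x_def sum_distrib_left sum_subtractf[symmetric] algebra_simps cong: sum.cong)
      also have "(\<Sum>u\<in>carrier G. (if u = \<one> then 1 else 0) * \<rho> u m n) = (if m = n then 1 else 0)"
        using rho_one[OF mn] by (simp add: if_distrib[of "\<lambda>x. x * _"] cong: if_cong)
      also have "(\<Sum>u\<in>carrier G. a (fst m) u * \<rho> u m n) = (if m = n then 1 else 0)"
        using a(1)[OF m(1,2) mn(2)] by simp
      finally show ?thesis by simp
    qed
    moreover have "f = p x"
    proof
      fix g
      show "f g = p x g"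
        using px[of g] f(1) by (cases "g \<in> carrier G") (auto simp: dvee_proj_eq x_def carrier_fspace)
    qed
    ultimately show "f \<in> R"
      by (auto simp: fibre_ideal_def mc_kernel_eq)
  qed
qed

end

section \<open>The vertical map\<close>

lemma lin_closed_tens: "lin_closed (tens U W)"
  unfolding tens_def by (subst lin_span_eq_fspan) (auto simp: carrier_fspace)

lemma mem_tens_iff:
  assumes "finite B" "lin_closed U"
  shows "t \<in> tens (carrier (fspace B)) U
    \<longleftrightarrow> (\<forall>b\<in>B. (\<lambda>c. t (b, c)) \<in> U) \<and> (\<forall>b c. b \<notin> B \<longrightarrow> t (b, c) = 0)"
  unfolding tens_fspace_eq[OF assms] by (auto simp: fun_eq_iff)

context nontrivial_class_rep
begin

interpretation bim: free_bimodule P L sr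
  by (rule free_bimodule)

section \<open>Coordinates on the quotients by the fibre ideal\<close>

abbreviation "M B \<equiv> (fspace (B \<times> carrier G))\<lparr>carrier := tens (carrier (fspace B)) (augm H)\<rparr>"
abbreviation "N B \<equiv> tens (carrier (fspace B)) R"

text \<open>On functions that vanish at 1 in the second variable, the kernel of this restriction is
  \<open>N B\<close>, so it provides coordinates on the quotient of \<open>M B\<close> by
  \<open>N B\<close>. The first factor is left arbitrary because both P and H occur there.\<close>

definition res :: "('c \<times> 'a \<Rightarrow> complex) \<Rightarrow> 'c \<times> 'a \<Rightarrow> complex" where
  "res t = (\<lambda>(b, c). if c \<in> S then t (b, c) else 0)"

lemma lin_closed_augm: "lin_closed (augm H)"
  unfolding augm_fun by (rule lin_closedI) (auto simp: carrier_fspace)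

lemma lin_closed_fibre_ideal: "lin_closed R"
  unfolding fibre_ideal_eq by (rule lin_closedI) (auto simp: carrier_fspace)

lemma mem_M:
  assumes "finite B"
  shows "t \<in> carrier (M B) \<longleftrightarrow> t \<in> carrier (fspace (B \<times> carrier G)) \<and> (\<forall>b. t (b, \<one>) = 0)"
proof -
  have "t \<in> carrier (M B) \<longleftrightarrow> t \<in> tens (carrier (fspace B)) (augm H)"
    by simp
  also have "\<dots> \<longleftrightarrow> t \<in> carrier (fspace (B \<times> carrier G)) \<and> (\<forall>b. t (b, \<one>) = 0)"
    unfolding mem_tens_iff[OF assms lin_closed_augm] unfolding augm_fun by (auto simp: carrier_fspace)
  finally show ?thesis .
qed

lemma mem_N:
  assumes "finite B"
  shows "t \<in> N B \<longleftrightarrow> t \<in> carrier (M B) \<and> (\<forall>b. \<forall>c\<in>S. t (b, c) = 0)"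
  unfolding mem_M[OF assms] mem_tens_iff[OF assms lin_closed_fibre_ideal]
  unfolding fibre_ideal_eq by (auto simp: carrier_fspace)

lemma res_quotient:
  assumes "finite B"
  shows "linear_quotient (M B) (N B) res"
proof
  show "fun_module (M B)"
    by (intro fun_module_carrier_update fun_module_fspace lin_closed_tens)
  show "flinear (carrier (M B)) res"
    by (rule flinearI) (auto simp: res_def fun_eq_iff)
  show "N B = {t \<in> carrier (M B). res t = (\<lambda>_. 0)}"
    unfolding set_eq_iff mem_N[OF assms] by (auto simp: res_def fun_eq_iff split: if_splits)
qed

text \<open>A function supported on \<open>S\<close> already vanishes at 1, because 1 is not in
  \<open>S\<close>, and is its own preimage.\<close>

lemma res_image:
  assumes "finite B"
  shows "res ` carrier (M B) = carrier (fspace (B \<times> S))"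
proof
  show "res ` carrier (M B) \<subseteq> carrier (fspace (B \<times> S))"
    unfolding image_subset_iff mem_M[OF assms] Ball_def by (auto simp: res_def carrier_fspace)
  show "carrier (fspace (B \<times> S)) \<subseteq> res ` carrier (M B)"
  proof
    fix t assume t: "t \<in> carrier (fspace (B \<times> S))"
    then have "t \<in> carrier (M B)"
      using S_carrier one_notin_S unfolding mem_M[OF assms] by (auto simp: carrier_fspace)
    moreover have "t = res t"
      using t by (auto simp: res_def carrier_fspace fun_eq_iff)
    ultimately show "t \<in> res ` carrier (M B)" by blast
  qed
qed

lemma tens_inv_forms_eq:
  "tens_inv_forms P H R = quot_module (M (basis P)) (N (basis P))"
  "tens_inv_forms H H R = quot_module (M (basis H)) (N (basis H))"
  by (simp_all add: tens_inv_forms_def alg_ops)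

lemma tens_class_eq:
  "tens_class P H R t = N (basis P) +>\<^bsub>M (basis P)\<^esub> t"
  "tens_class H H R t' = N (basis H) +>\<^bsub>M (basis H)\<^esub> t'"
  by (simp_all add: tens_class_def alg_ops a_r_coset_def')

text \<open>The vertical map in the coordinates given by \<open>res\<close>. For c in
  \<open>S\<close> the set \<open>J\<close> has one element, so this is the sum of a single row; if
  \<open>S\<close> is empty the map is zero.\<close>

definition hat :: "(('a \<times> 'a) \<times> (('a \<times> 'i) \<times> ('a \<times> 'i)) \<Rightarrow> complex) \<Rightarrow> ('a \<times> 'a) \<times> 'a \<Rightarrow> complex" where
  "hat w = (\<lambda>(b, c). if c \<in> S then \<Sum>i\<in>J. \<Sum>n\<in>K. w (b, ((c, i), n)) else 0)"

lemma flinear_hat: "flinear V hat"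
  by (rule flinearI) (auto simp: hat_def sum.distrib sum_distrib_left fun_eq_iff)

lemma res_res: "res (res t) = res t"
  by (simp add: res_def fun_eq_iff)

lemma res_hat: "res (hat w) = hat w"
  by (auto simp: res_def hat_def fun_eq_iff)

lemma hat_in_M:
  assumes "w \<in> carrier (fspace (basis P \<times> L))"
  shows "hat w \<in> carrier (M (basis P))"
  unfolding mem_M[OF finite_basis_dvee]
  using assms one_notin_S S_carrier by (auto simp: hat_def carrier_fspace intro!: sum.neutral)

abbreviation "ver_rep x y \<equiv> tprod x \<one>\<^bsub>alg H\<^esub> \<otimes>\<^bsub>alg (tensor_alg P H)\<^esub>
  (\<lambda>u. coact P p y u - tprod y \<one>\<^bsub>alg H\<^esub> u)"

lemma ver_rep_in:
  assumes "f \<in> carrier G" "h \<in> carrier G" "s \<in> carrier G"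
  shows "ver_rep x y ((f, h), s)
    = (\<Sum>k\<in>carrier G. x (f, k) * (y (f \<otimes> s, gconj G (inv s) (inv k \<otimes> h)) - y (f, inv k \<otimes> h)))"
  using assms by (simp add: dvee_fun_mult dvee_coact tprod_def alg_ops cong: sum.cong)

lemma ver_rep_in_M: "ver_rep x y \<in> carrier (M (basis P))"
  unfolding mem_M[OF finite_basis_dvee]
proof
  show "ver_rep x y \<in> carrier (fspace (basis P \<times> carrier G))"
    by (auto simp: carrier_fspace dvee_fun_mult)
  have "ver_rep x y ((f, h), \<one>) = 0" for f h
  proof (cases "f \<in> carrier G \<and> h \<in> carrier G")
    case True
    then show ?thesis by (simp add: ver_rep_in cong: sum.cong)
  qed (auto simp: dvee_fun_mult)
  then show "\<forall>b. ver_rep x y (b, \<one>) = 0" by auto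
qed

text \<open>As the row sums of \<open>\<rho>\<close> are 1, the matrices disappear from x dy. What
  remains is x times the difference of y at fc and y at f, which is the prescribed representative
  restricted to \<open>S\<close>.\<close>

lemma hat_lact_delta: "hat (free_lact P x (\<delta> y)) = res (ver_rep x y)"
proof -
  have "hat (free_lact P x (\<delta> y)) ((f, h), c) = res (ver_rep x y) ((f, h), c)" for f h c
  proof (cases "c \<in> S \<and> f \<in> carrier G \<and> h \<in> carrier G")
    case True
    then have z: "c \<in> S" "f \<in> carrier G" "h \<in> carrier G" by auto
    note cC = S_subset[OF z(1)] and cG = S_carrier[OF z(1)]
    obtain i where i: "i \<in> J"
      using irreducible by (auto simp: irreducible_rep_def)
    have J: "J = {i}"
      by (rule J_singleton[OF z(1) i])
    have ci: "(c, i) \<in> K"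
      using cC i by simp
    let ?g = "\<lambda>k. gconj G (inv c) (inv k \<otimes> h)"
    have "hat (free_lact P x (\<delta> y)) ((f, h), c) = (\<Sum>n\<in>K. free_lact P x (\<delta> y) ((f, h), ((c, i), n)))"
      unfolding hat_def using z by (subst J) simp
    also have "\<dots> = (\<Sum>n\<in>K. (\<Sum>k\<in>carrier G. \<rho> (?g k) (c, i) n * (x (f, k) * y (f \<otimes> c, ?g k)))
      - (\<Sum>k\<in>carrier G. (if (c, i) = n then 1 else 0) * (x (f, k) * y (f, inv k \<otimes> h))))"
      by (rule sum.cong[OF refl]) (subst lact_delta, use z ci in \<open>simp_all add: \<gamma>_def\<close>)
    also have "\<dots> = (\<Sum>k\<in>carrier G. (\<Sum>n\<in>K. \<rho> (?g k) (c, i) n) * (x (f, k) * y (f \<otimes> c, ?g k)))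
      - (\<Sum>k\<in>carrier G. (\<Sum>n\<in>K. if (c, i) = n then 1 else 0) * (x (f, k) * y (f, inv k \<otimes> h)))"
      unfolding sum_subtractf sum_distrib_right by (intro arg_cong2[of _ _ _ _ "(-)"] sum.swap)
    also have "\<dots> = (\<Sum>k\<in>carrier G. x (f, k) * y (f \<otimes> c, ?g k)) - (\<Sum>k\<in>carrier G. x (f, k) * y (f, inv k \<otimes> h))"
    proof -
      have "(\<Sum>n\<in>K. if (c, i) = n then 1 else 0) = (1 :: complex)"
        using ci by (subst sum.delta') auto
      moreover have "(\<Sum>n\<in>K. \<rho> (?g k) (c, i) n) = 1" if "k \<in> carrier G" for k
        by (rule row_sum_rho[OF z(1) i]) (use that z cG in simp)
      ultimately show ?thesis
        by (simp cong: sum.cong)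
    qed
    also have "\<dots> = res (ver_rep x y) ((f, h), c)"
      using z cG by (simp add: res_def ver_rep_in right_diff_distrib sum_subtractf)
    finally show ?thesis .
  next
    case False
    then show ?thesis
      by (auto simp: hat_def res_def lact_eq dvee_fun_mult)
  qed
  then show ?thesis by (simp add: fun_eq_iff)
qed

lemma hat_lact: "hat (free_lact P x w) ((f, h), c)
    = (if f \<in> carrier G \<and> h \<in> carrier G then \<Sum>k\<in>carrier G. x (f, k) * hat w ((f, inv k \<otimes> h), c) else 0)"
proof (cases "c \<in> S \<and> f \<in> carrier G \<and> h \<in> carrier G")
  case True
  then have "hat (free_lact P x w) ((f, h), c)
      = (\<Sum>i\<in>J. \<Sum>n\<in>K. \<Sum>k\<in>carrier G. x (f, k) * w ((f, inv k \<otimes> h), ((c, i), n)))"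
    by (simp add: hat_def lact_eq)
  also have "\<dots> = (\<Sum>i\<in>J. \<Sum>k\<in>carrier G. \<Sum>n\<in>K. x (f, k) * w ((f, inv k \<otimes> h), ((c, i), n)))"
    by (rule sum.cong[OF refl], rule sum.swap)
  also have "\<dots> = (\<Sum>k\<in>carrier G. \<Sum>i\<in>J. \<Sum>n\<in>K. x (f, k) * w ((f, inv k \<otimes> h), ((c, i), n)))"
    by (rule sum.swap)
  finally show ?thesis
    using True by (simp add: hat_def sum_distrib_left)
qed (auto simp: hat_def lact_eq)

text \<open>Right multiplication multiplies rows by matrices with row sums 1, so row sums are merely
  convolved with y. The kernel of \<open>hat\<close> is therefore stable on the right.\<close>

lemma hat_ract:
  assumes hat: "hat w = (\<lambda>_. 0)"
  shows "hat (free_ract P L sr w y) = (\<lambda>_. 0)"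
proof -
  have "hat (free_ract P L sr w y) ((f, h), c) = 0" for f h c
  proof (cases "c \<in> S \<and> f \<in> carrier G \<and> h \<in> carrier G")
    case True
    then have z: "c \<in> S" "f \<in> carrier G" "h \<in> carrier G" by auto
    note cC = S_subset[OF z(1)] and cG = S_carrier[OF z(1)]
    obtain i where i: "i \<in> J"
      using irreducible by (auto simp: irreducible_rep_def)
    have J: "J = {i}"
      by (rule J_singleton[OF z(1) i])
    have ci: "(c, i) \<in> K"
      using cC i by simp
    let ?g = "\<lambda>k. gconj G (inv c) (inv k \<otimes> h)"
    have w: "(\<Sum>l\<in>K. w ((f, k), ((c, i), l))) = 0" for k
    proof -
      have "hat w ((f, k), c) = (\<Sum>l\<in>K. w ((f, k), ((c, i), l)))"
        unfolding hat_def using z by (subst J) simp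
      then show ?thesis by (simp add: hat)
    qed
    have "hat (free_ract P L sr w y) ((f, h), c) = (\<Sum>n\<in>K. free_ract P L sr w y ((f, h), ((c, i), n)))"
      unfolding hat_def using z by (subst J) simp
    also have "\<dots> = (\<Sum>n\<in>K. \<Sum>k\<in>carrier G. \<Sum>l\<in>K. w ((f, k), ((c, i), l)) * (y (f \<otimes> c, ?g k) * \<rho> (?g k) l n))"
      by (rule sum.cong[OF refl]) (subst ract_in, use z ci in \<open>simp_all add: \<gamma>_def\<close>)
    also have "\<dots> = (\<Sum>k\<in>carrier G. \<Sum>n\<in>K. \<Sum>l\<in>K. w ((f, k), ((c, i), l)) * (y (f \<otimes> c, ?g k) * \<rho> (?g k) l n))"
      by (rule sum.swap)
    also have "\<dots> = (\<Sum>k\<in>carrier G. \<Sum>l\<in>K. \<Sum>n\<in>K. w ((f, k), ((c, i), l)) * (y (f \<otimes> c, ?g k) * \<rho> (?g k) l n))"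
      by (rule sum.cong[OF refl], rule sum.swap)
    also have "\<dots> = (\<Sum>k\<in>carrier G. (\<Sum>l\<in>K. w ((f, k), ((c, i), l))) * y (f \<otimes> c, ?g k))"
    proof (rule sum.cong[OF refl])
      fix k assume k: "k \<in> carrier G"
      have "(\<Sum>n\<in>K. w ((f, k), ((c, i), l)) * (y (f \<otimes> c, ?g k) * \<rho> (?g k) l n)) = w ((f, k), ((c, i), l)) * y (f \<otimes> c, ?g k)"
        if l: "l \<in> K" for l
      proof -
        \<comment> \<open>As soon as \<open>S\<close> is nonempty it is all of \<open>C\<close>, so
          every row of \<open>\<rho>\<close> has sum 1.\<close>
        have "fst l \<in> S"
          using l z(1) by (auto simp: S_def split: if_splits)
        then have "(\<Sum>n\<in>K. \<rho> (?g k) (fst l, snd l) n) = 1"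
          by (rule row_sum_rho) (use l k z cG in auto)
        then have "w ((f, k), ((c, i), l)) * y (f \<otimes> c, ?g k) * (\<Sum>n\<in>K. \<rho> (?g k) l n) = w ((f, k), ((c, i), l)) * y (f \<otimes> c, ?g k)"
          by simp
        then show ?thesis
          by (simp only: sum_distrib_left mult.assoc)
      qed
      then show "(\<Sum>l\<in>K. \<Sum>n\<in>K. w ((f, k), ((c, i), l)) * (y (f \<otimes> c, ?g k) * \<rho> (?g k) l n))
          = (\<Sum>l\<in>K. w ((f, k), ((c, i), l))) * y (f \<otimes> c, ?g k)"
        by (simp add: sum_distrib_right)
    qed
    also have "\<dots> = 0"
      by (simp add: w)
    finally show ?thesis .
  next
    case False
    have "free_ract P L sr w y ((f, h), l) = 0" if "\<not> (f \<in> carrier G \<and> h \<in> carrier G)" for l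
      by (rule fspaceD[OF ract_closed]) (use that in auto)
    with False show ?thesis
      by (auto simp: hat_def)
  qed
  then show ?thesis by (simp add: fun_eq_iff)
qed

section \<open>Horizontal forms as the kernel of the vertical map\<close>

abbreviation "\<Omega>\<^sub>A \<equiv> fspan {free_lact P a (\<delta> b) | a b. a \<in> A \<and> b \<in> A}"
abbreviation "Hor \<equiv> fspan {free_ract P L sr (free_lact P x w) y | x w y.
  x \<in> carrier (alg P) \<and> w \<in> \<Omega>\<^sub>A \<and> y \<in> carrier (alg P)}"

lemma base_forms_subset: "\<Omega>\<^sub>A \<subseteq> carrier (fspace (basis P \<times> L))"
proof (rule fspan_minimal[OF lin_closed_fspace], clarify)
  fix a b assume "a \<in> A" "b \<in> A"
  then show "free_lact P a (\<delta> b) \<in> carrier (fspace (basis P \<times> L))"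
    using coinv_subset by (intro bim.lact_closed delta_closed) auto
qed

lemma base_calculus_carrier: "carrier (base_calculus P H p \<Omega>) = \<Omega>\<^sub>A"
proof -
  have "{lact \<Omega> a (diff \<Omega> b) | a b. a \<in> A \<and> b \<in> A} \<subseteq> carrier \<Omega>"
    unfolding Omega_simps by (rule order_trans[OF fspan_superset base_forms_subset])
  from lin_span_eq_fspan[OF Omega_simps(5) this] show ?thesis
    by (simp add: base_calculus_def)
qed

lemma horizontal_forms_eq: "horizontal_forms P H p \<Omega> = Hor"
  unfolding horizontal_forms_def base_calculus_carrier Omega_simps
  by (rule lin_span_eq_fspan) (auto simp: ract_closed simp del: hopf_simps)

text \<open>The coaction sends a coinvariant b to b tensor 1, so the representative of the vertical
  map is itself zero.\<close>

lemma hat_base_form: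
  assumes "b \<in> A"
  shows "hat (free_lact P a (\<delta> b)) = (\<lambda>_. 0)"
proof -
  have b: "coact P p b = tprod b \<one>\<^bsub>alg H\<^esub>"
    using assms by (simp add: coinv_def)
  have "ver_rep a b ((f, h), s) = 0" for f h s
    by (simp add: b dvee_fun_mult)
  then show ?thesis
    unfolding hat_lact_delta by (auto simp: res_def fun_eq_iff)
qed

text \<open>The kernel of \<open>hat\<close> contains the base forms and is stable under left and
  right multiplication.\<close>

lemma hat_horizontal: "Hor \<subseteq> {w \<in> carrier (fspace (basis P \<times> L)). hat w = (\<lambda>_. 0)}"
proof -
  have closed: "lin_closed {w \<in> carrier (fspace (basis P \<times> L)). hat w \<in> {\<lambda>_. 0}}"
  proof (rule lin_closed_kernel[OF lin_closed_fspace flinear_hat])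
    show "lin_closed {\<lambda>_. 0}"
      by (simp add: lin_closed_def)
  qed
  have base: "\<Omega>\<^sub>A \<subseteq> {w \<in> carrier (fspace (basis P \<times> L)). hat w \<in> {\<lambda>_. 0}}"
  proof (rule fspan_minimal[OF closed], clarify, intro conjI)
    fix a b assume ab: "a \<in> A" "b \<in> A"
    show "free_lact P a (\<delta> b) \<in> carrier (fspace (basis P \<times> L))"
      using ab coinv_subset by (intro bim.lact_closed delta_closed) auto
    show "hat (free_lact P a (\<delta> b)) \<in> {\<lambda>_. 0}"
      using hat_base_form[OF ab(2)] by simp
  qed
  have "Hor \<subseteq> {w \<in> carrier (fspace (basis P \<times> L)). hat w \<in> {\<lambda>_. 0}}"
  proof (rule fspan_minimal[OF closed], clarify, intro conjI)
    fix x w y assume w: "w \<in> \<Omega>\<^sub>A"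
    show "free_ract P L sr (free_lact P x w) y \<in> carrier (fspace (basis P \<times> L))"
      by (rule ract_closed)
    have "hat w = (\<lambda>_. 0)"
      using base w by blast
    then have "hat (free_lact P x w) ((f, h), c) = 0" for f h c
      by (simp add: hat_lact)
    then have "hat (free_lact P x w) = (\<lambda>_. 0)"
      by (simp add: fun_eq_iff)
    then show "hat (free_ract P L sr (free_lact P x w) y) \<in> {\<lambda>_. 0}"
      using hat_ract by blast
  qed
  then show ?thesis by simp
qed

definition row :: "'a \<times> 'a \<Rightarrow> 'a \<Rightarrow> ('a \<times> 'i \<Rightarrow> 'a \<times> 'i \<Rightarrow> complex)
    \<Rightarrow> ('a \<times> 'a) \<times> (('a \<times> 'i) \<times> ('a \<times> 'i)) \<Rightarrow> complex" where
  "row b c X = (\<lambda>(b', (m, n)). if b' = b \<and> fst m = c \<and> m \<in> K \<and> n \<in> K then X m n else 0)"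

text \<open>The differential of the coinvariant belonging to a group element g has, at f and in the
  rows over c', the matrix rho((fc')^-1 g fc') - 1. A basis vector of P multiplied from the left
  fixes f, and a delta function multiplied from the right fixes fc'. Together they isolate the rows
  over one point.\<close>

lemma row_horizontal:
  assumes b: "b \<in> basis P" and c: "c \<in> C" and u: "u \<in> carrier G"
  shows "row b c (\<lambda>m n. \<rho> u m n - kron m n) \<in> Hor"
proof -
  obtain f0 h1 where b': "b = (f0, h1)" "f0 \<in> carrier G" "h1 \<in> carrier G"
    using b by auto
  note cG = C_subset[OF c]
  \<comment> \<open>Conjugating \<open>?g\<close> by (f0 c)^-1 gives u, so the required matrix
    appears; it appears at the group element cuc^-1, which left multiplication by \<open>?h0\<close>
    moves to h1.\<close>
  let ?g = "gconj G (f0 \<otimes> c) u" and ?h0 = "h1 \<otimes> gconj G c (inv u)"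
  let ?a = "dvee_incl G (bvec ?g)" and ?x = "bvec (f0, ?h0) :: 'a \<times> 'a \<Rightarrow> complex"
  \<comment> \<open>The delta function at f0 c. Its group part is 1, so right multiplication selects
    rows without changing matrices.\<close>
  define y where "y = (\<lambda>(f, k). if f = f0 \<otimes> c \<and> k = \<one> then 1 else 0 :: complex)"
  have h0: "?h0 \<in> carrier G"
    using b' cG u by simp
  have y: "y \<in> carrier (alg P)"
    using b' cG by (auto simp: y_def alg_ops carrier_fspace)
  have x: "?x \<in> carrier (alg P)"
    using b' h0 by (intro bvec_closed) simp
  have da: "\<delta> ?a \<in> \<Omega>\<^sub>A"
  proof -
    have "\<delta> ?a = free_lact P \<one>\<^bsub>alg P\<^esub> (\<delta> ?a)"
      using bim.lact_one[OF delta_closed[OF incl_closed]] by simp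
    then show ?thesis
      using one_in_coinv incl_in_coinv[of "bvec ?g"] by (intro fspan_base) blast
  qed
  have "row b c (\<lambda>m n. \<rho> u m n - kron m n) = free_ract P L sr (free_lact P ?x (\<delta> ?a)) y"
  proof (rule forms_eqI[OF _ ract_closed])
    show "row b c (\<lambda>m n. \<rho> u m n - kron m n) \<in> carrier (fspace (basis P \<times> L))"
      using b by (auto simp: row_def carrier_fspace)
    fix f h m n assume z: "f \<in> carrier G" "h \<in> carrier G" "m \<in> K" "n \<in> K"
    note m = K_fst[OF z(3)]
    let ?W = "free_lact P ?x (\<delta> ?a)"
    have "free_ract P L sr ?W y ((f, h), (m, n)) = (\<Sum>k\<in>carrier G. \<Sum>l\<in>K. if k = h then
        if l = n then if f \<otimes> fst m = f0 \<otimes> c then ?W ((f, k), (m, l)) else 0 else 0 else 0)"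
      unfolding ract_in[OF z]
    proof (rule sum.cong[OF refl], rule sum.cong[OF refl])
      fix k l assume k: "k \<in> carrier G" and l: "l \<in> K"
      have 1: "\<gamma> m (inv k \<otimes> h) = \<one> \<longleftrightarrow> k = h"
        using gconj_cancel[of "inv (fst m)" "inv k \<otimes> h" \<one>] inv_mult_eq_one_iff[of k h] k z m
        by (simp add: \<gamma>_def)
      show "?W ((f, k), (m, l)) * (y (f \<otimes> fst m, \<gamma> m (inv k \<otimes> h)) * \<rho> (\<gamma> m (inv k \<otimes> h)) l n)
        = (if k = h then if l = n then if f \<otimes> fst m = f0 \<otimes> c then ?W ((f, k), (m, l)) else 0 else 0 else 0)"
      proof (cases "k = h")
        case True
        then have "\<gamma> m (inv k \<otimes> h) = \<one>" using 1 by blast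
        then show ?thesis
          using True rho_one[OF l z(4)] by (simp only: y_def prod.case) simp
      next
        case False
        then have "\<gamma> m (inv k \<otimes> h) \<noteq> \<one>" using 1 by blast
        then show ?thesis
          using False by (simp add: y_def)
      qed
    qed
    also have "\<dots> = (\<Sum>k\<in>carrier G. if k = h then (\<Sum>l\<in>K. if l = n then if f \<otimes> fst m = f0 \<otimes> c then ?W ((f, k), (m, l)) else 0 else 0) else 0)"
      by (rule sum.cong[OF refl]) simp
    also have "\<dots> = (if f \<otimes> fst m = f0 \<otimes> c then ?W ((f, h), (m, n)) else 0)"
      using z by (subst sum.delta, simp, subst sum.delta) auto
    also have "?W ((f, h), (m, n)) = (if f = f0 then \<delta> ?a ((f, inv ?h0 \<otimes> h), (m, n)) else 0)"
    proof -
      have "?W ((f, h), (m, n)) = (\<Sum>k\<in>carrier G. ?x (f, k) * \<delta> ?a ((f, inv k \<otimes> h), (m, n)))"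
        using z by (simp add: lact_eq[of "bvec _"])
      also have "\<dots> = (\<Sum>k\<in>carrier G. if k = ?h0 then if f = f0 then \<delta> ?a ((f, inv k \<otimes> h), (m, n)) else 0 else 0)"
        by (intro sum.cong refl) (simp only: bvec_def prod.inject, simp)
      finally show ?thesis
        using h0 by simp
    qed
    also have "(if f \<otimes> fst m = f0 \<otimes> c then if f = f0 then \<delta> ?a ((f, inv ?h0 \<otimes> h), (m, n)) else 0 else 0)
        = row b c (\<lambda>m n. \<rho> u m n - kron m n) ((f, h), (m, n))"
    proof (cases "f = f0 \<and> fst m = c")
      case True
      have t: "inv ?h0 \<otimes> h \<in> carrier G"
        using h0 z by simp
      have h1: "inv ?h0 \<otimes> h = gconj G c u \<longleftrightarrow> h = h1"
      proof -
        have "gconj G c u = inv ?h0 \<otimes> h \<longleftrightarrow> h = ?h0 \<otimes> gconj G c u"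
          using eq_mult_iff(1)[of ?h0 "gconj G c u" h] h0 z cG u by auto
        moreover have "?h0 \<otimes> gconj G c u = h1"
          using b' cG u by (simp add: m_assoc flip: gconj_mult)
        ultimately show ?thesis by metis
      qed
      have 1: "\<gamma> m (inv ?h0 \<otimes> h) = u \<longleftrightarrow> h = h1"
        using gconj_eq_iff[of "inv c" "inv ?h0 \<otimes> h" u] t cG u True unfolding \<gamma>_def h1[symmetric] by auto
      have a1: "?a (f \<otimes> fst m, \<gamma> m (inv ?h0 \<otimes> h)) = (if h = h1 then 1 else 0)"
      proof -
        have "gconj G (f0 \<otimes> c) (\<gamma> m (inv ?h0 \<otimes> h)) = ?g \<longleftrightarrow> \<gamma> m (inv ?h0 \<otimes> h) = u"
          by (rule gconj_cancel) (use b' cG u t z in auto)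
        then show ?thesis
          using True b' cG gamma_in[OF z(3) t] unfolding dvee_incl_eq 1
          by (simp add: bvec_def)
      qed
      have a2: "?a (f, inv ?h0 \<otimes> h) = (if h = h1 then 1 else 0)"
      proof -
        have "?g = gconj G f0 (gconj G c u)"
          using b' cG u by (simp add: gconj_gconj)
        then have "gconj G f0 (inv ?h0 \<otimes> h) = ?g \<longleftrightarrow> inv ?h0 \<otimes> h = gconj G c u"
          using gconj_cancel[of f0 "inv ?h0 \<otimes> h" "gconj G c u"] b' cG u t by simp
        then show ?thesis
          using True b' t unfolding dvee_incl_eq h1 by (simp add: bvec_def)
      qed
      have "\<delta> ?a ((f, inv ?h0 \<otimes> h), (m, n)) = ?a (f \<otimes> fst m, \<gamma> m (inv ?h0 \<otimes> h)) * \<rho> (\<gamma> m (inv ?h0 \<otimes> h)) m n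
          - (if m = n then ?a (f, inv ?h0 \<otimes> h) else 0)"
        by (rule delta_in[OF z(1) t z(3,4)])
      also have "\<dots> = (if h = h1 then \<rho> u m n - kron m n else 0)"
        unfolding a1 a2 using 1 by (cases "h = h1") simp_all
      finally have "\<delta> ?a ((f, inv ?h0 \<otimes> h), (m, n)) = (if h = h1 then \<rho> u m n - kron m n else 0)" .
      then show ?thesis
        using True z by (simp add: row_def b')
    next
      case False
      have nested: "(if a then if b then x else 0 else 0) = (0 :: complex)" if "\<not> (a \<and> b)" for a b x
        using that by auto
      from False have "\<not> (f \<otimes> fst m = f0 \<otimes> c \<and> f = f0)"
        using m cG b' by auto
      then have "(if f \<otimes> fst m = f0 \<otimes> c then if f = f0 then \<delta> ?a ((f, inv ?h0 \<otimes> h), (m, n)) else 0 else 0) = 0"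
        by (intro nested)
      moreover have "row b c (\<lambda>m n. \<rho> u m n - kron m n) ((f, h), (m, n)) = 0"
        using False by (auto simp: row_def b')
      ultimately show ?thesis by (simp only:)
    qed
    finally show "row b c (\<lambda>m n. \<rho> u m n - kron m n) ((f, h), (m, n)) = free_ract P L sr ?W y ((f, h), (m, n))" ..
  qed
  also have "\<dots> \<in> Hor"
    by (rule fspan_base) (use x y da in blast)
  finally show ?thesis .
qed

text \<open>With the coefficients of \<open>matrix_unit_rho\<close>, the blocks rho(u) - 1 combine
  to a matrix unit minus the coefficient sum times the identity block, and this sum is 1 exactly
  over \<open>S\<close>.\<close>

lemma bvec_horizontal:
  assumes b: "b \<in> basis P" and m: "m \<in> K" and n: "n \<in> K"
  shows "(\<lambda>z. bvec (b, (m, n)) z - (if fst m \<in> S then row b (fst m) kron z else 0)) \<in> Hor"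
proof -
  obtain c i d j where mn: "m = (c, i)" "n = (d, j)" "c \<in> C" "i \<in> J" "d \<in> C" "j \<in> J"
    using m n by auto
  obtain a where a: "\<And>i' n. i' \<in> J \<Longrightarrow> n \<in> K \<Longrightarrow> (\<Sum>u\<in>carrier G. a u * \<rho> u (c, i') n) = (if i' = i \<and> n = (d, j) then 1 else 0)"
    "(\<Sum>u\<in>carrier G. a u) = (if c \<in> S then 1 else 0 :: complex)"
    by (rule matrix_unit_rho[OF mn(3,5,4,6)]) blast
  have "(\<lambda>z. \<Sum>u\<in>carrier G. a u * row b c (\<lambda>m n. \<rho> u m n - kron m n) z) \<in> Hor"
    by (intro lin_closed_lin_comb lin_closed_fspan row_horizontal b mn(3))
  also have "(\<lambda>z. \<Sum>u\<in>carrier G. a u * row b c (\<lambda>m n. \<rho> u m n - kron m n) z)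
      = (\<lambda>z. bvec (b, (m, n)) z - (if fst m \<in> S then row b (fst m) kron z else 0))"
  proof
    fix z :: "('a \<times> 'a) \<times> (('a \<times> 'i) \<times> ('a \<times> 'i))"
    obtain b' c' i' n' where z: "z = (b', ((c', i'), n'))"
      by (metis surj_pair)
    show "(\<Sum>u\<in>carrier G. a u * row b c (\<lambda>m n. \<rho> u m n - kron m n) z)
        = bvec (b, (m, n)) z - (if fst m \<in> S then row b (fst m) kron z else 0)"
    proof (cases "b' = b \<and> c' = c \<and> i' \<in> J \<and> n' \<in> K")
      case True
      then have "(\<Sum>u\<in>carrier G. a u * row b c (\<lambda>m n. \<rho> u m n - kron m n) z)
          = (\<Sum>u\<in>carrier G. a u * \<rho> u (c, i') n') - (\<Sum>u\<in>carrier G. a u) * kron (c, i') n'"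
        using mn by (simp add: z row_def right_diff_distrib sum_subtractf sum_distrib_right)
      also have "\<dots> = (if i' = i \<and> n' = (d, j) then 1 else 0) - (if c \<in> S then kron (c, i') n' else 0)"
        using True a by auto
      finally show ?thesis
        using True mn by (simp add: z row_def bvec_def)
    next
      case False
      have "row b c X z = 0" for X
        using False by (auto simp: z row_def)
      moreover have "bvec (b, (m, n)) z = (0 :: complex)"
        using False mn by (auto simp: z bvec_def)
      ultimately show ?thesis
        by (simp add: mn(1))
    qed
  qed
  finally show ?thesis .
qed

text \<open>Replacing each basis form by its horizontal companion from
  \<open>bvec_horizontal\<close> changes w by multiples of the identity blocks over
  \<open>S\<close>. Their coefficients are the row sums recorded by \<open>hat w\<close>, so for w
  in the kernel nothing changes.\<close>

lemma horizontal_eq: "Hor = {w \<in> carrier (fspace (basis P \<times> L)). hat w = (\<lambda>_. 0)}"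
proof
  show "{w \<in> carrier (fspace (basis P \<times> L)). hat w = (\<lambda>_. 0)} \<subseteq> Hor"
  proof clarify
    fix w assume w: "w \<in> carrier (fspace (basis P \<times> L))" and zero: "hat w = (\<lambda>_. 0)"
    let ?D = "\<lambda>b m z. if fst m \<in> S then row b (fst m) kron z else 0"
    have "(\<lambda>z. \<Sum>u\<in>basis P \<times> L. w u * (bvec u z - ?D (fst u) (fst (snd u)) z)) \<in> Hor"
    proof (rule lin_closed_lin_comb[OF lin_closed_fspan])
      fix u assume u: "u \<in> basis P \<times> L"
      then show "(\<lambda>z. bvec u z - ?D (fst u) (fst (snd u)) z) \<in> Hor"
        using bvec_horizontal[of "fst u" "fst (snd u)" "snd (snd u)"] by (simp add: mem_Times_iff del: hopf_simps)
    qed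
    also have "(\<lambda>z. \<Sum>u\<in>basis P \<times> L. w u * (bvec u z - ?D (fst u) (fst (snd u)) z)) = w"
    proof
      fix z
      have "(\<Sum>u\<in>basis P \<times> L. w u * bvec u z) = w z"
        by (rule fun_cong[OF fspace_expand[OF _ w], symmetric]) simp
      moreover have "(\<Sum>u\<in>basis P \<times> L. w u * ?D (fst u) (fst (snd u)) z) = 0"
      proof -
        have "(\<Sum>u\<in>basis P \<times> L. w u * ?D (fst u) (fst (snd u)) z)
            = (\<Sum>b\<in>basis P. \<Sum>c\<in>C. \<Sum>i\<in>J. \<Sum>n\<in>K. w (b, ((c, i), n)) * ?D b (c, i) z)"
          unfolding sum.cartesian_product'[of _ "basis P" L] sum.cartesian_product'[of _ K K]
            sum.cartesian_product'[of _ C J] by (simp cong: if_cong)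
        \<comment> \<open>The correction depends only on the point c of the row index, so any value
          may stand in the second component.\<close>
        also have "\<dots> = (\<Sum>b\<in>basis P. \<Sum>c\<in>C. hat w (b, c) * ?D b (c, undefined) z)"
          by (intro sum.cong refl) (simp add: hat_def sum_distrib_right)
        finally show ?thesis
          by (simp add: zero)
      qed
      ultimately show "(\<Sum>u\<in>basis P \<times> L. w u * (bvec u z - ?D (fst u) (fst (snd u)) z)) = w z"
        by (simp only: right_diff_distrib sum_subtractf diff_zero)
    qed
    finally show "w \<in> Hor" .
  qed
qed (rule hat_horizontal)

lemma ver_exact:
  "\<exists>ver. lin_map \<Omega> (tens_inv_forms P H R) ver
    \<and> (\<forall>x\<in>carrier (alg P). \<forall>y\<in>carrier (alg P). ver (lact \<Omega> x (diff \<Omega> y)) = tens_class P H R (ver_rep x y))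
    \<and> ver ` carrier \<Omega> = carrier (tens_inv_forms P H R)
    \<and> {w \<in> carrier \<Omega>. ver w = \<zero>\<^bsub>tens_inv_forms P H R\<^esub>} = horizontal_forms P H p \<Omega>"
proof -
  interpret Q: linear_quotient "M (basis P)" "N (basis P)" res
    by (rule res_quotient) simp
  let ?ver = "\<lambda>w. Q.cls (hat w)"
  have zero_in: "(\<lambda>_. 0) \<in> carrier (M (basis P))"
    by (rule lin_closedD(1)[OF Q.lin_closed_carrier])
  have "lin_map \<Omega> (tens_inv_forms P H R) ?ver"
    unfolding tens_inv_forms_eq
    by (rule Q.lin_map_cls) (use hat_in_M flinear_hat in \<open>auto simp del: hopf_simps\<close>)
  moreover have "?ver (free_lact P x (\<delta> y)) = tens_class P H R (ver_rep x y)"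
    if "x \<in> carrier (alg P)" "y \<in> carrier (alg P)" for x y
    unfolding tens_class_eq
    by (subst Q.coset_eq_iff[OF hat_in_M[OF bim.lact_closed[OF that(1) delta_closed[OF that(2)]]] ver_rep_in_M])
      (simp add: hat_lact_delta res_res)
  moreover have "?ver ` carrier \<Omega> = carrier (tens_inv_forms P H R)"
  proof
    show "?ver ` carrier \<Omega> \<subseteq> carrier (tens_inv_forms P H R)"
      unfolding tens_inv_forms_eq Q.carrier_quot using hat_in_M by auto
    show "carrier (tens_inv_forms P H R) \<subseteq> ?ver ` carrier \<Omega>"
    proof
      fix X assume "X \<in> carrier (tens_inv_forms P H R)"
      then obtain t where t: "t \<in> carrier (M (basis P))" "X = Q.cls t"
        unfolding tens_inv_forms_eq Q.carrier_quot by blast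
      \<comment> \<open>The values of t are placed on the diagonal, so that the row over c has sum
        t(b, c).\<close>
      define w where "w = (\<lambda>(b, (m, n)). if b \<in> basis P \<and> m \<in> K \<and> n = m then t (b, fst m) else 0)"
      have w: "w \<in> carrier (fspace (basis P \<times> L))"
        by (auto simp: w_def carrier_fspace)
      have "hat w (b, c) = res t (b, c)" for b c
      proof (cases "c \<in> S \<and> b \<in> basis P")
        case True
        then have c: "c \<in> S" and b: "b \<in> basis P" by auto
        obtain i where i: "i \<in> J"
          using irreducible by (auto simp: irreducible_rep_def)
        have "hat w (b, c) = (\<Sum>n\<in>K. w (b, ((c, i), n)))"
          unfolding hat_def using c by (subst J_singleton[OF c i]) simp
        also have "\<dots> = (\<Sum>n\<in>K. if n = (c, i) then t (b, c) else 0)"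
          using b S_subset[OF c] i by (intro sum.cong refl) (simp add: w_def)
        also have "\<dots> = t (b, c)"
          using S_subset[OF c] i by (subst sum.delta) auto
        finally show ?thesis
          using c by (simp add: res_def)
      next
        case False
        moreover have "t (b, c) = 0" if "b \<notin> basis P"
          using t(1) that unfolding mem_M[OF finite_basis_dvee] by (intro fspaceD[of t]) auto
        ultimately show ?thesis
          by (auto simp: hat_def res_def w_def)
      qed
      then have "res (hat w) = res t"
        by (simp add: fun_eq_iff res_hat)
      then have "X = ?ver w"
        using Q.coset_eq_iff[OF t(1) hat_in_M[OF w]] t(2) by simp
      with w show "X \<in> ?ver ` carrier \<Omega>"
        by (intro image_eqI) simp_all
    qed
  qed
  moreover have "{w \<in> carrier \<Omega>. ?ver w = \<zero>\<^bsub>tens_inv_forms P H R\<^esub>} = horizontal_forms P H p \<Omega>"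
  proof -
    have "?ver w = \<zero>\<^bsub>tens_inv_forms P H R\<^esub> \<longleftrightarrow> hat w = (\<lambda>_. 0)" if "w \<in> carrier (fspace (basis P \<times> L))" for w
      unfolding tens_inv_forms_eq Q.zero_quot Q.coset_eq_iff[OF hat_in_M[OF that] zero_in]
      by (simp add: res_hat) (simp add: res_def case_prod_unfold)
    then show ?thesis
      unfolding horizontal_forms_eq horizontal_eq by auto
  qed
  ultimately show ?thesis
    by (intro exI[of _ ?ver]) simp
qed

end

section \<open>The calculus on the base\<close>

context class_rep
begin

interpretation bim: free_bimodule P L sr
  by (rule free_bimodule)

abbreviation "GH \<equiv> group_hopf G"
abbreviation "\<Xi> \<equiv> rep_calculus G K \<rho>"

section \<open>The calculus of a representation in coordinates\<close>

definition rs :: "('a \<times> 'i) \<times> ('a \<times> 'i) \<Rightarrow> 'a \<Rightarrow> 'a \<times> (('a \<times> 'i) \<times> ('a \<times> 'i)) \<Rightarrow> complex" where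
  "rs = (\<lambda>(k, l) g. tprod (bvec g) (kmat K (\<lambda>m n. if m = k then \<rho> g l n else 0)))"

definition delta_Xi :: "('a \<Rightarrow> complex) \<Rightarrow> 'a \<times> (('a \<times> 'i) \<times> ('a \<times> 'i)) \<Rightarrow> complex" ("\<delta>\<^sub>\<Xi>") where
  "\<delta>\<^sub>\<Xi> = lext (carrier G) (\<lambda>g. tprod (bvec g) (kmat K (\<lambda>k l. \<rho> g k l - kron k l)))"

abbreviation "mat_of \<equiv> lext (carrier G) (\<lambda>g. kmat K (\<rho> g))"
abbreviation "\<Xi>\<^sub>0 \<equiv> tens (carrier CG) (mat_of ` augm GH)"

lemma Xi_simps:
  "carrier \<Xi> = \<Xi>\<^sub>0" "lact \<Xi> = free_lact GH" "ract \<Xi> = free_ract GH L rs" "diff \<Xi> = \<delta>\<^sub>\<Xi>" "fun_module \<Xi>"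
proof -
  show "fun_module \<Xi>"
    unfolding rep_calculus_def by (intro fun_module_carrier_update fun_module_free_calculus lin_closed_tens)
qed (simp_all add: rep_calculus_def free_calculus_def module.extend_def calculus.fields_def rs_def delta_Xi_def)

lemma lact_Xi: "free_lact GH x w = (\<lambda>(g, l). if g \<in> carrier G then \<Sum>u\<in>carrier G. x u * w (inv u \<otimes> g, l) else 0)"
  by (auto simp: free_lact_def group_mult)

lemma ract_Xi:
  assumes "g \<in> carrier G" "k \<in> K" "l \<in> K"
  shows "free_ract GH L rs w x (g, (k, l))
    = (\<Sum>l'\<in>K. \<Sum>u\<in>carrier G. w (u, (k, l')) * (x (inv u \<otimes> g) * \<rho> (inv u \<otimes> g) l' l))"
proof -
  have s: "lext (carrier G) (rs (k', l')) x (b, (k, l)) = (if k' = k then x b * \<rho> b l' l else 0)"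
    if "b \<in> carrier G" for k' l' b
  proof -
    have "lext (carrier G) (rs (k', l')) x (b, (k, l))
        = (\<Sum>u\<in>carrier G. if u = b then if k' = k then x u * \<rho> u l' l else 0 else 0)"
      unfolding lext_def by (intro sum.cong refl) (use assms in \<open>auto simp: rs_def tprod_def bvec_def kmat_def\<close>)
    then show ?thesis using that by simp
  qed
  have "free_ract GH L rs w x (g, (k, l)) = (\<Sum>k'\<in>K. \<Sum>l'\<in>K. \<Sum>u\<in>carrier G.
      w (u, (k', l')) * lext (carrier G) (rs (k', l')) x (inv u \<otimes> g, (k, l)))"
    using assms by (subst free_ract_eq) (simp_all add: group_mult sum.cartesian_product'[of _ K K])
  also have "\<dots> = (\<Sum>k'\<in>K. if k' = k then
      (\<Sum>l'\<in>K. \<Sum>u\<in>carrier G. w (u, (k, l')) * (x (inv u \<otimes> g) * \<rho> (inv u \<otimes> g) l' l)) else 0)"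
    (is "sum ?A _ = sum ?B _")
  proof (rule sum.cong[OF refl])
    fix k'
    show "?A k' = ?B k'"
    proof (cases "k' = k")
      case True
      show ?thesis
        unfolding if_P[OF True] by (rule sum.cong[OF refl], rule sum.cong[OF refl]) (simp add: s assms(1) True)
    next
      case False
      then show ?thesis
        by (simp only: if_False) (intro sum.neutral ballI, simp add: s assms(1))
    qed
  qed
  also have "\<dots> = (\<Sum>l'\<in>K. \<Sum>u\<in>carrier G. w (u, (k, l')) * (x (inv u \<otimes> g) * \<rho> (inv u \<otimes> g) l' l))"
    using assms by (subst sum.delta) auto
  finally show ?thesis .
qed

lemma delta_Xi_eq:
  "\<delta>\<^sub>\<Xi> x (g, (k, l)) = (if g \<in> carrier G \<and> k \<in> K \<and> l \<in> K then x g * (\<rho> g k l - kron k l) else 0)"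
proof -
  have "\<delta>\<^sub>\<Xi> x (g, (k, l)) = (\<Sum>u\<in>carrier G. if u = g then
      if k \<in> K \<and> l \<in> K then x u * (\<rho> u k l - kron k l) else 0 else 0)"
    unfolding delta_Xi_def lext_def by (intro sum.cong refl) (auto simp: tprod_def bvec_def kmat_def)
  then show ?thesis by simp
qed

lemma mat_of_eq: "mat_of x (k, l) = (if k \<in> K \<and> l \<in> K then \<Sum>g\<in>carrier G. x g * \<rho> g k l else 0)"
  by (auto simp: lext_def kmat_def)

lemma augm_group: "augm GH = {x \<in> carrier (fspace (carrier G)). (\<Sum>g\<in>carrier G. x g) = 0}"
  by (simp add: augm_def alg_ops counit_def)

lemma lin_closed_mat_of: "lin_closed (mat_of ` augm GH)"
proof (rule lin_closed_image)
  show "lin_closed (augm GH)"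
    unfolding augm_group
    by (rule lin_closedI) (auto simp: carrier_fspace sum.distrib simp flip: sum_distrib_left)
qed simp

text \<open>The image of the augmentation ideal is spanned by the matrices rho(v) - 1, which occur
  in the differentials of group elements. The resulting description of the carrier by generators x
  dy is the one that can be compared with A dA.\<close>

lemma Xi_carrier: "\<Xi>\<^sub>0 = fspan {free_lact GH x (\<delta>\<^sub>\<Xi> y) | x y. x \<in> carrier CG \<and> y \<in> carrier CG}" (is "_ = fspan ?Y")
proof
  have mem: "t \<in> \<Xi>\<^sub>0 \<longleftrightarrow> (\<forall>b\<in>carrier G. (\<lambda>c. t (b, c)) \<in> mat_of ` augm GH) \<and> (\<forall>b c. b \<notin> carrier G \<longrightarrow> t (b, c) = 0)" for t
    unfolding alg_ops hopf_simps by (rule mem_tens_iff[OF finite_carrier lin_closed_mat_of])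
  show "fspan ?Y \<subseteq> \<Xi>\<^sub>0"
  proof (rule fspan_minimal[OF lin_closed_tens], clarify)
    fix x y assume "x \<in> carrier CG" "y \<in> carrier CG"
    have "(\<lambda>c. free_lact GH x (\<delta>\<^sub>\<Xi> y) (g, c)) \<in> mat_of ` augm GH" if g: "g \<in> carrier G" for g
    proof -
      have m: "mat_of (\<lambda>z. bvec v z - bvec \<one> z) \<in> mat_of ` augm GH" if "v \<in> carrier G" for v
        using that by (intro imageI) (auto simp: augm_group bvec_def carrier_fspace sum_subtractf)
      have "(\<lambda>c. \<Sum>u\<in>carrier G. (x u * y (inv u \<otimes> g)) * mat_of (\<lambda>z. bvec (inv u \<otimes> g) z - bvec \<one> z) c) \<in> mat_of ` augm GH"
        by (intro lin_closed_lin_comb lin_closed_mat_of m) (simp add: g)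
      also have "(\<lambda>c. \<Sum>u\<in>carrier G. (x u * y (inv u \<otimes> g)) * mat_of (\<lambda>z. bvec (inv u \<otimes> g) z - bvec \<one> z) c)
          = (\<lambda>c. free_lact GH x (\<delta>\<^sub>\<Xi> y) (g, c))"
      proof
        fix c :: "('a \<times> 'i) \<times> ('a \<times> 'i)"
        obtain k l where c: "c = (k, l)" by (cases c)
        have "(\<Sum>u\<in>carrier G. (bvec v u - bvec \<one> u) * \<rho> u k l) = \<rho> v k l - kron k l"
          if "v \<in> carrier G" "k \<in> K" "l \<in> K" for v
          using that rho_one[of k l]
          by (simp add: left_diff_distrib sum_subtractf bvec_def if_distrib[of "\<lambda>x. x * _"] cong: if_cong)
        then show "(\<Sum>u\<in>carrier G. (x u * y (inv u \<otimes> g)) * mat_of (\<lambda>z. bvec (inv u \<otimes> g) z - bvec \<one> z) c)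
            = free_lact GH x (\<delta>\<^sub>\<Xi> y) (g, c)"
          unfolding c mat_of_eq lact_Xi delta_Xi_eq prod.case if_P[OF g]
          by (intro sum.cong refl) (use g in auto)
      qed
      finally show ?thesis .
    qed
    then show "free_lact GH x (\<delta>\<^sub>\<Xi> y) \<in> \<Xi>\<^sub>0"
      unfolding mem by (auto simp: lact_Xi)
  qed
  have "\<Xi>\<^sub>0 = fspan {tprod x y | x y. x \<in> carrier CG \<and> y \<in> mat_of ` augm GH}"
    unfolding tens_def by (rule lin_span_eq_fspan) (auto simp: carrier_fspace)
  also have "\<dots> \<subseteq> fspan ?Y"
  proof (rule fspan_minimal[OF lin_closed_fspan], clarify)
    fix x a assume x: "x \<in> carrier CG" and a: "a \<in> augm GH"
    have v: "tprod x (kmat K (\<lambda>k l. \<rho> v k l - kron k l)) \<in> fspan ?Y" if v: "v \<in> carrier G" for v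
    proof -
      \<comment> \<open>The translate for which the convolution of x' with v is x; it compensates
        the factor v that the differential of v carries.\<close>
      define x' where "x' = (\<lambda>g. if g \<in> carrier G then x (g \<otimes> v) else 0)"
      have "tprod x (kmat K (\<lambda>k l. \<rho> v k l - kron k l)) (g, (k, l)) = free_lact GH x' (\<delta>\<^sub>\<Xi> (bvec v)) (g, (k, l))" for g k l
      proof (cases "g \<in> carrier G \<and> k \<in> K \<and> l \<in> K")
        case True
        have "free_lact GH x' (\<delta>\<^sub>\<Xi> (bvec v)) (g, (k, l))
            = (\<Sum>u\<in>carrier G. x' u * \<delta>\<^sub>\<Xi> (bvec v) (inv u \<otimes> g, (k, l)))"
          using True by (simp add: lact_Xi)
        also have "\<dots> = (\<Sum>u\<in>carrier G. if u = g \<otimes> inv v then x g * (\<rho> v k l - kron k l) else 0)"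
        proof (rule sum.cong[OF refl])
          fix u assume u: "u \<in> carrier G"
          have iff: "v = inv u \<otimes> g \<longleftrightarrow> u = g \<otimes> inv v"
            using eq_mult_iff[of u v g] u v True by blast
          show "x' u * \<delta>\<^sub>\<Xi> (bvec v) (inv u \<otimes> g, (k, l)) = (if u = g \<otimes> inv v then x g * (\<rho> v k l - kron k l) else 0)"
          proof (cases "u = g \<otimes> inv v")
            case ug: True
            then have "inv u \<otimes> g = v" using iff by simp
            moreover have "x' u = x g"
              using ug True v by (simp add: x'_def m_assoc)
            ultimately show ?thesis
              using ug True v by (simp only: delta_Xi_eq if_True simp_thms) (simp add: bvec_def)
          next
            case False
            then have "inv u \<otimes> g \<noteq> v" using iff by simp
            with False show ?thesis
              unfolding delta_Xi_eq by (simp add: bvec_def)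
          qed
        qed
        also have "\<dots> = x g * (\<rho> v k l - kron k l)"
          using True v by simp
        finally show ?thesis
          using True by (simp add: tprod_def kmat_def)
      next
        case False
        then show ?thesis
          using x by (auto simp: tprod_def kmat_def lact_Xi delta_Xi_eq alg_ops carrier_fspace intro!: sum.neutral)
      qed
      then have "tprod x (kmat K (\<lambda>k l. \<rho> v k l - kron k l)) = free_lact GH x' (\<delta>\<^sub>\<Xi> (bvec v))"
        by (simp add: fun_eq_iff)
      moreover have "x' \<in> carrier CG" "bvec v \<in> carrier CG"
        using v by (auto simp: x'_def alg_ops carrier_fspace bvec_def)
      ultimately show ?thesis
        by (intro fspan_base) blast
    qed
    have "(\<lambda>z. \<Sum>v\<in>carrier G. a v * tprod x (kmat K (\<lambda>k l. \<rho> v k l - kron k l)) z) \<in> fspan ?Y"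
      by (intro lin_closed_lin_comb lin_closed_fspan v)
    also have "(\<lambda>z. \<Sum>v\<in>carrier G. a v * tprod x (kmat K (\<lambda>k l. \<rho> v k l - kron k l)) z) = tprod x (mat_of a)"
    proof
      fix z :: "'a \<times> (('a \<times> 'i) \<times> ('a \<times> 'i))"
      obtain g k l where z: "z = (g, (k, l))" by (cases z) auto
      \<comment> \<open>Since the coefficients a sum to 0, the subtracted identity matrices
        cancel.\<close>
      have "(\<Sum>v\<in>carrier G. a v * (x g * (\<rho> v k l - kron k l)))
          = x g * (\<Sum>v\<in>carrier G. a v * \<rho> v k l) - x g * kron k l * (\<Sum>v\<in>carrier G. a v)"
        by (simp only: sum_distrib_left sum_subtractf[symmetric]) (simp add: algebra_simps)
      moreover have "(\<Sum>v\<in>carrier G. a v) = 0"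
        using a by (simp add: augm_group)
      ultimately have sum: "(\<Sum>v\<in>carrier G. a v * (x g * (\<rho> v k l - kron k l))) = x g * (\<Sum>v\<in>carrier G. a v * \<rho> v k l)"
        by (simp only: mult_zero_right diff_zero)
      show "(\<Sum>v\<in>carrier G. a v * tprod x (kmat K (\<lambda>k l. \<rho> v k l - kron k l)) z) = tprod x (mat_of a) z"
      proof (cases "k \<in> K \<and> l \<in> K")
        case True
        show ?thesis
          unfolding z tprod_def prod.case mat_of_eq unfolding kmat_def prod.case if_P[OF True] by (rule sum)
      next
        case False
        show ?thesis
          unfolding z tprod_def prod.case mat_of_eq unfolding kmat_def prod.case if_not_P[OF False] by simp
      qed
    qed
    finally show "tprod x (mat_of a) \<in> fspan ?Y" .
  qed
  finally show "\<Xi>\<^sub>0 \<subseteq> fspan ?Y" .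
qed

section \<open>The isomorphism with the calculus on the base\<close>

text \<open>The form \<open>g \<otimes> x\<close> on \<open>\<complex>G\<close> corresponds to
  \<open>\<Sum>\<^sub>f\<^sub>,\<^sub>c \<delta>\<^sub>f \<otimes> f\<^sup>-\<^sup>1gf \<otimes> e\<^sub>c \<rho>(fc)\<^sup>-\<^sup>1 x \<rho>(fc)\<close>, where \<open>e\<^sub>c\<close> projects onto the part of the
  representation space over \<open>c\<close>.\<close>

definition base_form :: "('a \<times> (('a \<times> 'i) \<times> ('a \<times> 'i)) \<Rightarrow> complex)
    \<Rightarrow> ('a \<times> 'a) \<times> (('a \<times> 'i) \<times> ('a \<times> 'i)) \<Rightarrow> complex" where
  "base_form w = (\<lambda>((f, h), (m, n)). if f \<in> carrier G \<and> h \<in> carrier G \<and> m \<in> K \<and> n \<in> K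
     then \<Sum>l\<in>K. \<Sum>l'\<in>K. \<rho> (inv (f \<otimes> fst m)) m l * w (gconj G f h, (l, l')) * \<rho> (f \<otimes> fst m) l' n else 0)"

lemma flinear_base_form: "flinear V base_form"
  by (rule flinearI) (auto simp: base_form_def fun_eq_iff ring_distribs sum.distrib sum_distrib_left ac_simps)

lemma base_form_closed: "base_form w \<in> carrier (fspace (basis P \<times> L))"
  by (auto simp: base_form_def carrier_fspace)

lemma base_form_in:
  assumes "f \<in> carrier G" "h \<in> carrier G" "m \<in> K" "n \<in> K"
  shows "base_form w ((f, h), (m, n)) = (\<Sum>l\<in>K. \<Sum>l'\<in>K.
    \<rho> (inv (f \<otimes> fst m)) m l * w (gconj G f h, (l, l')) * \<rho> (f \<otimes> fst m) l' n)"
  using assms by (simp add: base_form_def)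

text \<open>Over each f the group coordinate is conjugated by f, which is compatible with
  convolution, and left multiplication does not touch the matrices.\<close>

lemma base_form_lact: "base_form (free_lact GH x w) = free_lact P (dvee_incl G x) (base_form w)"
proof (rule forms_eqI[OF base_form_closed bim.lact_closed[OF incl_closed base_form_closed]])
  fix f h m n assume z: "f \<in> carrier G" "h \<in> carrier G" "m \<in> K" "n \<in> K"
  note m = K_fst[OF z(3)]
  let ?A = "\<lambda>l. \<rho> (inv (f \<otimes> fst m)) m l" and ?B = "\<lambda>l'. \<rho> (f \<otimes> fst m) l' n"
  have "free_lact P (dvee_incl G x) (base_form w) ((f, h), (m, n))
      = (\<Sum>k\<in>carrier G. x (gconj G f k) * (\<Sum>l\<in>K. \<Sum>l'\<in>K. ?A l * w (inv (gconj G f k) \<otimes> gconj G f h, (l, l')) * ?B l'))"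
    using z by (simp add: lact_eq dvee_incl_eq base_form_in gconj_mult inv_gconj cong: sum.cong)
  also have "\<dots> = (\<Sum>k\<in>carrier G. x k * (\<Sum>l\<in>K. \<Sum>l'\<in>K. ?A l * w (inv k \<otimes> gconj G f h, (l, l')) * ?B l'))"
    by (rule sum_gconj[OF z(1)])
  also have "\<dots> = (\<Sum>l\<in>K. \<Sum>k\<in>carrier G. \<Sum>l'\<in>K. x k * (?A l * w (inv k \<otimes> gconj G f h, (l, l')) * ?B l'))"
    unfolding sum_distrib_left by (rule sum.swap)
  also have "\<dots> = (\<Sum>l\<in>K. \<Sum>l'\<in>K. \<Sum>k\<in>carrier G. x k * (?A l * w (inv k \<otimes> gconj G f h, (l, l')) * ?B l'))"
    by (rule sum.cong[OF refl], rule sum.swap)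
  also have "\<dots> = base_form (free_lact GH x w) ((f, h), (m, n))"
    using z by (simp add: base_form_in lact_Xi sum_distrib_left sum_distrib_right ac_simps)
  finally show "base_form (free_lact GH x w) ((f, h), (m, n)) = free_lact P (dvee_incl G x) (base_form w) ((f, h), (m, n))" ..
qed

text \<open>The right action multiplies by a matrix of \<open>\<rho>\<close>, on one side before and
  on the other side after the factor rho(fc). The identity fhf^-1 (fc) = (fc) c^-1 hc lets the two
  matrices pass each other.\<close>

lemma base_form_ract: "base_form (free_ract GH L rs w x) = free_ract P L sr (base_form w) (dvee_incl G x)"
proof (rule forms_eqI[OF base_form_closed ract_closed])
  fix f h m n assume z: "f \<in> carrier G" "h \<in> carrier G" "m \<in> K" "n \<in> K"
  note m = K_fst[OF z(3)]
  let ?A = "\<lambda>l. \<rho> (inv (f \<otimes> fst m)) m l" and ?g = "gconj G f h"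
  let ?T = "\<lambda>u l l'. ?A l * w (u, (l, l')) * x (inv u \<otimes> ?g) * \<rho> (inv u \<otimes> ?g \<otimes> (f \<otimes> fst m)) l' n"
  have fm: "f \<otimes> fst m \<in> carrier G"
    using z m by simp
  have "base_form (free_ract GH L rs w x) ((f, h), (m, n)) = (\<Sum>l\<in>K. \<Sum>j\<in>K. ?A l *
      (\<Sum>l'\<in>K. \<Sum>u\<in>carrier G. w (u, (l, l')) * (x (inv u \<otimes> ?g) * \<rho> (inv u \<otimes> ?g) l' j)) * \<rho> (f \<otimes> fst m) j n)"
    unfolding base_form_in[OF z] by (intro sum.cong refl) (simp only: ract_Xi z gconj_closed)
  also have "\<dots> = (\<Sum>l\<in>K. \<Sum>u\<in>carrier G. \<Sum>l'\<in>K. ?T u l l')"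
  proof (rule sum.cong[OF refl])
    fix l assume l: "l \<in> K"
    have "(\<Sum>j\<in>K. ?A l *
      (\<Sum>l'\<in>K. \<Sum>u\<in>carrier G. w (u, (l, l')) * (x (inv u \<otimes> ?g) * \<rho> (inv u \<otimes> ?g) l' j)) * \<rho> (f \<otimes> fst m) j n)
      = (\<Sum>j\<in>K. \<Sum>l'\<in>K. \<Sum>u\<in>carrier G. ?A l * w (u, (l, l')) * x (inv u \<otimes> ?g) * (\<rho> (inv u \<otimes> ?g) l' j * \<rho> (f \<otimes> fst m) j n))"
      by (simp only: sum_distrib_left sum_distrib_right mult.assoc)
    also have "\<dots> = (\<Sum>l'\<in>K. \<Sum>j\<in>K. \<Sum>u\<in>carrier G. ?A l * w (u, (l, l')) * x (inv u \<otimes> ?g) * (\<rho> (inv u \<otimes> ?g) l' j * \<rho> (f \<otimes> fst m) j n))"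
      by (rule sum.swap)
    also have "\<dots> = (\<Sum>l'\<in>K. \<Sum>u\<in>carrier G. \<Sum>j\<in>K. ?A l * w (u, (l, l')) * x (inv u \<otimes> ?g) * (\<rho> (inv u \<otimes> ?g) l' j * \<rho> (f \<otimes> fst m) j n))"
      by (rule sum.cong[OF refl], rule sum.swap)
    also have "\<dots> = (\<Sum>l'\<in>K. \<Sum>u\<in>carrier G. ?T u l l')"
    proof (rule sum.cong[OF refl], rule sum.cong[OF refl])
      fix l' u assume l': "l' \<in> K" and u: "u \<in> carrier G"
      have "(\<Sum>j\<in>K. \<rho> (inv u \<otimes> ?g) l' j * \<rho> (f \<otimes> fst m) j n) = \<rho> (inv u \<otimes> ?g \<otimes> (f \<otimes> fst m)) l' n"
        by (rule rho_mult[symmetric]) (use z u l' fm in auto)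
      then show "(\<Sum>j\<in>K. ?A l * w (u, (l, l')) * x (inv u \<otimes> ?g) * (\<rho> (inv u \<otimes> ?g) l' j * \<rho> (f \<otimes> fst m) j n)) = ?T u l l'"
        by (simp only: sum_distrib_left[symmetric])
    qed
    also have "\<dots> = (\<Sum>u\<in>carrier G. \<Sum>l'\<in>K. ?T u l l')"
      by (rule sum.swap)
    finally show "(\<Sum>j\<in>K. ?A l *
      (\<Sum>l'\<in>K. \<Sum>u\<in>carrier G. w (u, (l, l')) * (x (inv u \<otimes> ?g) * \<rho> (inv u \<otimes> ?g) l' j)) * \<rho> (f \<otimes> fst m) j n)
      = (\<Sum>u\<in>carrier G. \<Sum>l'\<in>K. ?T u l l')" .
  qed
  also have "\<dots> = (\<Sum>u\<in>carrier G. \<Sum>l\<in>K. \<Sum>l'\<in>K. ?T u l l')"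
    by (rule sum.swap)
  also have "\<dots> = (\<Sum>k\<in>carrier G. \<Sum>l\<in>K. \<Sum>l'\<in>K. ?T (gconj G f k) l l')"
    by (rule sum_gconj[OF z(1), symmetric])
  also have "\<dots> = free_ract P L sr (base_form w) (dvee_incl G x) ((f, h), (m, n))"
    unfolding ract_in[OF z]
  proof (rule sum.cong[OF refl])
    fix k assume k: "k \<in> carrier G"
    let ?\<gamma> = "\<gamma> m (inv k \<otimes> h)"
    have \<gamma>: "?\<gamma> \<in> carrier G"
      using k z by simp
    have 1: "inv (gconj G f k) \<otimes> ?g = gconj G f (inv k \<otimes> h)"
      using k z by (simp add: inv_gconj gconj_mult)
    have 2: "gconj G (f \<otimes> fst m) ?\<gamma> = gconj G f (inv k \<otimes> h)"
      using k z m by (simp add: \<gamma>_def gconj_gconj[symmetric])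
    have 3: "gconj G f (inv k \<otimes> h) \<otimes> (f \<otimes> fst m) = f \<otimes> fst m \<otimes> ?\<gamma>"
      using k z m by (simp add: \<gamma>_def gconj_def word_simps)
    have x: "dvee_incl G x (f \<otimes> fst m, ?\<gamma>) = x (gconj G f (inv k \<otimes> h))"
      unfolding dvee_incl_eq using fm \<gamma> 2 by simp
    have "(\<Sum>j\<in>K. base_form w ((f, k), (m, j)) * (dvee_incl G x (f \<otimes> fst m, ?\<gamma>) * \<rho> ?\<gamma> j n))
      = (\<Sum>j\<in>K. (\<Sum>l\<in>K. \<Sum>l'\<in>K. ?A l * w (gconj G f k, (l, l')) * \<rho> (f \<otimes> fst m) l' j) * (x (gconj G f (inv k \<otimes> h)) * \<rho> ?\<gamma> j n))"
      unfolding x by (rule sum.cong[OF refl]) (simp only: base_form_in[OF z(1) k z(3)])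
    also have "\<dots> = (\<Sum>j\<in>K. \<Sum>l\<in>K. \<Sum>l'\<in>K. ?A l * w (gconj G f k, (l, l')) * x (gconj G f (inv k \<otimes> h)) * (\<rho> (f \<otimes> fst m) l' j * \<rho> ?\<gamma> j n))"
      by (simp only: sum_distrib_left sum_distrib_right ac_simps)
    also have "\<dots> = (\<Sum>l\<in>K. \<Sum>j\<in>K. \<Sum>l'\<in>K. ?A l * w (gconj G f k, (l, l')) * x (gconj G f (inv k \<otimes> h)) * (\<rho> (f \<otimes> fst m) l' j * \<rho> ?\<gamma> j n))"
      by (rule sum.swap)
    also have "\<dots> = (\<Sum>l\<in>K. \<Sum>l'\<in>K. \<Sum>j\<in>K. ?A l * w (gconj G f k, (l, l')) * x (gconj G f (inv k \<otimes> h)) * (\<rho> (f \<otimes> fst m) l' j * \<rho> ?\<gamma> j n))"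
      by (rule sum.cong[OF refl], rule sum.swap)
    also have "\<dots> = (\<Sum>l\<in>K. \<Sum>l'\<in>K. ?T (gconj G f k) l l')"
    proof (rule sum.cong[OF refl], rule sum.cong[OF refl])
      fix l l' assume l': "l' \<in> K"
      have "(\<Sum>j\<in>K. \<rho> (f \<otimes> fst m) l' j * \<rho> ?\<gamma> j n) = \<rho> (f \<otimes> fst m \<otimes> ?\<gamma>) l' n"
        by (rule rho_mult[symmetric]) (use z \<gamma> l' fm in auto)
      then show "(\<Sum>j\<in>K. ?A l * w (gconj G f k, (l, l')) * x (gconj G f (inv k \<otimes> h)) * (\<rho> (f \<otimes> fst m) l' j * \<rho> ?\<gamma> j n))
          = ?T (gconj G f k) l l'"
        unfolding 1 3 by (simp only: sum_distrib_left[symmetric])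
    qed
    finally show "(\<Sum>l\<in>K. \<Sum>l'\<in>K. ?T (gconj G f k) l l')
      = (\<Sum>j\<in>K. base_form w ((f, k), (m, j)) * (dvee_incl G x (f \<otimes> fst m, ?\<gamma>) * \<rho> ?\<gamma> j n))" ..
  qed
  finally show "base_form (free_ract GH L rs w x) ((f, h), (m, n)) = free_ract P L sr (base_form w) (dvee_incl G x) ((f, h), (m, n))" .
qed

lemma sum_kron: "l \<in> K \<Longrightarrow> (\<Sum>l'\<in>K. kron l l' * F l') = (F l :: complex)"
  by (simp add: if_distrib[of "\<lambda>x. x * _"] sum.delta' cong: if_cong)

text \<open>With g = fhf^-1 one has (fc)^-1 g fc = c^-1 hc, so rho(g) - 1 conjugated by rho(fc) is
  the matrix in the differential on P. This requirement dictates the conjugating elements in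
  \<open>base_form\<close>.\<close>

lemma base_form_delta: "base_form (\<delta>\<^sub>\<Xi> x) = \<delta> (dvee_incl G x)"
proof (rule forms_eqI[OF base_form_closed delta_closed[OF incl_closed]])
  fix f h m n assume z: "f \<in> carrier G" "h \<in> carrier G" "m \<in> K" "n \<in> K"
  note m = K_fst[OF z(3)]
  have fm: "f \<otimes> fst m \<in> carrier G"
    using z m by simp
  let ?A = "\<lambda>l. \<rho> (inv (f \<otimes> fst m)) m l" and ?g = "gconj G f h" and ?B = "\<lambda>l'. \<rho> (f \<otimes> fst m) l' n"
  have g: "?g \<in> carrier G"
    using z by simp
  have "base_form (\<delta>\<^sub>\<Xi> x) ((f, h), (m, n)) = (\<Sum>l\<in>K. \<Sum>l'\<in>K. ?A l * (x ?g * (\<rho> ?g l l' - kron l l')) * ?B l')"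
    unfolding base_form_in[OF z] delta_Xi_eq using z by (intro sum.cong refl) simp
  also have "\<dots> = (\<Sum>l\<in>K. x ?g * ?A l * ((\<Sum>l'\<in>K. \<rho> ?g l l' * ?B l') - (\<Sum>l'\<in>K. kron l l' * ?B l')))"
    by (rule sum.cong[OF refl]) (simp only: sum_distrib_left sum_subtractf[symmetric], simp add: algebra_simps)
  also have "\<dots> = (\<Sum>l\<in>K. x ?g * ?A l * (\<rho> (?g \<otimes> (f \<otimes> fst m)) l n - ?B l))"
    by (rule sum.cong[OF refl]) (simp only: sum_kron rho_mult[OF g fm _ z(4)])
  also have "\<dots> = x ?g * ((\<Sum>l\<in>K. ?A l * \<rho> (?g \<otimes> (f \<otimes> fst m)) l n) - (\<Sum>l\<in>K. ?A l * ?B l))"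
    by (simp only: sum_distrib_left sum_subtractf[symmetric] right_diff_distrib mult.assoc)
  also have "(\<Sum>l\<in>K. ?A l * \<rho> (?g \<otimes> (f \<otimes> fst m)) l n) = \<rho> (inv (f \<otimes> fst m) \<otimes> (?g \<otimes> (f \<otimes> fst m))) m n"
    by (rule rho_mult[symmetric]) (use z fm in auto)
  also have "inv (f \<otimes> fst m) \<otimes> (?g \<otimes> (f \<otimes> fst m)) = \<gamma> m h"
    using z m by (simp add: \<gamma>_def gconj_def word_simps)
  also have "(\<Sum>l\<in>K. ?A l * ?B l) = \<rho> (inv (f \<otimes> fst m) \<otimes> (f \<otimes> fst m)) m n"
    by (rule rho_mult[symmetric]) (use z fm in auto)
  also have "\<dots> = kron m n"
    using fm z by (simp add: rho_one)
  also have "x ?g * (\<rho> (\<gamma> m h) m n - kron m n) = \<delta> (dvee_incl G x) ((f, h), (m, n))"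
  proof -
    have "gconj G (f \<otimes> fst m) (\<gamma> m h) = ?g"
      using z m by (simp add: \<gamma>_def gconj_gconj[symmetric])
    then show ?thesis
      unfolding delta_in[OF z] dvee_incl_eq using z fm by (simp add: algebra_simps)
  qed
  finally show "base_form (\<delta>\<^sub>\<Xi> x) ((f, h), (m, n)) = \<delta> (dvee_incl G x) ((f, h), (m, n))" .
qed

text \<open>At f = 1 the rows over c of \<open>base_form w\<close> are the rows over c of rho(c)^-1
  w rho(c). As c commutes with itself, rho(c) maps the block over c to itself, so these rows suffice
  to recover the rows of w over c.\<close>

lemma base_form_inverse:
  assumes "g \<in> carrier G" "k \<in> K" "l \<in> K"
  shows "w (g, (k, l)) = (\<Sum>m\<in>K. \<Sum>n\<in>K. \<rho> (fst k) k m * base_form w ((\<one>, g), (m, n)) * \<rho> (inv (fst k)) n l)"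
proof -
  note k = K_fst[OF assms(2)]
  let ?c = "fst k"
  have "(\<Sum>m\<in>K. \<Sum>n\<in>K. \<rho> ?c k m * base_form w ((\<one>, g), (m, n)) * \<rho> (inv ?c) n l)
      = (\<Sum>m\<in>K. \<Sum>n\<in>K. \<Sum>i\<in>K. \<Sum>j\<in>K. (\<rho> ?c k m * \<rho> (inv ?c) m i) * w (g, (i, j)) * (\<rho> ?c j n * \<rho> (inv ?c) n l))"
  proof (rule sum.cong[OF refl], rule sum.cong[OF refl])
    fix m n assume m: "m \<in> K" and n: "n \<in> K"
    show "\<rho> ?c k m * base_form w ((\<one>, g), (m, n)) * \<rho> (inv ?c) n l
      = (\<Sum>i\<in>K. \<Sum>j\<in>K. (\<rho> ?c k m * \<rho> (inv ?c) m i) * w (g, (i, j)) * (\<rho> ?c j n * \<rho> (inv ?c) n l))"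
    proof (cases "\<rho> ?c k m = 0")
      case False
      then have "?c = gconj G ?c (fst m)"
        by (rule rho_nonzero)
      then have "fst m = ?c"
        using gconj_cancel[of ?c "fst m" ?c] k K_fst[OF m] by (simp add: gconj_def m_assoc)
      then have "base_form w ((\<one>, g), (m, n)) = (\<Sum>i\<in>K. \<Sum>j\<in>K. \<rho> (inv ?c) m i * w (g, (i, j)) * \<rho> ?c j n)"
        using base_form_in[OF one_closed assms(1) m n, of w] assms(1) k by simp
      then show ?thesis
        by (simp only: sum_distrib_left sum_distrib_right mult.assoc)
    qed simp
  qed
  also have "\<dots> = (\<Sum>m\<in>K. \<Sum>i\<in>K. \<Sum>j\<in>K. \<Sum>n\<in>K. (\<rho> ?c k m * \<rho> (inv ?c) m i) * w (g, (i, j)) * (\<rho> ?c j n * \<rho> (inv ?c) n l))"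
  proof (rule sum.cong[OF refl])
    fix m
    show "(\<Sum>n\<in>K. \<Sum>i\<in>K. \<Sum>j\<in>K. (\<rho> ?c k m * \<rho> (inv ?c) m i) * w (g, (i, j)) * (\<rho> ?c j n * \<rho> (inv ?c) n l))
      = (\<Sum>i\<in>K. \<Sum>j\<in>K. \<Sum>n\<in>K. (\<rho> ?c k m * \<rho> (inv ?c) m i) * w (g, (i, j)) * (\<rho> ?c j n * \<rho> (inv ?c) n l))"
      by (rule trans[OF sum.swap], rule sum.cong[OF refl], rule sum.swap)
  qed
  also have "\<dots> = (\<Sum>m\<in>K. \<Sum>i\<in>K. (\<rho> ?c k m * \<rho> (inv ?c) m i) * w (g, (i, l)))"
  proof (rule sum.cong[OF refl], rule sum.cong[OF refl])
    fix m i
    have "(\<Sum>j\<in>K. \<Sum>n\<in>K. (\<rho> ?c k m * \<rho> (inv ?c) m i) * w (g, (i, j)) * (\<rho> ?c j n * \<rho> (inv ?c) n l))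
        = (\<Sum>j\<in>K. if j = l then (\<rho> ?c k m * \<rho> (inv ?c) m i) * w (g, (i, j)) else 0)"
      by (rule sum.cong[OF refl]) (simp add: sum_distrib_left[symmetric] sum_rho_one assms(3) k)
    also have "\<dots> = (\<rho> ?c k m * \<rho> (inv ?c) m i) * w (g, (i, l))"
      using assms(3) by (subst sum.delta) auto
    finally show "(\<Sum>j\<in>K. \<Sum>n\<in>K. (\<rho> ?c k m * \<rho> (inv ?c) m i) * w (g, (i, j)) * (\<rho> ?c j n * \<rho> (inv ?c) n l)) = \<dots>" .
  qed
  also have "\<dots> = (\<Sum>i\<in>K. (\<Sum>m\<in>K. \<rho> ?c k m * \<rho> (inv ?c) m i) * w (g, (i, l)))"
    unfolding sum_distrib_right by (rule sum.swap)
  also have "\<dots> = (\<Sum>i\<in>K. kron k i * w (g, (i, l)))"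
    by (rule sum.cong[OF refl]) (simp only: sum_rho_one[OF assms(2) _ k])
  also have "\<dots> = w (g, (k, l))"
    by (rule sum_kron[OF assms(2)])
  finally show ?thesis ..
qed

lemma Xi_carrier_subset: "\<Xi>\<^sub>0 \<subseteq> carrier (fspace (carrier G \<times> L))"
  unfolding Xi_carrier
  by (rule fspan_minimal[OF lin_closed_fspace]) (auto simp: carrier_fspace lact_Xi delta_Xi_eq intro!: sum.neutral split: if_splits)

lemma inj_base_form: "inj_on base_form \<Xi>\<^sub>0"
proof (rule inj_onI)
  fix v w assume vw: "v \<in> \<Xi>\<^sub>0" "w \<in> \<Xi>\<^sub>0" and eq: "base_form v = base_form w"
  show "v = w"
  proof (rule fspace_eqI)
    show "v \<in> carrier (fspace (carrier G \<times> L))" "w \<in> carrier (fspace (carrier G \<times> L))"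
      using vw Xi_carrier_subset by auto
    fix z assume "z \<in> carrier G \<times> L"
    then obtain g k l where z: "z = (g, (k, l))" "g \<in> carrier G" "k \<in> K" "l \<in> K" by blast
    show "v z = w z"
      unfolding z(1) base_form_inverse[OF z(2-4), of v] base_form_inverse[OF z(2-4), of w] eq ..
  qed
qed

text \<open>Both carriers are spans of forms x dy, and \<open>base_form\<close> maps one set of
  generators onto the other.\<close>

lemma calculus_iso_base:
  "calculus_iso CG \<Xi> (base_algebra P H p) (base_calculus P H p \<Omega>) (dvee_incl G) base_form"
proof -
  let ?B = "base_calculus P H p \<Omega>"
  let ?Y = "{free_lact GH x (\<delta>\<^sub>\<Xi> y) | x y. x \<in> carrier CG \<and> y \<in> carrier CG}"
  let ?X = "{free_lact P a (\<delta> b) | a b. a \<in> A \<and> b \<in> A}"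
  have sub: "?X \<subseteq> carrier \<Omega>"
    using bim.lact_closed delta_closed coinv_subset unfolding Omega_simps by blast
  have carr: "carrier ?B = fspan ?X"
    using lin_span_eq_fspan[OF Omega_simps(5) sub] by (simp add: base_calculus_def)
  have B: "fun_module ?B" "lact ?B = free_lact P" "ract ?B = free_ract P L sr" "diff ?B = \<delta>"
  proof -
    have "lin_closed (lin_span \<Omega> {lact \<Omega> a (diff \<Omega> b) | a b. a \<in> A \<and> b \<in> A})"
      using lin_span_eq_fspan[OF Omega_simps(5) sub] by simp
    then show "fun_module ?B"
      unfolding base_calculus_def by (intro fun_module_carrier_update Omega_simps(5))
  qed (simp_all add: base_calculus_def)
  have "base_form ` ?Y = ?X"
  proof
    show "base_form ` ?Y \<subseteq> ?X"
    proof clarify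
      fix x y
      have "base_form (free_lact GH x (\<delta>\<^sub>\<Xi> y)) = free_lact P (dvee_incl G x) (\<delta> (dvee_incl G y))"
        by (simp only: base_form_lact base_form_delta)
      then show "\<exists>a b. base_form (free_lact GH x (\<delta>\<^sub>\<Xi> y)) = free_lact P a (\<delta> b) \<and> a \<in> A \<and> b \<in> A"
        using incl_in_coinv by blast
    qed
    show "?X \<subseteq> base_form ` ?Y"
    proof clarify
      fix a b assume "a \<in> A" "b \<in> A"
      then obtain x y where xy: "x \<in> carrier CG" "y \<in> carrier CG" "a = dvee_incl G x" "b = dvee_incl G y"
        unfolding coinv_eq by blast
      then have "free_lact P a (\<delta> b) = base_form (free_lact GH x (\<delta>\<^sub>\<Xi> y))"
        by (simp only: base_form_lact base_form_delta)
      with xy(1,2) show "free_lact P a (\<delta> b) \<in> base_form ` ?Y"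
        by blast
    qed
  qed
  moreover have "base_form ` fspan ?Y = fspan (base_form ` ?Y)"
    using fspan_image[of UNIV base_form ?Y] flinear_base_form by (simp add: lin_closed_def)
  ultimately have image: "base_form ` \<Xi>\<^sub>0 = carrier ?B"
    unfolding Xi_carrier carr by (simp only:)
  have "lin_iso \<Xi> ?B base_form"
    unfolding lin_iso_def lin_map_fun_module[OF Xi_simps(5) B(1)] Xi_simps(1) bij_betw_def
    using image inj_base_form flinear_base_form by blast
  then show ?thesis
    unfolding calculus_iso_def B Xi_simps(2-4)
    using algebra_iso_incl base_form_lact base_form_ract base_form_delta by simp
qed

end

section \<open>The calculus on the fibre\<close>

context nontrivial_class_rep
begin

lemma gconj_S:
  assumes "c \<in> S" "g \<in> carrier G"
  shows "gconj G g c \<in> S"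
  using assms gconj_C[OF S_subset[OF assms(1)] assms(2)] by (simp add: S_def split: if_splits)

section \<open>The calculus of a union of classes on functions\<close>

definition sc :: "'a \<Rightarrow> 'a \<Rightarrow> 'a \<times> 'a \<Rightarrow> complex" where
  "sc = (\<lambda>c g. tprod (bvec (g \<otimes> inv c)) (bvec c))"

definition delta_class :: "('a \<Rightarrow> complex) \<Rightarrow> 'a \<times> 'a \<Rightarrow> complex" where
  "delta_class x = (\<lambda>(g, c). if g \<in> carrier G \<and> c \<in> S then x (g \<otimes> c) - x g else 0)"

lemma sum_translate:
  assumes "g \<in> carrier G" "c \<in> carrier G"
  shows "(\<Sum>u\<in>carrier G. if g = u \<otimes> inv c then f u else 0) = (f (g \<otimes> c) :: complex)"
proof (rule sum_delta_eq)
  fix u assume "u \<in> carrier G"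
  then show "g = u \<otimes> inv c \<longleftrightarrow> u = g \<otimes> c"
    using assms by (auto simp: m_assoc)
qed (use assms in auto)

lemma delta_class_lext:
  "lext (carrier G) (\<lambda>g z. \<Sum>c\<in>S. tprod (bvec (g \<otimes> inv c)) (bvec c) z - tprod (bvec g) (bvec c) z) x = delta_class x"
proof -
  have "(\<Sum>u\<in>carrier G. x u * (\<Sum>c'\<in>S. tprod (bvec (u \<otimes> inv c')) (bvec c') (g, c) - tprod (bvec u) (bvec c') (g, c)))
      = delta_class x (g, c)" for g c
  proof -
    have inner: "(\<Sum>c'\<in>S. tprod (bvec (u \<otimes> inv c')) (bvec c') (g, c) - tprod (bvec u) (bvec c') (g, c))
        = (if c \<in> S then (if g = u \<otimes> inv c then 1 else 0) - (if g = u then 1 else 0) else 0 :: complex)" for u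
    proof -
      have "(\<Sum>c'\<in>S. tprod (bvec (u \<otimes> inv c')) (bvec c') (g, c) - tprod (bvec u) (bvec c') (g, c))
        = (\<Sum>c'\<in>S. if c' = c then (if g = u \<otimes> inv c then 1 else 0) - (if g = u then 1 else 0) else 0 :: complex)"
        by (rule sum.cong[OF refl]) (simp add: tprod_def bvec_def)
      also have "\<dots> = (if c \<in> S then (if g = u \<otimes> inv c then 1 else 0) - (if g = u then 1 else 0) else 0)"
        by (rule sum.delta[OF finite_S])
      finally show ?thesis .
    qed
    show ?thesis
    proof (cases "g \<in> carrier G \<and> c \<in> S")
      case True
      then have "(\<Sum>u\<in>carrier G. x u * ((if g = u \<otimes> inv c then 1 else 0) - (if g = u then 1 else 0)))
          = (\<Sum>u\<in>carrier G. if g = u \<otimes> inv c then x u else 0) - (\<Sum>u\<in>carrier G. if g = u then x u else 0)"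
        unfolding sum_subtractf[symmetric] by (intro sum.cong refl) simp
      also have "\<dots> = x (g \<otimes> c) - x g"
        using True S_carrier by (subst sum_translate) auto
      finally show ?thesis
        using True by (simp only: inner delta_class_def) simp
    next
      case False
      have "x u * (if c \<in> S then (if g = u \<otimes> inv c then 1 else 0) - (if g = u then 1 else 0) else 0) = 0"
        if "u \<in> carrier G" for u
      proof (cases "c \<in> S")
        case True
        then have "u \<otimes> inv c \<in> carrier G" "g \<notin> carrier G"
          using False that S_carrier by simp_all
        then have "g \<noteq> u \<otimes> inv c" "g \<noteq> u"
          using that by blast+
        then show ?thesis by simp
      qed simp
      then show ?thesis
        unfolding inner using False by (subst sum.neutral) (auto simp: delta_class_def)
    qed
  qed
  then show ?thesis
    by (simp add: lext_def fun_eq_iff)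
qed

lemma class_calculus_eq: "class_calculus G S = free_calculus H S sc delta_class"
  unfolding class_calculus_def delta_class_lext[abs_def] sc_def ..

lemma lact_class: "free_lact H x w = (\<lambda>(g, c). if g \<in> carrier G then x g * w (g, c) else 0)"
  by (auto simp: free_lact_def fun_mult)

lemma lext_sc:
  assumes "c \<in> S"
  shows "lext (carrier G) (sc c) x (g, c') = (if g \<in> carrier G \<and> c' = c then x (g \<otimes> c) else 0)"
proof (cases "g \<in> carrier G \<and> c' = c")
  case True
  have "lext (carrier G) (sc c) x (g, c') = (\<Sum>u\<in>carrier G. if g = u \<otimes> inv c then x u else 0)"
    unfolding lext_def by (intro sum.cong refl) (use True in \<open>simp add: sc_def tprod_def bvec_def\<close>)
  then show ?thesis
    using True assms S_carrier by (simp only: sum_translate) simp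
next
  case False
  then show ?thesis
    using assms S_carrier unfolding lext_def by (auto simp: sc_def tprod_def bvec_def intro!: sum.neutral)
qed

lemma ract_class:
  "free_ract H S sc w x = (\<lambda>(g, c). if g \<in> carrier G \<and> c \<in> S then w (g, c) * x (g \<otimes> c) else 0)"
proof -
  have "free_ract H S sc w x (g, c) = (if g \<in> carrier G \<and> c \<in> S then w (g, c) * x (g \<otimes> c) else 0)" for g c
  proof -
    have "free_ract H S sc w x (g, c) = (\<Sum>l\<in>S. if l = c then if g \<in> carrier G then w (g, c) * x (g \<otimes> c) else 0 else 0)"
    proof -
      have "free_ract H S sc w x (g, c)
          = (\<Sum>l\<in>S. if g \<in> carrier G then w (g, l) * lext (carrier G) (sc l) x (g, c) else 0)"
        by (subst free_ract_eq) (simp_all add: fun_mult)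
      also have "\<dots> = (\<Sum>l\<in>S. if l = c then if g \<in> carrier G then w (g, c) * x (g \<otimes> c) else 0 else 0)"
      proof (rule sum.cong[OF refl])
        fix l assume l: "l \<in> S"
        show "(if g \<in> carrier G then w (g, l) * lext (carrier G) (sc l) x (g, c) else 0)
            = (if l = c then if g \<in> carrier G then w (g, c) * x (g \<otimes> c) else 0 else 0)"
          unfolding lext_sc[OF l] by auto
      qed
      finally show ?thesis .
    qed
    then show ?thesis
      by (simp add: sum.delta)
  qed
  then show ?thesis by (simp add: fun_eq_iff)
qed

lemma free_bimodule_class: "free_bimodule H S sc"
proof
  show "complex_algebra (alg H)"
    by (rule complex_algebra_fun)
  show "sc c g \<in> carrier (fspace (basis H \<times> S))" if "c \<in> S" "g \<in> basis H" for c g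
    using that S_carrier by (auto simp: sc_def tprod_def bvec_def carrier_fspace)
  show "free_ract H S sc w \<one>\<^bsub>alg H\<^esub> = w" if "w \<in> carrier (fspace (basis H \<times> S))" for w
    using that S_carrier by (auto simp: ract_class alg_ops carrier_fspace fun_eq_iff)
  show "free_ract H S sc w (x \<otimes>\<^bsub>alg H\<^esub> y) = free_ract H S sc (free_ract H S sc w x) y" for w x y
    using S_carrier by (auto simp: ract_class fun_mult fun_eq_iff)
qed simp_all

text \<open>The calculus is inner, with theta the sum of all basis forms. As 1 is not in
  \<open>S\<close>, translation by c has no fixed points, so the delta function at b times the
  differential of the delta function at bc is the single basis form (b, c).\<close>

lemma fo_calculus_class: "fo_calculus (alg H) (class_calculus G S)"
  unfolding class_calculus_eq
proof (rule free_bimodule.fo_calculus_inner[OF free_bimodule_class,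
      of "\<lambda>(g, c). if g \<in> carrier G \<and> c \<in> S then 1 else 0"])
  show "(\<lambda>(g, c). if g \<in> carrier G \<and> c \<in> S then 1 else 0) \<in> carrier (fspace (basis H \<times> S))"
    by (auto simp: carrier_fspace)
  show "delta_class x = (\<lambda>z. free_ract H S sc (\<lambda>(g, c). if g \<in> carrier G \<and> c \<in> S then 1 else 0) x z
      - free_lact H x (\<lambda>(g, c). if g \<in> carrier G \<and> c \<in> S then 1 else 0) z)" for x
    by (auto simp: delta_class_def ract_class lact_class fun_eq_iff)
  fix b c assume b: "b \<in> basis H" and c: "c \<in> S"
  have cG: "c \<in> carrier G" and bG: "b \<in> carrier G" and "c \<noteq> \<one>"
    using b c S_carrier one_notin_S by auto
  have "bvec (b, c) (g, d) = free_lact H (bvec b) (delta_class (bvec (b \<otimes> c))) (g, d)" for g d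
  proof (cases "g = b \<and> d \<in> S")
    case True
    then have "b \<otimes> c \<noteq> b" "b \<otimes> d = b \<otimes> c \<longleftrightarrow> d = c"
      using bG cG S_carrier \<open>c \<noteq> \<one>\<close> by auto
    then show ?thesis
      using True bG by (auto simp: lact_class delta_class_def bvec_def)
  next
    case False
    then show ?thesis
      using c by (auto simp: lact_class delta_class_def bvec_def)
  qed
  then have "bvec (b, c) = free_lact H (bvec b) (delta_class (bvec (b \<otimes> c)))"
    by (simp add: fun_eq_iff)
  moreover have "bvec b \<in> carrier (alg H)" "bvec (b \<otimes> c) \<in> carrier (alg H)"
    using bG cG by (simp_all add: alg_ops)
  ultimately show "bvec (b, c) \<in> fspan {free_lact H x (delta_class y) | x y. x \<in> carrier (alg H) \<and> y \<in> carrier (alg H)}"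
    by (intro fspan_base) blast
qed

lemma fun_module_class: "fun_module (class_calculus G S)"
  by (simp add: class_calculus_eq)

lemma form_of_class:
  "form_of H (class_calculus G S) t = (\<lambda>(g, c). if g \<in> carrier G \<and> c \<in> S then t (g, g \<otimes> c) - t (g, g) else 0)"
proof -
  have "form_of H (class_calculus G S) t
      = (\<lambda>z. \<Sum>u\<in>basis H \<times> basis H. t u * free_lact H (bvec (fst u)) (delta_class (bvec (snd u))) z)"
    unfolding form_of_def
    by (subst finsum_fun_module[OF fun_module_class])
      (auto simp: class_calculus_eq fun_module_ops(3) lact_class delta_class_def carrier_fspace)
  also have "\<dots> = (\<lambda>(g, c). if g \<in> carrier G \<and> c \<in> S then t (g, g \<otimes> c) - t (g, g) else 0)"
  proof -
    have "(\<Sum>u\<in>carrier G \<times> carrier G. t u * free_lact H (bvec (fst u)) (delta_class (bvec (snd u))) (g, c))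
        = (if g \<in> carrier G \<and> c \<in> S then t (g, g \<otimes> c) - t (g, g) else 0)" for g c
    proof (cases "g \<in> carrier G \<and> c \<in> S")
      case True
      then have cG: "c \<in> carrier G" using S_carrier by blast
      have "(\<Sum>u\<in>carrier G \<times> carrier G. t u * free_lact H (bvec (fst u)) (delta_class (bvec (snd u))) (g, c))
          = (\<Sum>u\<in>carrier G \<times> carrier G. if u = (g, g \<otimes> c) then t u else 0)
            - (\<Sum>u\<in>carrier G \<times> carrier G. if u = (g, g) then t u else 0)"
        unfolding sum_subtractf[symmetric]
        by (intro sum.cong refl) (use True in \<open>auto simp: lact_class delta_class_def bvec_def\<close>)
      then show ?thesis
        using True cG by simp
    qed (auto simp: lact_class delta_class_def intro!: sum.neutral)
    then show ?thesis by (simp add: fun_eq_iff)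
  qed
  finally show ?thesis .
qed

lemma bcomult_fun:
  assumes "g \<in> carrier G" "a \<in> carrier G" "b \<in> carrier G"
  shows "bcomult H g (a, b) = bvec g (a \<otimes> b)"
proof -
  have "bcomult H g = comult H (bvec g)"
    using assms(1) by (simp add: comult_def lext_bvec)
  then show ?thesis
    using assms by (simp add: fun_comult)
qed

lemma codiag_fun:
  assumes "a \<in> carrier G" "b \<in> carrier G" "g \<in> carrier G"
  shows "codiag_left H t (b, (a, g)) = t (b \<otimes> a, b \<otimes> g)" "codiag_right H t ((a, g), b) = t (a \<otimes> b, g \<otimes> b)"
proof -
  have l: "(\<Sum>b1\<in>basis H. \<Sum>b2\<in>basis H. bcomult H x (b1, a) * bcomult H y (b2, g) * bmult H b1 b2 b)
      = bvec x (b \<otimes> a) * bvec y (b \<otimes> g)" if "x \<in> carrier G" "y \<in> carrier G" for x y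
    using that assms by (subst fun_bmult_sum) (simp add: bcomult_fun)
  have r: "(\<Sum>b1\<in>basis H. \<Sum>b2\<in>basis H. bcomult H x (a, b1) * bcomult H y (g, b2) * bmult H b1 b2 b)
      = bvec x (a \<otimes> b) * bvec y (g \<otimes> b)" if "x \<in> carrier G" "y \<in> carrier G" for x y
    using that assms by (subst fun_bmult_sum) (simp add: bcomult_fun)
  have "codiag_left H t (b, (a, g)) = (\<Sum>u\<in>carrier G \<times> carrier G. if u = (b \<otimes> a, b \<otimes> g) then t u else 0)"
    unfolding codiag_left_def lext_def
  proof (rule sum.cong)
    fix u assume "u \<in> carrier G \<times> carrier G"
    then obtain x y where u: "u = (x, y)" "x \<in> carrier G" "y \<in> carrier G" by blast
    show "t u * (case u of (x, y) \<Rightarrow> \<lambda>(b, c, d). \<Sum>b1\<in>basis H. \<Sum>b2\<in>basis H.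
        bcomult H x (b1, c) * bcomult H y (b2, d) * bmult H b1 b2 b) (b, a, g)
      = (if u = (b \<otimes> a, b \<otimes> g) then t u else 0)"
      unfolding u(1) prod.case l[OF u(2,3)] by (auto simp: bvec_def)
  qed simp
  then show "codiag_left H t (b, (a, g)) = t (b \<otimes> a, b \<otimes> g)"
    using assms by simp
  have "codiag_right H t ((a, g), b) = (\<Sum>u\<in>carrier G \<times> carrier G. if u = (a \<otimes> b, g \<otimes> b) then t u else 0)"
    unfolding codiag_right_def lext_def
  proof (rule sum.cong)
    fix u assume "u \<in> carrier G \<times> carrier G"
    then obtain x y where u: "u = (x, y)" "x \<in> carrier G" "y \<in> carrier G" by blast
    show "t u * (case u of (x, y) \<Rightarrow> \<lambda>((c, d), b). \<Sum>b1\<in>basis H. \<Sum>b2\<in>basis H.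
        bcomult H x (c, b1) * bcomult H y (d, b2) * bmult H b1 b2 b) ((a, g), b)
      = (if u = (a \<otimes> b, g \<otimes> b) then t u else 0)"
      unfolding u(1) prod.case r[OF u(2,3)] by (auto simp: bvec_def)
  qed simp
  then show "codiag_right H t ((a, g), b) = t (a \<otimes> b, g \<otimes> b)"
    using assms by simp
qed

text \<open>By \<open>form_of_class\<close> a form vanishes when t(g, gc) = t(g, g) for all g and
  all c in \<open>S\<close>. Left translation permutes these equations; right translation by b
  replaces c by b^-1 cb, which stays in \<open>S\<close>.\<close>

lemma bicovariant_class: "bicovariant_calculus H (class_calculus G S)"
  unfolding bicovariant_calculus_def fun_module_ops(1)[OF fun_module_class]
proof (intro conjI fo_calculus_class ballI impI)
  fix t b assume form: "form_of H (class_calculus G S) t = (\<lambda>_. 0)" and "b \<in> basis H"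
  have zero: "t (g, g \<otimes> c) = t (g, g)" if "g \<in> carrier G" "c \<in> S" for g c
    using fun_cong[OF form[unfolded form_of_class], of "(g, c)"] that by simp
  have b: "b \<in> carrier G"
    using \<open>b \<in> basis H\<close> by simp
  have "t (b \<otimes> g, b \<otimes> (g \<otimes> c)) = t (b \<otimes> g, b \<otimes> g)" if "g \<in> carrier G" "c \<in> S" for g c
    using zero[of "b \<otimes> g" c] that b S_carrier by (simp add: m_assoc)
  then show "form_of H (class_calculus G S) (\<lambda>u. codiag_left H t (b, u)) = (\<lambda>_. 0)"
    using b S_carrier by (auto simp: form_of_class codiag_fun fun_eq_iff)
  have "t (g \<otimes> b, g \<otimes> c \<otimes> b) = t (g \<otimes> b, g \<otimes> b)" if "g \<in> carrier G" "c \<in> S" for g c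
  proof -
    have "g \<otimes> c \<otimes> b = g \<otimes> b \<otimes> gconj G (inv b) c"
      using that b S_carrier by (simp add: gconj_def m_assoc)
    then show ?thesis
      using zero[of "g \<otimes> b" "gconj G (inv b) c"] gconj_S[of c "inv b"] that b by simp
  qed
  then show "form_of H (class_calculus G S) (\<lambda>u. codiag_right H t (u, b)) = (\<lambda>_. 0)"
    using b S_carrier by (auto simp: form_of_class codiag_fun fun_eq_iff)
qed

section \<open>The fibre calculus and its left-invariant forms\<close>

interpretation fib: linear_quotient "M (carrier G)" "N (carrier G)" res
  by (rule res_quotient) simp

abbreviation "\<F> \<equiv> fibre_calculus P H p \<Omega>"
abbreviation "cls t \<equiv> N (carrier G) +>\<^bsub>M (carrier G)\<^esub> t"
abbreviation "\<Psi> \<equiv> linear_quotient.lift res"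

lemma fibre_simps:
  "carrier \<F> = cls ` carrier (M (carrier G))" "add \<F> = add (quot_module (M (carrier G)) (N (carrier G)))"
  "Module.smult \<F> = Module.smult (quot_module (M (carrier G)) (N (carrier G)))"
  "\<zero>\<^bsub>\<F>\<^esub> = \<zero>\<^bsub>quot_module (M (carrier G)) (N (carrier G))\<^esub>"
  "lact \<F> h X = (\<Union>t\<in>X. cls (tprod h \<one>\<^bsub>alg H\<^esub> \<otimes>\<^bsub>alg (tensor_alg H H)\<^esub> t))"
  "ract \<F> X h = (\<Union>t\<in>X. cls (t \<otimes>\<^bsub>alg (tensor_alg H H)\<^esub> comult H h))"
  "diff \<F> h = cls (\<lambda>u. comult H h u - tprod h \<one>\<^bsub>alg H\<^esub> u)"
  unfolding fib.carrier_quot[symmetric]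
  by (simp_all add: fibre_calculus_def quot_calculus_def Let_def module.extend_def calculus.fields_def
      tens_inv_forms_eq tens_class_eq)

lemma in_M: "t \<in> carrier (M (carrier G))
    \<longleftrightarrow> t \<in> carrier (fspace (carrier G \<times> carrier G)) \<and> (\<forall>b. t (b, \<one>) = 0)"
  by (rule mem_M) simp

text \<open>\<open>res\<close> intertwines the operation on representatives with that of the class
  calculus. Hence the operation on cosets is well defined and the induced map respects it;
  \<open>M_ract\<close> and \<open>M_diff\<close> serve the same purpose.\<close>

lemma M_lact:
  assumes "t \<in> carrier (M (carrier G))"
  shows "tprod h \<one>\<^bsub>alg H\<^esub> \<otimes>\<^bsub>alg (tensor_alg H H)\<^esub> t \<in> carrier (M (carrier G))"
    "res (tprod h \<one>\<^bsub>alg H\<^esub> \<otimes>\<^bsub>alg (tensor_alg H H)\<^esub> t) = free_lact H h (res t)"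
proof -
  show "tprod h \<one>\<^bsub>alg H\<^esub> \<otimes>\<^bsub>alg (tensor_alg H H)\<^esub> t \<in> carrier (M (carrier G))"
    using assms unfolding in_M by (auto simp: carrier_fspace fun_fun_mult)
  show "res (tprod h \<one>\<^bsub>alg H\<^esub> \<otimes>\<^bsub>alg (tensor_alg H H)\<^esub> t) = free_lact H h (res t)"
    using S_carrier by (auto simp: res_def fun_fun_mult lact_class tprod_def alg_ops fun_eq_iff)
qed

lemma M_ract:
  assumes "t \<in> carrier (M (carrier G))"
  shows "t \<otimes>\<^bsub>alg (tensor_alg H H)\<^esub> comult H h \<in> carrier (M (carrier G))"
    "res (t \<otimes>\<^bsub>alg (tensor_alg H H)\<^esub> comult H h) = free_ract H S sc (res t) h"
proof -
  show "t \<otimes>\<^bsub>alg (tensor_alg H H)\<^esub> comult H h \<in> carrier (M (carrier G))"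
    using assms unfolding in_M by (auto simp: carrier_fspace fun_fun_mult)
  show "res (t \<otimes>\<^bsub>alg (tensor_alg H H)\<^esub> comult H h) = free_ract H S sc (res t) h"
    using S_carrier by (auto simp: res_def fun_fun_mult ract_class fun_comult fun_eq_iff)
qed

lemma M_diff:
  assumes "h \<in> carrier (alg H)"
  shows "(\<lambda>u. comult H h u - tprod h \<one>\<^bsub>alg H\<^esub> u) \<in> carrier (M (carrier G))"
    "res (\<lambda>u. comult H h u - tprod h \<one>\<^bsub>alg H\<^esub> u) = delta_class h"
proof -
  have h: "h g = 0" if "g \<notin> carrier G" for g
    using assms that by (simp add: alg_ops carrier_fspace)
  show "(\<lambda>u. comult H h u - tprod h \<one>\<^bsub>alg H\<^esub> u) \<in> carrier (M (carrier G))"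
    unfolding in_M using h by (auto simp: carrier_fspace fun_comult tprod_def alg_ops)
  show "res (\<lambda>u. comult H h u - tprod h \<one>\<^bsub>alg H\<^esub> u) = delta_class h"
    using S_carrier h by (auto simp: res_def delta_class_def fun_comult tprod_def alg_ops fun_eq_iff)
qed

lemma lact_fibre:
  assumes "t \<in> carrier (M (carrier G))"
  shows "lact \<F> h (cls t) = cls (tprod h \<one>\<^bsub>alg H\<^esub> \<otimes>\<^bsub>alg (tensor_alg H H)\<^esub> t)"
  unfolding fibre_simps
  by (rule fib.Union_coset[OF assms]) (simp only: fib.coset_eq_iff M_lact assms)

lemma ract_fibre:
  assumes "t \<in> carrier (M (carrier G))"
  shows "ract \<F> (cls t) h = cls (t \<otimes>\<^bsub>alg (tensor_alg H H)\<^esub> comult H h)"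
  unfolding fibre_simps
  by (rule fib.Union_coset[OF assms]) (simp only: fib.coset_eq_iff M_ract assms)

text \<open>In the coordinates of \<open>res\<close> the coset calculus on the fibre becomes an
  explicit one, whose axioms and bicovariance can then be pulled back.\<close>

lemma fibre_transport: "calculus_transport H \<F> (class_calculus G S) \<Psi>"
proof
  show "complex_algebra (alg H)" "fo_calculus (alg H) (class_calculus G S)" "fun_module (class_calculus G S)"
    by (rule complex_algebra_fun fo_calculus_class fun_module_class)+
  have image: "res ` carrier (M (carrier G)) = carrier (class_calculus G S)"
    unfolding class_calculus_eq free_calculus_simps hopf_simps by (rule res_image) simp
  have "lin_iso (quot_module (M (carrier G)) (N (carrier G))) (class_calculus G S) \<Psi>"
    by (rule fib.lin_iso_lift[OF fun_module_class image])
  then show "lin_iso \<F> (class_calculus G S) \<Psi>"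
    unfolding lin_iso_def lin_map_def fib.carrier_quot fibre_simps(1-3) .
  show "u \<oplus>\<^bsub>\<F>\<^esub> v \<in> carrier \<F>" if "u \<in> carrier \<F>" "v \<in> carrier \<F>" for u v
    using fib.quot_closed(1)[of u v] that unfolding fibre_simps(1-3) fib.carrier_quot by blast
  show "c \<odot>\<^bsub>\<F>\<^esub> u \<in> carrier \<F>" if "u \<in> carrier \<F>" for c u
    using fib.quot_closed(2)[of u u] that unfolding fibre_simps(1-3) fib.carrier_quot by blast
  have zero: "(\<lambda>_. 0) \<in> carrier (M (carrier G))"
    by (rule lin_closedD(1)[OF fib.lin_closed_carrier])
  show "\<zero>\<^bsub>\<F>\<^esub> \<in> carrier \<F>"
    unfolding fibre_simps(1,4) fib.zero_quot using zero by blast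
  show "\<Psi> \<zero>\<^bsub>\<F>\<^esub> = (\<lambda>_. 0)"
    unfolding fibre_simps(4) fib.zero_quot fib.lift_cls[OF zero] by (simp add: res_def fun_eq_iff)
  fix h assume h: "h \<in> carrier (alg H)"
  show "diff \<F> h \<in> carrier \<F>"
    unfolding fibre_simps using M_diff(1)[OF h] by blast
  show "\<Psi> (diff \<F> h) = diff (class_calculus G S) h"
    unfolding fibre_simps(7) fib.lift_cls[OF M_diff(1)[OF h]] M_diff(2)[OF h] by (simp add: class_calculus_eq)
  fix X assume "X \<in> carrier \<F>"
  then obtain t where t: "t \<in> carrier (M (carrier G))" and X: "X = cls t"
    unfolding fibre_simps(1) by blast
  show "lact \<F> h X \<in> carrier \<F>"
    unfolding X lact_fibre[OF t] fibre_simps(1) using M_lact(1)[OF t] by blast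
  show "\<Psi> (lact \<F> h X) = lact (class_calculus G S) h (\<Psi> X)"
    unfolding X lact_fibre[OF t] fib.lift_cls[OF t] fib.lift_cls[OF M_lact(1)[OF t]] M_lact(2)[OF t]
    by (simp add: class_calculus_eq)
  show "ract \<F> X h \<in> carrier \<F>"
    unfolding X ract_fibre[OF t] fibre_simps(1) using M_ract(1)[OF t] by blast
  show "\<Psi> (ract \<F> X h) = ract (class_calculus G S) (\<Psi> X) h"
    unfolding X ract_fibre[OF t] fib.lift_cls[OF t] fib.lift_cls[OF M_ract(1)[OF t]] M_ract(2)[OF t]
    by (simp add: class_calculus_eq)
qed

text \<open>The counterpart of \<open>res\<close> without a tensor factor: on the augmentation ideal
  of H its kernel is the fibre ideal.\<close>

definition restr :: "('a \<Rightarrow> complex) \<Rightarrow> 'a \<Rightarrow> complex" where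
  "restr x = (\<lambda>c. if c \<in> S then x c else 0)"

lemma restr_quotient: "linear_quotient ((fspace (carrier G))\<lparr>carrier := augm H\<rparr>) R restr"
proof
  show "fun_module ((fspace (carrier G))\<lparr>carrier := augm H\<rparr>)"
    by (intro fun_module_carrier_update fun_module_fspace lin_closed_augm)
  show "flinear (carrier ((fspace (carrier G))\<lparr>carrier := augm H\<rparr>)) restr"
    by (rule flinearI) (auto simp: restr_def fun_eq_iff)
  show "R = {x \<in> carrier ((fspace (carrier G))\<lparr>carrier := augm H\<rparr>). restr x = (\<lambda>_. 0)}"
    unfolding fibre_ideal_eq by (auto simp: augm_fun restr_def fun_eq_iff split: if_splits)
qed

abbreviation "\<Phi> \<equiv> linear_quotient.lift restr"

lemma lin_iso_inv_forms: "lin_iso (inv_forms H R) (fspace S) \<Phi>"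
proof -
  have "restr ` augm H = carrier (fspace S)"
  proof
    show "restr ` augm H \<subseteq> carrier (fspace S)"
      by (auto simp: restr_def carrier_fspace)
    show "carrier (fspace S) \<subseteq> restr ` augm H"
    proof
      fix x assume x: "x \<in> carrier (fspace S)"
      then have "x \<in> augm H" "x = restr x"
        using one_notin_S S_carrier by (auto simp: augm_fun restr_def carrier_fspace fun_eq_iff)
      then show "x \<in> restr ` augm H" by blast
    qed
  qed
  then show ?thesis
    unfolding inv_forms_def hopf_simps
    by (intro linear_quotient.lin_iso_lift[OF restr_quotient]) simp_all
qed

text \<open>Restriction to \<open>S\<close> acts on the second tensor factor alone. The isomorphism
  of calculi is therefore the identity tensor the isomorphism of left-invariant forms, which ties
  the two isomorphisms of the theorem together.\<close>

lemma lift_tprod: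
  assumes "x \<in> carrier (alg H)" "y \<in> augm H"
  shows "\<Psi> (tens_class H H R (tprod x y)) = tprod x (\<Phi> (R +>\<^bsub>fspace (basis H)\<^esub> y))"
proof -
  have t: "tprod x y \<in> carrier (M (carrier G))"
    unfolding in_M using assms by (auto simp: augm_fun alg_ops carrier_fspace tprod_def)
  have "\<Psi> (tens_class H H R (tprod x y)) = res (tprod x y)"
    unfolding tens_class_eq hopf_simps by (rule fib.lift_cls[OF t])
  also have "\<dots> = tprod x (restr y)"
    by (auto simp: res_def restr_def tprod_def fun_eq_iff)
  also have "restr y = \<Phi> (R +>\<^bsub>(fspace (carrier G))\<lparr>carrier := augm H\<rparr>\<^esub> y)"
    by (rule linear_quotient.lift_cls[OF restr_quotient, symmetric]) (simp add: assms)
  also have "R +>\<^bsub>(fspace (carrier G))\<lparr>carrier := augm H\<rparr>\<^esub> y = R +>\<^bsub>fspace (basis H)\<^esub> y"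
    by (simp add: a_r_coset_def')
  finally show ?thesis .
qed

lemma fo_calculus_base: "fo_calculus (base_algebra P H p) (base_calculus P H p \<Omega>)"
  unfolding base_algebra_def base_calculus_def
  by (rule fo_calculus_restrict[OF fo_calculus_dvee Omega_simps(5) coinv_subset lin_closed_coinv
        one_in_coinv mult_in_coinv])

lemma principal_homogeneous_bundle_dvee: "principal_homogeneous_bundle P H p \<Omega>"
  unfolding principal_homogeneous_bundle_def Let_def
  by (intro conjI hopf_algebra_dvee hopf_algebra_fun hopf_surjection_proj hopf_galois_dvee bicovariant_dvee
      fo_calculus_base bicovariant_calculus_transport[OF fibre_transport bicovariant_class] ver_exact)

lemma bundle_summary:
  "principal_homogeneous_bundle P H p \<Omega> \<and> algebra_iso CG (base_algebra P H p) (dvee_incl G)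
    \<and> (\<exists>\<phi>. calculus_iso CG (rep_calculus G K \<rho>) (base_algebra P H p) (base_calculus P H p \<Omega>) (dvee_incl G) \<phi>)
    \<and> (\<exists>\<Phi> \<Psi>. lin_iso (inv_forms H R) (fspace S) \<Phi>
         \<and> calculus_iso (alg H) (fibre_calculus P H p \<Omega>) (alg H) (class_calculus G S) (\<lambda>x. x) \<Psi>
         \<and> (\<forall>x\<in>carrier (alg H). \<forall>y\<in>augm H.
              \<Psi> (tens_class H H R (tprod x y)) = tprod x (\<Phi> (R +>\<^bsub>fspace (basis H)\<^esub> y))))"
proof (intro conjI exI ballI)
  show "calculus_iso (alg H) \<F> (alg H) (class_calculus G S) (\<lambda>x. x) \<Psi>"
    by (rule calculus_transport.calculus_iso[OF fibre_transport])
qed (rule principal_homogeneous_bundle_dvee algebra_iso_incl calculus_iso_base lin_iso_inv_forms lift_tprod,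
    assumption?)+

end

theorem proposition4p2:
  fixes G :: "('g, 'z) monoid_scheme" (structure)
    and r :: 'g and C :: "'g set" and q :: "'g \<Rightarrow> 'g"
    and J :: "'i set" and \<pi> :: "'g \<Rightarrow> 'i \<Rightarrow> 'i \<Rightarrow> complex"
  assumes "group G" and "finite (carrier G)"
    and "r \<in> carrier G" and "C = conj_class G r"
    and "q \<in> C \<rightarrow> carrier G" and "\<And>c. c \<in> C \<Longrightarrow> q c \<otimes> r \<otimes> inv (q c) = c" and "q r = \<one>"
    and "irreducible_rep (centralizer G r) J \<pi>"
    and "\<not> (C = {\<one>} \<and> trivial_rep (centralizer G r) J \<pi>)"
  defines "P \<equiv> dvee G" and "H \<equiv> fun_hopf G" and "p \<equiv> dvee_proj G"
    and "\<Omega> \<equiv> dvee_calculus G C q J \<pi>"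
    and "S \<equiv> (if trivial_rep (centralizer G r) J \<pi> then C else {})"
  shows "principal_homogeneous_bundle P H p \<Omega>
    \<and> algebra_iso (alg (group_hopf G)) (base_algebra P H p) (dvee_incl G)
    \<and> (\<exists>\<phi>. calculus_iso (alg (group_hopf G)) (rep_calculus G (C \<times> J) (pi_tilde G q \<pi>))
              (base_algebra P H p) (base_calculus P H p \<Omega>) (dvee_incl G) \<phi>)
    \<and> (\<exists>\<Phi> \<Psi>. lin_iso (inv_forms H (fibre_ideal P p \<Omega>)) (fspace S) \<Phi>
         \<and> calculus_iso (alg H) (fibre_calculus P H p \<Omega>) (alg H) (class_calculus G S) (\<lambda>x. x) \<Psi>
         \<and> (\<forall>x\<in>carrier (alg H). \<forall>y\<in>augm H.
              \<Psi> (tens_class H H (fibre_ideal P p \<Omega>) (tprod x y))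
                = tprod x (\<Phi> (fibre_ideal P p \<Omega> +>\<^bsub>fspace (basis H)\<^esub> y))))"
proof -
  interpret X: nontrivial_class_rep G r C q J \<pi>
    using assms(1-9)
    by (simp add: nontrivial_class_rep_def nontrivial_class_rep_axioms_def class_rep_def class_rep_axioms_def
        finite_group_def finite_group_axioms_def)
  show ?thesis
    unfolding P_def H_def p_def \<Omega>_def S_def using X.bundle_summary unfolding X.S_def .
qed

end
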